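(* Let $k\subseteq K$ be fields and let $G$ be a torsion-free subgroup of finite rank of the multiplicative group $K^{\times}$, such that the only element of $G$ algebraic over $k$ is $1$. Let $I$ be the kernel of the natural projection $kG\to k[G]$ and let $B$ be the isolator in $G$ of the controller of $I$. Then there is a finite set $\mathcal Y$ of rank one subgroups of $B$ such that the subgroups in $\mathcal Y$ together generate a dense subgroup of $B$, and such that any group of $k$-automorphisms of $k(G)$ which stabilises $G$ has a subgroup of finite index which stabilises each element of $\mathcal Y$.
   Context: $kG$ denotes the group ring of $G$ over $k$; $k[G]$ denotes the $k$-subalgebra of $K$ generated by $G$ (the image of $kG$ in $K$ under the natural map); $k(G)$ is the subfield of $K$ generated by $k$ and $G$. The rank of a torsion-free abelian group $E$ is $\dim_{\mathbb Q}(E\otimes\mathbb Q)$. For an ideal $P$ of $kG$, the controller $\mathcal C_G(P)$ is the unique minimal subgroup $H$ of $G$ such that $P=(kH\cap P)kG$. The isolator in $G$ of a subgroup $H$ is the subgroup of all $g\in G$ with $g^m\in H$ for some $m\ge 1$. So $B=\{g\in G: g^m\in \mathcal C_G(I)\text{ for some } m\geq 1\}$. A subgroup $H$ of an abelian group $E$ is dense in $E$ if $E/H$ is torsion. A $k$-automorphism is a field automorphism fixing $k$ elementwise. An automorphism $\sigma$ of $k(G)$ stabilises a subgroup $E\subseteq K^\times$ contained in $k(G)$ if $\sigma(E)=E$; a group of automorphisms stabilises $E$ if each of its elements does. (Any $k$-automorphism of $k(G)$ stabilising $G$ also stabilises $B$.) *)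

theory Defs
  imports
    "HOL-Algebra.Algebra"
    "HOL-Algebra.Finite_Extensions"
    "HOL-Algebra.Free_Abelian_Groups"
    "Jordan_Normal_Form.Missing_VectorSpace"
begin

text \<open>Elements of the group ring are finitely supported functions on \<open>carrier G\<close>, extended by
  zero outside \<open>carrier G\<close>.  Hence, for a subgroup \<open>H\<close> of \<open>G\<close>, the carrier of
  \<open>group_ring R (G\<lparr>carrier := H\<rparr>)\<close> is literally a subset of that of \<open>group_ring R G\<close>.\<close>

definition group_ring :: "('a, 'm) ring_scheme \<Rightarrow> ('g, 'n) monoid_scheme \<Rightarrow> ('g \<Rightarrow> 'a) ring" where
  "group_ring R G =
    \<lparr> carrier = {f. f \<in> carrier G \<rightarrow> carrier R \<and> (\<forall>x. x \<notin> carrier G \<longrightarrow> f x = \<zero>\<^bsub>R\<^esub>)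
                  \<and> finite {x. f x \<noteq> \<zero>\<^bsub>R\<^esub>}},
      monoid.mult = (\<lambda>f h x. finsum R (\<lambda>(y, z). f y \<otimes>\<^bsub>R\<^esub> h z)
                 {(y, z). f y \<noteq> \<zero>\<^bsub>R\<^esub> \<and> h z \<noteq> \<zero>\<^bsub>R\<^esub> \<and> y \<otimes>\<^bsub>G\<^esub> z = x}),
      one = (\<lambda>x. if x = \<one>\<^bsub>G\<^esub> then \<one>\<^bsub>R\<^esub> else \<zero>\<^bsub>R\<^esub>),
      ring.zero = (\<lambda>x. \<zero>\<^bsub>R\<^esub>),
      ring.add = (\<lambda>f h x. f x \<oplus>\<^bsub>R\<^esub> h x) \<rparr>"

text \<open>\<open>HOL-Algebra\<close> has two identical constants \<open>mult_of\<close>; the one with the larger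
  theory is selected explicitly.\<close>

abbreviation mult_grp :: "('a, 'm) ring_scheme \<Rightarrow> 'a set \<Rightarrow> 'a monoid" where
  "mult_grp K E \<equiv> (Multiplicative_Group.mult_of K)\<lparr>carrier := E\<rparr>"

text \<open>A unital \<open>k\<close>-subalgebra is the same as a subring containing \<open>k\<close>.  (The library's
  \<open>subalgebra\<close> is only a subspace, not closed under products.)\<close>

abbreviation algebra_gen :: "('a, 'm) ring_scheme \<Rightarrow> 'a set \<Rightarrow> 'a set \<Rightarrow> ('a, 'm) ring_scheme" where
  "algebra_gen K k G \<equiv> K\<lparr>carrier := generate_ring K (k \<union> G)\<rparr>"

abbreviation field_gen :: "('a, 'm) ring_scheme \<Rightarrow> 'a set \<Rightarrow> 'a set \<Rightarrow> ('a, 'm) ring_scheme" where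
  "field_gen K k G \<equiv> K\<lparr>carrier := generate_field K (k \<union> G)\<rparr>"

definition group_ring_proj :: "('a, 'm) ring_scheme \<Rightarrow> ('a \<Rightarrow> 'a) \<Rightarrow> 'a" where
  "group_ring_proj K f = (\<Oplus>\<^bsub>K\<^esub>g \<in> {g. f g \<noteq> \<zero>\<^bsub>K\<^esub>}. f g \<otimes>\<^bsub>K\<^esub> g)"

definition controls ::
    "('a, 'm) ring_scheme \<Rightarrow> ('g, 'n) monoid_scheme \<Rightarrow> ('g \<Rightarrow> 'a) set \<Rightarrow> 'g set \<Rightarrow> bool" where
  "controls R G P H \<longleftrightarrow> subgroup H G \<and>
     P = (carrier (group_ring R (G\<lparr>carrier := H\<rparr>)) \<inter> P) \<cdot>\<^bsub>group_ring R G\<^esub> carrier (group_ring R G)"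

definition controller ::
    "('a, 'm) ring_scheme \<Rightarrow> ('g, 'n) monoid_scheme \<Rightarrow> ('g \<Rightarrow> 'a) set \<Rightarrow> 'g set" where
  "controller R G P =
     (THE H. controls R G P H \<and> (\<forall>H'. controls R G P H' \<and> H' \<subseteq> H \<longrightarrow> H' = H))"

definition isolator :: "('g, 'n) monoid_scheme \<Rightarrow> 'g set \<Rightarrow> 'g set" where
  "isolator G H = {g \<in> carrier G. \<exists>m::nat. m \<ge> 1 \<and> g [^]\<^bsub>G\<^esub> m \<in> H}"

definition torsion_free_group :: "('g, 'n) monoid_scheme \<Rightarrow> bool" where
  "torsion_free_group G \<longleftrightarrow>
     (\<forall>g \<in> carrier G. \<forall>m::nat. m \<ge> 1 \<and> g [^]\<^bsub>G\<^esub> m = \<one>\<^bsub>G\<^esub> \<longrightarrow> g = \<one>\<^bsub>G\<^esub>)"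

definition torsion_group :: "('g, 'n) monoid_scheme \<Rightarrow> bool" where
  "torsion_group G \<longleftrightarrow> (\<forall>g \<in> carrier G. \<exists>m::nat. m \<ge> 1 \<and> g [^]\<^bsub>G\<^esub> m = \<one>\<^bsub>G\<^esub>)"

definition dense_subgroup :: "'g set \<Rightarrow> ('g, 'n) monoid_scheme \<Rightarrow> bool" where
  "dense_subgroup H E \<longleftrightarrow> subgroup H E \<and> torsion_group (E Mod H)"

text \<open>The tensor product over the integers of an abelian group (written multiplicatively) with the
  rationals, by generators \<open>(g, q)\<close> and bilinear relations, as a vector space over the
  rationals with \<open>r \<odot> (g \<otimes> q) = g \<otimes> (r * q)\<close>.
  The ring multiplication and unit of the module record carry no meaning.\<close>

definition tensor_relations :: "('g, 'n) monoid_scheme \<Rightarrow> (('g \<times> rat) \<Rightarrow>\<^sub>0 int) set" where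
  "tensor_relations G =
     {frag_of (g \<otimes>\<^bsub>G\<^esub> h, q) - frag_of (g, q) - frag_of (h, q) | g h q.
        g \<in> carrier G \<and> h \<in> carrier G} \<union>
     {frag_of (g, q + r) - frag_of (g, q) - frag_of (g, r) | g q r. g \<in> carrier G}"

definition tensor_scale :: "rat \<Rightarrow> (('g \<times> rat) \<Rightarrow>\<^sub>0 int) \<Rightarrow> (('g \<times> rat) \<Rightarrow>\<^sub>0 int)" where
  "tensor_scale r = frag_extend (\<lambda>(g, q). frag_of (g, r * q))"

definition rat_tensor ::
    "('g, 'n) monoid_scheme \<Rightarrow> (rat, (('g \<times> rat) \<Rightarrow>\<^sub>0 int) set) module" where
  "rat_tensor G =
    (let F = free_Abelian_group (carrier G \<times> UNIV);
         N = generate F (tensor_relations G)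
     in \<lparr> carrier = carrier (F Mod N), monoid.mult = (\<lambda>_ _. N), one = N,
          ring.zero = \<one>\<^bsub>F Mod N\<^esub>, ring.add = (\<otimes>\<^bsub>F Mod N\<^esub>),
          module.smult = (\<lambda>r C. N <#>\<^bsub>F\<^esub> (tensor_scale r ` C)) \<rparr>)"

definition rat_field :: "rat ring" where
  "rat_field = \<lparr>carrier = UNIV, monoid.mult = (*), one = 1, ring.zero = 0, ring.add = (+)\<rparr>"

definition finite_rank :: "('g, 'n) monoid_scheme \<Rightarrow> bool" where
  "finite_rank G \<longleftrightarrow> vectorspace.fin_dim rat_field (rat_tensor G)"

text \<open>The dimension is meaningful only in the finite-dimensional case.\<close>

definition group_rank :: "('g, 'n) monoid_scheme \<Rightarrow> nat" where
  "group_rank G = vectorspace.dim rat_field (rat_tensor G)"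

definition rank_one :: "('g, 'n) monoid_scheme \<Rightarrow> bool" where
  "rank_one G \<longleftrightarrow> finite_rank G \<and> group_rank G = 1"

definition rel_auto :: "'a set \<Rightarrow> ('a, 'm) ring_scheme \<Rightarrow> ('a \<Rightarrow> 'a) set" where
  "rel_auto k L = {\<sigma> \<in> ring_hom L L \<inter> Bij (carrier L). \<forall>a \<in> k. \<sigma> a = a}"

definition RelAutoGroup :: "'a set \<Rightarrow> ('a, 'm) ring_scheme \<Rightarrow> ('a \<Rightarrow> 'a) monoid" where
  "RelAutoGroup k L = BijGroup (carrier L) \<lparr>carrier := rel_auto k L\<rparr>"

definition stabilises :: "('a \<Rightarrow> 'a) set \<Rightarrow> 'a set \<Rightarrow> bool" where
  "stabilises \<Gamma> E \<longleftrightarrow> (\<forall>\<sigma> \<in> \<Gamma>. \<sigma> ` E = E)"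

definition finite_index :: "'g set \<Rightarrow> ('g, 'n) monoid_scheme \<Rightarrow> bool" where
  "finite_index H G \<longleftrightarrow> subgroup H G \<and> finite (rcosets\<^bsub>G\<^esub> H)"

end

theory Submission
  imports Defs
begin

text \<open>
  A valuation ring \<open>\<O>\<close> containing \<open>k(T)\<close> satisfies Abhyankar's inequality
  \<open>rk W - rk (W \<inter> \<O>\<^sup>\<times>) \<le> td W - td T\<close> for isolated subgroups \<open>T \<subseteq> W\<close> of \<open>G\<close>.
  The subgroups \<open>W \<inter> \<O>\<^sup>\<times>\<close> for which equality holds form a finite set \<open>Z T W\<close>; let \<open>zflat T W\<close> be
  the isolated subgroup generated by \<open>T\<close> and \<open>Z T W\<close>.  The isolated subgroups with finite orbit
  under the \<open>k\<close>-automorphisms stabilising \<open>G\<close> form a modular lattice that is closed under \<open>Z\<close> and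
  under relative algebraic closure, which by Chevalley's theorem is also cut out by valuation rings.
  Induction on the relative rank shows that \<open>zflat T W\<close> is generated over \<open>T\<close> by members of this
  lattice of relative rank one whenever \<open>T\<close> is algebraically closed in \<open>W\<close>.  Finally
  \<open>zflat {1} G\<close> is the isolator of the controller of \<open>I\<close>.
\<close>

section \<open>Pregeometries\<close>

text \<open>Two dimension functions live on the same group: the rational rank \<open>rk\<close>,
  whose lattice of closed subgroups is modular, and the transcendence degree \<open>td\<close>,
  whose lattice in general is not. All lattice arguments therefore take place in the first, and
  algebraic dependence enters only through the operations \<open>W Int acl Q\<close> and
  \<open>Z T W\<close>. Valuation rings link the two: an algebraic relation between multiplicatively
  independent elements forces two monomials to have the same value, hence a ratio out of a fixed
  finite set to be a unit. This gives both the inequality and the finiteness of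
  \<open>Z T W\<close>. The obstacle is that finite orbits alone give no members of relative rank
  one. If \<open>S\<close> in \<open>Z T W\<close> has rank \<open>d > 1\<close> over
  \<open>T\<close> and \<open>W\<close> is algebraic over \<open>S\<close>, induction says nothing
  about \<open>S\<close>. A second member of \<open>Z T W\<close> is then needed that cuts
  \<open>S\<close> properly without meeting it in \<open>T\<close> only. The valuation producing it
  comes from a growth comparison: monomials in two exponents with pairwise different values grow
  quadratically, whereas a ring with a finite-dimensional reduction modulo \<open>y\<close> leaves
  room for linear growth only.\<close>

locale pregeometry =
 fixes E :: "'a set" and cl :: "'a set => 'a set"
 assumes cl_increasing: "A <= E ==> A <= cl A"
  and cl_in: "A <= E ==> cl A <= E"
  and cl_mono: "A <= B ==> B <= E ==> cl A <= cl B"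
  and cl_idem: "A <= E ==> cl (cl A) = cl A"
  and exchange: "A <= E ==> a \<in> E ==> b \<in> cl (insert a A) ==> b ~: cl A ==> a \<in> cl (insert b A)"
  and finite_dim: "EX B. finite B & B <= E & E <= cl B"
begin

definition indep :: "'a set => bool" where
 "indep B \<longleftrightarrow> B <= E & (ALL b:B. b ~: cl (B - {b}))"

text \<open>\<open>GREATEST\<close> is meaningful because \<open>finite_dim\<close> bounds the size
  of independent sets (\<open>indep_bounded\<close>); \<open>rk_eq_card\<close> identifies the value
  with the size of any basis.\<close>

definition rk :: "'a set => nat" where
 "rk A = (GREATEST n. EX I. I <= A & indep I & finite I & card I = n)"

lemma cl_subset: "A <= cl B ==> B <= E ==> cl A <= cl B" by (metis cl_idem cl_in cl_mono)

lemma indep_subset: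
 assumes "indep B" "A <= B"
 shows "indep A"
proof -
 have "cl (A - {b}) <= cl (B - {b})" for b using cl_mono[of "A - {b}" "B - {b}"] assms unfolding indep_def by blast
 then show ?thesis using assms unfolding indep_def by blast
qed

text \<open>When the elements of \<open>P\<close> are added to \<open>C\<close> one by one, some
  element is the one that brings \<open>a\<close> into the closure, and this element can be
  exchanged for \<open>a\<close>.\<close>

lemma exchange_finite:
 assumes "finite P" "C <= E" "P <= E" "a \<in> cl (C Un P)" "a ~: cl C"
 shows "EX s:P. s ~: C & s \<in> cl (insert a (C Un P - {s}))" using assms
proof (induction P rule: finite_induct)
 case empty
 then show ?case by simp
next
 case (insert p P)
 have a: "a \<in> E" using insert.prems cl_in[of "C Un insert p P"] by blast
 show ?case
 proof (cases "a \<in> cl (C Un P)")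
  case True
  then obtain s where s: "s \<in> P" "s ~: C" "s \<in> cl (Set.insert a (C Un P - {s}))" using insert by blast
  have "s \<in> cl (Set.insert a (C Un Set.insert p P - {s}))"
   using s(3) cl_mono[of "Set.insert a (C Un P - {s})" "Set.insert a (C Un Set.insert p P - {s})"]
    insert.prems a by blast
  then show ?thesis using s by blast
 next
  case False
  then have pc: "p ~: C" using insert.prems by (metis Un_insert_right insert_absorb UnI1)
  have "p \<in> cl (Set.insert a (C Un P))" using exchange[of "C Un P" p a] False insert.prems by auto
  moreover have e: "C Un P = C Un Set.insert p P - {p}" using insert.hyps pc by auto
  ultimately have "p \<in> cl (Set.insert a (C Un Set.insert p P - {p}))" unfolding e by blast
  then show ?thesis using pc by blast
 qed
qed

text \<open>Each step swaps an element of \<open>S\<close> outside \<open>I\<close> for an element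
  of \<open>I\<close> outside \<open>S\<close>. The size and the spanning property of
  \<open>S\<close> are kept while \<open>card (S - I)\<close> drops.\<close>

lemma steinitz:
 assumes "indep I" "finite I" "finite S" "S <= E" "I <= cl S"
 shows "card I <= card S" using assms
proof (induction "card (S - I)" arbitrary: S rule: less_induct)
 case less
 show ?case
 proof (cases "I <= S")
  case True
  then show ?thesis using less.prems card_mono by blast
 next
  case False
  then obtain a where a: "a \<in> I" "a ~: S" by blast
  have aE: "a \<in> E" using a less.prems indep_def by blast
  have "a ~: cl (I - {a})" using less.prems a indep_def by blast
  then have n: "a ~: cl (S Int I)" using cl_mono[of "S Int I" "I - {a}"] a less.prems(1) unfolding indep_def by blast
  have "S Int I Un (S - I) = S" by blast
  then have "a \<in> cl (S Int I Un (S - I))" using a less.prems by auto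
  then obtain s where s: "s \<in> S - I" "s \<in> cl (insert a (S Int I Un (S - I) - {s}))"
   using exchange_finite[of "S - I" "S Int I" a] n less.prems by blast
  define S' where "S' = insert a (S - {s})"
  have s': "s \<in> cl S'" using s(2) \<open>S Int I Un (S - I) = S\<close> S'_def by simp
  have S'E: "S' <= E" using less.prems aE S'_def by blast
  have "S <= cl S'" using s' cl_increasing[OF S'E] S'_def by blast
  then have "I <= cl S'" using cl_subset[of S S'] S'E less.prems by blast
  moreover have "S' - I = (S - I) - {s}" unfolding S'_def using a by blast
  then have "S' - I \<subset> S - I" using s by blast
  ultimately have "card I <= card S'" using less.hyps[of S'] less.prems S'E psubset_card_mono[of "S - I" "S' - I"] S'_def by auto
  also have "card S' = card S"
  proof -
   have "s \<in> S" "a ~: S - {s}" using s a by auto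
   then show ?thesis using less.prems S'_def card_Suc_Diff1[of S s] by simp
  qed
  finally show ?thesis .
 qed
qed

lemma indep_bounded: "EX N. ALL I. indep I --> finite I & card I <= N"
proof -
 obtain B where B: "finite B" "B <= E" "E <= cl B" using finite_dim by blast
 have fin: "card I <= card B" if "indep I" "finite I" for I using steinitz[OF that B(1,2)] that B(3) unfolding indep_def by blast
 have "finite I" if "indep I" for I
 proof (rule ccontr)
  assume "infinite I"
  then obtain J where "J <= I" "finite J" "card J = Suc (card B)" using infinite_arbitrarily_large by blast
  then show False using fin[of J] indep_subset[OF that] by auto
 qed
 then show ?thesis using fin by blast
qed

lemma indep_finite: "indep I ==> finite I" using indep_bounded by blast

lemma indep_insert:
 assumes "indep I" "a \<in> E" "a ~: cl I"
 shows "indep (insert a I)"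
proof -
 have IE: "I <= E" using assms indep_def by blast
 have aI: "a ~: I" using assms cl_increasing[OF IE] by blast
 have "b ~: cl (insert a I - {b})" if b: "b \<in> insert a I" for b
 proof (cases "b = a")
  case True
  then show ?thesis using assms aI by simp
 next
  case False
  then have bI: "b \<in> I" using b by blast
  show ?thesis
  proof
   assume "b \<in> cl (insert a I - {b})"
   moreover have "insert a I - {b} = insert a (I - {b})" using False by blast
   ultimately have "a \<in> cl (insert b (I - {b}))" using exchange[of "I - {b}" a b] bI assms IE unfolding indep_def by auto
   then show False using assms bI by (simp add: insert_absorb)
  qed
 qed
 then show ?thesis using assms IE unfolding indep_def by blast
qed

lemma indep_empty: "indep {}" by (simp add: indep_def)

lemma indep_extend:
 assumes "indep J" "J <= A" "A <= E"
 shows "EX I. indep I & J <= I & I <= A & A <= cl I"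
proof -
 obtain N where N: "!!I. indep I ==> finite I & card I <= N" using indep_bounded by blast
 let ?P = "%n. EX I. indep I & J <= I & I <= A & card I = n"
 have "?P (card J)" using assms by blast
 then have "EX n. ?P n & (ALL m. ?P m --> m <= n)"
  by (rule Nat.ex_has_greatest_nat[of ?P "card J" N]) (use N in blast)
 then obtain I where I: "indep I" "J <= I" "I <= A"
  and mx: "!!m. ?P m ==> m <= card I" by blast
 have "a \<in> cl I" if a: "a \<in> A" for a
 proof (rule ccontr)
  assume na: "a ~: cl I"
  have "I <= cl I" using cl_increasing[of I] I assms by blast
  then have "a ~: I" using na by blast
  then have "card (insert a I) = Suc (card I)" using N[OF I(1)] by simp
  moreover have "?P (card (insert a I))" using indep_insert[OF I(1) _ na] a assms(3) I by (intro exI[of _ "insert a I"]) blast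
  ultimately show False using mx[of "card (insert a I)"] by simp
 qed
 then show ?thesis using I by blast
qed

lemma rk_eq_card:
 assumes "indep I" "I <= A" "A <= cl I"
 shows "rk A = card I" unfolding rk_def
proof (rule Greatest_equality)
 show "EX J. J <= A & indep J & finite J & card J = card I" using assms indep_finite by blast
next
 fix n assume "EX J. J <= A & indep J & finite J & card J = n"
 then obtain J where J: "J <= A" "indep J" "finite J" "card J = n" by blast
 have "I <= E" using assms indep_def by blast
 then show "n <= card I" using steinitz[OF J(2,3) indep_finite[OF assms(1)]] J assms by blast
qed

lemma basis_exists:
 assumes "A <= E"
 obtains I where "indep I" "I <= A" "A <= cl I" "rk A = card I" "finite I"
proof -
 obtain I where "indep I" "I <= A" "A <= cl I" using indep_extend[OF indep_empty _ assms] by blast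
 then show ?thesis using that rk_eq_card indep_finite by blast
qed

lemma rk_mono_cl:
 assumes "A <= cl B" "B <= E"
 shows "rk A <= rk B"
proof -
 have AE: "A <= E" using assms cl_in by blast
 obtain I where I: "indep I" "I <= A" "A <= cl I" "rk A = card I" "finite I" by (rule basis_exists[OF AE])
 obtain J where J: "indep J" "J <= B" "B <= cl J" "rk B = card J" "finite J" by (rule basis_exists[OF assms(2)])
 have JE: "J <= E" using J assms by blast
 have "I <= cl J" using I assms cl_subset[OF J(3) JE] by blast
 then show ?thesis using steinitz[OF I(1) I(5) J(5) JE] I(4) J(4) by simp
qed

lemma rk_mono: "A <= B ==> B <= E ==> rk A <= rk B"
 by (rule rk_mono_cl) (use cl_increasing in blast)+

lemma rk_cl: "A <= E ==> rk (cl A) = rk A" using rk_mono_cl[of "cl A" A] rk_mono_cl[of A "cl A"] cl_in cl_increasing cl_idem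
 by (simp add: antisym)

lemma rk_insert:
 assumes "A <= E" "a \<in> E" "a ~: cl A"
 shows "rk (insert a A) = Suc (rk A)"
proof -
 obtain I where I: "indep I" "I <= A" "A <= cl I" "rk A = card I" "finite I" by (rule basis_exists[OF assms(1)])
 have IE: "I <= E" using I assms by blast
 have na: "a ~: cl I" using cl_mono[OF I(2) assms(1)] assms by blast
 have "insert a A <= cl (insert a I)" using cl_mono[of I "insert a I"] cl_increasing[of "insert a I"] I IE assms by blast
 then have "rk (insert a A) = card (insert a I)" using rk_eq_card[OF indep_insert[OF I(1) assms(2) na]] I by blast
 moreover have "a ~: I" using na cl_increasing IE by blast
 ultimately show ?thesis using I by simp
qed

lemma rk_insert_le:
 assumes "A <= E" "a \<in> E"
 shows "rk (insert a A) <= Suc (rk A)"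
proof (cases "a \<in> cl A")
 case True
 then have "insert a A <= cl A" using cl_increasing assms by blast
 then have "rk (insert a A) <= rk A" by (rule rk_mono_cl[OF _ assms(1)])
 then show ?thesis by simp
qed (simp add: rk_insert assms)

lemma rk_eq_imp_cl:
 assumes "A <= B" "B <= E" "rk B <= rk A"
 shows "B <= cl A"
proof
 fix b assume b: "b \<in> B"
 show "b \<in> cl A"
 proof (rule ccontr)
  assume "b ~: cl A"
  then have "rk (insert b A) = Suc (rk A)" using rk_insert assms b by blast
  moreover have "rk (insert b A) <= rk B" using rk_mono[of "insert b A" B] assms b by blast
  ultimately show False using assms by simp
 qed
qed

text \<open>\<open>C\<close> is what must be added to a basis of \<open>A\<close> to obtain one of
  \<open>B\<close>. The last two conjuncts range over all \<open>D <= C\<close> because later rank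
  counts are made with arbitrary parts of \<open>C\<close>.\<close>

lemma relative_basis:
 assumes "A <= B" "B <= E"
 shows "EX C. finite C & C <= B & B <= cl (A Un C) & rk B = rk A + card C
  & (ALL D<=C. rk (A Un D) = rk A + card D)
  & (ALL D<=C. ALL c:C - D. c ~: cl (A Un D))"
proof -
 obtain I where I: "indep I" "I <= A" "A <= cl I" "rk A = card I" "finite I" by (rule basis_exists[OF order_trans[OF assms]])
 obtain J where J: "indep J" "I <= J" "J <= B" "B <= cl J" using indep_extend[OF I(1) _ assms(2)] I assms by blast
 define C where "C = J - I"
 have fJ: "finite J" using indep_finite J by blast
 have JE: "J <= E" and IE: "I <= E" using J assms I by blast+
 have e: "I Un C = J" using C_def J by blast
 have AD: "A Un D <= cl (I Un D)" if "D <= C" for D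
 proof -
  have "I Un D <= E" using that e JE IE by blast
  then show ?thesis using I cl_mono[of I "I Un D"] cl_increasing[of "I Un D"] by blast
 qed
 have r: "rk (A Un D) = rk A + card D" if "D <= C" for D
 proof -
  have i: "indep (I Un D)" using indep_subset[OF J(1)] e that by blast
  have "rk (A Un D) = card (I Un D)" using rk_eq_card[OF i] AD[OF that] I by blast
  also have "\<dots> = card I + card D" using that C_def fJ I by (intro card_Un_disjoint) (auto intro: finite_subset)
  finally show ?thesis using I by simp
 qed
 have out: "c ~: cl (A Un D)" if "D <= C" "c \<in> C" "c ~: D" for D c
 proof -
  have "rk (A Un insert c D) = Suc (rk (A Un D))" using r[of D] r[of "insert c D"] that finite_subset[of D C] fJ C_def by simp
  moreover have AE: "A Un D <= E" using that e JE assms by blast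
  moreover have "insert c (A Un D) <= cl (A Un D)" if "c \<in> cl (A Un D)" using that cl_increasing[OF AE] by blast
  ultimately show ?thesis using rk_mono_cl[of "insert c (A Un D)" "A Un D"] by fastforce
 qed
 have B: "B <= cl (A Un C)" using J cl_mono[of J "A Un C"] e I assms C_def by blast
 have CB: "C <= B" using C_def J by blast
 have "rk B <= rk (A Un C)" using rk_mono_cl[OF B] assms CB by blast
 moreover have "rk (A Un C) <= rk B" using rk_mono[of "A Un C" B] assms CB by blast
 ultimately have "rk B = rk A + card C" using r[of C] by simp
 moreover have "finite C" using fJ C_def by simp
 ultimately show ?thesis using CB B r out by (intro exI[of _ C]) blast
qed

text \<open>A bijection that commutes with the closure carries bases to bases; the application is to
  field automorphisms, for both closures.\<close>

lemma rk_image: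
 assumes f: "bij_betw f E E" and c: "!!A. A <= E ==> cl (f ` A) = f ` cl A" and A: "A <= E"
 shows "rk (f ` A) = rk A"
proof -
 obtain I where I: "indep I" "I <= A" "A <= cl I" "rk A = card I" "finite I" by (rule basis_exists[OF A])
 have inj: "inj_on f E" using f bij_betw_def by blast
 have IE: "I <= E" using I A by blast
 have fE: "f ` I <= E" using image_mono[OF IE, of f] bij_betw_imp_surj_on[OF f] by simp
 have "f b ~: cl (f ` I - {f b})" if b: "b \<in> I" for b
 proof -
  have "f ` I - {f b} = f ` (I - {b})" using inj_on_image_set_diff[OF inj, of I "{b}"] b IE by auto
  then have "cl (f ` I - {f b}) = f ` cl (I - {b})" using c[of "I - {b}"] IE by auto
  moreover have "b ~: cl (I - {b})" using I b indep_def by blast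
  moreover have "cl (I - {b}) <= E" using cl_in IE by blast
  moreover have "b \<in> E" using b IE by blast
  ultimately show ?thesis using inj_on_image_mem_iff[OF inj] by auto
 qed
 then have "indep (f ` I)" using fE unfolding indep_def by blast
 moreover have "f ` A <= cl (f ` I)" using c[OF IE] I by blast
 ultimately have "rk (f ` A) = card (f ` I)" using rk_eq_card I by blast
 then show ?thesis using card_image[OF inj_on_subset[OF inj IE]] I by simp
qed

end

subsection \<open>Modular pregeometries and semisimplicity\<close>

text \<open>The assumption is the non-trivial inclusion of the modular law. Rational closure
  satisfies it, algebraic closure in general does not.\<close>

locale modular_pregeometry = pregeometry E cl for E :: "'a set" and cl :: "'a set => 'a set" +
 assumes modular: "A <= C ==> cl A = A ==> cl B = B ==> cl C = C ==> A <= E ==> B <= E ==> C <= E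
   ==> cl (A Un B) Int C <= cl (A Un (B Int C))"
begin

definition flat :: "'a set => bool" where
 "flat V \<longleftrightarrow> V <= E & cl V = V"

lemma flat_in: "flat V ==> V <= E" by (simp add: flat_def)

lemma flat_cl: "A <= E ==> flat (cl A)" by (simp add: flat_def cl_in cl_idem)

lemma cl_flat_min: "A <= V ==> flat V ==> cl A <= V" by (metis cl_mono flat_def)

lemma flat_Int:
 assumes "flat V" "flat Y"
 shows "flat (V Int Y)"
proof -
 have "V Int Y <= E" using assms(1) flat_in by blast
 moreover have "cl (V Int Y) <= V" "cl (V Int Y) <= Y" using cl_flat_min assms by (metis inf_le1, metis inf_le2)
 ultimately show ?thesis unfolding flat_def using cl_increasing[of "V Int Y"] by blast
qed

lemma flat_eqI: "A <= B ==> flat A ==> flat B ==> rk B <= rk A ==> A = B"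
 using rk_eq_imp_cl[of A B] unfolding flat_def by blast

lemma flat_psubset_rk:
 assumes "A \<subset> B" "flat A" "flat B"
 shows "rk A < rk B"
proof (rule ccontr)
 assume "~ rk A < rk B"
 then have "A = B" using flat_eqI[of A B] assms by simp
 then show False using assms by blast
qed

text \<open>The identity is proved for all flats \<open>X'\<close> between \<open>V Int Y\<close>
  and \<open>V\<close> by induction on the rank: enlarging \<open>X'\<close> by one basis element
  raises both sides by exactly one.\<close>

lemma rk_modular:
 assumes "flat V" "flat Y"
 shows "rk (cl (V Un Y)) + rk (V Int Y) = rk V + rk Y"
proof -
 have *: "rk (cl (X' Un Y)) + rk (V Int Y) = rk X' + rk Y"
  if "flat X'" "V Int Y <= X'" "X' <= V" for X' using that
 proof (induction "rk X'" arbitrary: X' rule: less_induct)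
  case less
  show ?case
  proof (cases "X' = V Int Y")
   case True
   then have "X' Un Y = Y" by blast
   then show ?thesis using True assms by (simp add: flat_def)
  next
   case False
   have XYE: "V Int Y <= X'" "X' <= E" using less by (auto simp: flat_def)
   obtain C where C: "finite C" "C <= X'" "X' <= cl (V Int Y Un C)" "rk X' = rk (V Int Y) + card C"
    and rC: "ALL D<=C. rk (V Int Y Un D) = rk (V Int Y) + card D"
    and oC: "ALL D<=C. ALL c:C - D. c ~: cl (V Int Y Un D)" using relative_basis[OF XYE] by (elim exE conjE)
   have "C ~= {}" using C(3) False less.prems flat_Int[OF assms] by (auto simp: flat_def)
   then obtain c where c: "c \<in> C" by blast
   define X1 where "X1 = cl (V Int Y Un (C - {c}))"
   have sub: "V Int Y Un (C - {c}) <= E" using C XYE by blast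
   have f1: "flat X1" unfolding X1_def by (rule flat_cl[OF sub])
   have c1: "c ~: X1" using oC[rule_format, of "C - {c}" c] c X1_def by blast
   have X1X: "X1 <= X'" unfolding X1_def
   proof (rule cl_flat_min[OF _ less.prems(1)])
    show "V Int Y Un (C - {c}) <= X'" using XYE(1) C(2) by blast
   qed
   have XY1: "V Int Y <= X1" using cl_increasing[OF sub] X1_def by blast
   have r1: "rk X' = Suc (rk X1)" using rC[rule_format, of "C - {c}"] C c rk_cl[OF sub] X1_def card_Suc_Diff1[OF C(1) c] by simp
   have IH: "rk (cl (X1 Un Y)) + rk (V Int Y) = rk X1 + rk Y" using less.hyps[of X1] r1 f1 XY1 X1X less.prems by auto
   have cE: "c \<in> E" and cX: "c \<in> V" using c C(2) XYE(2) less.prems(3) by auto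
   have X1XX: "X1 <= V" using X1X less.prems by blast
   have Y: "Y <= E" "cl Y = Y" and V: "V <= E" "cl V = V" using assms by (auto simp: flat_def)
   have X1E: "X1 <= E" "cl X1 = X1" using f1 flat_def by auto
   \<comment> \<open>Here modularity acts: an element of \<open>V\<close> that lies outside
     \<open>X1\<close> also lies outside the closure of \<open>X1 Un Y\<close>.\<close>
   have "cl (X1 Un Y) Int V <= cl (X1 Un (Y Int V))" by (rule modular[OF X1XX X1E(2) Y(2) V(2) X1E(1) Y(1) V(1)])
   also have "X1 Un (Y Int V) = X1" using XY1 by blast
   finally have "cl (X1 Un Y) Int V <= X1" using X1E by simp
   then have nc: "c ~: cl (X1 Un Y)" using c1 cX by blast
   have u: "X1 Un Y <= E" using X1E Y by blast
   have "rk (insert c (X1 Un Y)) = Suc (rk (X1 Un Y))" by (rule rk_insert[OF u cE nc])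
   moreover have "rk (insert c (X1 Un Y)) = rk (X' Un Y)"
   proof -
    have i: "insert c (X1 Un Y) <= E" using u cE by blast
    have "C - {c} <= X1" using cl_increasing[OF sub] X1_def by blast
    then have "V Int Y Un C <= insert c (X1 Un Y)" using XY1 by blast
    then have "X' <= cl (insert c (X1 Un Y))" using order_trans[OF C(3) cl_mono[OF _ i]] by simp
    then have "X' Un Y <= cl (insert c (X1 Un Y))" using cl_increasing[OF i] by blast
    then have "rk (X' Un Y) <= rk (insert c (X1 Un Y))" using rk_mono_cl i by blast
    moreover have "rk (insert c (X1 Un Y)) <= rk (X' Un Y)"
    proof (rule rk_mono)
     show "insert c (X1 Un Y) <= X' Un Y" using X1X c C(2) by blast
     show "X' Un Y <= E" using XYE(2) Y(1) by blast
    qed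
    ultimately show ?thesis by simp
   qed
   moreover have "rk (cl (X' Un Y)) = rk (X' Un Y)" "rk (cl (X1 Un Y)) = rk (X1 Un Y)"
    using rk_cl[of "X' Un Y"] rk_cl[OF u] XYE Y by auto
   ultimately show ?thesis using IH r1 by simp
  qed
 qed
 show ?thesis using *[of V] assms by simp
qed

end

section \<open>Sublattices of flats, socles and semisimple intervals\<close>

context modular_pregeometry
begin

abbreviation join :: "'a set => 'a set => 'a set" (infixl "\<squnion>\<^sub>c" 65) where
 "A \<squnion>\<^sub>c B \<equiv> cl (A Un B)"

lemma flat_join: "flat A ==> flat B ==> flat (A \<squnion>\<^sub>c B)" by (rule flat_cl) (auto dest: flat_in)

lemma join_upper:
 assumes "flat A" "flat B"
 shows "A <= A \<squnion>\<^sub>c B" "B <= A \<squnion>\<^sub>c B" using cl_increasing[of "A Un B"] assms flat_in by auto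

lemma join_least: "A <= V ==> B <= V ==> flat V ==> A \<squnion>\<^sub>c B <= V"
 by (rule cl_flat_min) auto

lemma flat_rk_mono: "A <= B ==> flat B ==> rk A <= rk B" using rk_mono flat_in by blast

lemma Int_eq_if_rk:
 assumes "flat A" "flat B" "flat T" "T <= A" "T <= B" "rk (A Int B) <= rk T"
 shows "A Int B = T" using flat_eqI[of T "A Int B"] assms flat_Int by auto

end

text \<open>To be instantiated with the flats that have finite orbit, so every complement and every
  line has to be found inside \<open>LL\<close> and not merely among all flats.\<close>

locale flat_lattice = modular_pregeometry E cl
 for E :: "'a set" and cl :: "'a set => 'a set" +
 fixes LL :: "'a set set"
 assumes LL_flat: "V \<in> LL ==> flat V"
  and LL_Int: "V \<in> LL ==> W \<in> LL ==> V Int W \<in> LL"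
  and LL_join: "V \<in> LL ==> W \<in> LL ==> V \<squnion>\<^sub>c W \<in> LL"
begin

text \<open>More than an atom of \<open>LL\<close> above \<open>T\<close>: the rank must grow by
  exactly one. Atoms of larger rank are conceivable, and excluding them in the relevant interval is
  the content of the later existence proof.\<close>

definition line :: "'a set => 'a set => bool" where
 "line T L \<longleftrightarrow> L \<in> LL & T <= L & rk L = Suc (rk T)"

definition socle :: "'a set => 'a set => 'a set" where
 "socle T V = cl (T Un \<Union>{L. line T L & L <= V})"

definition semisimple :: "'a set => 'a set => bool" where
 "semisimple T V \<longleftrightarrow> V = socle T V"

lemma socle_flat: "T <= E ==> flat (socle T V)"
 unfolding socle_def by (rule flat_cl) (auto simp: line_def dest!: LL_flat flat_in)

lemma socle_upper:
 assumes "T <= E"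
 shows "T <= socle T V" "line T L ==> L <= V ==> L <= socle T V"
proof -
 have "T Un \<Union>{L. line T L & L <= V} <= E" using assms by (auto simp: line_def dest!: LL_flat flat_in)
 from cl_increasing[OF this] show "T <= socle T V" "line T L ==> L <= V ==> L <= socle T V"
  unfolding socle_def by auto
qed

lemma socle_least: "T <= V ==> (!!L. line T L ==> L <= U ==> L <= V) ==> flat V ==> socle T U <= V"
 unfolding socle_def by (rule cl_flat_min) auto

lemma semisimpleI:
 assumes "flat V" "T <= V" "V <= socle T V"
 shows "semisimple T V" using assms socle_least[of T V V] unfolding semisimple_def by blast

lemma line_Int:
 assumes "line T L" "flat T" "flat V" "T <= V" "~ L <= V"
 shows "L Int V = T"
proof -
 have L: "flat L" "T <= L" "rk L = Suc (rk T)" using assms(1) LL_flat line_def by auto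
 have "rk (L Int V) < rk L" using flat_psubset_rk[of "L Int V" L] flat_Int L assms by blast
 then show ?thesis using Int_eq_if_rk[of L V T] L assms by simp
qed

text \<open>The argument for submodules of semisimple modules: a maximal \<open>M\<close> meeting
  \<open>V'\<close> in \<open>T\<close> is a complement of \<open>V'\<close>, and projection along
  \<open>M\<close> turns lines of \<open>V\<close> into lines of \<open>V'\<close>.\<close>

lemma semisimple_sub:
 assumes ss: "semisimple T V" and LL: "T \<in> LL" "V \<in> LL" "V' \<in> LL" and sub: "T <= V'" "V' <= V"
 shows "semisimple T V'"
proof -
 note f = LL[THEN LL_flat]
 let ?P = "%n. EX M:LL. T <= M & M <= V & M Int V' = T & rk M = n"
 have "?P (rk T)" using LL sub by blast
 moreover have "!!n. ?P n ==> n <= rk V" using flat_rk_mono f(2) by blast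
 ultimately have "EX n. ?P n & (ALL m. ?P m --> m <= n)" using Nat.ex_has_greatest_nat[of ?P "rk T" "rk V"] by blast
 then obtain M where M: "M \<in> LL" "T <= M" "M <= V" "M Int V' = T"
  and mx: "!!m. ?P m ==> m <= rk M" by blast
 have fM: "flat M" using LL_flat M by blast
 have rMV': "rk (M \<squnion>\<^sub>c V') + rk T = rk M + rk V'" using rk_modular[OF fM f(3)] M by simp
 have fMV': "flat (M \<squnion>\<^sub>c V')" by (rule flat_join[OF fM f(3)])
 have up: "M <= M \<squnion>\<^sub>c V'" "V' <= M \<squnion>\<^sub>c V'" by (rule join_upper[OF fM f(3)])+
 \<comment> \<open>If \<open>L\<close> stuck out, the join of \<open>M\<close> and \<open>L\<close>
   would still meet \<open>V'\<close> in \<open>T\<close>, against the maximal rank of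
   \<open>M\<close>.\<close>
 have Lsub: "L <= M \<squnion>\<^sub>c V'" if L: "line T L" "L <= V" for L
 proof (rule ccontr)
  assume n: "~ L <= M \<squnion>\<^sub>c V'"
  have LLL: "L \<in> LL" and TL: "T <= L" and rL: "rk L = Suc (rk T)" using L line_def by auto
  have fL: "flat L" using LLL LL_flat by blast
  have i: "L Int (M \<squnion>\<^sub>c V') = T" using line_Int[OF L(1) f(1) fMV' _ n] up sub by blast
  have r: "rk (L \<squnion>\<^sub>c (M \<squnion>\<^sub>c V')) = Suc (rk (M \<squnion>\<^sub>c V'))" using rk_modular[OF fL fMV'] i rL by simp
  define M1 where "M1 = M \<squnion>\<^sub>c L"
  have fM1: "flat M1" unfolding M1_def by (rule flat_join[OF fM fL])
  have M1: "M <= M1" "L <= M1" unfolding M1_def by (rule join_upper[OF fM fL])+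
  have "T <= M Int L" using M TL by blast
  then have "rk T <= rk (M Int L)" using flat_rk_mono flat_Int[OF fM fL] by blast
  then have rM1: "rk M1 <= Suc (rk M)" using rk_modular[OF fM fL] rL M1_def by simp
  have "L \<squnion>\<^sub>c (M \<squnion>\<^sub>c V') <= M1 \<squnion>\<^sub>c V'" using join_upper[OF fM1 f(3)] M1
   by (intro join_least flat_join[OF fM1 f(3)]) (auto intro: subset_trans)
  then have "rk (L \<squnion>\<^sub>c (M \<squnion>\<^sub>c V')) <= rk (M1 \<squnion>\<^sub>c V')"
   using flat_rk_mono flat_join[OF fM1 f(3)] by blast
  then have "rk (M1 Int V') <= rk T" using rk_modular[OF fM1 f(3)] r rMV' rM1 by simp
  then have "M1 Int V' = T" using Int_eq_if_rk[OF fM1 f(3) f(1)] M1 M(2) sub by blast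
  moreover have "M1 \<in> LL" using LL_join M(1) LLL M1_def by blast
  moreover have "M1 <= V" unfolding M1_def by (rule join_least[OF M(3) L(2) f(2)])
  ultimately have "rk M1 <= rk M" using mx M1(1) M(2) by blast
  then have "M = M1" using flat_eqI[OF M1(1) fM fM1] by blast
  then show False using n M1(2) up by blast
 qed
 have "V <= M \<squnion>\<^sub>c V'" using ss socle_least[OF _ Lsub fMV'] M(2) up unfolding semisimple_def by blast
 moreover have "M \<squnion>\<^sub>c V' <= V" by (rule join_least[OF M(3) sub(2) f(2)])
 ultimately have V: "M \<squnion>\<^sub>c V' = V" by blast
 define Q where "Q = socle T V'"
 have TE: "T <= E" using f flat_in by blast
 have fQ: "flat Q" unfolding Q_def by (rule socle_flat[OF TE])
 have QV': "Q <= V'" unfolding Q_def by (rule socle_least[OF sub(1) _ f(3)])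
 have upQ: "M <= M \<squnion>\<^sub>c Q" "Q <= M \<squnion>\<^sub>c Q" by (rule join_upper[OF fM fQ])+
 have fMQ: "flat (M \<squnion>\<^sub>c Q)" by (rule flat_join[OF fM fQ])
 have LQ: "L <= M \<squnion>\<^sub>c Q" if L: "line T L" "L <= V" for L
 proof (cases "L <= M")
  case True
  then show ?thesis using upQ by blast
 next
  case False
  have LLL: "L \<in> LL" and TL: "T <= L" and rL: "rk L = Suc (rk T)" using L line_def by auto
  have fL: "flat L" using LLL LL_flat by blast
  have i: "L Int M = T" using line_Int[OF L(1) f(1) fM M(2) False] .
  define J where "J = L \<squnion>\<^sub>c M"
  have fJ: "flat J" unfolding J_def by (rule flat_join[OF fL fM])
  have rJ: "rk J = Suc (rk M)" using rk_modular[OF fL fM] i rL J_def by simp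
  have J: "L <= J" "M <= J" unfolding J_def by (rule join_upper[OF fL fM])+
  have "J <= V" unfolding J_def by (rule join_least[OF L(2) M(3) f(2)])
  then have "J \<squnion>\<^sub>c V' <= V" by (rule join_least[OF _ sub(2) f(2)])
  moreover have "V <= J \<squnion>\<^sub>c V'" unfolding V[symmetric] by (rule cl_mono) (use J flat_in[OF fJ] flat_in[OF f(3)] in auto)
  ultimately have JV: "J \<squnion>\<^sub>c V' = V" by blast
  \<comment> \<open>The shadow of \<open>L\<close> on \<open>V'\<close> along \<open>M\<close>. The
    modular rank formula shows that it is a line and that it generates with \<open>M\<close> the
    same flat as \<open>L\<close> does.\<close>
  define L' where "L' = J Int V'"
  have fL': "flat L'" unfolding L'_def by (rule flat_Int[OF fJ f(3)])
  have rL': "rk L' = Suc (rk T)" using rk_modular[OF fJ f(3)] JV rJ rMV' V L'_def by simp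
  have TL': "T <= L'" using TL J sub L'_def by blast
  have "J \<in> LL" using LL_join[OF LLL M(1)] J_def by simp
  then have "L' \<in> LL" using LL_Int LL(3) L'_def by blast
  then have "line T L'" using rL' TL' line_def by blast
  then have L'Q: "L' <= Q" unfolding Q_def using socle_upper(2)[OF TE] L'_def by blast
  have "M Int L' <= T" using M(4) L'_def by blast
  then have "rk (M Int L') <= rk T" using flat_rk_mono f(1) by blast
  then have "rk J <= rk (M \<squnion>\<^sub>c L')" using rk_modular[OF fM fL'] rL' rJ by simp
  moreover have "M \<squnion>\<^sub>c L' <= J" using join_least[OF J(2) _ fJ] L'_def by blast
  ultimately have "M \<squnion>\<^sub>c L' = J" using flat_eqI[OF _ flat_join[OF fM fL'] fJ] by blast
  moreover have "M \<squnion>\<^sub>c L' <= M \<squnion>\<^sub>c Q" using join_least[OF upQ(1) _ fMQ] L'Q upQ(2) by blast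
  ultimately show ?thesis using J by blast
 qed
 have "V <= M \<squnion>\<^sub>c Q" using ss socle_least[OF _ LQ fMQ] M(2) upQ unfolding semisimple_def by blast
 then have "rk V <= rk (M \<squnion>\<^sub>c Q)" using flat_rk_mono fMQ by blast
 moreover have "rk T <= rk (M Int Q)" using flat_rk_mono[OF _ flat_Int[OF fM fQ], of T] M(2) socle_upper(1)[OF TE] Q_def by blast
 ultimately have "rk V' <= rk Q" using rk_modular[OF fM fQ] rMV' V by simp
 then have "Q = V'" using flat_eqI[OF QV' fQ f(3)] by blast
 then show ?thesis unfolding semisimple_def Q_def by simp
qed

text \<open>By modularity, intersection with \<open>C\<close> transports the interval from
  \<open>T'\<close> to \<open>S\<close> to the one from \<open>T\<close> to \<open>C\<close>; lines
  over \<open>T'\<close> become lines over \<open>T\<close>.\<close>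

lemma semisimple_complement:
 assumes ss: "semisimple T' S" and LL: "T \<in> LL" "T' \<in> LL" "S \<in> LL" "C \<in> LL"
  and C: "T <= C" "T <= T'" "C Int T' <= T" "C \<squnion>\<^sub>c T' = S"
 shows "semisimple T C"
proof -
 note f = LL[THEN LL_flat]
 have CT: "C Int T' = T" using C by blast
 have CS: "C <= S" "T' <= S" using join_upper[OF f(4) f(2)] C(4) by auto
 have rS: "rk S + rk T = rk C + rk T'" using rk_modular[OF f(4) f(2)] CT C(4) by simp
 have TE: "T <= E" using f flat_in by blast
 define Q where "Q = socle T C"
 have fQ: "flat Q" unfolding Q_def by (rule socle_flat[OF TE])
 have QC: "Q <= C" unfolding Q_def by (rule socle_least[OF C(1) _ f(4)])
 have upQ: "T' <= T' \<squnion>\<^sub>c Q" "Q <= T' \<squnion>\<^sub>c Q" by (rule join_upper[OF f(2) fQ])+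
 have fTQ: "flat (T' \<squnion>\<^sub>c Q)" by (rule flat_join[OF f(2) fQ])
 have LQ: "L <= T' \<squnion>\<^sub>c Q" if L: "line T' L" "L <= S" for L
 proof -
  have LLL: "L \<in> LL" and TL: "T' <= L" and rL: "rk L = Suc (rk T')" using L line_def by auto
  have fL: "flat L" using LLL LL_flat by blast
  have "L \<squnion>\<^sub>c C <= S" by (rule join_least[OF L(2) CS(1) f(3)])
  moreover have "S <= L \<squnion>\<^sub>c C" unfolding C(4)[symmetric] by (rule cl_mono) (use TL flat_in[OF fL] flat_in[OF f(4)] in auto)
  ultimately have LC: "L \<squnion>\<^sub>c C = S" by blast
  define L' where "L' = L Int C"
  have fL': "flat L'" unfolding L'_def by (rule flat_Int[OF fL f(4)])
  have rL': "rk L' = Suc (rk T)" using rk_modular[OF fL f(4)] LC rL rS L'_def by simp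
  have TL': "T <= L'" using TL C L'_def by blast
  have "L' \<in> LL" using LL_Int LLL LL(4) L'_def by blast
  then have "line T L'" using rL' TL' line_def by blast
  then have L'Q: "L' <= Q" unfolding Q_def using socle_upper(2)[OF TE] L'_def by blast
  have "T' Int L' <= T" using CT L'_def by blast
  then have "rk (T' Int L') <= rk T" using flat_rk_mono f(1) by blast
  then have "rk L <= rk (T' \<squnion>\<^sub>c L')" using rk_modular[OF f(2) fL'] rL' rL by simp
  moreover have "T' \<squnion>\<^sub>c L' <= L" using join_least[OF TL _ fL] L'_def by blast
  ultimately have "T' \<squnion>\<^sub>c L' = L" using flat_eqI[OF _ flat_join[OF f(2) fL'] fL] by blast
  moreover have "T' \<squnion>\<^sub>c L' <= T' \<squnion>\<^sub>c Q" using join_least[OF upQ(1) _ fTQ] L'Q upQ(2) by blast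
  ultimately show ?thesis by blast
 qed
 have "S <= T' \<squnion>\<^sub>c Q" using ss socle_least[OF _ LQ fTQ] upQ unfolding semisimple_def by blast
 then have "rk S <= rk (T' \<squnion>\<^sub>c Q)" using flat_rk_mono fTQ by blast
 moreover have "rk T <= rk (T' Int Q)" using flat_rk_mono[OF _ flat_Int[OF f(2) fQ], of T] C(2) socle_upper(1)[OF TE] Q_def by blast
 ultimately have "rk C <= rk Q" using rk_modular[OF f(2) fQ] rS by simp
 then have "Q = C" using flat_eqI[OF QC fQ f(4)] by blast
 then show ?thesis unfolding semisimple_def Q_def by simp
qed

text \<open>Lattice form of the fact that a module of finite length with zero radical is semisimple.
  A hyperplane \<open>U\<close> is semisimple by induction, and a line complementing it is
  produced.\<close>

lemma semisimple_hyperplanes: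
 assumes "T \<in> LL" "V \<in> LL" "T <= V"
  and "!!g. g \<in> V - T ==> EX U:LL. T <= U & U <= V & g ~: U & rk V <= Suc (rk U)"
 shows "semisimple T V" using assms
proof (induction "rk V" arbitrary: V rule: less_induct)
 case less
 note f = less.prems(1,2)[THEN LL_flat]
 have TE: "T <= E" using f flat_in by blast
 show ?case
 proof (cases "V = T")
  case True
  then show ?thesis using semisimpleI[OF f(2)] socle_upper(1)[OF TE] by blast
 next
  case False
  then obtain g where "g \<in> V - T" using less.prems by blast
  then obtain U where U: "U \<in> LL" "T <= U" "U <= V" "g ~: U" "rk V <= Suc (rk U)" using less.prems(4) by blast
  have fU: "flat U" using U LL_flat by blast
  have "U ~= V" using U(4) \<open>g \<in> V - T\<close> by blast
  then have rU: "rk V = Suc (rk U)" using flat_psubset_rk[of U V] U fU f(2) by force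
  have "EX U':LL. T <= U' & U' <= U & h ~: U' & rk U <= Suc (rk U')" if h: "h \<in> U - T" for h
  proof -
   obtain U' where U': "U' \<in> LL" "T <= U'" "U' <= V" "h ~: U'" "rk V <= Suc (rk U')"
    using less.prems(4) h U(3) by blast
   have fU': "flat U'" using U' LL_flat by blast
   have "rk (U \<squnion>\<^sub>c U') <= rk V" using flat_rk_mono[OF join_least[OF U(3) U'(3) f(2)] f(2)] .
   then have "rk U <= Suc (rk (U Int U'))" using rk_modular[OF fU fU'] U'(5) by simp
   then show ?thesis using LL_Int[OF U(1) U'(1)] U U' by (intro bexI[of _ "U Int U'"]) auto
  qed
  then have ssU: "semisimple T U" using less.hyps[of U] rU less.prems(1) U(1,2) by simp
  \<comment> \<open>A member of least rank among those not contained in \<open>U\<close> will turn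
    out to be a line that complements \<open>U\<close>.\<close>
  let ?P = "%N. N \<in> LL & T <= N & N <= V & ~ N <= U"
  have "?P V" using less.prems U \<open>U ~= V\<close> by blast
  then obtain N where N: "?P N" and mn: "!!N'. ?P N' ==> rk N <= rk N'" using ex_has_least_nat[of ?P V rk] by blast
  have fN: "flat N" using N LL_flat by blast
  have "rk (N \<squnion>\<^sub>c U) <= rk V" using flat_rk_mono[OF join_least[OF _ U(3) f(2)] f(2)] N by blast
  then have rNU: "rk N <= Suc (rk (N Int U))" using rk_modular[OF fN fU] rU by simp
  have NU: "N Int U = T"
  proof (rule ccontr)
   assume "N Int U ~= T"
   then obtain h where h: "h \<in> N Int U" "h ~: T" using N U(2) by blast
   then obtain U' where U': "U' \<in> LL" "T <= U'" "U' <= V" "h ~: U'" "rk V <= Suc (rk U')"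
    using less.prems(4)[of h] U(3) by blast
   have fU': "flat U'" using U' LL_flat by blast
   have "rk (N \<squnion>\<^sub>c U') <= rk V" using flat_rk_mono[OF join_least[OF _ U'(3) f(2)] f(2)] N by blast
   then have rNU': "rk N <= Suc (rk (N Int U'))" using rk_modular[OF fN fU'] U'(5) by simp
   have "N Int U' \<subset> N" using h U'(4) by blast
   then have lt: "rk (N Int U') < rk N" using flat_psubset_rk flat_Int[OF fN fU'] fN by blast
   \<comment> \<open>\<open>N Int U'\<close> has smaller rank than \<open>N\<close>, so minimality
     puts it into \<open>U\<close>. Then \<open>N Int U'\<close> and \<open>N Int U\<close> both
     have corank one in \<open>N\<close> and must coincide, although \<open>h\<close> lies only in
     the second.\<close>
   have "N Int U' <= U"
   proof (rule ccontr)
    assume n: "~ N Int U' <= U"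
    have "N Int U' \<in> LL" using LL_Int N U'(1) by blast
    moreover have "T <= N Int U'" "N Int U' <= V" using N U'(2) by auto
    ultimately show False using mn[of "N Int U'"] n lt by simp
   qed
   then have s: "N Int U' <= N Int U" by blast
   have "N Int U \<subset> N" using N by blast
   then have "rk (N Int U) < rk N" using flat_psubset_rk flat_Int[OF fN fU] fN by blast
   then have "rk (N Int U) <= rk (N Int U')" using rNU' by simp
   then have "N Int U' = N Int U" using flat_eqI[OF s flat_Int[OF fN fU'] flat_Int[OF fN fU]] by blast
   then show False using h U'(4) by blast
  qed
  have "N ~= T" using N U(2) by blast
  then have "rk T < rk N" using flat_psubset_rk[of T N] N f(1) fN by blast
  then have "rk N = Suc (rk T)" using rNU NU by simp
  then have lN: "line T N" using N line_def by blast
  have "U <= socle T V"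
  proof -
   have "socle T U <= socle T V" by (rule socle_least[OF _ _ socle_flat[OF TE]]) (use socle_upper[OF TE] U(3) in blast)+
   then show ?thesis using ssU unfolding semisimple_def by simp
  qed
  moreover have "N <= socle T V" using socle_upper(2)[OF TE lN] N by blast
  ultimately have "U \<squnion>\<^sub>c N <= socle T V" by (rule join_least[OF _ _ socle_flat[OF TE]])
  moreover have "U \<squnion>\<^sub>c N = V"
  proof (rule flat_eqI[OF _ flat_join[OF fU fN] f(2)])
   show "U \<squnion>\<^sub>c N <= V" using join_least[OF U(3) _ f(2)] N by blast
   have "U Int N = T" using NU by blast
   then show "rk V <= rk (U \<squnion>\<^sub>c N)" using rk_modular[OF fU fN] rU \<open>rk N = Suc (rk T)\<close> by simp
  qed
  ultimately show ?thesis using semisimpleI[OF f(2) less.prems(3)] by simp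
 qed
qed

lemma semisimple_Union:
 assumes "T \<in> LL" "!!V. V \<in> \<V> ==> semisimple T V & V <= E"
 shows "semisimple T (cl (T Un \<Union>\<V>))"
proof -
 have TE: "T <= E" using assms LL_flat flat_in by blast
 have UE: "T Un \<Union>\<V> <= E" using TE assms by blast
 define Q where "Q = cl (T Un \<Union>\<V>)"
 have fQ: "flat Q" unfolding Q_def by (rule flat_cl[OF UE])
 have up: "T Un \<Union>\<V> <= Q" unfolding Q_def by (rule cl_increasing[OF UE])
 have "V <= socle T Q" if "V \<in> \<V>" for V
 proof -
  have VQ: "V <= Q" using up that by blast
  have "socle T V <= socle T Q" by (rule socle_least[OF _ _ socle_flat[OF TE]]) (use socle_upper[OF TE] VQ in blast)+
  then show ?thesis using assms(2)[OF that] unfolding semisimple_def by simp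
 qed
 then have "T Un \<Union>\<V> <= socle T Q" using socle_upper(1)[OF TE] by blast
 then have "Q <= socle T Q" unfolding Q_def using cl_flat_min[OF _ socle_flat[OF TE]] by blast
 then show ?thesis using semisimpleI[OF fQ] up unfolding Q_def by blast
qed

lemma semisimple_has_line:
 assumes "semisimple T V" "T \<in> LL" "V ~= T"
 shows "EX L. line T L & L <= V"
proof (rule ccontr)
 assume "\<nexists>L. line T L & L <= V"
 then have e: "{L. line T L & L <= V} = {}" by blast
 have "socle T V = cl T" unfolding socle_def e by (simp only: Union_empty Un_empty_right)
 then show False using assms LL_flat unfolding semisimple_def flat_def by blast
qed

lemma LL_Union_finite:
 assumes "finite \<V>" "\<V> <= LL" "T \<in> LL"
 shows "cl (T Un \<Union>\<V>) \<in> LL" using assms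
proof (induction rule: finite_induct)
 case empty
 then show ?case using LL_flat flat_def by simp
next
 case (insert V \<V>)
 have Q: "cl (T Un \<Union>\<V>) \<in> LL" using insert by simp
 have V: "V \<in> LL" using insert by simp
 have UE: "T Un \<Union>\<V> <= E" using insert.prems LL_flat flat_in by blast
 have VE: "V <= E" using V LL_flat flat_in by blast
 have "cl (T Un \<Union>\<V>) \<squnion>\<^sub>c V = cl (T Un \<Union>(Set.insert V \<V>))"
 proof
  have 1: "T Un \<Union>(Set.insert V \<V>) <= E" using UE VE by auto
  have "cl (T Un \<Union>\<V>) <= cl (T Un \<Union>(Set.insert V \<V>))" by (rule cl_mono[OF _ 1]) auto
  moreover have "V <= cl (T Un \<Union>(Set.insert V \<V>))" using cl_increasing[OF 1] by blast
  ultimately show "cl (T Un \<Union>\<V>) \<squnion>\<^sub>c V <= cl (T Un \<Union>(Set.insert V \<V>))"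
   by (rule join_least[OF _ _ flat_cl[OF 1]])
  have 2: "cl (T Un \<Union>\<V>) Un V <= E" using cl_in[OF UE] VE by blast
  show "cl (T Un \<Union>(Set.insert V \<V>)) <= cl (T Un \<Union>\<V>) \<squnion>\<^sub>c V"
   by (rule cl_mono[OF _ 2]) (use cl_increasing[OF UE] in auto)
 qed
 then show ?case using LL_join[OF Q V] by simp
qed

end

section \<open>Isolated subgroups of a torsion-free abelian group\<close>

definition isolated :: "('g, 'n) monoid_scheme => 'g set => bool" where
 "isolated M H \<longleftrightarrow> subgroup H M & (ALL g:carrier M. ALL n::nat. n \<ge> 1 & g [^]\<^bsub>M\<^esub> n \<in> H --> g \<in> H)"

text \<open>Isolated subgroups correspond to the rational subspaces of the tensor product with the
  rationals, so for an abelian group \<open>icl\<close> is linear span expressed inside the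
  group.\<close>

definition icl :: "('g, 'n) monoid_scheme => 'g set => 'g set" where
 "icl M A = \<Inter>{H. isolated M H & A <= H}"

context comm_group
begin

lemma subgroup_nat_pow: "subgroup H G ==> h \<in> H ==> h [^] (n::nat) \<in> H"
 by (induction n) (auto intro: subgroup.one_closed subgroup.m_closed)

lemma subgroup_int_pow: "subgroup H G ==> h \<in> H ==> h [^] (n::int) \<in> H" unfolding int_pow_def2
 using subgroup_nat_pow[of H h "nat (- n)"] subgroup_nat_pow[of H h "nat n"] subgroup.m_inv_closed[of H G] by metis

lemma isolatedD: "isolated G H ==> g \<in> carrier G ==> n \<ge> (1::nat) ==> g [^] n \<in> H ==> g \<in> H"
 by (auto simp: isolated_def)

lemma isolatedD_int:
 assumes "isolated G H" "g \<in> carrier G" "i ~= (0::int)" "g [^] i \<in> H"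
 shows "g \<in> H"
proof (cases "i > 0")
 case True
 then obtain n where n: "i = int n" "n \<ge> 1" using zero_less_imp_eq_int[of i] by auto
 then have "g [^] i = g [^] n" by (simp add: int_pow_int)
 then show ?thesis using isolatedD[OF assms(1,2) n(2)] assms by simp
next
 case False
 then have "- i > 0" using assms by simp
 then obtain n where n: "- i = int n" "n \<ge> 1" using zero_less_imp_eq_int[of "- i"] assms by auto
 have "i = - int n" using n(1) by simp
 then have "g [^] i = inv (g [^] n)" using int_pow_neg_int[OF assms(2), of n] by simp
 moreover have "inv (g [^] i) \<in> H" using assms(1,4) subgroup.m_inv_closed[of H G "g [^] i"] unfolding isolated_def by blast
 ultimately have "g [^] n \<in> H" using assms(2) by simp
 then show ?thesis using isolatedD[OF assms(1,2) n(2)] by simp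
qed

lemma isolated_isolator:
 assumes H: "subgroup H G"
 shows "isolated G (isolator G H)"
proof -
 have 1: "\<one> \<in> isolator G H" unfolding isolator_def using subgroup.one_closed[OF H] by (auto intro!: exI[of _ "1::nat"])
 have 2: "g \<otimes> h \<in> isolator G H" if gh: "g \<in> isolator G H" "h \<in> isolator G H" for g h
 proof -
  obtain n m :: nat where nm: "n \<ge> 1" "m \<ge> 1" "g [^] n \<in> H" "h [^] m \<in> H"
   and c: "g \<in> carrier G" "h \<in> carrier G" using gh unfolding isolator_def by blast
  have "(g \<otimes> h) [^] (n * m) = (g [^] n) [^] m \<otimes> (h [^] m) [^] n" using c by (simp add: nat_pow_distrib nat_pow_pow mult.commute)
  also have "\<dots> \<in> H" using subgroup_nat_pow[OF H] nm subgroup.m_closed[OF H] by blast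
  finally show ?thesis using c nm unfolding isolator_def by (auto intro!: exI[of _ "n * m"] simp: Suc_leI)
 qed
 have 3: "inv g \<in> isolator G H" if g: "g \<in> isolator G H" for g
 proof -
  obtain n :: nat where n: "n \<ge> 1" "g [^] n \<in> H" and c: "g \<in> carrier G" using g unfolding isolator_def by blast
  have "inv g [^] n \<in> H" using nat_pow_inv[OF c, of n] subgroup.m_inv_closed[OF H n(2)] by simp
  then show ?thesis using c n unfolding isolator_def by auto
 qed
 have "subgroup (isolator G H) G" by (rule subgroup.intro) (use 1 2 3 in \<open>auto simp: isolator_def\<close>)
 moreover have "g \<in> isolator G H" if g: "g \<in> carrier G" "n \<ge> (1::nat)" "g [^] n \<in> isolator G H" for g n
 proof -
  obtain m :: nat where m: "m \<ge> 1" "(g [^] n) [^] m \<in> H" using g unfolding isolator_def by blast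
  then have "g [^] (n * m) \<in> H" using nat_pow_pow g by simp
  then show ?thesis using g m unfolding isolator_def by (auto intro!: exI[of _ "n * m"] simp: Suc_leI)
 qed
 ultimately show ?thesis unfolding isolated_def by blast
qed

lemma isolator_upper:
 assumes H: "subgroup H G"
 shows "H <= isolator G H"
proof
 fix h assume h: "h \<in> H"
 have "h \<in> carrier G" "h [^] (1::nat) \<in> H" using subgroup.mem_carrier[OF H h] h by auto
 then show "h \<in> isolator G H" unfolding isolator_def using le_refl[of "1::nat"] by blast
qed

lemma isolator_least: "isolated G V ==> H <= V ==> isolator G H <= V"
 unfolding isolator_def isolated_def by blast

lemma isolated_carrier: "isolated G (carrier G)" unfolding isolated_def using subgroup_self by simp

lemma isolated_Inter:
 assumes "!!H. H \<in> \<H> ==> isolated G H" "\<H> ~= {}"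
 shows "isolated G (\<Inter>\<H>)"
proof -
 have "subgroup (\<Inter>\<H>) G" using assms by (intro subgroups_Inter) (auto simp: isolated_def)
 then show ?thesis unfolding isolated_def using assms isolatedD by blast
qed

lemma isolated_icl:
 assumes "A <= carrier G"
 shows "isolated G (icl G A)" unfolding icl_def using isolated_carrier assms by (intro isolated_Inter) auto

lemma icl_upper: "A <= icl G A" unfolding icl_def by blast

lemma icl_least: "isolated G H ==> A <= H ==> icl G A <= H" unfolding icl_def by blast

lemma icl_isolated: "isolated G H ==> icl G H = H" using icl_upper icl_least by blast

lemma icl_eq_isolator:
 assumes "A <= carrier G"
 shows "icl G A = isolator G (generate G A)"
proof
 have s: "subgroup (generate G A) G" using generate_is_subgroup assms by blast
 show "icl G A <= isolator G (generate G A)"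
  using icl_least[OF isolated_isolator[OF s]] isolator_upper[OF s] generate.incl[of _ A G] by blast
 have "generate G A <= icl G A" using generate_subgroup_incl[OF icl_upper] isolated_icl[OF assms] isolated_def by blast
 then show "isolator G (generate G A) <= icl G A" using isolator_least[OF isolated_icl[OF assms]] by blast
qed

lemma subgroup_set_mult:
 assumes H: "subgroup H G" and V: "subgroup V G"
 shows "subgroup (H <#> V) G"
proof (rule subgroup.intro)
 have c: "h \<in> carrier G" if "h \<in> H | h \<in> V" for h using that subgroup.subset[OF H] subgroup.subset[OF V] by blast
 show "H <#> V <= carrier G" using c by (auto simp: set_mult_def)
 have "\<one> = \<one> \<otimes> \<one>" by simp
 then show "\<one> \<in> H <#> V" using subgroup.one_closed[OF H] subgroup.one_closed[OF V] unfolding set_mult_def by blast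
 fix x assume "x \<in> H <#> V"
 then obtain h v where x: "h \<in> H" "v \<in> V" "x = h \<otimes> v" by (auto simp: set_mult_def)
 have "inv x = inv h \<otimes> inv v" using x c inv_mult by simp
 then show "inv x \<in> H <#> V" using x subgroup.m_inv_closed[OF H] subgroup.m_inv_closed[OF V] by (auto simp: set_mult_def)
 fix y assume "y \<in> H <#> V"
 then obtain h' v' where y: "h' \<in> H" "v' \<in> V" "y = h' \<otimes> v'" by (auto simp: set_mult_def)
 have "x \<otimes> y = (h \<otimes> h') \<otimes> (v \<otimes> v')" using x y c by (simp add: m_ac)
 moreover have "h \<otimes> h' \<in> H" "v \<otimes> v' \<in> V" using x y subgroup.m_closed[OF H] subgroup.m_closed[OF V] by auto
 ultimately show "x \<otimes> y \<in> H <#> V" unfolding set_mult_def by blast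
qed

lemma icl_Un_elem:
 assumes H: "subgroup H G" and V: "subgroup V G" and g: "g \<in> icl G (H Un V)"
 shows "EX n::nat. n \<ge> 1 & (EX h:H. EX v:V. g [^] n = h \<otimes> v)"
proof -
 have s: "subgroup (H <#> V) G" by (rule subgroup_set_mult[OF H V])
 have "H <= H <#> V"
 proof
  fix h assume h: "h \<in> H"
  have "h = h \<otimes> \<one>" using subgroup.mem_carrier[OF H h] by simp
  then show "h \<in> H <#> V" using h subgroup.one_closed[OF V] unfolding set_mult_def by blast
 qed
 moreover have "V <= H <#> V"
 proof
  fix v assume v: "v \<in> V"
  have "v = \<one> \<otimes> v" using subgroup.mem_carrier[OF V v] by simp
  then show "v \<in> H <#> V" using v subgroup.one_closed[OF H] unfolding set_mult_def by blast
 qed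
 ultimately have "icl G (H Un V) <= isolator G (H <#> V)" using icl_least[OF isolated_isolator[OF s]] isolator_upper[OF s] by blast
 then show ?thesis using g unfolding isolator_def set_mult_def by blast
qed

lemma icl_insert_elem:
 assumes H: "isolated G H" and a: "a \<in> carrier G" and g: "g \<in> icl G (insert a H)"
 shows "EX n::nat. n \<ge> 1 & (EX h:H. EX i::int. g [^] n = h \<otimes> a [^] i)"
proof -
 have s: "subgroup H G" using H isolated_def by blast
 have s2: "subgroup (generate G {a}) G" using generate_is_subgroup a by blast
 have HG: "H <= carrier G" by (rule subgroup.subset[OF s])
 have c: "H Un generate G {a} <= carrier G" using HG subgroup.subset[OF s2] by blast
 have "insert a H <= icl G (H Un generate G {a})" using icl_upper[of "H Un generate G {a}"] generate.incl[of a "{a}" G] by blast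
 then have "g \<in> icl G (H Un generate G {a})" using icl_least[OF isolated_icl[OF c]] g by blast
 from icl_Un_elem[OF s s2 this] show ?thesis unfolding generate_pow[OF a] by blast
qed

end

text \<open>The working form of finite rank. \<open>finite_rank_imp_finite_icl\<close> derives it
  from the definition by the tensor product.\<close>

locale fin_rank_group = comm_group M for M (structure) +
 assumes fin: "EX B. finite B & B <= carrier M & carrier M <= icl M B"
begin

sublocale modular_pregeometry "carrier M" "icl M"
proof
 show "A <= icl M A" if "A <= carrier M" for A by (rule icl_upper)
 show i: "icl M A <= carrier M" if "A <= carrier M" for A using icl_least[OF isolated_carrier that] .
 show mono: "icl M A <= icl M B" if "A <= B" "B <= carrier M" for A B
  using icl_least[OF isolated_icl[OF that(2)]] icl_upper that by blast
 show idem: "icl M (icl M A) = icl M A" if "A <= carrier M" for A using icl_isolated[OF isolated_icl[OF that]] .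
 show "EX B. finite B & B <= carrier M & carrier M <= icl M B" by (rule fin)
 show "a \<in> icl M (insert b A)"
  if A: "A <= carrier M" and a: "a \<in> carrier M" and b: "b \<in> icl M (insert a A)" "b ~: icl M A" for A a b
 proof -
  have iA: "isolated M (icl M A)" by (rule isolated_icl[OF A])
  have aA: "insert a (icl M A) <= carrier M" using a i[OF A] by blast
  have bc: "b \<in> carrier M" using b(1) i[of "insert a A"] a A by blast
  have "b \<in> icl M (insert a (icl M A))" using mono[of "insert a A" "insert a (icl M A)"] aA icl_upper[of A] b(1) by blast
  then obtain n :: nat and h and k :: int where n: "n \<ge> 1" "h \<in> icl M A" "b [^] n = h \<otimes> a [^] k"
   using icl_insert_elem[OF iA a] by blast
  have hc: "h \<in> carrier M" using n i[OF A] by blast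
  \<comment> \<open>A zero exponent would place a power of \<open>b\<close>, hence \<open>b\<close>
    itself, in the isolated subgroup generated by \<open>A\<close>.\<close>
  have k0: "k ~= 0" using n b(2) isolatedD[OF iA bc n(1)] hc by auto
  have bA: "insert b A <= carrier M" using bc A by blast
  have ib: "isolated M (icl M (insert b A))" by (rule isolated_icl[OF bA])
  then have s: "subgroup (icl M (insert b A)) M" by (simp add: isolated_def)
  have "h \<in> icl M (insert b A)" using n mono[OF _ bA, of A] by blast
  moreover have "b \<in> icl M (insert b A)" using icl_upper by blast
  ultimately have "inv h \<otimes> b [^] n \<in> icl M (insert b A)"
   using s subgroup_nat_pow[OF s] subgroup.m_closed[OF s] subgroup.m_inv_closed[OF s] by blast
  moreover have "inv h \<otimes> b [^] n = a [^] k" using n hc a by (simp add: m_assoc[symmetric])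
  ultimately show ?thesis using isolatedD_int[OF ib a k0] by simp
 qed
 show "icl M (A Un B) Int C <= icl M (A Un (B Int C))"
  if AC: "A <= C" and cl: "icl M A = A" "icl M B = B" "icl M C = C"
   and c: "A <= carrier M" "B <= carrier M" "C <= carrier M" for A B C
 proof
  fix g assume g: "g \<in> icl M (A Un B) Int C"
  have iA: "isolated M A" and iB: "isolated M B" and iC: "isolated M C"
   using isolated_icl[OF c(1)] isolated_icl[OF c(2)] isolated_icl[OF c(3)] cl by auto
  have s: "subgroup A M" "subgroup B M" "subgroup C M" using iA iB iC isolated_def by auto
  obtain n :: nat and a b where n: "n \<ge> 1" "a \<in> A" "b \<in> B" "g [^] n = a \<otimes> b" using icl_Un_elem[OF s(1,2)] g by blast
  have gc: "g \<in> carrier M" using g c by blast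
  have "inv a \<otimes> g [^] n \<in> C" using n AC g subgroup.m_closed[OF s(3)] subgroup.m_inv_closed[OF s(3)] subgroup_nat_pow[OF s(3)] by blast
  moreover have "inv a \<otimes> g [^] n = b" using n subsetD[OF c(1) n(2)] subsetD[OF c(2) n(3)] by (simp add: m_assoc[symmetric])
  ultimately have bBC: "b \<in> B Int C" using n by simp
  have u: "A Un (B Int C) <= carrier M" using c by blast
  have ii: "isolated M (icl M (A Un (B Int C)))" by (rule isolated_icl[OF u])
  have "a \<otimes> b \<in> icl M (A Un (B Int C))"
   using ii n bBC icl_upper[of "A Un (B Int C)"] by (auto simp: isolated_def intro!: subgroup.m_closed)
  then show "g \<in> icl M (A Un (B Int C))" using isolatedD[OF ii gc n(1)] n by simp
 qed
qed

lemma flat_iff_isolated: "flat H \<longleftrightarrow> isolated M H"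
proof
 show "flat H ==> isolated M H" using isolated_icl[of H] unfolding flat_def by simp
 show "isolated M H ==> flat H" unfolding flat_def using icl_isolated[of H] subgroup.subset[of H M] by (simp add: isolated_def)
qed

end

section \<open>Valuation rings of a field\<close>

context field
begin

lemma Units_iff: "x \<in> Units R \<longleftrightarrow> x \<in> carrier R & x ~= \<zero>" using field_Units by blast

lemma Units_cancel:
 assumes "x \<in> Units R" "y \<in> carrier R"
 shows "x \<otimes> (inv x \<otimes> y) = y" "inv x \<otimes> (x \<otimes> y) = y" "x \<otimes> (y \<otimes> inv x) = y" "inv x \<otimes> (y \<otimes> x) = y"
proof -
 have c: "x \<in> carrier R" "inv x \<in> carrier R" using assms Units_closed by auto
 show 1: "x \<otimes> (inv x \<otimes> y) = y" "inv x \<otimes> (x \<otimes> y) = y"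
  using assms c m_assoc[of x "inv x" y] m_assoc[of "inv x" x y] by auto
 show "x \<otimes> (y \<otimes> inv x) = y" "inv x \<otimes> (y \<otimes> x) = y" using 1 c assms m_comm by auto
qed

lemma Units_pow: "x \<in> Units R ==> x [^] (n::nat) \<in> Units R" by (induction n) auto

lemma Units_inv_mult:
 assumes "x \<in> Units R" "y \<in> Units R"
 shows "inv (x \<otimes> y) = inv x \<otimes> inv y"
proof (rule comm_inv_char)
 have c: "x \<in> carrier R" "inv x \<in> carrier R" "y \<in> carrier R" "inv y \<in> carrier R" using assms Units_closed by auto
 then show "x \<otimes> y \<in> carrier R" "inv x \<otimes> inv y \<in> carrier R" by auto
 have "x \<otimes> y \<otimes> (inv x \<otimes> inv y) = x \<otimes> (inv x \<otimes> (y \<otimes> inv y))" using c by (simp add: m_ac)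
 then show "x \<otimes> y \<otimes> (inv x \<otimes> inv y) = \<one>" using assms c by simp
qed

text \<open>The whole field counts as a valuation ring. This trivial case starts the construction of
  valuations that attain equality.\<close>

definition valring :: "'a set => bool" where
 "valring \<O> \<longleftrightarrow> subring \<O> R & (ALL x:Units R. x \<in> \<O> | inv x \<in> \<O>)"

definition vunits :: "'a set => 'a set" where
 "vunits \<O> = {x \<in> Units R. x \<in> \<O> & inv x \<in> \<O>}"

definition vmax :: "'a set => 'a set" where
 "vmax \<O> = \<O> - vunits \<O>"

definition vals :: "'a set => 'a set set" where
 "vals L = {\<O>. valring \<O> & L <= \<O>}"

text \<open>Equality of values, expressed as congruence modulo units; no value group is ever
  formed.\<close>

definition veq :: "'a set => 'a => 'a => bool" where
 "veq \<O> x y \<longleftrightarrow> x \<in> Units R & y \<in> Units R & x \<otimes> inv y \<in> vunits \<O>"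

lemma valring_carrier: "valring (carrier R)" unfolding valring_def using carrier_is_subring by auto

context
 fixes \<O> assumes O: "valring \<O>"
begin

lemmas O_sub = subringE[OF conjunct1[OF O[unfolded valring_def]]]

lemma vunits_Units: "x \<in> vunits \<O> ==> x \<in> Units R" by (simp add: vunits_def)

lemma vunits_one: "\<one> \<in> vunits \<O>" using O_sub by (simp add: vunits_def)

lemma vunits_mult: "x \<in> vunits \<O> ==> y \<in> vunits \<O> ==> x \<otimes> y \<in> vunits \<O>"
 using O_sub by (auto simp: vunits_def Units_inv_mult)

lemma vunits_inv: "x \<in> vunits \<O> ==> inv x \<in> vunits \<O>" by (auto simp: vunits_def)

lemma vunits_trichotomy: "x \<in> Units R ==> x \<in> vunits \<O> | x \<in> vmax \<O> | inv x \<in> vmax \<O>"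
 using O unfolding valring_def vmax_def vunits_def by auto

lemma vmax_in: "x \<in> vmax \<O> ==> x \<in> carrier R" "x \<in> vmax \<O> ==> x \<in> \<O>"
 using O_sub by (auto simp: vmax_def)

lemma vmax_inv: "x \<in> vmax \<O> ==> x \<in> Units R ==> inv x ~: \<O>" unfolding vmax_def vunits_def by auto

lemma zero_vmax: "\<zero> \<in> vmax \<O>" using O_sub by (auto simp: vmax_def vunits_def Units_iff)

lemma vmax_mult: assumes "x \<in> vmax \<O>" "y \<in> \<O>" shows "x \<otimes> y \<in> vmax \<O>"
proof (rule ccontr)
 have c: "x \<in> carrier R" "y \<in> carrier R" "x \<in> \<O>" using assms O_sub by (auto simp: vmax_def)
 assume "x \<otimes> y ~: vmax \<O>"
 then have u: "x \<otimes> y \<in> vunits \<O>" using assms O_sub c by (auto simp: vmax_def)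
 then have "x ~= \<zero>" "y ~= \<zero>" using c by (auto simp: vunits_def Units_iff)
 then have xy: "x \<in> Units R" "y \<in> Units R" using c Units_iff by auto
 have "inv x = y \<otimes> inv (x \<otimes> y)"
  using xy c by (simp add: Units_inv_mult m_ac) (metis Units_inv_closed Units_l_inv l_one m_assoc m_comm)
 then have "inv x \<in> \<O>" using u assms O_sub by (auto simp: vunits_def)
 then show False using assms xy vmax_inv by blast
qed

lemma vmax_add: assumes "x \<in> vmax \<O>" "y \<in> vmax \<O>" shows "x \<oplus> y \<in> vmax \<O>"
proof -
 have *: "x \<oplus> y \<in> vmax \<O>" if a: "x \<in> vmax \<O>" "y \<in> vmax \<O>" "x \<in> Units R" "y \<otimes> inv x \<in> \<O>" for x y
 proof -
  have c: "x \<in> carrier R" "y \<in> carrier R" using a vmax_in by auto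
  have "x \<oplus> y = x \<otimes> (\<one> \<oplus> y \<otimes> inv x)" using c a(3) by (simp add: r_distr Units_cancel)
  then show ?thesis using vmax_mult[OF a(1)] a(4) O_sub by simp
 qed
 have c: "x \<in> carrier R" "y \<in> carrier R" using assms vmax_in by auto
 show ?thesis
 proof (cases "x = \<zero> | y = \<zero>")
  case True
  then show ?thesis using assms c by auto
 next
  case False
  then have u: "x \<in> Units R" "y \<in> Units R" using c Units_iff by auto
  then have "y \<otimes> inv x \<in> Units R" by simp
  then have "y \<otimes> inv x \<in> \<O> | inv (y \<otimes> inv x) \<in> \<O>" using O valring_def by blast
  moreover have "inv (y \<otimes> inv x) = x \<otimes> inv y" using u by (simp add: Units_inv_mult m_comm Units_closed)
  ultimately show ?thesis using *[OF assms u(1)] *[OF assms(2,1) u(2)] c a_comm by auto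
 qed
qed

lemma vmax_uminus: "x \<in> vmax \<O> ==> \<ominus> x \<in> vmax \<O>"
proof -
 assume x: "x \<in> vmax \<O>"
 have "\<ominus> x = x \<otimes> (\<ominus> \<one>)" using vmax_in[OF x] by (simp add: r_minus)
 then show ?thesis using vmax_mult[OF x] O_sub by simp
qed

lemma vunits_add_vmax: assumes "x \<in> vunits \<O>" "y \<in> vmax \<O>" shows "x \<oplus> y \<in> vunits \<O>"
proof (rule ccontr)
 have c: "x \<in> carrier R" "y \<in> carrier R" "x \<in> \<O>" "y \<in> \<O>" using assms O_sub by (auto simp: vmax_def vunits_def)
 assume "x \<oplus> y ~: vunits \<O>"
 then have "x \<oplus> y \<in> vmax \<O>" using c O_sub by (simp add: vmax_def)
 then have "(x \<oplus> y) \<oplus> \<ominus> y \<in> vmax \<O>" using vmax_add vmax_uminus assms by blast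
 moreover have "(x \<oplus> y) \<oplus> \<ominus> y = x" using c by algebra
 ultimately show False using assms by (simp add: vmax_def)
qed

lemma veq_refl: "x \<in> Units R ==> veq \<O> x x" using vunits_one by (simp add: veq_def)

lemma veq_sym: "veq \<O> x y ==> veq \<O> y x"
 unfolding veq_def using vunits_inv[of "x \<otimes> inv y"] by (auto simp: Units_inv_mult m_comm Units_closed)

lemma veq_trans: assumes "veq \<O> x y" "veq \<O> y z" shows "veq \<O> x z"
proof -
 have u: "x \<in> Units R" "y \<in> Units R" "z \<in> Units R" using assms by (auto simp: veq_def)
 have "(x \<otimes> inv y) \<otimes> (y \<otimes> inv z) = x \<otimes> (inv y \<otimes> y) \<otimes> inv z"
  using u by (simp add: m_assoc Units_closed del: Units_l_inv)
 also have "\<dots> = x \<otimes> inv z" using u by (simp add: Units_closed)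
 finally show ?thesis using assms vunits_mult unfolding veq_def by metis
qed

lemma veq_mult: assumes "veq \<O> x y" "veq \<O> z w" shows "veq \<O> (x \<otimes> z) (y \<otimes> w)"
proof -
 have u: "x \<in> Units R" "y \<in> Units R" "z \<in> Units R" "w \<in> Units R" using assms by (auto simp: veq_def)
 have "(x \<otimes> z) \<otimes> inv (y \<otimes> w) = (x \<otimes> inv y) \<otimes> (z \<otimes> inv w)"
  using u by (simp add: Units_inv_mult m_ac Units_closed)
 then show ?thesis using assms vunits_mult unfolding veq_def by simp
qed

lemma veq_inv: "veq \<O> x y ==> veq \<O> (inv x) (inv y)"
 unfolding veq_def using vunits_inv[of "x \<otimes> inv y"] by (auto simp: Units_inv_mult Units_closed)

lemma veq_pow: "veq \<O> x y ==> veq \<O> (x [^] (n::nat)) (y [^] n)" by (induction n) (auto simp: veq_refl veq_mult)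

lemma veq_one: "veq \<O> x \<one> \<longleftrightarrow> x \<in> vunits \<O>" unfolding veq_def using vunits_Units by (auto simp: Units_closed)

lemma veq_div: assumes "veq \<O> x y" "z \<in> Units R" shows "veq \<O> (x \<otimes> inv z) (y \<otimes> inv z)"
 using veq_mult[OF assms(1) veq_refl[of "inv z"]] assms by simp

lemma vunits_pow: "x \<in> vunits \<O> ==> x [^] (n::nat) \<in> vunits \<O>" by (induction n) (auto simp: vunits_one vunits_mult)

lemma vmax_pow: assumes "x \<in> vmax \<O>" "n \<ge> (1::nat)" shows "x [^] n \<in> vmax \<O>" using assms(2)
proof (induction n rule: nat_induct_at_least)
 case base
 then show ?case using assms vmax_in by simp
next
 case (Suc n)
 then show ?case using vmax_mult[OF Suc.IH] vmax_in assms by simp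
qed

lemma vunits_root:
 assumes "x \<in> Units R" "n \<ge> (1::nat)" "x [^] n \<in> vunits \<O>"
 shows "x \<in> vunits \<O>"
proof (rule ccontr)
 assume "x ~: vunits \<O>"
 then consider "x \<in> vmax \<O>" | "inv x \<in> vmax \<O>" using vunits_trichotomy assms by blast
 then show False
 proof cases
  case 1
  then show False using vmax_pow[OF 1 assms(2)] assms(3) by (simp add: vmax_def)
 next
  case 2
  have "inv (x [^] n) = (inv x) [^] n" by (rule comm_inv_char) (use assms Units_closed in \<open>auto simp: nat_pow_distrib[symmetric]\<close>)
  then have "inv (x [^] n) \<in> vmax \<O>" using vmax_pow[OF 2 assms(2)] by simp
  then show False using vunits_inv[OF assms(3)] by (simp add: vmax_def)
 qed
qed

section \<open>Sums of elements with pairwise different values\<close>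

definition lsum :: "'a list => 'a" where
 "lsum xs = foldr (\<oplus>) xs \<zero>"

lemma lsum_simps [simp]: "lsum [] = \<zero>" "lsum (x # xs) = x \<oplus> lsum xs" by (simp_all add: lsum_def)

lemma lsum_closed [simp]: "set xs <= carrier R ==> lsum xs \<in> carrier R" by (induction xs) auto

text \<open>The ultrametric principle. \<open>sorted_wrt\<close> merely expresses that values are
  pairwise different; the list need not be ordered by value.\<close>

lemma dominant_term:
 assumes "xs ~= []" "set xs <= Units R" "sorted_wrt (%x y. ~ veq \<O> x y) xs"
 shows "EX x:set xs. veq \<O> (lsum xs) x" using assms
proof (induction xs)
 case Nil
 then show ?case by simp
next
 case (Cons x xs)
 have x: "x \<in> Units R" "x \<in> carrier R" using Cons.prems Units_closed by auto
 show ?case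
 proof (cases "xs = []")
  case True
  then show ?thesis using veq_refl x by simp
 next
  case False
  then obtain y where y: "y \<in> set xs" "veq \<O> (lsum xs) y" using Cons by auto
  define s where "s = lsum xs"
  have s: "s \<in> Units R" "y \<in> Units R" "veq \<O> s y" using y s_def by (auto simp: veq_def)
  have sc: "s \<in> carrier R" "y \<in> carrier R" using s Units_closed by auto
  have nxs: "~ veq \<O> x s" using Cons.prems y s veq_trans by auto
  have xs: "x \<otimes> inv s \<in> Units R" using x s by simp
  have e: "inv (x \<otimes> inv s) = s \<otimes> inv x" using x s sc by (simp add: Units_inv_mult m_comm)
  have "x \<otimes> inv s \<in> vmax \<O> | s \<otimes> inv x \<in> vmax \<O>" using vunits_trichotomy[OF xs] nxs x s e by (auto simp: veq_def)
  then show ?thesis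
  proof
   assume m: "x \<otimes> inv s \<in> vmax \<O>"
   have "(x \<oplus> s) = (\<one> \<oplus> x \<otimes> inv s) \<otimes> s" using x s sc by (simp add: l_distr m_assoc a_comm)
   moreover have "\<one> \<oplus> x \<otimes> inv s \<in> vunits \<O>" using vunits_add_vmax[OF vunits_one m] .
   ultimately have "veq \<O> (x \<oplus> s) (\<one> \<otimes> s)"
    using veq_mult[OF _ veq_refl[OF s(1)], of "\<one> \<oplus> x \<otimes> inv s" \<one>] veq_one by simp
   then have "veq \<O> (x \<oplus> s) s" using sc by simp
   then have "veq \<O> (lsum (x # xs)) y" using veq_trans[OF _ s(3)] s_def by simp
   then show ?thesis using y(1) by (meson list.set_intros(2))
  next
   assume m: "s \<otimes> inv x \<in> vmax \<O>"
   have "(x \<oplus> s) = (\<one> \<oplus> s \<otimes> inv x) \<otimes> x" using x s sc by (simp add: l_distr m_assoc)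
   moreover have "\<one> \<oplus> s \<otimes> inv x \<in> vunits \<O>" using vunits_add_vmax[OF vunits_one m] .
   ultimately have "veq \<O> (x \<oplus> s) (\<one> \<otimes> x)"
    using veq_mult[OF _ veq_refl[OF x(1)], of "\<one> \<oplus> s \<otimes> inv x" \<one>] veq_one by simp
   then have "veq \<O> (lsum (x # xs)) x" using x s_def by simp
   then show ?thesis by (meson list.set_intros(1))
  qed
 qed
qed

text \<open>Coefficient lists begin with the leading coefficient, so the length of the tail is the
  exponent. Zero coefficients are skipped because zero has no value.\<close>

fun pterms :: "'a list => 'a => 'a list" where
 "pterms [] x = []"
| "pterms (a # p) x = (if a = \<zero> then pterms p x else a \<otimes> x [^] length p # pterms p x)"

lemma lsum_pterms: "set p <= carrier R ==> x \<in> carrier R ==> lsum (pterms p x) = eval p x"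
 by (induction p) (auto simp: eval_in_carrier)

lemma set_pterms: "t \<in> set (pterms p x) ==> EX a:set p - {\<zero>}. EX i<length p. t = a \<otimes> x [^] i"
 by (induction p) (auto split: if_splits dest: less_SucI)

lemma poly_dominant_term:
 assumes p: "set p <= carrier R" "~ set p <= {\<zero>}" and x: "x \<in> Units R"
  and ties: "!!a b i j. a \<in> set p - {\<zero>} ==> b \<in> set p - {\<zero>} ==> j < i ==> i < length p
   ==> ~ veq \<O> (a \<otimes> x [^] i) (b \<otimes> x [^] (j::nat))"
 shows "EX a:set p - {\<zero>}. EX i<length p. veq \<O> (eval p x) (a \<otimes> x [^] i)"
proof -
 have "sorted_wrt (%y z. ~ veq \<O> y z) (pterms q x)" if "set q <= set p" "length q <= length p" for q using that
 proof (induction q)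
  case Nil
  then show ?case by simp
 next
  case (Cons a q)
  have "~ veq \<O> (a \<otimes> x [^] length q) t" if t: "a ~= \<zero>" "t \<in> set (pterms q x)" for t
   using set_pterms[OF t(2)] ties[of a _ _ "length q"] Cons.prems t(1) by force
  then show ?case using Cons by auto
 qed
 moreover have "set (pterms p x) <= Units R"
 proof
  fix t assume "t \<in> set (pterms p x)"
  then obtain a i where "a \<in> set p - {\<zero>}" "t = a \<otimes> x [^] (i::nat)" using set_pterms by blast
  moreover have "a \<in> Units R" using calculation(1) p(1) Units_iff[of a] by blast
  ultimately show "t \<in> Units R" using x Units_pow by simp
 qed
 moreover have "pterms p x ~= []" using p(2) by (induction p) auto
 ultimately obtain t where t: "t \<in> set (pterms p x)" "veq \<O> (lsum (pterms p x)) t" using dominant_term by blast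
 then show ?thesis using set_pterms[OF t(1)] lsum_pterms[OF p(1)] x Units_closed by metis
qed

text \<open>Without a tie the sum would have the value of one of its non-zero monomials and could
  not vanish. This is how an algebraic relation becomes a multiplicative one.\<close>

lemma poly_tie:
 assumes p: "set p <= carrier R" "~ set p <= {\<zero>}" and x: "x \<in> Units R" and 0: "eval p x = \<zero>"
 shows "EX a:set p - {\<zero>}. EX b:set p - {\<zero>}. EX i j::nat. i < j & j < length p & veq \<O> (a \<otimes> x [^] i) (b \<otimes> x [^] j)"
proof (rule ccontr)
 assume n: "~ ?thesis"
 have "~ veq \<O> (a \<otimes> x [^] i) (b \<otimes> x [^] (j::nat))"
  if "a \<in> set p - {\<zero>}" "b \<in> set p - {\<zero>}" "j < i" "i < length p" for a b i j using n that veq_sym by blast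
 then obtain a i where "veq \<O> (eval p x) (a \<otimes> x [^] (i::nat))" using poly_dominant_term[OF p x] by blast
 then show False using 0 by (simp add: veq_def Units_iff)
qed

lemma veq_pow_diff:
 assumes "veq \<O> (a \<otimes> x [^] i) (b \<otimes> x [^] j)" "i < (j::nat)" "a \<in> Units R" "b \<in> Units R" "x \<in> Units R"
 shows "veq \<O> (a \<otimes> inv b) (x [^] (j - i))"
proof -
 have c: "a \<in> carrier R" "b \<in> carrier R" "x \<in> carrier R" using assms Units_closed by auto
 have p: "x [^] i \<in> Units R" "x [^] (j - i) \<in> Units R" using assms Units_pow by auto
 have u: "b \<otimes> x [^] i \<in> Units R" using assms p by simp
 have "x [^] j = x [^] i \<otimes> x [^] (j - i)" using assms(2) c nat_pow_mult[of x i "j - i"] by simp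
 have 1: "(a \<otimes> x [^] i) \<otimes> inv (b \<otimes> x [^] i) = a \<otimes> inv b"
  using assms c p by (simp add: m_ac Units_inv_mult Units_cancel)
 have 2: "(b \<otimes> x [^] j) \<otimes> inv (b \<otimes> x [^] i) = x [^] (j - i)"
  unfolding \<open>x [^] j = _\<close> using assms c p by (simp add: m_ac Units_inv_mult Units_cancel)
 show ?thesis using veq_div[OF assms(1) u] 1 2 by simp
qed

end
end

section \<open>Polynomial evaluation and Chevalley's extension theorem\<close>

context field
begin

lemma eval_snoc: "set p <= carrier R ==> b \<in> carrier R ==> x \<in> carrier R ==> eval (p @ [b]) x = eval p x \<otimes> x \<oplus> b"
 by (rule eval_append_aux)

lemma eval_map_mult:
 "set p <= carrier R ==> a \<in> carrier R ==> x \<in> carrier R ==> eval (map ((\<otimes>) a) p) x = a \<otimes> eval p x"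
 by (induction p) (auto simp: r_distr m_assoc eval_in_carrier)

lemma simple_extension_eval:
 assumes "I <= carrier R" "x \<in> carrier R"
 shows "y \<in> simple_extension I x \<longleftrightarrow> (EX p. set p <= I & eval p x = y)"
proof
 assume "y \<in> simple_extension I x"
 then show "EX p. set p <= I & eval p x = y"
 proof (induction rule: simple_extension.induct)
  case zero
  then show ?case by (intro exI[of _ "[]"]) simp
 next
  case (lin k1 k2)
  then obtain p where p: "set p <= I" "eval p x = k1" by blast
  then have "eval (p @ [k2]) x = k1 \<otimes> x \<oplus> k2" using eval_snoc[of p k2 x] lin assms by blast
  then show ?case using p lin by (intro exI[of _ "p @ [k2]"]) simp
 qed
next
 have "eval p x \<in> simple_extension I x" if "set p <= I" for p using that
 proof (induction p rule: rev_induct)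
  case Nil
  then show ?case by (simp add: simple_extension.zero)
 next
  case (snoc b p)
  then have "eval (p @ [b]) x = eval p x \<otimes> x \<oplus> b" using eval_snoc[of p b x] assms by auto
  then show ?case using snoc by (simp add: simple_extension.lin)
 qed
 then show "EX p. set p <= I & eval p x = y ==> y \<in> simple_extension I x" by blast
qed

lemma simple_extension_add:
 assumes I: "I <= carrier R" "\<zero> \<in> I" "!!a b. a \<in> I ==> b \<in> I ==> a \<oplus> b \<in> I" and x: "x \<in> carrier R"
  and "y \<in> simple_extension I x" "z \<in> simple_extension I x"
 shows "y \<oplus> z \<in> simple_extension I x" using assms(5,6)
proof (induction arbitrary: z rule: simple_extension.induct)
 case zero
 then show ?case using simple_extension_in_carrier[OF I(1) x] by auto
next
 case (lin k1 k2)
 have c: "k1 \<in> carrier R" "k2 \<in> carrier R" using simple_extension_in_carrier[OF I(1) x] lin I by auto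
 from lin.prems show ?case
 proof (cases rule: simple_extension.cases)
  case zero
  then show ?thesis using c x simple_extension.lin[OF lin.hyps] by simp
 next
  case (lin l1 l2)
  have d: "l1 \<in> carrier R" "l2 \<in> carrier R" using simple_extension_in_carrier[OF I(1) x] lin I by auto
  have "k1 \<otimes> x \<oplus> k2 \<oplus> (l1 \<otimes> x \<oplus> l2) = (k1 \<oplus> l1) \<otimes> x \<oplus> (k2 \<oplus> l2)"
   using c d x by (simp add: l_distr a_ac)
  then show ?thesis using simple_extension.lin[of "k1 \<oplus> l1" I x "k2 \<oplus> l2"] lin.IH lin.hyps I local.lin \<open>k2 \<in> I\<close> by auto
 qed
qed

text \<open>For a subring \<open>A\<close> containing \<open>J\<close> this is the ideal of
  \<open>A\<close> generated by \<open>J\<close>. The inductive form makes visible that a membership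
  uses finitely many coefficients, which the chain argument in \<open>chevalley\<close> relies
  on.\<close>

inductive_set idl :: "'a set => 'a set => 'a set" for A J where
 zero: "\<zero> \<in> idl A J"
| step: "a \<in> A ==> j \<in> J ==> s \<in> idl A J ==> a \<otimes> j \<oplus> s \<in> idl A J"

lemma idl_in: assumes "subring A R" "J <= A" shows "idl A J <= A"
proof
 note s = subringE[OF assms(1)]
 fix x assume "x \<in> idl A J"
 then show "x \<in> A"
 proof induction
  case zero
  then show ?case by (rule s(2))
 next
  case (step a j s')
  have "j \<in> A" using step assms by blast
  then show ?case using s(7)[OF s(6)[OF step.hyps(1)] step.IH] by blast
 qed
qed

lemma idl_add: assumes "subring A R" "J <= A" "x \<in> idl A J" "y \<in> idl A J" shows "x \<oplus> y \<in> idl A J" using assms(3)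
proof induction
 note s = subringE[OF assms(1)]
 have c: "idl A J <= carrier R" using idl_in[OF assms(1,2)] s by auto
 {
  case zero
  then show ?case using assms(4) c by auto
 next
  case (step a j s')
  then have "a \<otimes> j \<oplus> s' \<oplus> y = a \<otimes> j \<oplus> (s' \<oplus> y)" using c s(1) assms by (intro a_assoc) auto
  then show ?case using idl.step[OF step.hyps(1,2) step.IH] by simp
 }
qed

lemma idl_mult: assumes "subring A R" "J <= A" "x \<in> idl A J" "y \<in> A" shows "y \<otimes> x \<in> idl A J" using assms(3)
proof induction
 note s = subringE[OF assms(1)]
 have c: "idl A J <= carrier R" using idl_in[OF assms(1,2)] s by auto
 {
  case zero
  then show ?case using idl.zero assms s by auto
 next
  case (step a j s')
  have cc: "y \<in> carrier R" "a \<in> carrier R" "j \<in> carrier R" "s' \<in> carrier R" using step c s(1) assms by auto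
  then have "y \<otimes> (a \<otimes> j \<oplus> s') = (y \<otimes> a) \<otimes> j \<oplus> y \<otimes> s'" by (simp add: r_distr m_assoc)
  then show ?case using idl.step[OF _ step.hyps(2) step.IH, of "y \<otimes> a"] step s assms by simp
 }
qed

lemma idl_incl: assumes "subring A R" "J <= A" shows "J <= idl A J"
proof
 fix j assume j: "j \<in> J"
 have "\<one> \<otimes> j \<oplus> \<zero> \<in> idl A J" using j subringE(3)[OF assms(1)] by (intro idl.step idl.zero) auto
 moreover have "j \<in> carrier R" using j assms subringE(1) by auto
 ultimately show "j \<in> idl A J" by simp
qed

lemma idl_mono: assumes "A <= B" shows "idl A J <= idl B J"
proof
 fix x assume "x \<in> idl A J"
 then show "x \<in> idl B J" by induction (use assms in \<open>auto intro: idl.intros\<close>)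
qed

text \<open>Coefficients in reverse order. That \<open>s\<close> has length \<open>k\<close> means
  degree below \<open>k\<close>, so the identity can replace a top power of \<open>x\<close> by
  lower ones.\<close>

lemma reverse_eval:
 assumes I: "set c <= carrier R" and x: "x \<in> Units R" and k: "length c <= k"
 shows "EX s. length s = k & set s <= insert \<zero> (set c) & x [^] k \<otimes> (eval c (inv x) \<otimes> inv x) = eval s x"
 using I k
proof (induction c arbitrary: k rule: rev_induct)
 case Nil
 have "eval (replicate k \<zero>) x = \<zero>" using eval_replicate[of "[]" x k] x Units_closed by simp
 then show ?case using x Units_closed by (intro exI[of _ "replicate k \<zero>"]) auto
next
 case (snoc b c)
 then obtain k' where k': "k = Suc k'" by (cases k) auto
 obtain s where s: "length s = k'" "set s <= insert \<zero> (set c)"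
  "x [^] k' \<otimes> (eval c (inv x) \<otimes> inv x) = eval s x" using snoc.IH[of k'] snoc.prems k' by auto
 have c: "b \<in> carrier R" "x \<in> carrier R" "inv x \<in> carrier R" "set c <= carrier R" using snoc.prems x Units_closed by auto
 have ec: "eval c (inv x) \<in> carrier R" using eval_in_carrier c by blast
 have "x [^] k \<otimes> (eval (c @ [b]) (inv x) \<otimes> inv x)
   = (x [^] k' \<otimes> x) \<otimes> ((eval c (inv x) \<otimes> inv x \<oplus> b) \<otimes> inv x)" using eval_snoc[OF c(4,1,3)] k' by simp
 also have "\<dots> = (x [^] k' \<otimes> (eval c (inv x) \<otimes> inv x \<oplus> b)) \<otimes> (x \<otimes> inv x)" using c ec by (simp add: m_ac)
 also have "\<dots> = x [^] k' \<otimes> (eval c (inv x) \<otimes> inv x) \<oplus> b \<otimes> x [^] k'" using c ec x by (simp add: r_distr m_comm)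
 also have "\<dots> = eval (b # s) x"
 proof -
  have "set s <= carrier R" using s(2) c(4) by auto
  then have "eval s x \<in> carrier R" using eval_in_carrier c(2) by blast
  then show ?thesis using s(1,3) c by (simp add: a_comm)
 qed
 finally show ?case using s k' by (intro exI[of _ "b # s"]) auto
qed

lemma eval_map2_add:
 "length p = length q ==> set p <= carrier R ==> set q <= carrier R ==> x \<in> carrier R
  ==> eval (map2 (\<oplus>) p q) x = eval p x \<oplus> eval q x"
proof (induction p q rule: list_induct2)
 case Nil
 then show ?case by simp
next
 case (Cons a p b q)
 have "eval p x \<in> carrier R" "eval q x \<in> carrier R" using Cons eval_in_carrier by auto
 then show ?case using Cons by (simp add: l_distr a_ac)
qed

text \<open>The relation in \<open>inv x\<close> writes the leading power of \<open>x\<close> in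
  \<open>p\<close> through lower powers with coefficients in \<open>I\<close>; substituting this
  removes the leading term.\<close>

lemma shorten:
 assumes I: "I <= carrier R" "\<zero> \<in> I" "!!a b. a \<in> I ==> b \<in> I ==> a \<oplus> b \<in> I" "!!a b. a \<in> I ==> b \<in> I ==> a \<otimes> b \<in> I"
  and x: "x \<in> Units R"
  and c: "set c <= I" "eval c (inv x) \<otimes> inv x = \<one>"
  and p: "set p <= I" "eval p x = \<one>" "length c < length p"
 shows "EX p'. set p' <= I & eval p' x = \<one> & length p' < length p"
proof -
 obtain a r where r: "p = a # r" using p(3) by (cases p) auto
 have xc: "x \<in> carrier R" using x Units_closed by blast
 have cc: "set c <= carrier R" using c I by blast
 obtain s where s: "length s = length r" "set s <= insert \<zero> (set c)"
  "x [^] length r \<otimes> (eval c (inv x) \<otimes> inv x) = eval s x" using reverse_eval[OF cc x, of "length r"] p(3) r by auto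
 have sI: "set s <= I" using s c I by auto
 have a: "a \<in> I" "a \<in> carrier R" "set r <= I" "set r <= carrier R" using r p I by auto
 have es: "eval s x = x [^] length r" using s(3) c(2) xc by simp
 define p' where "p' = map2 (\<oplus>) (map ((\<otimes>) a) s) r"
 have "set (map ((\<otimes>) a) s) <= I" using a sI I(4) by auto
 then have sm: "set (map ((\<otimes>) a) s) <= I" "set (map ((\<otimes>) a) s) <= carrier R" using I by auto
 have "eval p' x = a \<otimes> eval s x \<oplus> eval r x" unfolding p'_def using eval_map2_add[of "map ((\<otimes>) a) s" r x] s(1) sm a xc
   eval_map_mult[of s a x] sI I by auto
 then have "eval p' x = \<one>" using es p(2) r by simp
 moreover have "set p' <= I"
 proof
  fix z assume "z \<in> set p'"
  then obtain u v where uv: "(u, v) \<in> set (zip (map ((\<otimes>) a) s) r)" "z = u \<oplus> v" unfolding p'_def by auto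
  have "u \<in> set (map ((\<otimes>) a) s)" "v \<in> set r" using set_zip_leftD[OF uv(1)] set_zip_rightD[OF uv(1)] by auto
  then show "z \<in> I" using sm(1) a(3) I(3) uv(2) by blast
 qed
 moreover have "length p' < length p" unfolding p'_def using s(1) r by simp
 ultimately show ?thesis by blast
qed

text \<open>Among the rings above \<open>A\<close> in which \<open>J\<close> still generates a
  proper ideal, a maximal one is a valuation ring: for \<open>x\<close> with neither
  \<open>x\<close> nor \<open>inv x\<close> in it, shortest relations for the two would shorten each
  other.\<close>

lemma chevalley:
 assumes A: "subring A R" and J: "J <= A" and proper: "\<one> ~: idl A J"
 shows "EX \<O>. valring \<O> & A <= \<O> & J <= vmax \<O>"
proof -
 define Ss where "Ss = {B. subring B R & A <= B & \<one> ~: idl B J}"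
 have AS: "A \<in> Ss" using assms Ss_def by blast
 have "EX U:Ss. ALL B:\<C>. B <= U" if ch: "subset.chain Ss \<C>" for \<C>
 proof (cases "\<C> = {}")
  case True
  then show ?thesis using AS by blast
 next
  case False
  have CS: "\<C> <= Ss" and tot: "!!B C. B \<in> \<C> ==> C \<in> \<C> ==> B <= C | C <= B"
   using ch by (auto simp: subset_chain_def)
  have sub: "subring B R" if "B \<in> \<C>" for B using that CS Ss_def by blast
  have both: "EX D:\<C>. x \<in> D & y \<in> D" if "x \<in> \<Union>\<C>" "y \<in> \<Union>\<C>" for x y using that tot by blast
  have "subring (\<Union>\<C>) R"
  proof (rule subringI)
   show "\<Union>\<C> <= carrier R" using sub subringE(1) by blast
   show "\<one> \<in> \<Union>\<C>" using sub subringE(3) False by blast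
   show "\<ominus> h \<in> \<Union>\<C>" if h: "h \<in> \<Union>\<C>" for h
   proof -
    obtain D where D: "D \<in> \<C>" "h \<in> D" using h by blast
    show ?thesis using subringE(5)[OF sub[OF D(1)] D(2)] D(1) by blast
   qed
   fix h1 h2 assume h: "h1 \<in> \<Union>\<C>" "h2 \<in> \<Union>\<C>"
   obtain D where D: "D \<in> \<C>" "h1 \<in> D" "h2 \<in> D" using both[OF h] by blast
   show "h1 \<otimes> h2 \<in> \<Union>\<C>" using subringE(6)[OF sub[OF D(1)] D(2,3)] D(1) by blast
   show "h1 \<oplus> h2 \<in> \<Union>\<C>" using subringE(7)[OF sub[OF D(1)] D(2,3)] D(1) by blast
  qed
  moreover have "EX B:\<C>. x \<in> idl B J" if "x \<in> idl (\<Union>\<C>) J" for x using that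
  proof induction
   case zero
   then show ?case using False idl.zero by blast
  next
   case (step a j s)
   then obtain B C where BC: "B \<in> \<C>" "s \<in> idl B J" "C \<in> \<C>" "a \<in> C" by blast
   then obtain D where D: "D \<in> \<C>" "B <= D" "C <= D" using tot[OF BC(1,3)] by blast
   have "s \<in> idl D J" "a \<in> D" using idl_mono[OF D(2)] D(3) BC by auto
   then have "a \<otimes> j \<oplus> s \<in> idl D J" using step.hyps(2) by (intro idl.step) auto
   then show ?case using D by blast
  qed
  ultimately have "\<Union>\<C> \<in> Ss" using CS False unfolding Ss_def by blast
  then show ?thesis by blast
 qed
 then have "EX M:Ss. ALL C:Ss. M <= C --> C = M" by (rule subset_Zorn)
 then obtain B where B: "B \<in> Ss" and mx: "!!C. C \<in> Ss ==> B <= C ==> C = B" by blast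
 have sB: "subring B R" and AB: "A <= B" and nB: "\<one> ~: idl B J" using B Ss_def by auto
 have JB: "J <= B" by (rule order_trans[OF J AB])
 note s = subringE[OF sB]
 define I where "I = idl B J"
 have IB: "I <= B" unfolding I_def by (rule idl_in[OF sB JB])
 have Ic: "I <= carrier R" by (rule order_trans[OF IB s(1)])
 have I0: "\<zero> \<in> I" unfolding I_def by (rule idl.zero)
 have Ia: "a \<oplus> b \<in> I" if "a \<in> I" "b \<in> I" for a b using idl_add[OF sB JB] that I_def by simp
 have Im: "a \<otimes> b \<in> I" if "a \<in> B" "b \<in> I" for a b using idl_mult[OF sB JB] that I_def by simp
 have n1: "\<one> ~: I" using nB I_def by simp
 \<comment> \<open>The inverses of all powers of \<open>e\<close> are adjoined to \<open>B\<close>.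
   These powers are one modulo \<open>I\<close>, so \<open>J\<close> still generates a proper ideal,
   and by maximality nothing was added.\<close>
 have loc: "inv (\<one> \<ominus> b) \<in> B & \<one> \<ominus> b \<in> Units R" if b: "b \<in> I" for b
 proof -
  have bc: "b \<in> carrier R" "b \<in> B" using subsetD[OF Ic b] subsetD[OF IB b] by auto
  define e where "e = \<one> \<ominus> b"
  have eB: "e \<in> B" using s(7)[OF s(3) s(5)[OF bc(2)]] unfolding e_def a_minus_def .
  have ec: "e \<in> carrier R" by (rule subsetD[OF s(1) eB])
  have "e ~= \<zero>"
  proof
   assume "e = \<zero>"
   then have "\<one> = b" using bc unfolding e_def by simp
   then show False using n1 b by simp
  qed
  then have eU: "e \<in> Units R" using ec Units_iff by blast
  have pU: "e [^] (n::nat) \<in> Units R" for n using Units_pow[OF eU] .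
  have pB: "e [^] (n::nat) \<in> B" for n by (induction n) (simp_all add: s(3) s(6) eB)
  have p1: "EX i:I. e [^] (n::nat) = \<one> \<ominus> i" for n
  proof (induction n)
   case 0
   then show ?case using I0 by (intro bexI[of _ \<zero>]) (auto simp: a_minus_def)
  next
   case (Suc n)
   then obtain i where i: "i \<in> I" "e [^] n = \<one> \<ominus> i" by blast
   have ic: "i \<in> carrier R" using i Ic by blast
   have m: "\<ominus> \<one> \<otimes> i \<in> I" using Im[OF s(5)[OF s(3)] i(1)] .
   have "e [^] Suc n = \<one> \<ominus> (i \<oplus> b \<oplus> b \<otimes> (\<ominus> \<one> \<otimes> i))"
    using ic bc i(2) unfolding e_def by simp algebra
   moreover have "i \<oplus> b \<oplus> b \<otimes> (\<ominus> \<one> \<otimes> i) \<in> I" using i b Im[OF bc(2) m] Ia by blast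
   ultimately show ?case by blast
  qed
  define C where "C = {c \<otimes> inv (e [^] n) | c n. c \<in> B & n \<in> (UNIV::nat set)}"
  have Cc: "C <= carrier R" unfolding C_def using subsetD[OF s(1)] pU by auto
  have inB: "z \<otimes> e [^] n \<in> B" if "z = c \<otimes> inv (e [^] n)" "c \<in> B" for z c and n :: nat
  proof -
   have "c \<in> carrier R" using subsetD[OF s(1)] that by blast
   then have "z \<otimes> e [^] n = c" using that pU[of n] Units_closed[OF pU[of n]] by (simp add: m_assoc)
   then show ?thesis using that by simp
  qed
  have CI: "z \<in> C" if "z \<in> carrier R" "z \<otimes> e [^] (n::nat) \<in> B" for z and n :: nat
  proof -
   have "z = (z \<otimes> e [^] n) \<otimes> inv (e [^] n)" using that pU[of n] Units_closed[OF pU[of n]] by (simp add: m_assoc)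
   then show ?thesis unfolding C_def using that by blast
  qed
  have CE: "\<exists>n::nat. \<forall>m\<ge>n. z \<otimes> e [^] m \<in> B" if z: "z \<in> C" for z
  proof -
   obtain c n where c: "z = c \<otimes> inv (e [^] (n::nat))" "c \<in> B" using z C_def by auto
   have zc: "z \<in> carrier R" using z Cc by blast
   have "z \<otimes> e [^] m \<in> B" if "m \<ge> n" for m
   proof -
    have "e [^] m = e [^] n \<otimes> e [^] (m - n)" using that ec by (simp add: nat_pow_mult)
    then have "z \<otimes> e [^] m = (z \<otimes> e [^] n) \<otimes> e [^] (m - n)" using zc ec by (simp add: m_assoc)
    then show ?thesis using s(6)[OF inB[OF c] pB] by simp
   qed
   then show ?thesis by blast
  qed
  have BC: "B <= C"
  proof
   fix z assume "z \<in> B"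
   then show "z \<in> C" using CI[of z 0] subsetD[OF s(1)] by auto
  qed
  have sC: "subring C R"
  proof (rule subringI[OF Cc])
   show "\<one> \<in> C" using subsetD[OF BC s(3)] .
   show "\<ominus> h \<in> C" if h: "h \<in> C" for h
   proof -
    obtain n where "h \<otimes> e [^] (n::nat) \<in> B" using CE[OF h] by blast
    then have "\<ominus> (h \<otimes> e [^] n) \<in> B" by (rule s(5))
    then show ?thesis using CI[of "\<ominus> h" n] subsetD[OF Cc h] ec by (simp add: l_minus)
   qed
   fix h1 h2 assume h: "h1 \<in> C" "h2 \<in> C"
   obtain n1 n2 where n: "!!m. m \<ge> n1 ==> h1 \<otimes> e [^] (m::nat) \<in> B" "!!m. m \<ge> n2 ==> h2 \<otimes> e [^] (m::nat) \<in> B"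
    using CE h by blast
   have hc: "h1 \<in> carrier R" "h2 \<in> carrier R" using h Cc by auto
   have "(h1 \<otimes> e [^] n1) \<otimes> (h2 \<otimes> e [^] n2) = (h1 \<otimes> h2) \<otimes> (e [^] n1 \<otimes> e [^] n2)"
    using hc ec by (simp add: m_ac)
   then have "(h1 \<otimes> h2) \<otimes> e [^] (n1 + n2) \<in> B" using s(6)[OF n(1)[OF le_refl] n(2)[OF le_refl]] ec by (simp add: nat_pow_mult)
   then show "h1 \<otimes> h2 \<in> C" using CI hc by blast
   have "(h1 \<oplus> h2) \<otimes> e [^] (n1 + n2) = h1 \<otimes> e [^] (n1 + n2) \<oplus> h2 \<otimes> e [^] (n1 + n2)"
    using hc ec by (simp add: l_distr)
   also have "\<dots> \<in> B" using s(7)[OF n(1) n(2)] by simp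
   finally show "h1 \<oplus> h2 \<in> C" using CI hc by blast
  qed
  have "\<one> ~: idl C J"
  proof
   assume 1: "\<one> \<in> idl C J"
   have JC: "J <= C" using JB BC by blast
   have *: "\<exists>n::nat. \<forall>m\<ge>n. z \<otimes> e [^] m \<in> I" if "z \<in> idl C J" for z using that
   proof induction
    case zero
    then show ?case using I0 ec by auto
   next
    case (step a j s')
    obtain n1 n2 where n: "!!m. m \<ge> n1 ==> a \<otimes> e [^] (m::nat) \<in> B" "!!m. m \<ge> n2 ==> s' \<otimes> e [^] (m::nat) \<in> I"
     using CE step by blast
    have cc: "a \<in> carrier R" "j \<in> carrier R" "s' \<in> carrier R" using step Cc JC idl_in[OF sC JC] by auto
    have "(a \<otimes> j \<oplus> s') \<otimes> e [^] m \<in> I" if m: "m \<ge> n1 + n2" for m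
    proof -
     have "(a \<otimes> j \<oplus> s') \<otimes> e [^] m = (a \<otimes> j) \<otimes> e [^] m \<oplus> s' \<otimes> e [^] m"
      using cc ec by (simp add: l_distr)
     moreover have "(a \<otimes> j) \<otimes> e [^] m = (a \<otimes> e [^] m) \<otimes> j" using cc ec by (simp add: m_ac)
     moreover have "j \<in> I" unfolding I_def using subsetD[OF idl_incl[OF sB JB] step.hyps(2)] .
     moreover have "a \<otimes> e [^] m \<in> B" "s' \<otimes> e [^] m \<in> I" using n(1)[of m] n(2)[of m] m by auto
     ultimately show ?thesis using Im Ia by simp
    qed
    then show ?case by blast
   qed
   obtain n where "\<one> \<otimes> e [^] (n::nat) \<in> I" using *[OF 1] by blast
   then have "e [^] n \<in> I" using ec by simp
   moreover obtain i where i: "i \<in> I" "e [^] n = \<one> \<ominus> i" using p1 by blast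
   ultimately have "(\<one> \<ominus> i) \<oplus> i \<in> I" using Ia by simp
   moreover have "(\<one> \<ominus> i) \<oplus> i = \<one>" using subsetD[OF Ic i(1)] by algebra
   ultimately show False using n1 by simp
  qed
  then have "C = B" using mx[of C] BC sC AB unfolding Ss_def by blast
  moreover have "inv e \<in> C" using CI[of "inv e" 1] eU s(3) ec by simp
  ultimately show ?thesis using eU e_def by simp
 qed
 \<comment> \<open>By maximality \<open>J\<close> generates the unit ideal once \<open>x\<close> is
   adjoined; sorting by powers of \<open>x\<close> leaves coefficients in \<open>I\<close>.\<close>
 have one: "EX p. set p <= I & eval p x = \<one>" if x: "x \<in> carrier R" "x ~: B" for x
 proof -
  define C where "C = simple_extension B x"
  have Bc: "B <= carrier R" by (rule s(1))
  have Cc: "C <= carrier R" unfolding C_def using simple_extension_in_carrier[OF Bc x(1)] .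
  have sC: "subring C R" unfolding C_def by (rule simple_extension_is_subring[OF sB x(1)])
  have BC: "B <= C" unfolding C_def by (rule simple_extension_incl[OF Bc x(1)])
  have xC: "x \<in> C" unfolding C_def by (rule simple_extension_mem[OF sB x(1)])
  have "\<one> \<in> idl C J"
  proof (rule ccontr)
   assume "\<one> ~: idl C J"
   then have "C = B" using mx[of C] BC sC AB unfolding Ss_def by blast
   then show False using xC x by simp
  qed
  moreover have "idl C J <= simple_extension I x"
  proof
   fix z assume "z \<in> idl C J"
   then show "z \<in> simple_extension I x"
   proof induction
    case zero
    then show ?case by (rule simple_extension.zero)
   next
    case (step a j s')
    obtain p where p: "set p <= B" "eval p x = a" using step simple_extension_eval[OF Bc x(1)] C_def by auto
    have j: "j \<in> I" unfolding I_def using subsetD[OF idl_incl[OF sB JB] step.hyps(2)] .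
    have jc: "j \<in> carrier R" by (rule subsetD[OF Ic j])
    have pc: "set p <= carrier R" by (rule order_trans[OF p(1) Bc])
    have ac: "a \<in> carrier R" by (rule subsetD[OF Cc step.hyps(1)])
    have "eval (map ((\<otimes>) j) p) x = j \<otimes> a" using eval_map_mult[OF pc jc x(1)] p(2) by simp
    then have "eval (map ((\<otimes>) j) p) x = a \<otimes> j" using m_comm[OF jc ac] by simp
    moreover have "set (map ((\<otimes>) j) p) <= I"
    proof
     fix w assume "w \<in> set (map ((\<otimes>) j) p)"
     then obtain u where u: "u \<in> set p" "w = j \<otimes> u" by auto
     have "u \<in> B" "u \<in> carrier R" using u(1) p(1) pc by auto
     then show "w \<in> I" using Im[of u j] j u(2) m_comm[OF jc, of u] by simp
    qed
    ultimately have "a \<otimes> j \<in> simple_extension I x" using simple_extension_eval[OF Ic x(1)] by blast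
    show ?case by (rule simple_extension_add[OF Ic I0 Ia x(1) \<open>a \<otimes> j \<in> simple_extension I x\<close> step.IH])
   qed
  qed
  ultimately show ?thesis using simple_extension_eval[OF Ic x(1)] by blast
 qed
 \<comment> \<open>One minus the constant coefficient is invertible in \<open>B\<close> by
   \<open>loc\<close>. Dividing by it removes the constant term, and a factor \<open>y\<close>
   splits off.\<close>
 have norm: "EX c. set c <= I & Suc (length c) = length q & eval c y \<otimes> y = \<one>"
  if q: "set q <= I" "eval q y = \<one>" and y: "y \<in> carrier R" for q y
 proof -
  have "q ~= []" using q by auto
  then obtain q' b where q': "q = q' @ [b]" by (metis rev_exhaust)
  have b: "b \<in> I" "set q' <= I" using q(1) q' by auto
  have b: "b \<in> I" "b \<in> carrier R" "set q' <= I" "set q' <= carrier R"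
   using b subsetD[OF Ic b(1)] order_trans[OF b(2) Ic] by auto
  define u where "u = inv (\<one> \<ominus> b)"
  have u: "u \<in> B" "\<one> \<ominus> b \<in> Units R" using loc[OF b(1)] u_def by auto
  have uc: "u \<in> carrier R" by (rule subsetD[OF s(1) u(1)])
  have ev: "eval q' y \<in> carrier R" using eval_in_carrier b y by blast
  have "eval q' y \<otimes> y \<oplus> b = \<one>" using eval_snoc[OF b(4,2) y] q q' by simp
  moreover have "w = (w \<oplus> b) \<ominus> b" if "w \<in> carrier R" for w using that b(2) by algebra
  ultimately have "eval q' y \<otimes> y = \<one> \<ominus> b" using m_closed[OF ev y] by metis
  then have "eval (map ((\<otimes>) u) q') y \<otimes> y = \<one>" using eval_map_mult[OF b(4) uc y] u uc ev y u_def by (simp add: m_assoc)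
  moreover have "set (map ((\<otimes>) u) q') <= I" using Im[OF u(1)] b(3) by auto
  ultimately show ?thesis using q' by (intro exI[of _ "map ((\<otimes>) u) q'"]) simp
 qed
 have ImI: "a \<otimes> b \<in> I" if "a \<in> I" "b \<in> I" for a b using Im[OF subsetD[OF IB that(1)] that(2)] .
 have "x \<in> B | inv x \<in> B" if x: "x \<in> Units R" for x
 proof (rule ccontr)
  assume "~ ?thesis"
  then have n: "x ~: B" "inv x ~: B" by auto
  have xc: "x \<in> carrier R" "inv x \<in> carrier R" "inv x \<in> Units R" "inv (inv x) = x" using x Units_closed by auto
  \<comment> \<open>Shortest relations are chosen for \<open>x\<close> and for \<open>inv x\<close>.
    Whichever of them is not shorter than the other is then shortened by means of the other.\<close>
  have least: "EX p. (set p <= I & eval p y = \<one>) & (ALL p'. set p' <= I & eval p' y = \<one> --> length p <= length p')"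
   if y: "y \<in> carrier R" "y ~: B" for y
  proof -
   obtain p0 where "set p0 <= I & eval p0 y = \<one>" using one[OF y] by blast
   from ex_has_least_nat[of "%p. set p <= I & eval p y = \<one>", OF this, of length] show ?thesis .
  qed
  obtain p where p: "set p <= I" "eval p x = \<one>"
   and pm: "!!p'. set p' <= I ==> eval p' x = \<one> ==> length p <= length p'"
   using least[OF xc(1) n(1)] by blast
  obtain q where q: "set q <= I" "eval q (inv x) = \<one>"
   and qm: "!!q'. set q' <= I ==> eval q' (inv x) = \<one> ==> length q <= length q'"
   using least[OF xc(2) n(2)] by blast
  show False
  proof (cases "length q <= length p")
   case True
   obtain c where c: "set c <= I" "Suc (length c) = length q" "eval c (inv x) \<otimes> inv x = \<one>" using norm[OF q xc(2)] by blast
   have lt: "length c < length p" using c(2) True by simp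
   obtain p' where p': "set p' <= I" "eval p' x = \<one>" "length p' < length p"
    using shorten[of I x c p, OF Ic I0] Ia ImI x c(1,3) p lt by blast
   then show False using pm[OF p'(1,2)] p'(3) by linarith
  next
   case False
   obtain c where c: "set c <= I" "Suc (length c) = length p" "eval c x \<otimes> x = \<one>" using norm[OF p xc(1)] by blast
   have lt: "length c < length q" using c(2) False by simp
   obtain p' where p': "set p' <= I" "eval p' (inv x) = \<one>" "length p' < length q"
    using shorten[of I "inv x" c q, OF Ic I0, unfolded xc(4)] Ia ImI xc(3) c(1,3) q lt by blast
   then show False using qm[OF p'(1,2)] p'(3) by linarith
  qed
 qed
 then have vB: "valring B" using sB valring_def by blast
 have "J <= vmax B"
 proof
  fix j assume j: "j \<in> J"
  have "j ~: vunits B"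
  proof
   assume "j \<in> vunits B"
   then have "inv j \<in> B" "j \<in> Units R" by (auto simp: vunits_def)
   moreover have "j \<in> I" unfolding I_def using subsetD[OF idl_incl[OF sB JB] j] .
   ultimately have "\<one> \<in> I" using Im[of "inv j" j] by simp
   then show False using n1 by simp
  qed
  then show "j \<in> vmax B" using j JB vmax_def by blast
 qed
 then show ?thesis using vB AB by blast
qed

end

section \<open>Algebraic elements detected by valuation rings\<close>

context field
begin

lemma subfield_vunits:
 assumes L: "subfield L R" "\<O> \<in> vals L" "a \<in> L" "a ~= \<zero>"
 shows "a \<in> vunits \<O>"
proof -
 have "a \<in> carrier R" using subfieldE(3)[OF L(1)] L(3) by blast
 moreover have "inv a \<in> L" using subfield_m_inv(1)[OF L(1), of a] L by blast
 ultimately show ?thesis using L unfolding vunits_def vals_def Units_iff by blast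
qed

text \<open>The coefficients involved in a tie are units, so a positive power of \<open>x\<close> is
  a unit, and therefore \<open>x\<close> is.\<close>

lemma algebraic_vunits:
 assumes L: "subfield L R" and O: "\<O> \<in> vals L" and x: "x \<in> Units R"
  and p: "set p <= L" "~ set p <= {\<zero>}" "eval p x = \<zero>"
 shows "x \<in> vunits \<O>"
proof -
 have vO: "valring \<O>" using O vals_def by blast
 have pc: "set p <= carrier R" using p(1) subfieldE(3)[OF L] by blast
 obtain a b and i j :: nat where ab: "a \<in> set p - {\<zero>}" "b \<in> set p - {\<zero>}" "i < j"
  "veq \<O> (a \<otimes> x [^] i) (b \<otimes> x [^] j)" using poly_tie[OF vO pc p(2) x p(3)] by blast
 have u: "a \<in> vunits \<O>" "b \<in> vunits \<O>" using subfield_vunits[OF L O] ab p(1) by auto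
 have uu: "a \<in> Units R" "b \<in> Units R" using u vunits_Units[OF vO] by auto
 have "veq \<O> (a \<otimes> inv b) (x [^] (j - i))" using veq_pow_diff[OF vO ab(4,3) uu x] .
 moreover have "veq \<O> (a \<otimes> inv b) \<one>" using veq_one[OF vO] vunits_mult[OF vO u(1) vunits_inv[OF vO u(2)]] by blast
 ultimately have "veq \<O> (x [^] (j - i)) \<one>" using veq_sym[OF vO] veq_trans[OF vO] by blast
 then have "x [^] (j - i) \<in> vunits \<O>" using veq_one[OF vO] by blast
 then show ?thesis using vunits_root[OF vO x, of "j - i"] ab(3) by simp
qed

text \<open>Chevalley's theorem for the ring generated by \<open>L\<close> and \<open>x\<close> and
  its ideal generated by \<open>x\<close>, which is proper because \<open>x\<close> satisfies no
  relation over \<open>L\<close>.\<close>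

lemma transcendental_vmax:
 assumes L: "subfield L R" and x: "x \<in> Units R"
  and tr: "!!p. set p <= L ==> eval p x = \<zero> ==> set p <= {\<zero>}"
 shows "EX \<O>:vals L. x \<in> vmax \<O>"
proof -
 have sL: "subring L R" using subfieldE(1)[OF L] .
 have Lc: "L <= carrier R" using subfieldE(3)[OF L] .
 have xc: "x \<in> carrier R" using x Units_closed by blast
 define A where "A = simple_extension L x"
 have sA: "subring A R" unfolding A_def by (rule simple_extension_is_subring[OF sL xc])
 have LA: "L <= A" unfolding A_def by (rule simple_extension_incl[OF Lc xc])
 have xA: "{x} <= A" unfolding A_def using simple_extension_mem[OF sL xc] by blast
 note s = subringE[OF sA]
 have *: "EX c:A. z = c \<otimes> x" if "z \<in> idl A {x}" for z using that
 proof induction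
  case zero
  then show ?case using s(2) xc by (intro bexI[of _ \<zero>]) auto
 next
  case (step a j s')
  then obtain c where c: "c \<in> A" "s' = c \<otimes> x" by blast
  have "a \<in> carrier R" "c \<in> carrier R" using s(1) step.hyps(1) c(1) by auto
  then have "a \<otimes> j \<oplus> s' = (a \<oplus> c) \<otimes> x" using step.hyps(2) c xc by (simp add: l_distr)
  then show ?case using s(7)[OF step.hyps(1) c(1)] by blast
 qed
 have "\<one> ~: idl A {x}"
 proof
  assume "\<one> \<in> idl A {x}"
  then obtain c where c: "c \<in> A" "\<one> = c \<otimes> x" using * by blast
  obtain p where p: "set p <= L" "eval p x = c" using c(1) simple_extension_eval[OF Lc xc] A_def by blast
  have pc: "set p <= carrier R" using p(1) Lc by blast
  have "eval (p @ [\<ominus> \<one>]) x = c \<otimes> x \<oplus> \<ominus> \<one>" using eval_snoc[OF pc _ xc, of "\<ominus> \<one>"] p(2) by simp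
  then have "eval (p @ [\<ominus> \<one>]) x = \<zero>" using r_neg[OF one_closed] by (simp only: c(2)[symmetric])
  moreover have "set (p @ [\<ominus> \<one>]) <= L" using p(1) subringE(3,5)[OF sL] by auto
  ultimately have "\<ominus> \<one> = \<zero>" using tr[of "p @ [\<ominus> \<one>]"] by auto
  then have "\<one> = \<zero>" using minus_minus[of \<one>] minus_zero by (metis one_closed)
  then show False by simp
 qed
 then obtain \<O> where "valring \<O>" "A <= \<O>" "{x} <= vmax \<O>" using chevalley[OF sA xA] by blast
 then show ?thesis using LA unfolding vals_def by blast
qed


text \<open>For a subfield \<open>L\<close> this intersection of valuation rings is the algebraic
  closure of \<open>L\<close> in the field, obtained here without degrees or towers of
  extensions.\<close>

definition valg :: "'a set => 'a set" where
 "valg L = {x \<in> carrier R. ALL \<O>:vals L. x \<in> \<O>}"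

lemma carrier_vals: "L <= carrier R ==> carrier R \<in> vals L" using valring_carrier vals_def by blast

lemma algebraic_if_in_vals:
 assumes L: "subfield L R" and x: "x \<in> Units R" and a: "!!\<O>. \<O> \<in> vals L ==> x \<in> \<O> | inv x \<in> vunits \<O>"
 shows "EX p. set p <= L & ~ set p <= {\<zero>} & eval p (inv x) = \<zero>"
proof (rule ccontr)
 assume n: "~ ?thesis"
 have "EX \<O>:vals L. inv x \<in> vmax \<O>" by (rule transcendental_vmax[OF L]) (use n x in auto)
 then obtain \<O> where O: "\<O> \<in> vals L" "inv x \<in> vmax \<O>" by blast
 have vO: "valring \<O>" using O vals_def by blast
 have "inv (inv x) ~: \<O>" using vmax_inv[OF vO O(2)] x by simp
 then show False using a[OF O(1)] O(2) x by (auto simp: vmax_def)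
qed

lemma valg_vunits:
 assumes L: "subfield L R" and x: "x \<in> valg L" "x ~= \<zero>" and O: "\<O> \<in> vals L"
 shows "x \<in> vunits \<O>"
proof -
 have vO: "valring \<O>" using O vals_def by blast
 have xU: "x \<in> Units R" using x valg_def Units_iff by blast
 obtain p where p: "set p <= L" "~ set p <= {\<zero>}" "eval p (inv x) = \<zero>"
  using algebraic_if_in_vals[OF L xU] x valg_def by blast
 have "inv x \<in> vunits \<O>" using algebraic_vunits[OF L O _ p] xU by simp
 then show ?thesis using vunits_inv[OF vO, of "inv x"] xU by simp
qed

lemma valg_algebraic:
 assumes L: "subfield L R" and x: "x \<in> Units R" "!!\<O>. \<O> \<in> vals L ==> x \<in> vunits \<O>"
 shows "EX p. set p <= L & ~ set p <= {\<zero>} & eval p x = \<zero>"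
 using algebraic_if_in_vals[OF L, of "inv x"] x by auto

lemma valg_subfield:
 assumes L: "subfield L R"
 shows "subfield (valg L) R" "L <= valg L" "vals (valg L) = vals L"
proof -
 have sub: "subring \<O> R" if "\<O> \<in> vals L" for \<O> using that vals_def valring_def by blast
 have ne: "carrier R \<in> vals L" using carrier_vals subfieldE(3)[OF L] by blast
 have e: "valg L = \<Inter>(vals L)" using ne unfolding valg_def by blast
 have "subring (valg L) R" unfolding e using subring_Inter[of "vals L"] sub ne by blast
 moreover have "inv x \<in> valg L" if x: "x \<in> valg L - {\<zero>}" for x
 proof -
  have "inv x \<in> \<O>" if "\<O> \<in> vals L" for \<O> using valg_vunits[OF L _ _ that, of x] x unfolding vunits_def by blast
  moreover have "x \<in> Units R" using x valg_def Units_iff by blast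
  ultimately show ?thesis unfolding valg_def using Units_inv_closed by blast
 qed
 ultimately show "subfield (valg L) R" by (rule subfieldI')
 show 1: "L <= valg L" unfolding e vals_def by blast
 show "vals (valg L) = vals L"
 proof
  show "vals (valg L) <= vals L" using 1 unfolding vals_def by blast
  show "vals L <= vals (valg L)" unfolding e vals_def by blast
 qed
qed

definition fracs :: "'a set => 'a set" where
 "fracs A = {a \<otimes> inv b | a b. a \<in> A & b \<in> A & b ~= \<zero>}"

lemma fracs_iff:
 assumes A: "subring A R"
 shows "x \<in> fracs A \<longleftrightarrow> x \<in> carrier R & (EX b:A. b ~= \<zero> & x \<otimes> b \<in> A)"
proof
 note s = subringE[OF A]
 assume "x \<in> fracs A"
 then obtain a b where ab: "a \<in> A" "b \<in> A" "b ~= \<zero>" "x = a \<otimes> inv b" unfolding fracs_def by blast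
 have c: "a \<in> carrier R" "b \<in> Units R" using ab s(1) Units_iff by auto
 then have "x \<otimes> b = a" using ab by (simp add: m_assoc Units_closed)
 then show "x \<in> carrier R & (EX b:A. b ~= \<zero> & x \<otimes> b \<in> A)" using ab c by auto
next
 note s = subringE[OF A]
 assume "x \<in> carrier R & (EX b:A. b ~= \<zero> & x \<otimes> b \<in> A)"
 then obtain b where b: "x \<in> carrier R" "b \<in> A" "b ~= \<zero>" "x \<otimes> b \<in> A" by blast
 have "b \<in> Units R" using b s(1) Units_iff by auto
 then have "x = (x \<otimes> b) \<otimes> inv b" using b(1) by (simp add: m_assoc Units_closed)
 then show "x \<in> fracs A" unfolding fracs_def using b by blast
qed

lemma fracs_subfield:
 assumes A: "subring A R"
 shows "subfield (fracs A) R" "A <= fracs A"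
proof -
 note s = subringE[OF A]
 have Ac: "!!a. a \<in> A ==> a \<in> carrier R" using s(1) by blast
 show AF: "A <= fracs A"
 proof
  fix a assume a: "a \<in> A"
  then have "a \<otimes> \<one> \<in> A" using Ac by simp
  then show "a \<in> fracs A" unfolding fracs_iff[OF A] using Ac[OF a] s(3) one_not_zero by blast
 qed
 have "subring (fracs A) R"
 proof (rule subringI)
  show "fracs A <= carrier R" using fracs_iff[OF A] by blast
  show "\<one> \<in> fracs A" using AF s(3) by blast
  show "\<ominus> h \<in> fracs A" if h: "h \<in> fracs A" for h
  proof -
   obtain b where b: "h \<in> carrier R" "b \<in> A" "b ~= \<zero>" "h \<otimes> b \<in> A" using h fracs_iff[OF A] by blast
   have "\<ominus> h \<otimes> b = \<ominus> (h \<otimes> b)" using b Ac by (simp add: l_minus)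
   then have "\<ominus> h \<otimes> b \<in> A" using s(5)[OF b(4)] by simp
   then show ?thesis unfolding fracs_iff[OF A] using b by blast
  qed
  fix h1 h2 assume h: "h1 \<in> fracs A" "h2 \<in> fracs A"
  obtain b where b: "h1 \<in> carrier R" "b \<in> A" "b ~= \<zero>" "h1 \<otimes> b \<in> A" using h fracs_iff[OF A] by blast
  obtain d where d: "h2 \<in> carrier R" "d \<in> A" "d ~= \<zero>" "h2 \<otimes> d \<in> A" using h fracs_iff[OF A] by blast
  have bd: "b \<otimes> d \<in> A" "b \<otimes> d ~= \<zero>" using s(6)[OF b(2) d(2)] b d Ac integral_iff by auto
  have cc: "b \<in> carrier R" "d \<in> carrier R" using b d Ac by auto
  have "(h1 \<otimes> h2) \<otimes> (b \<otimes> d) = (h1 \<otimes> b) \<otimes> (h2 \<otimes> d)" using b(1) d(1) cc by (simp add: m_ac)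
  then have "(h1 \<otimes> h2) \<otimes> (b \<otimes> d) \<in> A" using s(6)[OF b(4) d(4)] by simp
  then show "h1 \<otimes> h2 \<in> fracs A" unfolding fracs_iff[OF A] using bd b(1) d(1) by blast
  have "(h1 \<oplus> h2) \<otimes> (b \<otimes> d) = h1 \<otimes> (b \<otimes> d) \<oplus> h2 \<otimes> (b \<otimes> d)" using b(1) d(1) cc by (simp add: l_distr)
  moreover have "h1 \<otimes> (b \<otimes> d) = (h1 \<otimes> b) \<otimes> d" "h2 \<otimes> (b \<otimes> d) = (h2 \<otimes> d) \<otimes> b"
   using b(1) d(1) cc by (simp_all add: m_ac)
  moreover have "(h1 \<otimes> b) \<otimes> d \<oplus> (h2 \<otimes> d) \<otimes> b \<in> A" using s(7)[OF s(6)[OF b(4) d(2)] s(6)[OF d(4) b(2)]] .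
  ultimately have "(h1 \<oplus> h2) \<otimes> (b \<otimes> d) \<in> A" by simp
  then show "h1 \<oplus> h2 \<in> fracs A" unfolding fracs_iff[OF A] using bd b(1) d(1) by blast
 qed
 moreover have "inv x \<in> fracs A" if x: "x \<in> fracs A - {\<zero>}" for x
 proof -
  obtain b where b: "x \<in> carrier R" "b \<in> A" "b ~= \<zero>" "x \<otimes> b \<in> A" using x fracs_iff[OF A] by blast
  have xU: "x \<in> Units R" using x b Units_iff by blast
  have n: "x \<otimes> b ~= \<zero>" using integral_iff[OF b(1) Ac[OF b(2)]] x b by blast
  have "inv x \<otimes> (x \<otimes> b) = b" using Units_cancel(2)[OF xU Ac[OF b(2)]] .
  then have "inv x \<otimes> (x \<otimes> b) \<in> A" using b by simp
  then show ?thesis unfolding fracs_iff[OF A] using xU b n by auto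
 qed
 ultimately show "subfield (fracs A) R" by (rule subfieldI')
qed

lemma clear_denominators:
 assumes A: "subring A R" and p: "set p <= fracs A"
 shows "EX d:A. d ~= \<zero> & set (map ((\<otimes>) d) p) <= A" using p
proof (induction p)
 case Nil
 then show ?case using subringE(3)[OF A] by (intro bexI[of _ \<one>]) auto
next
 note s = subringE[OF A]
 have Ac: "!!a. a \<in> A ==> a \<in> carrier R" using s(1) by blast
 case (Cons x p)
 then obtain d where d: "d \<in> A" "d ~= \<zero>" "set (map ((\<otimes>) d) p) <= A" by auto
 have "x \<in> fracs A" using Cons.prems by simp
 then obtain b where b: "x \<in> carrier R" "b \<in> A" "b ~= \<zero>" "x \<otimes> b \<in> A" using fracs_iff[OF A] by blast
 have cc: "b \<in> carrier R" "d \<in> carrier R" using b d Ac by auto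
 have pc: "set p <= carrier R" using Cons.prems fracs_iff[OF A] by auto
 have bd: "b \<otimes> d \<in> A" "b \<otimes> d ~= \<zero>" using s(6)[OF b(2) d(1)] b d cc integral_iff by auto
 have "(b \<otimes> d) \<otimes> x = (x \<otimes> b) \<otimes> d" using b cc by (simp add: m_ac)
 then have 1: "(b \<otimes> d) \<otimes> x \<in> A" using s(6)[OF b(4) d(1)] by simp
 have 2: "(b \<otimes> d) \<otimes> y \<in> A" if y: "y \<in> set p" for y
 proof -
  have "y \<in> carrier R" using y pc by blast
  then have "(b \<otimes> d) \<otimes> y = b \<otimes> (d \<otimes> y)" using cc by (simp add: m_assoc)
  moreover have "d \<otimes> y \<in> A" using d(3) y by auto
  ultimately show ?thesis using s(6)[OF b(2)] by simp
 qed
 have "set (map ((\<otimes>) (b \<otimes> d)) (x # p)) <= A" using 1 2 by auto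
 then show ?case using bd by blast
qed

text \<open>Clearing denominators moves the coefficients from the fraction field into the ring
  \<open>A\<close>, whose elements have an explicit form in each application.\<close>

lemma algebraic_over_fracs:
 assumes A: "subring A R" and L: "subfield L R" "L <= fracs A"
  and x: "x \<in> Units R" "!!\<O>. \<O> \<in> vals L ==> x \<in> vunits \<O>"
 shows "EX p. set p <= A & ~ set p <= {\<zero>} & eval p x = \<zero>"
proof -
 obtain p where p: "set p <= L" "~ set p <= {\<zero>}" "eval p x = \<zero>" using valg_algebraic[OF L(1) x] by blast
 have pF: "set p <= fracs A" using p(1) L(2) by blast
 obtain d where d: "d \<in> A" "d ~= \<zero>" "set (map ((\<otimes>) d) p) <= A" using clear_denominators[OF A pF] by blast
 have pc: "set p <= carrier R" using p(1) subfieldE(3)[OF L(1)] by blast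
 have dc: "d \<in> carrier R" using d(1) subringE(1)[OF A] by blast
 have xc: "x \<in> carrier R" using x Units_closed by blast
 have "eval (map ((\<otimes>) d) p) x = \<zero>" using eval_map_mult[OF pc dc xc] p(3) dc by simp
 moreover obtain a where a: "a \<in> set p" "a ~= \<zero>" using p(2) by blast
 have "d \<otimes> a ~= \<zero>" using integral_iff[OF dc, of a] a d(2) pc by blast
 then have "~ set (map ((\<otimes>) d) p) <= {\<zero>}" using a(1) by auto
 ultimately show ?thesis using d(3) by blast
qed

lemma generate_field_insert:
 assumes A: "A <= carrier R" and x: "x \<in> carrier R"
 shows "generate_field R (insert x A) <= fracs (simple_extension (generate_field R A) x)"
proof -
 have L: "subfield (generate_field R A) R" using generate_field_is_subfield[OF A] .
 have sL: "subring (generate_field R A) R" using subfieldE(1)[OF L] .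
 have Lc: "generate_field R A <= carrier R" using subfieldE(3)[OF L] .
 have sE: "subring (simple_extension (generate_field R A) x) R" by (rule simple_extension_is_subring[OF sL x])
 have "A <= generate_field R A" using generate_fieldE(2)[OF A refl] .
 then have "insert x A <= simple_extension (generate_field R A) x"
  using simple_extension_incl[OF Lc x] simple_extension_mem[OF sL x] by blast
 then have "insert x A <= fracs (simple_extension (generate_field R A) x)" using fracs_subfield(2)[OF sE] by blast
 then show ?thesis using generate_field_min_subfield1[OF _ fracs_subfield(1)[OF sE]] A x by blast
qed

lemma eval_split:
 assumes "!!q. q \<in> set qs ==> f q = g q \<otimes> a \<oplus> h q" "!!q. q \<in> set qs ==> g q \<in> carrier R"
  "!!q. q \<in> set qs ==> h q \<in> carrier R" "a \<in> carrier R" "b \<in> carrier R"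
 shows "eval (map f qs) b = eval (map g qs) b \<otimes> a \<oplus> eval (map h qs) b" using assms(1-3)
proof (induction qs)
 case Nil
 then show ?case using assms by simp
next
 case (Cons q qs)
 have c: "g q \<in> carrier R" "h q \<in> carrier R" "eval (map g qs) b \<in> carrier R" "eval (map h qs) b \<in> carrier R"
  "b [^] length qs \<in> carrier R" using Cons.prems assms by (auto intro!: eval_in_carrier)
 have "eval (map f (q # qs)) b = (g q \<otimes> a \<oplus> h q) \<otimes> b [^] length qs \<oplus> (eval (map g qs) b \<otimes> a \<oplus> eval (map h qs) b)"
  using Cons by simp
 also have "\<dots> = (g q \<otimes> b [^] length qs \<oplus> eval (map g qs) b) \<otimes> a \<oplus> (h q \<otimes> b [^] length qs \<oplus> eval (map h qs) b)"
  using c assms(4) by (simp add: l_distr r_distr m_ac a_ac)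
 finally show ?case by simp
qed

lemma eval_in_subring:
 assumes A: "subring A R" and "set p <= A" "x \<in> A"
 shows "eval p x \<in> A" using assms(2)
proof (induction p)
 case Nil
 then show ?case using subringE(2)[OF A] by simp
next
 case (Cons a p)
 have "x [^] (n::nat) \<in> A" for n by (induction n) (simp_all add: subringE(3,6)[OF A] assms(3))
 then show ?case using Cons subringE(6,7)[OF A] by simp
qed

text \<open>A two-variable relation between \<open>a\<close> and \<open>b\<close> is divided by the largest power of \<open>a\<close>; its
 constant term is then a relation for \<open>b\<close> alone.\<close>

lemma no_two_variable_relation:
 assumes L: "subfield L R" and O: "\<O> \<in> vals L" and a: "a \<in> vmax \<O>" "a ~= \<zero>" and b: "b \<in> vunits \<O>"
  and tr: "!!q. set q <= L ==> ~ set q <= {\<zero>} ==> eval q b \<in> vunits \<O>"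
  and qs: "!!q. q \<in> set qs ==> set q <= L" "EX q:set qs. eval q a ~= \<zero>"
 shows "eval (map (%q. eval q a) qs) b ~= \<zero>" using qs
proof (induction "sum_list (map length qs)" arbitrary: qs rule: less_induct)
 case less
 have vO: "valring \<O>" using O vals_def by blast
 have sO: "subring \<O> R" using vO valring_def by blast
 have Lc: "L <= carrier R" using subfieldE(3)[OF L] .
 have L0: "\<zero> \<in> L" using subringE(2)[OF subfieldE(1)[OF L]] .
 have LO: "L <= \<O>" using O vals_def by blast
 have c: "a \<in> carrier R" "b \<in> carrier R" "a \<in> \<O>" "b \<in> \<O>" using vmax_in[OF vO a(1)] b by (auto simp: vunits_def)
 define cst where "cst q = (if q = [] then \<zero> else last q)" for q :: "'a list"
 have bl: "set (butlast q) <= L" if "q \<in> set qs" for q using less.prems(1)[OF that] by (auto dest: in_set_butlastD)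
 have cL: "cst q \<in> L" if "q \<in> set qs" for q using less.prems(1)[OF that] L0 by (auto simp: cst_def)
 have sp: "eval q a = eval (butlast q) a \<otimes> a \<oplus> cst q" if "q \<in> set qs" for q
 proof (cases "q = []")
  case True
  then show ?thesis using c by (simp add: cst_def)
 next
  case False
  then have "q = butlast q @ [cst q]" by (simp add: cst_def)
  then show ?thesis using eval_snoc[of "butlast q" "cst q" a] bl[OF that] cL[OF that] Lc c by (metis subset_trans subsetD)
 qed
 have e: "eval (map (%q. eval q a) qs) b = eval (map (%q. eval (butlast q) a) qs) b \<otimes> a \<oplus> eval (map cst qs) b"
 proof (rule eval_split[OF sp _ _ c(1,2)])
  show "eval (butlast q) a \<in> carrier R" if "q \<in> set qs" for q using bl[OF that] Lc c by (intro eval_in_carrier) auto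
  show "cst q \<in> carrier R" if "q \<in> set qs" for q using cL[OF that] Lc by blast
 qed auto
 have mL: "set (map cst qs) <= L" using cL by auto
 show ?case
 proof (cases "set (map cst qs) <= {\<zero>}")
  case False
  then have u: "eval (map cst qs) b \<in> vunits \<O>" using tr mL by blast
  have "eval (butlast q) a \<in> \<O>" if "q \<in> set qs" for q using eval_in_subring[OF sO _ c(3), of "butlast q"] bl[OF that] LO by blast
  then have "eval (map (%q. eval (butlast q) a) qs) b \<in> \<O>" by (intro eval_in_subring[OF sO _ c(4)]) auto
  then have "a \<otimes> eval (map (%q. eval (butlast q) a) qs) b \<in> vmax \<O>" using vmax_mult[OF vO a(1)] by blast
  moreover have "eval (map (%q. eval (butlast q) a) qs) b \<in> carrier R"
   using \<open>eval (map (%q. eval (butlast q) a) qs) b \<in> \<O>\<close> subringE(1)[OF sO] by blast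
  moreover have "eval (map cst qs) b \<in> carrier R" using mL Lc c by (intro eval_in_carrier) auto
  ultimately have "eval (map (%q. eval q a) qs) b = eval (map cst qs) b \<oplus> a \<otimes> eval (map (%q. eval (butlast q) a) qs) b"
   unfolding e using c(1) by (simp add: m_comm a_comm)
  then have "eval (map (%q. eval q a) qs) b \<in> vunits \<O>"
   using vunits_add_vmax[OF vO u] \<open>a \<otimes> eval (map (%q. eval (butlast q) a) qs) b \<in> vmax \<O>\<close> by simp
  then show ?thesis using vunits_Units[OF vO] Units_iff by blast
 next
  case True
  have z: "cst q = \<zero>" if "q \<in> set qs" for q using True that by auto
  have "eval (replicate n \<zero>) b = \<zero>" for n using eval_replicate[of "[]" b n] c by simp
  moreover have "map cst qs = replicate (length qs) \<zero>" using z by (simp add: map_replicate_const[symmetric] cong: map_cong)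
  ultimately have ez: "eval (map cst qs) b = \<zero>" by simp
  obtain q where q: "q \<in> set qs" "eval q a ~= \<zero>" using less.prems(2) by blast
  then have "q ~= []" by auto
  then have lt: "length (butlast q) < length q" by simp
  have "sum_list (map length (map butlast qs)) < sum_list (map length qs)" using q(1) lt
  proof (induction qs)
   case (Cons r rs)
   have "sum_list (map length (map butlast rs)) <= sum_list (map length rs)" by (induction rs) auto
   then show ?case using Cons by (cases "q = r") auto
  qed simp
  moreover have "eval (butlast q) a ~= \<zero>"
  proof
   assume "eval (butlast q) a = \<zero>"
   then show False using sp[OF q(1)] z[OF q(1)] q(2) c by simp
  qed
  ultimately have "eval (map (%q. eval q a) (map butlast qs)) b ~= \<zero>" using less.hyps[of "map butlast qs"] bl q(1) by auto
  moreover have "map (%q. eval q a) (map butlast qs) = map (%q. eval (butlast q) a) qs" by simp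
  moreover have "eval (map (%q. eval (butlast q) a) qs) b \<in> carrier R"
  proof (rule eval_in_carrier[OF _ c(2)])
   show "set (map (%q. eval (butlast q) a) qs) <= carrier R" using bl Lc c(1) by (auto intro!: eval_in_carrier)
  qed
  ultimately show ?thesis unfolding e ez using c(1) a(2) integral_iff by (simp add: comp_def)
 qed
qed

end

section \<open>Rank after adjoining finitely many elements\<close>

context pregeometry
begin

lemma rk_Un_le:
 assumes "A <= E" "finite C" "C <= E"
 shows "rk (A Un C) <= rk A + card C" using assms(2,3)
proof (induction C rule: finite_induct)
 case empty
 then show ?case by simp
next
 case (insert c C)
 have "rk (Set.insert c (A Un C)) <= Suc (rk (A Un C))" by (rule rk_insert_le) (use assms insert in auto)
 then show ?case using insert by simp
qed

lemma rk_Un_indep: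
 assumes "A <= E" "finite C" "C <= E"
  and "!!D c. D <= C ==> c \<in> C ==> c ~: D ==> c ~: cl (A Un D)"
 shows "rk (A Un C) = rk A + card C" using assms(2-4)
proof (induction C rule: finite_induct)
 case empty
 then show ?case by simp
next
 case (insert c C)
 have "c ~: cl (A Un C)" using insert.prems(2)[of C c] insert.hyps by blast
 then have "rk (Set.insert c (A Un C)) = Suc (rk (A Un C))" using rk_insert[of "A Un C" c] assms(1) insert.prems(1) by blast
 moreover have "rk (A Un C) = rk A + card C" by (rule insert.IH) (use insert.prems in blast)+
 ultimately show ?case using insert.hyps by simp
qed

lemma independent_subset_of_generators:
 assumes "A <= E" "finite C" "C <= E"
 shows "EX D<=C. rk (A Un D) = rk A + card D & C <= cl (A Un D)" using assms(2,3)
proof (induction C rule: finite_induct)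
 case empty
 then show ?case by simp
next
 case (insert c C)
 then obtain D where D: "D <= C" "rk (A Un D) = rk A + card D" "C <= cl (A Un D)" by auto
 have AD: "A Un D <= E" using assms(1) insert.prems D(1) by blast
 show ?case
 proof (cases "c \<in> cl (A Un D)")
  case True
  then show ?thesis using D by blast
 next
  case False
  have cE: "c \<in> E" using insert.prems by blast
  have fD: "finite D" "c ~: D" using D(1) insert.hyps finite_subset by blast+
  have "rk (A Un Set.insert c D) = rk A + card (Set.insert c D)" using rk_insert[OF AD cE False] D(2) fD by simp
  moreover have "Set.insert c C <= cl (A Un Set.insert c D)"
  proof -
   have i: "A Un Set.insert c D <= E" using AD cE by blast
   have "cl (A Un D) <= cl (A Un Set.insert c D)" by (rule cl_mono[OF _ i]) blast
   then show ?thesis using D(3) cl_increasing[OF i] by blast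
  qed
  moreover have "Set.insert c D <= Set.insert c C" using D(1) by blast
  ultimately show ?thesis by blast
 qed
qed

end

section \<open>Finite-rank multiplicative groups in a field\<close>

text \<open>In the final application \<open>R\<close> is the field generated by \<open>k\<close> and
  \<open>G\<close>, not the ambient field, because the given automorphisms are defined only
  there.\<close>

locale mult_field = field R for R :: "('a, 'm) ring_scheme" (structure) +
 fixes k G :: "'a set"
 assumes k: "subfield k R"
  and G: "subgroup G (Multiplicative_Group.mult_of R)"
  and fin_G: "EX B. finite B & B <= G & G <= icl (mult_grp R G) B"
begin

abbreviation "M \<equiv> mult_grp R G"

lemma G_Units: "g \<in> G ==> g \<in> Units R" using subgroup.subset[OF G] Units_iff by auto

lemma G_carrier: "G <= carrier R" using G_Units Units_closed by blast

lemma group_mult_of: "comm_group (Multiplicative_Group.mult_of R)" unfolding mult_of_is_Units by (rule units_comm_group)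

lemma M_group: "comm_group M"
proof -
 have g: "group (Multiplicative_Group.mult_of R)" using group_mult_of by (rule comm_group.axioms(2))
 show ?thesis
 proof (rule group.group_comm_groupI[OF subgroup.subgroup_is_group[OF G g]])
  fix x y assume "x \<in> carrier M" "y \<in> carrier M"
  then have "x \<in> carrier R" "y \<in> carrier R" using G_carrier by auto
  then show "x \<otimes>\<^bsub>M\<^esub> y = y \<otimes>\<^bsub>M\<^esub> x" by (simp add: m_comm)
 qed
qed

lemma M_nat_pow: "x [^]\<^bsub>M\<^esub> (n::nat) = x [^] n" by (induction n) (simp_all add: nat_pow_def)

lemma M_inv:
 assumes "x \<in> G"
 shows "inv\<^bsub>M\<^esub> x = inv x"
proof -
 have "inv\<^bsub>M\<^esub> x = inv\<^bsub>Multiplicative_Group.mult_of R\<^esub> x"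
  using group.m_inv_consistent[OF comm_group.axioms(2)[OF group_mult_of] G assms] .
 also have "\<dots> = inv x" by (rule m_inv_mult_of) (use G_Units[OF assms, unfolded Units_iff] in auto)
 finally show ?thesis .
qed

lemma subgroup_M_iff:
 "subgroup H M \<longleftrightarrow> H <= G & \<one> \<in> H & (ALL x:H. ALL y:H. x \<otimes> y \<in> H) & (ALL x:H. inv x \<in> H)"
proof
 assume H: "subgroup H M"
 have HG: "H <= G" using subgroup.subset[OF H] by simp
 have "x \<otimes> y \<in> H" if "x \<in> H" "y \<in> H" for x y using subgroup.m_closed[OF H that] by simp
 moreover have "inv x \<in> H" if "x \<in> H" for x using subgroup.m_inv_closed[OF H that] M_inv[OF subsetD[OF HG that]] by simp
 moreover have "\<one> \<in> H" using subgroup.one_closed[OF H] by simp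
 ultimately show "H <= G & \<one> \<in> H & (ALL x:H. ALL y:H. x \<otimes> y \<in> H) & (ALL x:H. inv x \<in> H)"
  using HG by blast
next
 assume H: "H <= G & \<one> \<in> H & (ALL x:H. ALL y:H. x \<otimes> y \<in> H) & (ALL x:H. inv x \<in> H)"
 show "subgroup H M"
 proof (rule subgroup.intro)
  show "inv\<^bsub>M\<^esub> x \<in> H" if "x \<in> H" for x
  proof -
   have "x \<in> G" using H that by blast
   then show ?thesis using M_inv[of x] H that by simp
  qed
 qed (use H in simp_all)
qed

lemma isolated_M_iff:
 "isolated M H \<longleftrightarrow> H <= G & \<one> \<in> H & (ALL x:H. ALL y:H. x \<otimes> y \<in> H) & (ALL x:H. inv x \<in> H)
   & (ALL g:G. ALL n::nat. n \<ge> 1 & g [^] n \<in> H --> g \<in> H)"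
 unfolding isolated_def subgroup_M_iff M_nat_pow by (simp add: conj_assoc)

sublocale M: fin_rank_group M using M_group fin_G by (simp add: fin_rank_group_def fin_rank_group_axioms_def)

abbreviation flat where "flat \<equiv> M.flat"
abbreviation rk where "rk \<equiv> M.rk"
abbreviation ic where "ic \<equiv> icl M"

lemma flatD:
 assumes "flat H"
 shows "H <= G" "\<one> \<in> H" "!!x y. x \<in> H ==> y \<in> H ==> x \<otimes> y \<in> H" "!!x. x \<in> H ==> inv x \<in> H"
  "!!g n. g \<in> G ==> n \<ge> (1::nat) ==> g [^] n \<in> H ==> g \<in> H"
 using assms unfolding M.flat_iff_isolated isolated_M_iff by auto

lemma flat_pow: "flat H ==> x \<in> H ==> x [^] (n::nat) \<in> H" by (induction n) (auto intro: flatD)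

lemma flat_G: "flat G" using M.isolated_carrier unfolding M.flat_iff_isolated by simp

lemma G_mult: "x \<in> G ==> y \<in> G ==> x \<otimes> y \<in> G" and G_inv: "x \<in> G ==> inv x \<in> G" and G_one: "\<one> \<in> G"
 using flatD[OF flat_G] by auto

lemma flatI:
 assumes "H <= G" "\<one> \<in> H" "!!x y. x \<in> H ==> y \<in> H ==> x \<otimes> y \<in> H" "!!x. x \<in> H ==> inv x \<in> H"
  "!!g n. g \<in> G ==> n \<ge> (1::nat) ==> g [^] n \<in> H ==> g \<in> H"
 shows "flat H" unfolding M.flat_iff_isolated isolated_M_iff
proof (intro conjI ballI allI impI)
 show "g \<in> H" if "g \<in> G" "1 <= n & g [^] n \<in> H" for g and n :: nat using assms(5)[OF that(1)] that(2) by blast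
qed (fact assms(1), fact assms(2), erule (1) assms(3), erule assms(4))

lemma flat_vunits:
 assumes "valring \<O>" "flat W"
 shows "flat (W Int vunits \<O>)"
proof (rule flatI)
 show "W Int vunits \<O> <= G" using flatD(1)[OF assms(2)] by blast
 show "\<one> \<in> W Int vunits \<O>" using flatD(2)[OF assms(2)] vunits_one[OF assms(1)] by blast
 show "x \<otimes> y \<in> W Int vunits \<O>" if "x \<in> W Int vunits \<O>" "y \<in> W Int vunits \<O>" for x y
  using flatD(3)[OF assms(2)] vunits_mult[OF assms(1)] that by simp
 show "inv x \<in> W Int vunits \<O>" if "x \<in> W Int vunits \<O>" for x using flatD(4)[OF assms(2)] vunits_inv[OF assms(1)] that by simp
 show "g \<in> W Int vunits \<O>" if "g \<in> G" "n \<ge> 1" "g [^] n \<in> W Int vunits \<O>" for g and n :: nat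
  using flatD(5)[OF assms(2) that(1,2)] vunits_root[OF assms(1) G_Units[OF that(1)] that(2)] that(3) by simp
qed

section \<open>Algebraic closure inside the group, defined by valuation rings\<close>

definition kf :: "'a set => 'a set" where
 "kf A = generate_field R (k Un A)"

lemma kA_carrier: "A <= G ==> k Un A <= carrier R" using G_carrier subfieldE(3)[OF k] by blast

lemma kf_subfield: "A <= G ==> subfield (kf A) R" unfolding kf_def using generate_field_is_subfield kA_carrier by blast

lemma kf_upper: "A <= G ==> A <= kf A" "A <= G ==> k <= kf A"
 using generate_fieldE(2)[OF kA_carrier refl] unfolding kf_def by blast+

lemma kf_least: "A <= G ==> subfield L R ==> k <= L ==> A <= L ==> kf A <= L"
 unfolding kf_def using generate_field_min_subfield1[OF kA_carrier] by simp

lemma kf_mono: "A <= B ==> B <= G ==> kf A <= kf B"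
 unfolding kf_def using mono_generate_field[OF _ kA_carrier] by (meson Un_mono order_refl)

lemma vals_mono: "L <= L' ==> vals L' <= vals L" unfolding vals_def by blast

lemma kf_vunits: "A <= G ==> \<O> \<in> vals (kf A) ==> A <= vunits \<O>"
 using subfield_vunits[OF kf_subfield] kf_upper(1) G_Units Units_iff by blast

text \<open>By \<open>algebraic_vunits\<close> and \<open>valg_algebraic\<close> these are the
  elements of \<open>G\<close> that are algebraic over \<open>kf A\<close>. In this form
  monotonicity, idempotence and closure under roots are direct; exchange is the one axiom that needs
  an argument.\<close>

definition acl :: "'a set => 'a set" where
 "acl A = {g \<in> G. ALL \<O>:vals (kf A). g \<in> vunits \<O>}"

lemma acl_increasing: "A <= G ==> A <= acl A" unfolding acl_def using kf_vunits by blast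

lemma acl_in: "acl A <= G" unfolding acl_def by blast

lemma acl_mono: "A <= B ==> B <= G ==> acl A <= acl B"
 unfolding acl_def using vals_mono[OF kf_mono] by blast

lemma vals_valring: "\<O> \<in> vals L ==> valring \<O>" unfolding vals_def by blast

lemma acl_flat: "flat (acl A)"
proof (rule flatI)
 show "acl A <= G" by (rule acl_in)
 show "\<one> \<in> acl A" unfolding acl_def using G_one vunits_one[OF vals_valring] by simp
 show "x \<otimes> y \<in> acl A" if "x \<in> acl A" "y \<in> acl A" for x y using G_mult vunits_mult[OF vals_valring] that unfolding acl_def by simp
 show "inv x \<in> acl A" if "x \<in> acl A" for x using G_inv vunits_inv[OF vals_valring] that unfolding acl_def by simp
 show "g \<in> acl A" if "g \<in> G" "n \<ge> 1" "g [^] n \<in> acl A" for g and n :: nat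
  using vunits_root[OF vals_valring G_Units[OF that(1)] that(2)] that unfolding acl_def by simp
qed

lemma vals_kf_acl:
 assumes "A <= G"
 shows "vals (kf (acl A)) = vals (kf A)"
proof
 show "vals (kf (acl A)) <= vals (kf A)" using vals_mono[OF kf_mono] acl_increasing[OF assms] acl_in by blast
 have L: "subfield (kf A) R" by (rule kf_subfield[OF assms])
 have "acl A <= valg (kf A)" unfolding acl_def valg_def using G_carrier by (auto simp: vunits_def)
 moreover have "k <= valg (kf A)" using valg_subfield(2)[OF L] kf_upper(2)[OF assms] by blast
 ultimately have "kf (acl A) <= valg (kf A)" using kf_least[OF acl_in valg_subfield(1)[OF L]] by blast
 then show "vals (kf A) <= vals (kf (acl A))" using vals_mono valg_subfield(3)[OF L] by blast
qed

lemma acl_idem: "A <= G ==> acl (acl A) = acl A"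
 using vals_kf_acl[of A] by (simp add: acl_def[of "acl A"]) (simp add: acl_def[of A])

lemma not_acl_transcendental:
 assumes "A <= G" "b \<in> G" "b ~: acl A" "set q <= kf A" "~ set q <= {\<zero>}"
 shows "eval q b ~= \<zero>" using algebraic_vunits[OF kf_subfield[OF assms(1)] _ G_Units[OF assms(2)] assms(4,5)] assms(2,3)
 unfolding acl_def by blast

lemma kf_insert: "A <= G ==> a \<in> G ==> kf (insert a A) <= fracs (simple_extension (kf A) a)"
 unfolding kf_def using generate_field_insert[OF kA_carrier, of A a] subsetD[OF G_carrier, of a] by simp

text \<open>In \<open>\<O>\<close> the element \<open>a'\<close> is not a unit, while every
  non-trivial polynomial in \<open>b\<close> over \<open>kf A\<close> takes a unit value. A
  polynomial relation between \<open>a'\<close> and \<open>b\<close> over \<open>kf A\<close> is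
  then impossible. In the application \<open>a'\<close> is \<open>a\<close> or its inverse.\<close>

lemma exchange_core:
 assumes A: "A <= G" and b: "b \<in> G" "b ~: acl A" and a': "a' \<in> Units R" "a' \<in> vmax \<O>"
  and F: "kf (insert a A) <= fracs (simple_extension (kf A) a')" and aG: "a \<in> G"
  and O: "\<O> \<in> vals (kf (insert b A))"
 shows "b ~: acl (insert a A)"
proof
 assume ba: "b \<in> acl (insert a A)"
 have L: "subfield (kf A) R" by (rule kf_subfield[OF A])
 have sL: "subring (kf A) R" using subfieldE(1)[OF L] .
 have Lc: "kf A <= carrier R" using subfieldE(3)[OF L] .
 have ac: "a' \<in> carrier R" using a' Units_closed by blast
 have bA: "insert b A <= G" using A b by blast
 have aA: "insert a A <= G" using A aG by blast
 have sE: "subring (simple_extension (kf A) a') R" by (rule simple_extension_is_subring[OF sL ac])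
 have "!!\<O>. \<O> \<in> vals (kf (insert a A)) ==> b \<in> vunits \<O>" using ba acl_def by blast
 then obtain p where p: "set p <= simple_extension (kf A) a'" "~ set p <= {\<zero>}" "eval p b = \<zero>"
  using algebraic_over_fracs[OF sE kf_subfield[OF aA] F G_Units[OF b(1)]] by blast
 have "ALL y:set p. EX q. set q <= kf A & eval q a' = y" using p(1) simple_extension_eval[OF Lc ac] by blast
 then obtain f where f: "!!y. y \<in> set p ==> set (f y) <= kf A & eval (f y) a' = y" by metis
 have pm: "map (%q. eval q a') (map f p) = p" using f by (simp add: map_idI)
 have O': "\<O> \<in> vals (kf A)" using O vals_mono[OF kf_mono[OF _ bA]] by blast
 have bu: "b \<in> vunits \<O>" using kf_vunits[OF bA O] by blast
 have "eval (map (%q. eval q a') (map f p)) b ~= \<zero>"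
 proof (rule no_two_variable_relation[OF L O' a'(2) _ bu])
  show "a' ~= \<zero>" using a' Units_iff by blast
  show "eval q b \<in> vunits \<O>" if q: "set q <= kf A" "~ set q <= {\<zero>}" for q
  proof -
   have sb: "subring (kf (insert b A)) R" using subfieldE(1)[OF kf_subfield[OF bA]] .
   have "set q <= kf (insert b A)" using q(1) kf_mono[OF _ bA] by blast
   then have "eval q b \<in> kf (insert b A)" using eval_in_subring[OF sb] kf_upper(1)[OF bA] by blast
   then show ?thesis using subfield_vunits[OF kf_subfield[OF bA] O] not_acl_transcendental[OF A b q] by blast
  qed
  show "set q <= kf A" if "q \<in> set (map f p)" for q using that f by auto
  obtain y where "y \<in> set p" "y ~= \<zero>" using p(2) by blast
  then show "EX q:set (map f p). eval q a' ~= \<zero>" using f by force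
 qed
 then show False using pm p(3) by simp
qed

lemma acl_exchange:
 assumes A: "A <= G" and a: "a \<in> G" and b: "b \<in> acl (insert a A)" "b ~: acl A"
 shows "a \<in> acl (insert b A)"
proof (rule ccontr)
 assume "a ~: acl (insert b A)"
 then obtain \<O> where O: "\<O> \<in> vals (kf (insert b A))" "a ~: vunits \<O>" using a unfolding acl_def by blast
 have bG: "b \<in> G" using b acl_in by blast
 have vO: "valring \<O>" using O vals_valring by blast
 have L: "subfield (kf A) R" by (rule kf_subfield[OF A])
 have sL: "subring (kf A) R" using subfieldE(1)[OF L] .
 have aU: "a \<in> Units R" by (rule G_Units[OF a])
 have iU: "inv a \<in> Units R" using aU by simp
 have ic: "inv a \<in> carrier R" using aU by simp
 have sE: "subring (simple_extension (kf A) (inv a)) R" by (rule simple_extension_is_subring[OF sL ic])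
 have fF: "subfield (fracs (simple_extension (kf A) (inv a))) R" by (rule fracs_subfield(1)[OF sE])
 have up: "simple_extension (kf A) (inv a) <= fracs (simple_extension (kf A) (inv a))" by (rule fracs_subfield(2)[OF sE])
 have Lup: "kf A <= simple_extension (kf A) (inv a)" using simple_extension_incl[OF subfieldE(3)[OF L] ic] .
 have "inv a \<in> fracs (simple_extension (kf A) (inv a)) - {\<zero>}" using up simple_extension_mem[OF sL ic] iU Units_iff by blast
 then have "inv (inv a) \<in> fracs (simple_extension (kf A) (inv a))" using subfield_m_inv(1)[OF fF] by blast
 then have "insert a A <= fracs (simple_extension (kf A) (inv a))" using aU up Lup kf_upper(1)[OF A] by auto
 then have F: "kf (insert a A) <= fracs (simple_extension (kf A) (inv a))"
  by (intro kf_least[OF _ fF] order_trans[OF kf_upper(2)[OF A] order_trans[OF Lup up]]) (use a A in blast)+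
 consider "a \<in> vmax \<O>" | "inv a \<in> vmax \<O>" using vunits_trichotomy[OF vO aU] O(2) by blast
 then show False
 proof cases
  case 1
  show False using exchange_core[OF A bG b(2) aU 1 kf_insert[OF A a] a O(1)] b(1) by (rule notE)
 next
  case 2
  show False using exchange_core[OF A bG b(2) iU 2 F a O(1)] b(1) by (rule notE)
 qed
qed

lemma ic_acl: "A <= G ==> ic A <= acl A"
 using M.icl_least[of "acl A" A] acl_flat acl_increasing M.flat_iff_isolated by blast

sublocale D: pregeometry G acl
proof
 show "A <= acl A" if "A <= G" for A by (rule acl_increasing[OF that])
 show "acl A <= G" for A by (rule acl_in)
 show "acl A <= acl B" if "A <= B" "B <= G" for A B by (rule acl_mono[OF that])
 show "acl (acl A) = acl A" if "A <= G" for A by (rule acl_idem[OF that])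
 show "a \<in> acl (insert b A)" if "A <= G" "a \<in> G" "b \<in> acl (insert a A)" "b ~: acl A" for A a b
  by (rule acl_exchange[OF that])
 show "EX B. finite B & B <= G & G <= acl B" using fin_G ic_acl by (meson order_trans)
qed

abbreviation td where "td \<equiv> D.rk"

text \<open>What generates \<open>S\<close> over \<open>N\<close> up to roots also generates it
  algebraically. Here and below, differences of ranks and of degrees are compared through sums,
  since subtraction of natural numbers truncates.\<close>

lemma td_le_rk:
 assumes "N <= S" "S <= G"
 shows "td S + rk N <= td N + rk S"
proof -
 have SG: "S <= carrier M" using assms by simp
 obtain C where C: "finite C" "C <= S" "S <= ic (N Un C)" "rk S = rk N + card C"
  using M.relative_basis[OF assms(1) SG] by blast
 have NC: "N Un C <= G" using assms C by blast
 have "S <= acl (N Un C)" using C(3) ic_acl[OF NC] by blast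
 then have "td S <= td (N Un C)" by (rule D.rk_mono_cl[OF _ NC])
 also have "\<dots> <= td N + card C" by (rule D.rk_Un_le) (use NC C in auto)
 finally show ?thesis using C(4) by simp
qed

lemma td_Int_acl:
 assumes "Q <= W" "W <= G"
 shows "td (W Int acl Q) = td Q"
proof -
 have QG: "Q <= G" using assms by blast
 have "td (W Int acl Q) <= td Q" by (rule D.rk_mono_cl[OF _ QG]) blast
 moreover have "td Q <= td (W Int acl Q)" by (rule D.rk_mono) (use assms acl_increasing[OF QG] in auto)
 ultimately show ?thesis by simp
qed

end

context field
begin

lemma eval_zero_coeffs: "set p <= {\<zero>} ==> x \<in> carrier R ==> eval p x = \<zero>" by (induction p) auto

lemma tie_quotient:
 assumes "d \<in> Units R" "d' \<in> Units R" "b \<in> Units R" "e \<in> carrier R"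
 shows "(d \<otimes> (b \<otimes> e)) \<otimes> inv (d' \<otimes> b) \<otimes> (d' \<otimes> inv d) = e"
proof -
 have c: "d \<in> carrier R" "d' \<in> carrier R" "b \<in> carrier R" "inv d \<in> carrier R" "inv d' \<in> carrier R" "inv b \<in> carrier R"
  using assms Units_closed by auto
 have "(d \<otimes> (b \<otimes> e)) \<otimes> (inv d' \<otimes> inv b) \<otimes> (d' \<otimes> inv d) = (d \<otimes> inv d) \<otimes> ((d' \<otimes> inv d') \<otimes> (b \<otimes> inv b)) \<otimes> e"
  using c assms(4) by (simp add: m_ac del: Units_r_inv Units_l_inv)
 also have "\<dots> = e" using assms by simp
 finally show ?thesis using assms by (simp add: Units_inv_mult)
qed

end

lemma disjI_neg: "(~ P ==> Q) ==> P | Q" by blast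

section \<open>Tame elements and Abhyankar's inequality\<close>

context mult_field
begin

text \<open>Up to a finite set of exceptional ratios (none of which lies in \<open>T\<close>), the elements of \<open>L\<close> have
 the same values as finitely many elements of \<open>S\<close>, for all valuations over \<open>kf T\<close> at once.\<close>

definition tame :: "'a set => 'a set => 'a => bool" where
 "tame T S x \<longleftrightarrow> (EX D D'. finite D & finite D' & D <= S - T & D' <= S
   & (ALL \<O>:vals (kf T). D Int vunits \<O> ~= {} | (EX d:D'. veq \<O> x d)))"

lemma tameE:
 assumes "tame T S x"
 obtains D D' where "finite D" "finite D'" "D <= S - T" "D' <= S"
  "ALL \<O>:vals (kf T). D Int vunits \<O> ~= {} | (EX d:D'. veq \<O> x d)"
 using assms[unfolded tame_def] by (elim exE conjE) (rule that, assumption+)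

text \<open>\<open>N\<close> collects the ratios of all representatives of monomials of different
  degree. None lies in \<open>T\<close>, for otherwise a positive power of \<open>b\<close> would
  lie in \<open>S\<close>. If no element of \<open>N\<close> is a unit, all monomials have different
  values and one of them dominates.\<close>

lemma tame_poly:
 assumes S: "flat S" and T: "T <= S" and b: "b \<in> G" "b ~: S"
  and p: "set p <= carrier R" "~ set p <= {\<zero>}" "!!a. a \<in> set p - {\<zero>} ==> tame T S a"
 shows "tame T (ic (insert b S)) (eval p b)"
proof -
 define S' where "S' = ic (insert b S)"
 have SG: "S <= G" using flatD(1)[OF S] .
 have bS: "insert b S <= carrier M" using SG b by simp
 have fS': "flat S'" unfolding S'_def by (rule M.flat_cl[OF bS])
 have SS': "insert b S <= S'" unfolding S'_def by (rule M.cl_increasing[OF bS])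
 have bU: "b \<in> Units R" by (rule G_Units[OF b(1)])
 obtain D D' where D: "!!a. a \<in> set p - {\<zero>} ==> finite (D a) & finite (D' a) & D a <= S - T & D' a <= S
   & (ALL \<O>:vals (kf T). D a Int vunits \<O> ~= {} | (EX d:D' a. veq \<O> a d))"
  using p(3) unfolding tame_def by metis
 define P where "P = \<Union>(D ` (set p - {\<zero>}))"
 define Q where "Q = \<Union>(D' ` (set p - {\<zero>}))"
 define n where "n = length p"
 define f where "f = (%(d, d', i :: nat, j). (d \<otimes> b [^] i) \<otimes> inv (d' \<otimes> b [^] (j::nat)))"
 define N where "N = f ` {(d, d', i, j). d \<in> Q & d' \<in> Q & j < i & i < n}"
 define Q' where "Q' = (%(d, i). d \<otimes> b [^] (i::nat)) ` (Q \<times> {..<n})"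
 have fP: "finite P" and fQ: "finite Q" using D unfolding P_def Q_def by auto
 have "{(d, d', i, j). d \<in> Q & d' \<in> Q & j < i & i < n} <= Q \<times> Q \<times> {..<n} \<times> {..<n}" by auto
 then have fN: "finite N" unfolding N_def using fQ by (meson finite_SigmaI finite_imageI finite_lessThan finite_subset)
 have fQ': "finite Q'" unfolding Q'_def using fQ by simp
 have PS: "P <= S - T" and QS: "Q <= S" using D unfolding P_def Q_def by blast+
 have QU: "!!d. d \<in> Q ==> d \<in> Units R" using QS SG G_Units by blast
 have bp: "b [^] (i::nat) \<in> S'" for i using flat_pow[OF fS'] SS' by blast
 have dS: "d \<otimes> b [^] (i::nat) \<in> S'" if "d \<in> Q" for d i using flatD(3)[OF fS' _ bp] that QS SS' by blast
 have NS: "N <= S' - T"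
 proof
  fix z assume "z \<in> N"
  then obtain d d' i j where z: "d \<in> Q" "d' \<in> Q" "j < i" "z = (d \<otimes> b [^] i) \<otimes> inv (d' \<otimes> b [^] (j::nat))"
   unfolding N_def f_def by auto
  have zS': "z \<in> S'" unfolding z(4) by (rule flatD(3)[OF fS' dS[OF z(1)] flatD(4)[OF fS' dS[OF z(2)]]])
  have u: "d \<in> Units R" "d' \<in> Units R" "b [^] j \<in> Units R" "b [^] (i - j) \<in> Units R" using QU z bU Units_pow by auto
  have c: "d \<in> carrier R" "d' \<in> carrier R" "b [^] j \<in> carrier R" "b [^] (i - j) \<in> carrier R" using u Units_closed by auto
  have "b [^] i = b [^] j \<otimes> b [^] (i - j)" using z(3) nat_pow_mult[of b j "i - j"] bU Units_closed by simp
  then have "z \<otimes> (d' \<otimes> inv d) = b [^] (i - j)" unfolding z(4) using tie_quotient[OF u(1,2,3) c(4)] by simp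
  moreover have "z \<otimes> (d' \<otimes> inv d) \<in> S" if "z \<in> T"
   by (rule flatD(3)[OF S _ flatD(3)[OF S _ flatD(4)[OF S]]]) (use that T z(1,2) QS in blast)+
  ultimately have "b [^] (i - j) \<in> S" if "z \<in> T" using that by simp
  moreover have "1 <= i - j" using z(3) by arith
  ultimately have "z ~: T" using flatD(5)[OF S b(1), of "i - j"] b(2) by blast
  then show "z \<in> S' - T" using zS' by blast
 qed
 have main: "(P Un N) Int vunits \<O> ~= {} | (EX d:Q'. veq \<O> (eval p b) d)" if O: "\<O> \<in> vals (kf T)" for \<O>
 proof (rule disjI_neg)
  have vO: "valring \<O>" using O vals_valring by blast
  assume "~ (P Un N) Int vunits \<O> ~= {}"
  then have nP: "!!z. z \<in> P ==> z ~: vunits \<O>" and nN: "!!z. z \<in> N ==> z ~: vunits \<O>" by auto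
  have q: "EX d:Q. veq \<O> a d" if a: "a \<in> set p - {\<zero>}" for a
  proof -
   have "D a Int vunits \<O> = {}" using nP a unfolding P_def by blast
   then obtain d where "d \<in> D' a" "veq \<O> a d" using D[OF a] O by blast
   then show ?thesis using a unfolding Q_def by blast
  qed
  have bb: "veq \<O> (b [^] (i::nat)) (b [^] i)" for i using veq_refl[OF vO] Units_pow[OF bU] by blast
  have "EX a:set p - {\<zero>}. EX i<length p. veq \<O> (eval p b) (a \<otimes> b [^] i)"
  proof (rule poly_dominant_term[OF vO p(1,2) bU])
   fix a a' i j assume a: "a \<in> set p - {\<zero>}" "a' \<in> set p - {\<zero>}" and ij: "j < i" "i < length p"
   show "~ veq \<O> (a \<otimes> b [^] i) (a' \<otimes> b [^] (j::nat))"
   proof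
    assume v: "veq \<O> (a \<otimes> b [^] i) (a' \<otimes> b [^] j)"
    obtain d d' where d: "d \<in> Q" "veq \<O> a d" "d' \<in> Q" "veq \<O> a' d'" using q a by blast
    have 1: "veq \<O> (a \<otimes> b [^] i) (d \<otimes> b [^] i)" "veq \<O> (a' \<otimes> b [^] j) (d' \<otimes> b [^] j)"
     using veq_mult[OF vO d(2) bb] veq_mult[OF vO d(4) bb] by auto
    have "veq \<O> (d \<otimes> b [^] i) (d' \<otimes> b [^] j)" using veq_trans[OF vO veq_trans[OF vO veq_sym[OF vO 1(1)] v] 1(2)] .
    then have "(d \<otimes> b [^] i) \<otimes> inv (d' \<otimes> b [^] j) \<in> vunits \<O>" unfolding veq_def by blast
    moreover have "(d \<otimes> b [^] i) \<otimes> inv (d' \<otimes> b [^] j) \<in> N"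
     unfolding N_def f_def n_def using d ij by (intro image_eqI[of _ _ "(d, d', i, j)"]) auto
    ultimately show False using nN by blast
   qed
  qed
  then obtain a i where a: "a \<in> set p - {\<zero>}" "i < length p" "veq \<O> (eval p b) (a \<otimes> b [^] i)" by blast
  obtain d where d: "d \<in> Q" "veq \<O> a d" using q[OF a(1)] by blast
  have "veq \<O> (eval p b) (d \<otimes> b [^] i)" using veq_trans[OF vO a(3) veq_mult[OF vO d(2) bb]] .
  moreover have "d \<otimes> b [^] i \<in> Q'" unfolding Q'_def n_def using d(1) a(2) by auto
  ultimately show "EX d:Q'. veq \<O> (eval p b) d" by blast
 qed
 have "P Un N <= S' - T" using PS NS SS' by blast
 moreover have "Q' <= S'" unfolding Q'_def using dS by auto
 ultimately show ?thesis unfolding tame_def S'_def[symmetric] using fP fN fQ' main by (intro exI[of _ "P Un N"] exI[of _ Q']) auto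
qed

lemma tame_div:
 assumes "flat S" "tame T S x" "tame T S y" "y \<in> Units R"
 shows "tame T S (x \<otimes> inv y)"
proof -
 obtain D D' where D: "finite D" "finite D'" "D <= S - T" "D' <= S"
   "ALL \<O>:vals (kf T). D Int vunits \<O> ~= {} | (EX d:D'. veq \<O> x d)"
  by (rule tameE[OF assms(2)]) (rule that, assumption+)
 obtain C C' where C: "finite C" "finite C'" "C <= S - T" "C' <= S"
   "ALL \<O>:vals (kf T). C Int vunits \<O> ~= {} | (EX d:C'. veq \<O> y d)"
  by (rule tameE[OF assms(3)]) (rule that, assumption+)
 define Q where "Q = (%(d, c). d \<otimes> inv c) ` (D' \<times> C')"
 have fQ: "finite Q" unfolding Q_def using D(2) C(2) by simp
 have QS: "Q <= S" unfolding Q_def using D(4) C(4) by (auto intro!: flatD(3)[OF assms(1)] flatD(4)[OF assms(1)])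
 have main: "(D Un C) Int vunits \<O> ~= {} | (EX d:Q. veq \<O> (x \<otimes> inv y) d)" if O: "\<O> \<in> vals (kf T)" for \<O>
 proof -
  have vO: "valring \<O>" using O vals_valring by blast
  show ?thesis
  proof (rule disjI_neg)
   assume "~ (D Un C) Int vunits \<O> ~= {}"
   then obtain d c where dc: "d \<in> D'" "veq \<O> x d" "c \<in> C'" "veq \<O> y c" using bspec[OF D(5) O] bspec[OF C(5) O] by blast
   have "veq \<O> (x \<otimes> inv y) (d \<otimes> inv c)" using veq_mult[OF vO dc(2) veq_inv[OF vO dc(4)]] .
   then show "EX d:Q. veq \<O> (x \<otimes> inv y) d" unfolding Q_def using dc by force
  qed
 qed
 have fDC: "finite (D Un C)" "D Un C <= S - T" using D(1,3) C(1,3) by auto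
 show ?thesis unfolding tame_def by (intro exI[of _ "D Un C"] exI[of _ Q] conjI ballI) (fact fDC fQ QS | erule main)+
qed

text \<open>The elements of \<open>B\<close> are adjoined one at a time: polynomials are covered by
  \<open>tame_poly\<close>, fractions by \<open>tame_div\<close>. At the start every non-zero
  element of \<open>kf T\<close> has trivial value.\<close>

lemma tame_kf:
 assumes T: "flat T" and B: "finite B" "B <= G"
  and ind: "!!D c. D <= B ==> c \<in> B ==> c ~: D ==> c ~: ic (T Un D)"
 shows "x \<in> kf (T Un B) - {\<zero>} ==> tame T (ic (T Un B)) x" using B ind
proof (induction B arbitrary: x rule: finite_induct)
 case empty
 have TG: "T <= G" by (rule flatD(1)[OF T])
 have "veq \<O> x \<one>" if "\<O> \<in> vals (kf T)" for \<O>
  using subfield_vunits[OF kf_subfield[OF TG] that, of x] veq_one[OF vals_valring[OF that]] empty.prems by auto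
 moreover have "\<one> \<in> ic T" using flatD(2)[OF T] M.cl_increasing[of T] TG by auto
 ultimately show ?case unfolding tame_def by (intro exI[of _ "{}"] exI[of _ "{\<one>}"]) auto
next
 case (insert b B)
 have TG: "T <= G" by (rule flatD(1)[OF T])
 have TB: "T Un B <= G" using TG insert.prems by blast
 have TBM: "T Un B <= carrier M" using TB by simp
 define S where "S = ic (T Un B)"
 have S: "flat S" unfolding S_def by (rule M.flat_cl[OF TBM])
 have TS: "T Un B <= S" unfolding S_def by (rule M.cl_increasing[OF TBM])
 have b: "b \<in> G" "b ~: S" using insert.prems(2) insert.prems(3)[of B b] insert.hyps(2) unfolding S_def by auto
 have bU: "b \<in> Units R" and bc: "b \<in> carrier R" using G_Units[OF b(1)] Units_closed by auto
 have IH: "tame T S y" if "y \<in> kf (T Un B) - {\<zero>}" for y unfolding S_def by (rule insert.IH[OF that]) (use insert.prems in blast)+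
 have Lc: "kf (T Un B) <= carrier R" using subfieldE(3)[OF kf_subfield[OF TB]] .
 define S' where "S' = ic (Set.insert b S)"
 have SG: "Set.insert b S <= carrier M" using flatD(1)[OF S] b by simp
 have S': "flat S'" unfolding S'_def by (rule M.flat_cl[OF SG])
 have pt: "tame T S' z" if z: "z \<in> simple_extension (kf (T Un B)) b" "z ~= \<zero>" for z
 proof -
  obtain p where p: "set p <= kf (T Un B)" "eval p b = z" using z(1) simple_extension_eval[OF Lc bc] by blast
  have "~ set p <= {\<zero>}" using eval_zero_coeffs[OF _ bc] p(2) z(2) by blast
  then show ?thesis unfolding S'_def p(2)[symmetric] using tame_poly[OF S _ b, of T p] TS p(1) Lc IH by blast
 qed
 have "x \<in> fracs (simple_extension (kf (T Un B)) b)" using kf_insert[OF TB b(1)] insert.prems(1) by auto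
 then obtain u v where uv: "x = u \<otimes> inv v" "u \<in> simple_extension (kf (T Un B)) b"
  "v \<in> simple_extension (kf (T Un B)) b" "v ~= \<zero>" unfolding fracs_def by blast
 have c: "u \<in> carrier R" "v \<in> carrier R" using uv simple_extension_in_carrier[OF Lc bc] by auto
 have vU: "v \<in> Units R" using c uv Units_iff by blast
 have "u ~= \<zero>"
 proof
  assume "u = \<zero>"
  then have "x = \<zero>" using uv(1) vU by simp
  then show False using insert.prems(1) by blast
 qed
 then have "tame T S' x" unfolding uv(1) using tame_div[OF S' pt[OF uv(2)] pt[OF uv(3,4)] vU] by blast
 moreover have "S' = ic (T Un Set.insert b B)"
 proof
  have TbB: "T Un Set.insert b B <= carrier M" using TBM b by simp
  have f: "flat (ic (T Un Set.insert b B))" by (rule M.flat_cl[OF TbB])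
  have "S <= ic (T Un Set.insert b B)" unfolding S_def by (rule M.cl_mono[OF _ TbB]) blast
  then have "Set.insert b S <= ic (T Un Set.insert b B)" using M.cl_increasing[OF TbB] by blast
  then show "S' <= ic (T Un Set.insert b B)" unfolding S'_def by (rule M.cl_flat_min[OF _ f])
  show "ic (T Un Set.insert b B) <= S'" unfolding S'_def by (rule M.cl_mono[OF _ SG]) (use TS in auto)
 qed
 ultimately show ?case by simp
qed

text \<open>The vanishing element \<open>eval p b\<close> is tame, but zero has the value of no
  element, so the exceptional alternative must hold for every valuation ring over
  \<open>kf T\<close>. An algebraic relation between multiplicatively independent elements thus
  forces units in a fixed finite set outside \<open>T\<close>.\<close>

lemma finite_hitting_set:
 assumes T: "flat T" and B: "finite B" "B <= G" "b \<in> G"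
  and ind: "!!D c. D <= B ==> c \<in> B ==> c ~: D ==> c ~: ic (T Un D)"
  and b: "b ~: ic (T Un B)" "b \<in> acl (T Un B)"
 shows "EX D. finite D & D <= ic (insert b (T Un B)) - T & (ALL \<O>:vals (kf T). D Int vunits \<O> ~= {})"
proof -
 have TG: "T <= G" by (rule flatD(1)[OF T])
 have TB: "T Un B <= G" using TG B by blast
 have TBM: "T Un B <= carrier M" using TB by simp
 have bTB: "insert b (T Un B) <= carrier M" using TB B by simp
 define S where "S = ic (T Un B)"
 have S: "flat S" unfolding S_def by (rule M.flat_cl[OF TBM])
 have TS: "T Un B <= S" unfolding S_def by (rule M.cl_increasing[OF TBM])
 have bc: "b \<in> Units R" using G_Units B by blast
 have L: "subfield (kf (T Un B)) R" by (rule kf_subfield[OF TB])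
 obtain p where p: "set p <= kf (T Un B)" "~ set p <= {\<zero>}" "eval p b = \<zero>"
  using valg_algebraic[OF L bc] b(2) unfolding acl_def by blast
 have pc: "set p <= carrier R" using p(1) subfieldE(3)[OF L] by blast
 have "tame T (ic (insert b S)) (eval p b)"
 proof (rule tame_poly[OF S _ B(3) _ pc p(2)])
  show "T <= S" using TS by blast
  show "b ~: S" using b S_def by blast
  show "tame T S a" if "a \<in> set p - {\<zero>}" for a unfolding S_def using tame_kf[OF T B(1,2) ind, of a] that p(1) by blast
 qed
 then obtain D D' where D: "finite D" "D <= ic (insert b S) - T"
  "ALL \<O>:vals (kf T). D Int vunits \<O> ~= {} | (EX d:D'. veq \<O> (eval p b) d)"
  by (rule tameE) (rule that, assumption+)
 have "~ veq \<O> (eval p b) d" for \<O> d using p(3) by (simp add: veq_def Units_iff)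
 then have "ALL \<O>:vals (kf T). D Int vunits \<O> ~= {}" using D(3) by blast
 moreover have "ic (insert b S) <= ic (insert b (T Un B))"
 proof (rule M.cl_flat_min[OF _ M.flat_cl[OF bTB]])
  have "S <= ic (insert b (T Un B))" unfolding S_def by (rule M.cl_mono[OF _ bTB]) blast
  then show "insert b S <= ic (insert b (T Un B))" using M.cl_increasing[OF bTB] by blast
 qed
 ultimately show ?thesis using D(1,2) by blast
qed

lemma kf_vunits_nonzero: "T <= G ==> \<O> \<in> vals (kf T) ==> x \<in> kf T - {\<zero>} ==> x \<in> vunits \<O>"
 using subfield_vunits[OF kf_subfield] by blast

text \<open>Abhyankar's inequality. A basis \<open>C\<close> of \<open>W\<close> over its units
  \<open>S\<close> is algebraically independent over \<open>T\<close>: a dependence would give, by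
  \<open>finite_hitting_set\<close>, a unit outside \<open>T\<close> in the flat \<open>J\<close>
  generated by part of \<open>C\<close>, whereas the rank count shows that \<open>J\<close> meets
  \<open>S\<close> only in \<open>T\<close>.\<close>

lemma rk_le_td:
 assumes T: "flat T" and W: "flat W" and TW: "T <= W" and O: "\<O> \<in> vals (kf T)"
 shows "rk W + td T <= rk (W Int vunits \<O>) + td W"
proof -
 have TG: "T <= G" and WG: "W <= G" using flatD(1) T W by auto
 have WM: "W <= carrier M" using WG by simp
 define S where "S = W Int vunits \<O>"
 have S: "flat S" unfolding S_def by (rule flat_vunits[OF vals_valring[OF O] W])
 have SW: "S <= W" and TS: "T <= S" unfolding S_def using TW kf_vunits[OF TG O] by auto
 have SG: "S <= G" using SW WG by blast
 obtain C where C: "finite C" "C <= W" "rk W = rk S + card C"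
  and rC: "ALL D<=C. rk (S Un D) = rk S + card D"
  and oC: "ALL D<=C. ALL c:C - D. c ~: ic (S Un D)" using M.relative_basis[OF SW WM] by blast
 have oT: "c ~: ic (T Un D)" if "D <= C" "c \<in> C" "c ~: D" for c D
 proof -
  have "ic (T Un D) <= ic (S Un D)" by (rule M.cl_mono) (use TS SG that C WG in auto)
  then show ?thesis using oC that by blast
 qed
 have CG: "C <= G" using C WG by blast
 have "c ~: acl (T Un D)" if D: "D <= C" "c \<in> C" "c ~: D" for D c
 proof
  assume a: "c \<in> acl (T Un D)"
  have fD: "finite D" using D C finite_subset by blast
  have DG: "D <= G" using D CG by blast
  have cG: "c \<in> G" using D CG by blast
  obtain z where z: "z \<in> ic (insert c (T Un D)) - T" "z \<in> vunits \<O>"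
   using finite_hitting_set[OF T fD DG cG _ oT[OF D] a] oT D O by blast
  define J where "J = ic (insert c (T Un D))"
  have cTD: "insert c (T Un D) <= carrier M" using cG TG DG by simp
  have J: "flat J" unfolding J_def by (rule M.flat_cl[OF cTD])
  have "insert c (T Un D) <= W" using TW D C by blast
  then have JW: "J <= W" unfolding J_def by (rule M.cl_flat_min[OF _ W])
  have TJ: "T <= J" unfolding J_def using M.cl_increasing[OF cTD] by blast
  have e: "insert c (T Un D) = T Un insert c D" by blast
  have "rk (T Un insert c D) <= rk T + card (insert c D)" by (rule M.rk_Un_le) (use TG fD DG cG in auto)
  then have rJ: "rk J <= rk T + card (insert c D)" unfolding J_def using M.rk_cl[OF cTD] arg_cong[OF e, of rk] by linarith
  have "rk (S Un insert c D) = rk S + card (insert c D)" using rC D by blast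
  moreover have "rk (S Un insert c D) <= rk (ic (J Un S))"
  proof (rule M.rk_mono[OF _ M.cl_in])
   have JS: "J Un S <= carrier M" using JW WG SG by auto
   then show "J Un S <= carrier M" .
   show "S Un insert c D <= ic (J Un S)" using M.cl_increasing[OF JS] M.cl_increasing[OF cTD] unfolding J_def by blast
  qed
  ultimately have "rk (J Int S) <= rk T" using M.rk_modular[OF J S] rJ by simp
  then have "J Int S = T" by (rule M.Int_eq_if_rk[OF J S T TJ TS])
  then show False using z JW unfolding J_def S_def by blast
 qed
 then have "td (T Un C) = td T + card C" by (rule D.rk_Un_indep[OF TG C(1) CG])
 moreover have "td (T Un C) <= td W" by (rule D.rk_mono[OF _ WG]) (use TW C in blast)
 ultimately show ?thesis using C(3) S_def by simp
qed

text \<open>Composition of places: the residue field of \<open>\<W>\<close> contains a copy of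
  \<open>kf T'\<close>, and \<open>\<U>\<close> prescribes how to continue there. No residue field
  is formed; Chevalley's theorem is applied to the ring \<open>A\<close> made of the part of
  \<open>\<U>\<close> in \<open>kf T'\<close> and the maximal ideal of \<open>\<W>\<close>.\<close>

lemma composite_valuation:
 assumes T: "T' <= G" and w: "\<W> \<in> vals (kf T')" and u: "valring \<U>"
 shows "EX \<O>. valring \<O> & vunits \<O> <= vunits \<W> & (ALL x:kf T'. x \<in> vunits \<O> \<longleftrightarrow> x \<in> vunits \<U>)
  & (ALL L. L <= kf T' & L <= \<U> --> L <= \<O>)"
proof -
 define L where "L = kf T'"
 have sfL: "subfield L R" unfolding L_def by (rule kf_subfield[OF T])
 have sL: "subring L R" using subfieldE(1)[OF sfL] .
 have vW: "valring \<W>" by (rule vals_valring[OF w])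
 have sW: "subring \<W> R" and sU: "subring \<U> R" using vW u valring_def by auto
 have LW: "L <= \<W>" using w vals_def L_def by blast
 note l = subringE[OF sL] and ww = subringE[OF sW] and uu = subringE[OF sU]
 define A where "A = {a \<oplus> m | a m. a \<in> \<U> Int L & m \<in> vmax \<W>}"
 define J where "J = {a \<oplus> m | a m. a \<in> vmax \<U> Int L & m \<in> vmax \<W>}"
 have UL: "subring (\<U> Int L) R" by (rule subring_inter[OF sU sL])
 note ul = subringE[OF UL]
 have mc: "!!m. m \<in> vmax \<W> ==> m \<in> carrier R" using vmax_in(1)[OF vW] .
 have mU: "!!a. a \<in> vmax \<U> ==> a \<in> \<U>" using vmax_in(2)[OF u] .
 have m0: "\<zero> \<in> vmax \<W>" by (rule zero_vmax[OF vW])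
 have ac: "!!a. a \<in> \<U> Int L ==> a \<in> carrier R" using ul(1) by blast
 have prodm: "a \<otimes> m' \<oplus> m \<otimes> (a' \<oplus> m') \<in> vmax \<W>"
  if "a \<in> L" "a' \<in> L" "m \<in> vmax \<W>" "m' \<in> vmax \<W>" for a a' m m'
 proof -
  have "m' \<otimes> a \<in> vmax \<W>" using vmax_mult[OF vW that(4)] that(1) LW by blast
  moreover have "a \<otimes> m' = m' \<otimes> a" using that mc l(1) m_comm by blast
  moreover have "a' \<oplus> m' \<in> \<W>" using that LW vmax_in(2)[OF vW] ww(7) by blast
  ultimately show ?thesis using vmax_add[OF vW] vmax_mult[OF vW that(3)] by simp
 qed
 have prod: "(a \<oplus> m) \<otimes> (a' \<oplus> m') = a \<otimes> a' \<oplus> (a \<otimes> m' \<oplus> m \<otimes> (a' \<oplus> m'))"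
  if "a \<in> carrier R" "a' \<in> carrier R" "m \<in> carrier R" "m' \<in> carrier R" for a a' m m' using that by algebra
 have sA: "subring A R"
 proof (rule subringI)
  show "A <= carrier R" unfolding A_def using ac mc by auto
  show "\<one> \<in> A" unfolding A_def using ul(3) m0 by (intro CollectI exI[of _ \<one>] exI[of _ \<zero>]) simp
  show "\<ominus> h \<in> A" if h: "h \<in> A" for h
  proof -
   obtain a m where am: "h = a \<oplus> m" "a \<in> \<U> Int L" "m \<in> vmax \<W>" using h A_def by blast
   have "\<ominus> h = \<ominus> a \<oplus> \<ominus> m" using am ac mc by (simp add: minus_add)
   then show ?thesis unfolding A_def using ul(5)[OF am(2)] vmax_uminus[OF vW am(3)] by blast
  qed
  fix h1 h2 assume h: "h1 \<in> A" "h2 \<in> A"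
  obtain a m where am: "h1 = a \<oplus> m" "a \<in> \<U> Int L" "m \<in> vmax \<W>" using h A_def by blast
  obtain a' m' where am': "h2 = a' \<oplus> m'" "a' \<in> \<U> Int L" "m' \<in> vmax \<W>" using h A_def by blast
  have c: "a \<in> carrier R" "a' \<in> carrier R" "m \<in> carrier R" "m' \<in> carrier R" using am am' ac mc by auto
  have "a \<otimes> m' \<oplus> m \<otimes> (a' \<oplus> m') \<in> vmax \<W>" using prodm am am' by blast
  then show "h1 \<otimes> h2 \<in> A" unfolding A_def am(1) am'(1) prod[OF c] using ul(6)[OF am(2) am'(2)] by blast
  have "h1 \<oplus> h2 = (a \<oplus> a') \<oplus> (m \<oplus> m')" unfolding am(1) am'(1) using c by (simp add: a_ac)
  then show "h1 \<oplus> h2 \<in> A" unfolding A_def using ul(7)[OF am(2) am'(2)] vmax_add[OF vW am(3) am'(3)] by blast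
 qed
 have JA: "J <= A" unfolding J_def A_def using mU by blast
 have iJ: "idl A J <= J"
 proof
  fix z assume "z \<in> idl A J"
  then show "z \<in> J"
  proof induction
   case zero
   have "\<zero> \<in> vmax \<U> Int L" using zero_vmax[OF u] l(2) by blast
   then show ?case unfolding J_def using m0 by (intro CollectI exI[of _ \<zero>]) simp
  next
   case (step h j s)
   obtain a m where am: "h = a \<oplus> m" "a \<in> \<U> Int L" "m \<in> vmax \<W>" using step A_def by blast
   obtain a' m' where am': "j = a' \<oplus> m'" "a' \<in> vmax \<U> Int L" "m' \<in> vmax \<W>" using step J_def by blast
   obtain b n where bn: "s = b \<oplus> n" "b \<in> vmax \<U> Int L" "n \<in> vmax \<W>" using step J_def by blast
   have c: "a \<in> carrier R" "a' \<in> carrier R" "m \<in> carrier R" "m' \<in> carrier R" "b \<in> carrier R" "n \<in> carrier R"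
    using am am' bn l(1) mc by auto
   have "a' \<otimes> a \<in> vmax \<U>" using vmax_mult[OF u] am am' by blast
   then have 1: "a \<otimes> a' \<oplus> b \<in> vmax \<U> Int L" using vmax_add[OF u] bn(2) l(6,7) am(2) am'(2) m_comm[OF c(1,2)] by auto
   have 2: "(a \<otimes> m' \<oplus> m \<otimes> (a' \<oplus> m')) \<oplus> n \<in> vmax \<W>" using vmax_add[OF vW prodm bn(3)] am am' by blast
   have "h \<otimes> j \<oplus> s = (a \<otimes> a' \<oplus> b) \<oplus> ((a \<otimes> m' \<oplus> m \<otimes> (a' \<oplus> m')) \<oplus> n)"
    unfolding am(1) am'(1) bn(1) prod[OF c(1-4)] using c by (simp add: a_ac)
   then show ?case unfolding J_def using 1 2 by blast
  qed
 qed
 have "\<one> ~: J"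
 proof
  assume "\<one> \<in> J"
  then obtain a m where am: "\<one> = a \<oplus> m" "a \<in> vmax \<U> Int L" "m \<in> vmax \<W>" unfolding J_def by blast
  have c: "a \<in> carrier R" "m \<in> carrier R" using am l(1) mc by auto
  \<comment> \<open>\<open>L\<close> is a field inside \<open>\<W>\<close>, so it meets the maximal
    ideal of \<open>\<W>\<close> only in zero.\<close>
  have "m = \<one> \<oplus> \<ominus> a" unfolding am(1) using c by algebra
  then have mL: "m \<in> L" using l(7)[OF l(3) l(5)] am(2) by blast
  have "m = \<zero>" using subfield_vunits[OF sfL w[folded L_def] mL] am(3) unfolding vmax_def by blast
  then have "a = \<one>" using am(1) c by simp
  then show False using am(2) vunits_one[OF u] unfolding vmax_def by blast
 qed
 then obtain \<O> where O: "valring \<O>" "A <= \<O>" "J <= vmax \<O>" using chevalley[OF sA JA] iJ by blast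
 have ULA: "\<U> Int L <= A"
 proof
  fix a assume a: "a \<in> \<U> Int L"
  then have "a = a \<oplus> \<zero>" using ac by simp
  then show "a \<in> A" unfolding A_def using a m0 by blast
 qed
 have ULJ: "vmax \<U> Int L <= J"
 proof
  fix a assume a: "a \<in> vmax \<U> Int L"
  then have "a = a \<oplus> \<zero>" using l(1) by auto
  then show "a \<in> J" unfolding J_def using a m0 by blast
 qed
 have WJ: "vmax \<W> <= J"
 proof
  fix m assume m: "m \<in> vmax \<W>"
  then have "m = \<zero> \<oplus> m" using mc by simp
  then show "m \<in> J" unfolding J_def using m zero_vmax[OF u] l(2) by blast
 qed
 have "vunits \<O> <= vunits \<W>"
 proof
  fix x assume x: "x \<in> vunits \<O>"
  have "x \<in> Units R" using vunits_Units[OF O(1) x] .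
  moreover have "x ~: vmax \<W>" using x O(3) WJ unfolding vmax_def by blast
  moreover have "inv x ~: vmax \<W>" using vunits_inv[OF O(1) x] O(3) WJ unfolding vmax_def by blast
  ultimately show "x \<in> vunits \<W>" using vunits_trichotomy[OF vW] by blast
 qed
 moreover have "x \<in> vunits \<O> \<longleftrightarrow> x \<in> vunits \<U>" if x: "x \<in> L" for x
 proof (cases "x = \<zero>")
  case True
  then show ?thesis by (simp add: vunits_def Units_iff)
 next
  case False
  have xU: "x \<in> Units R" using x False l(1) Units_iff by blast
  have iL: "inv x \<in> L" using subfield_m_inv(1)[OF sfL, of x] x False by blast
  show ?thesis
  proof
   assume "x \<in> vunits \<U>"
   then have "x \<in> \<U> Int L" "inv x \<in> \<U> Int L" using x iL unfolding vunits_def by auto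
   then show "x \<in> vunits \<O>" using ULA O(2) xU unfolding vunits_def by blast
  next
   assume xO: "x \<in> vunits \<O>"
   have "x ~: vmax \<U>" using xO ULJ O(3) x unfolding vmax_def by blast
   moreover have "inv x ~: vmax \<U>" using vunits_inv[OF O(1) xO] ULJ O(3) iL unfolding vmax_def by blast
   ultimately show "x \<in> vunits \<U>" using vunits_trichotomy[OF u xU] by blast
  qed
 qed
 moreover have "K' <= \<O>" if "K' <= L" "K' <= \<U>" for K' using that ULA O(2) by blast
 ultimately show ?thesis using O(1) unfolding L_def by blast
qed

lemma composite:
 assumes T: "T <= T'" "T' <= G" and w: "\<W> \<in> vals (kf T')" and u: "\<U> \<in> vals (kf T)"
 obtains \<O> where "\<O> \<in> vals (kf T)" "vunits \<O> <= vunits \<W>" "!!x. x \<in> T' ==> x \<in> vunits \<O> \<longleftrightarrow> x \<in> vunits \<U>"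
proof -
 obtain \<O> where O: "valring \<O>" "vunits \<O> <= vunits \<W>" "ALL x:kf T'. x \<in> vunits \<O> \<longleftrightarrow> x \<in> vunits \<U>"
  "ALL L. L <= kf T' & L <= \<U> --> L <= \<O>"
  using composite_valuation[OF T(2) w vals_valring[OF u]] by blast
 have "kf T <= \<U>" using u vals_def by blast
 then have "\<O> \<in> vals (kf T)" using O(1,4) kf_mono[OF T] unfolding vals_def by blast
 then show ?thesis using that O(2,3) kf_upper(1)[OF T(2)] by blast
qed

section \<open>Equality in Abhyankar's inequality\<close>

definition full :: "'a set => 'a set => 'a set => bool" where
 "full T W \<O> \<longleftrightarrow> \<O> \<in> vals (kf T) & rk W + td T = rk (W Int vunits \<O>) + td W"

definition Z :: "'a set => 'a set => 'a set set" where
 "Z T W = {W Int vunits \<O> | \<O>. full T W \<O>}"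

lemma fullI:
 assumes "flat T" "flat W" "T <= W" "\<O> \<in> vals (kf T)" "rk (W Int vunits \<O>) + td W <= rk W + td T"
 shows "full T W \<O>" using rk_le_td[OF assms(1-4)] assms(4,5) unfolding full_def by simp

text \<open>Composition with a valuation for which \<open>g\<close> is not a unit lowers the rank of
  the units by at least one, while the degree of the base drops by one from \<open>T'\<close> to
  \<open>T\<close>. By Abhyankar the rank cannot drop further, so equality survives.\<close>

lemma full_step:
 assumes T: "flat T" and W: "flat W" and TW: "T <= W" and g: "g \<in> W" "g ~: acl T"
  and w: "full (W Int acl (insert g T)) W \<W>"
 shows "EX \<O>. full T W \<O> & g ~: vunits \<O> & vunits \<O> <= vunits \<W>"
proof -
 define T' where "T' = W Int acl (insert g T)"
 have TG: "T <= G" and WG: "W <= G" using flatD(1) T W by auto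
 have gG: "g \<in> G" using g WG by blast
 have gT: "insert g T <= G" using gG TG by blast
 have gT': "insert g T <= T'" unfolding T'_def using acl_increasing[OF gT] g TW by blast
 have T'G: "T' <= G" unfolding T'_def using WG by blast
 have tdT': "td T' = Suc (td T)" unfolding T'_def using td_Int_acl[of "insert g T" W] WG g TW D.rk_insert[OF TG gG g(2)] by simp
 obtain \<U> where U: "\<U> \<in> vals (kf T)" "g ~: vunits \<U>" using g(2) gG unfolding acl_def by blast
 have wv: "\<W> \<in> vals (kf T')" and rw: "rk W + td T' = rk (W Int vunits \<W>) + td W" using w unfolding full_def T'_def by auto
 have TT': "T <= T'" using gT' by blast
 obtain \<O> where O: "\<O> \<in> vals (kf T)" "vunits \<O> <= vunits \<W>" "!!x. x \<in> T' ==> x \<in> vunits \<O> \<longleftrightarrow> x \<in> vunits \<U>"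
  using composite[OF TT' T'G wv U(1)] by blast
 have gO: "g ~: vunits \<O>" using O(3)[of g] gT' U(2) by blast
 have gw: "g \<in> vunits \<W>" using kf_vunits[OF T'G wv] gT' by blast
 have "W Int vunits \<O> \<subset> W Int vunits \<W>" using O(2) g(1) gO gw by blast
 then have "rk (W Int vunits \<O>) < rk (W Int vunits \<W>)"
  using M.flat_psubset_rk flat_vunits[OF vals_valring[OF O(1)] W] flat_vunits[OF vals_valring[OF wv] W] by blast
 then have "full T W \<O>" using fullI[OF T W TW O(1)] rw tdT' by simp
 then show ?thesis using gO O(2) by blast
qed

lemma vunits_carrier: "vunits (carrier R) = Units R" unfolding vunits_def using Units_closed by auto

text \<open>The base is enlarged until \<open>W\<close> is algebraic over it. There the trivial
  valuation ring works, since all of \<open>W\<close> consists of units.\<close>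

lemma full_exists:
 assumes "flat T" "flat W" "T <= W"
 shows "EX \<O>. full T W \<O>" using assms
proof (induction "td W - td T" arbitrary: T rule: less_induct)
 case less
 have TG: "T <= G" and WG: "W <= G" using flatD(1) less.prems by auto
 show ?case
 proof (cases "W <= acl T")
  case True
  have "td W <= td T" by (rule D.rk_mono_cl[OF True TG])
  moreover have "W Int vunits (carrier R) = W" using WG G_Units vunits_carrier by blast
  moreover have "carrier R \<in> vals (kf T)" using carrier_vals subfieldE(3)[OF kf_subfield[OF TG]] by blast
  ultimately show ?thesis using fullI[OF less.prems, of "carrier R"] by auto
 next
  case False
  then obtain g where g: "g \<in> W" "g ~: acl T" by blast
  define T' where "T' = W Int acl (insert g T)"
  have gG: "g \<in> G" using g WG by blast
  have gT: "insert g T <= G" using gG TG by blast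
  have fT': "flat T'" unfolding T'_def by (rule M.flat_Int[OF less.prems(2) acl_flat])
  have tdT': "td T' = Suc (td T)" unfolding T'_def using td_Int_acl[of "insert g T" W] WG g less.prems D.rk_insert[OF TG gG g(2)] by simp
  have "td T' <= td W" by (rule D.rk_mono[OF _ WG]) (simp add: T'_def)
  then have "td W - td T' < td W - td T" using tdT' by simp
  then obtain \<W> where "full T' W \<W>" using less.hyps[of T'] fT' less.prems(2) T'_def by blast
  then show ?thesis using full_step[OF less.prems g, folded T'_def] by blast
 qed
qed

lemma full_exists_avoiding:
 assumes T: "flat T" and W: "flat W" and TW: "T <= W" and g: "g \<in> W" "g ~: acl T"
 shows "EX \<O>. full T W \<O> & g ~: vunits \<O>"
proof -
 have "flat (W Int acl (insert g T))" by (rule M.flat_Int[OF W acl_flat])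
 then obtain \<W> where "full (W Int acl (insert g T)) W \<W>" using full_exists[OF _ W] by blast
 then show ?thesis using full_step[OF assms] by blast
qed

lemma Z_props:
 assumes T: "flat T" and W: "flat W" and TW: "T <= W" and S: "S \<in> Z T W"
 shows "flat S" "T <= S" "S <= W" "rk W + td T = rk S + td W"
proof -
 obtain \<O> where O: "\<O> \<in> vals (kf T)" "rk W + td T = rk (W Int vunits \<O>) + td W" "S = W Int vunits \<O>"
  using S unfolding Z_def full_def by blast
 show "flat S" using flat_vunits[OF vals_valring[OF O(1)] W] O(3) by simp
 show "T <= S" using kf_vunits[OF flatD(1)[OF T] O(1)] O(3) TW by blast
 show "S <= W" using O by blast
 show "rk W + td T = rk S + td W" using O by simp
qed

text \<open>Each \<open>S\<close> in \<open>Z T W\<close> is recovered from its intersection with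
  one finite set \<open>H\<close>. This set unites hitting sets for those parts \<open>A\<close> of
  a basis that are too large to be algebraically independent over \<open>T\<close>. If
  \<open>S\<close> were bigger than what it generates inside \<open>H\<close>, some such
  \<open>A\<close> could be chosen transversal to that part, and its hitting set would contribute a
  further unit.\<close>

lemma finite_Z:
 assumes T: "flat T" and W: "flat W" and TW: "T <= W"
 shows "finite (Z T W)"
proof -
 have TG: "T <= G" and WG: "W <= G" using flatD(1) T W by auto
 have WM: "W <= carrier M" using WG by simp
 obtain C where C: "finite C" "C <= W" "W <= ic (T Un C)" "rk W = rk T + card C"
  and rC: "ALL D<=C. rk (T Un D) = rk T + card D"
  and oC: "ALL D<=C. ALL c:C - D. c ~: ic (T Un D)" using M.relative_basis[OF TW WM] by blast
 have CG: "C <= G" using C WG by blast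
 have tdTW: "td T <= td W" by (rule D.rk_mono[OF TW WG])
 have "EX D. finite D & D <= ic (T Un A) - T & (ALL \<O>:vals (kf T). D Int vunits \<O> ~= {})"
  if A: "A <= C" "td W < td T + card A" for A
 proof -
  have AG: "A <= G" and fA: "finite A" using A C CG finite_subset by blast+
  have "EX D c. D <= A & c \<in> A & c ~: D & c \<in> acl (T Un D)"
  proof (rule ccontr)
   assume "~ ?thesis"
   then have "td (T Un A) = td T + card A" by (intro D.rk_Un_indep[OF TG fA AG]) blast
   moreover have "td (T Un A) <= td W" by (rule D.rk_mono[OF _ WG]) (use TW A C in blast)
   ultimately show False using A(2) by simp
  qed
  then obtain B b where b: "B <= A" "b \<in> A" "b ~: B" "b \<in> acl (T Un B)" by blast
  have fB: "finite B" "B <= G" "b \<in> G" using b fA AG finite_subset by blast+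
  have BC: "B <= C" "b \<in> C" using b A by auto
  have nb: "b ~: ic (T Un B)" using oC BC b(3) by blast
  have ind: "c ~: ic (T Un D)" if "D <= B" "c \<in> B" "c ~: D" for D c using oC BC(1) that by blast
  have "EX D. finite D & D <= ic (insert b (T Un B)) - T & (ALL \<O>:vals (kf T). D Int vunits \<O> ~= {})"
   by (rule finite_hitting_set[OF T fB _ nb b(4)]) (rule ind)
  then obtain D where D: "finite D" "D <= ic (insert b (T Un B)) - T" "ALL \<O>:vals (kf T). D Int vunits \<O> ~= {}"
   by (elim exE conjE) (rule that, assumption+)
  have "ic (insert b (T Un B)) <= ic (T Un A)" by (rule M.cl_mono) (use b TG AG in auto)
  then show ?thesis using D by blast
 qed
 then obtain h where h: "!!A. A <= C ==> td W < td T + card A ==>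
   finite (h A) & h A <= ic (T Un A) - T & (ALL \<O>:vals (kf T). h A Int vunits \<O> ~= {})" by metis
 define H where "H = \<Union>(h ` {A. A <= C & td W < td T + card A})"
 have fH: "finite H" unfolding H_def using h C(1) by auto
 have "S = ic (T Un (S Int H))" if S: "S \<in> Z T W" for S
 proof -
  note sp = Z_props[OF T W TW S]
  obtain \<O> where O: "\<O> \<in> vals (kf T)" "S = W Int vunits \<O>" using S unfolding Z_def full_def by blast
  have SG: "S <= G" using sp(3) WG by blast
  define Q where "Q = ic (T Un (S Int H))"
  have TSM: "T Un (S Int H) <= carrier M" using TG SG by auto
  have fQ: "flat Q" unfolding Q_def by (rule M.flat_cl[OF TSM])
  have upQ: "T Un (S Int H) <= Q" unfolding Q_def by (rule M.cl_increasing[OF TSM])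
  have QS: "Q <= S" unfolding Q_def by (rule M.cl_flat_min[OF _ sp(1)]) (use sp(2) in blast)
  have QG: "Q <= G" using QS SG by blast
  have "rk S <= rk Q"
  proof (rule ccontr)
   assume "~ rk S <= rk Q"
   then have lt: "rk Q < rk S" by simp
   \<comment> \<open>\<open>A\<close> completes \<open>Q\<close> to a generating set. Because
     \<open>Q\<close> has smaller rank than \<open>S\<close>, it needs more than
     \<open>td W - td T\<close> elements, which is the condition for a hitting set to exist.\<close>
   obtain A where A: "A <= C" "rk (Q Un A) = rk Q + card A" "C <= ic (Q Un A)"
    using M.independent_subset_of_generators[of Q C] QG C(1) CG by auto
   have AG: "A <= G" and fA: "finite A" using A C CG finite_subset by blast+
   have QA: "Q Un A <= carrier M" using QG AG by auto
   have "T Un C <= ic (Q Un A)" using A(3) upQ M.cl_increasing[OF QA] by blast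
   then have "ic (T Un C) <= ic (Q Un A)" by (rule M.cl_flat_min[OF _ M.flat_cl[OF QA]])
   then have "rk W <= rk (Q Un A)" using M.rk_mono_cl[OF _ QA] C(3) by blast
   then have cA: "td W < td T + card A" using A(2) sp(4) lt by simp
   define B where "B = ic (T Un A)"
   have TAM: "T Un A <= carrier M" using TG AG by auto
   have fB: "flat B" unfolding B_def by (rule M.flat_cl[OF TAM])
   have TB: "T Un A <= B" unfolding B_def by (rule M.cl_increasing[OF TAM])
   obtain z where z: "z \<in> h A" "z \<in> vunits \<O>" using h[OF A(1) cA] O(1) by blast
   have zB: "z \<in> B" "z ~: T" using h[OF A(1) cA] z(1) B_def by auto
   have "B <= W" unfolding B_def by (rule M.cl_flat_min[OF _ W]) (use TW A C in blast)
   then have "z \<in> S" using zB z O by blast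
   moreover have "z \<in> H" unfolding H_def using z(1) A(1) cA by blast
   ultimately have zQ: "z \<in> Q" using upQ by blast
   have "rk B = rk T + card A" unfolding B_def using M.rk_cl[OF TAM] rC A(1) by simp
   moreover have "rk Q + card A <= rk (ic (B Un Q))"
   proof -
    have BQ: "B Un Q <= carrier M" using flatD(1)[OF fB] QG by auto
    have "rk (Q Un A) <= rk (ic (B Un Q))" by (rule M.rk_mono[OF _ M.cl_in[OF BQ]]) (use M.cl_increasing[OF BQ] TB in blast)
    then show ?thesis using A(2) by simp
   qed
   ultimately have "rk (B Int Q) <= rk T" using M.rk_modular[OF fB fQ] by simp
   then have "B Int Q = T" using M.Int_eq_if_rk[OF fB fQ T] TB upQ by blast
   then show False using zB zQ by blast
  qed
  then show ?thesis using M.flat_eqI[OF QS fQ sp(1)] unfolding Q_def by simp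
 qed
 then have "Z T W <= (%B. ic (T Un B)) ` Pow H" by blast
 then show ?thesis using fH finite_subset by blast
qed

text \<open>Abhyankar's inequality on \<open>Q\<close> bounds the rank of \<open>S Int Q\<close>
  from below, and the modular law then leaves no rank for \<open>S\<close> outside
  \<open>Q\<close>.\<close>

lemma Z_subset:
 assumes T: "flat T" and Q: "flat Q" and W: "flat W" and sub: "T <= Q" "Q <= W"
  and eq: "rk W + td Q <= td W + rk Q" and S: "S \<in> Z T W"
 shows "S <= Q"
proof -
 have TW: "T <= W" using sub by blast
 note sp = Z_props[OF T W TW S]
 obtain \<O> where O: "\<O> \<in> vals (kf T)" "S = W Int vunits \<O>" using S unfolding Z_def full_def by blast
 have "Q Int vunits \<O> = S Int Q" using O sub by blast
 then have "rk Q + td T <= rk (S Int Q) + td Q" using rk_le_td[OF T Q sub(1) O(1)] by simp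
 then have "rk (ic (S Un Q)) <= rk Q" using M.rk_modular[OF sp(1) Q] sp(4) eq by simp
 moreover have j: "flat (ic (S Un Q))" "Q <= ic (S Un Q)" "S <= ic (S Un Q)"
  using M.flat_join[OF sp(1) Q] M.join_upper[OF sp(1) Q] by auto
 ultimately have "Q = ic (S Un Q)" using M.flat_eqI[OF j(2) Q j(1)] by blast
 then show ?thesis using j(3) by blast
qed

text \<open>Equality for two steps gives equality for the composite. By modularity the rank identity
  says that the units of the composite together with \<open>T'\<close> generate all units of
  \<open>\<W>\<close> in \<open>W\<close>, which is what makes them usable as complements.\<close>

lemma composite_full:
 assumes T: "flat T" and T': "flat T'" and W: "flat W" and sub: "T <= T'" "T' <= W"
  and w: "full T' W \<W>" and u: "full T T' \<U>"
 obtains \<O> where "full T W \<O>" "vunits \<O> <= vunits \<W>" "T' Int vunits \<O> = T' Int vunits \<U>"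
  "ic ((W Int vunits \<O>) Un T') <= W Int vunits \<W>"
  "rk (W Int vunits \<O>) + rk T' = rk (W Int vunits \<W>) + rk (T' Int vunits \<U>)"
proof -
 have T'G: "T' <= G" using flatD(1)[OF T'] .
 have TW: "T <= W" using sub by blast
 have wv: "\<W> \<in> vals (kf T')" and rw: "rk W + td T' = rk (W Int vunits \<W>) + td W" using w unfolding full_def by auto
 have uv: "\<U> \<in> vals (kf T)" and ru: "rk T' + td T = rk (T' Int vunits \<U>) + td T'" using u unfolding full_def by auto
 obtain \<O> where O: "\<O> \<in> vals (kf T)" "vunits \<O> <= vunits \<W>" "!!x. x \<in> T' ==> x \<in> vunits \<O> \<longleftrightarrow> x \<in> vunits \<U>"
  using composite[OF sub(1) T'G wv uv] by blast
 have e: "T' Int vunits \<O> = T' Int vunits \<U>" using O(3) by blast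
 define S where "S = W Int vunits \<O>"
 have S: "flat S" unfolding S_def by (rule flat_vunits[OF vals_valring[OF O(1)] W])
 have Sw: "flat (W Int vunits \<W>)" by (rule flat_vunits[OF vals_valring[OF wv] W])
 have T'w: "T' <= W Int vunits \<W>" using kf_vunits[OF T'G wv] sub by blast
 have j: "ic (S Un T') <= W Int vunits \<W>" by (rule M.join_least[OF _ T'w Sw]) (use O(2) S_def in blast)
 then have "rk (ic (S Un T')) <= rk (W Int vunits \<W>)" by (rule M.flat_rk_mono[OF _ Sw])
 moreover have "S Int T' = T' Int vunits \<U>" unfolding S_def using e sub by blast
 ultimately have r: "rk S + rk T' <= rk (W Int vunits \<W>) + rk (T' Int vunits \<U>)" using M.rk_modular[OF S T'] by simp
 have f: "full T W \<O>" using fullI[OF T W TW O(1)] r rw ru S_def by simp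
 then have "rk S + rk T' = rk (W Int vunits \<W>) + rk (T' Int vunits \<U>)" unfolding full_def S_def using rw ru by simp
 then show ?thesis using that[OF f O(2) e] j unfolding S_def by blast
qed

text \<open>A full valuation on \<open>Q\<close> composed with a full one on \<open>W\<close> over
  the algebraic closure of \<open>Q\<close> is full, so its units in \<open>W\<close> lie in
  \<open>Q\<close> and are those of the first factor. Comparing the two equalities gives the claim.
  With \<open>Z_subset\<close> it follows that \<open>Q\<close> is the smallest flat between
  \<open>T\<close> and \<open>W\<close> above which rank and degree grow equally.\<close>

lemma td_eq_rk_above_Z:
 assumes T: "flat T" and W: "flat W" and TW: "T <= W"
  and Q: "Q = ic (T Un \<Union>(Z T W))"
 shows "rk W + td Q = td W + rk Q"
proof (rule ccontr)
 assume ne: "~ ?thesis"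
 have TG: "T <= G" and WG: "W <= G" using flatD(1) T W by auto
 have UW: "T Un \<Union>(Z T W) <= W" using Z_props(3)[OF T W TW] TW by blast
 have UM: "T Un \<Union>(Z T W) <= carrier M" using UW WG by auto
 have fQ: "flat Q" unfolding Q by (rule M.flat_cl[OF UM])
 have upQ: "T Un \<Union>(Z T W) <= Q" unfolding Q by (rule M.cl_increasing[OF UM])
 have QW: "Q <= W" unfolding Q by (rule M.cl_flat_min[OF UW W])
 have QG: "Q <= G" using QW WG by blast
 have "td W + rk Q <= td Q + rk W" by (rule td_le_rk[OF QW WG])
 then have lt: "td W + rk Q < rk W + td Q" using ne by simp
 define T' where "T' = W Int acl Q"
 have fT': "flat T'" unfolding T'_def by (rule M.flat_Int[OF W acl_flat])
 have QT': "Q <= T'" and T'W: "T' <= W" unfolding T'_def using QW acl_increasing[OF QG] by auto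
 have tdT': "td T' = td Q" unfolding T'_def by (rule td_Int_acl[OF QW WG])
 have T'G: "T' <= G" using T'W WG by blast
 obtain \<W> where w: "full T' W \<W>" using full_exists[OF fT' W T'W] by blast
 then have wv: "\<W> \<in> vals (kf T')" and rw: "rk W + td T' = rk (W Int vunits \<W>) + td W" unfolding full_def by auto
 have TQ: "T <= Q" using upQ by blast
 obtain \<U> where u: "full T Q \<U>" using full_exists[OF T fQ TQ] by blast
 then have uv: "\<U> \<in> vals (kf T)" and ru: "rk Q + td T = rk (Q Int vunits \<U>) + td Q" unfolding full_def by auto
 have TT': "T <= T'" using TQ QT' by blast
 obtain \<O> where O: "\<O> \<in> vals (kf T)" "vunits \<O> <= vunits \<W>" "!!x. x \<in> T' ==> x \<in> vunits \<O> \<longleftrightarrow> x \<in> vunits \<U>"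
  using composite[OF TT' T'G wv uv] by blast
 define S where "S = W Int vunits \<O>"
 have S: "flat S" unfolding S_def by (rule flat_vunits[OF vals_valring[OF O(1)] W])
 have Sw: "flat (W Int vunits \<W>)" by (rule flat_vunits[OF vals_valring[OF wv] W])
 have Qw: "Q <= W Int vunits \<W>" using kf_vunits[OF T'G wv] QT' QW by blast
 have "ic (S Un Q) <= W Int vunits \<W>" by (rule M.join_least[OF _ Qw Sw]) (use O(2) S_def in blast)
 then have "rk (ic (S Un Q)) <= rk (W Int vunits \<W>)" by (rule M.flat_rk_mono[OF _ Sw])
 moreover have SQ: "S Int Q = Q Int vunits \<U>" unfolding S_def using O(3) QT' QW by blast
 ultimately have r: "rk S + rk Q <= rk (W Int vunits \<W>) + rk (Q Int vunits \<U>)" using M.rk_modular[OF S fQ] by simp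
 have f: "full T W \<O>" using fullI[OF T W TW O(1)] r rw ru tdT' S_def by simp
 then have "S \<in> Z T W" unfolding Z_def S_def by blast
 then have "S <= Q" using upQ by blast
 then have "S = Q Int vunits \<U>" using SQ by blast
 moreover have "rk W + td T = rk S + td W" using f unfolding full_def S_def by simp
 ultimately show False using ru lt rw tdT' by simp
qed

end

section \<open>Finite-dimensional reductions and growth of monomials\<close>

context field
begin

definition lsubspace :: "'a set => 'a set => bool" where
 "lsubspace L N \<longleftrightarrow> N <= carrier R & \<zero> \<in> N & (ALL x:N. ALL y:N. x \<oplus> y \<in> N) & (ALL c:L. ALL x:N. c \<otimes> x \<in> N)"

lemma lsubspaceD:
 assumes "lsubspace L N"
 shows "N <= carrier R" "\<zero> \<in> N" "!!x y. x \<in> N ==> y \<in> N ==> x \<oplus> y \<in> N"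
  "!!c x. c \<in> L ==> x \<in> N ==> c \<otimes> x \<in> N" using assms unfolding lsubspace_def by auto

lemma lsubspaceI:
 assumes "N <= carrier R" "\<zero> \<in> N" "!!x y. x \<in> N ==> y \<in> N ==> x \<oplus> y \<in> N"
  "!!c x. c \<in> L ==> x \<in> N ==> c \<otimes> x \<in> N"
 shows "lsubspace L N" using assms unfolding lsubspace_def by auto

lemma lsubspace_subset: "lsubspace A N ==> L <= A ==> lsubspace L N" unfolding lsubspace_def by blast

lemma lsubspace_subring: "subring A R ==> L <= A ==> lsubspace L A"
 using subringE[of A R] by (intro lsubspaceI) auto

text \<open>The last argument is the subspace modulo which the span is taken:
  \<open>A <= lspan L D N\<close> expresses that \<open>A\<close> has dimension at most
  \<open>length D\<close> modulo \<open>N\<close>, without forming a quotient.\<close>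

primrec lspan :: "'a set => 'a list => 'a set => 'a set" where
 "lspan L [] N = N"
| "lspan L (d # D) N = {c \<otimes> d \<oplus> h | c h. c \<in> L & h \<in> lspan L D N}"

lemma lspan_append: "lspan L (D @ D') N = lspan L D (lspan L D' N)" by (induction D) auto

lemma lspan_mono: "N <= N' ==> lspan L D N <= lspan L D N'" by (induction D) auto

lemma lspan_mult:
 assumes L: "L <= carrier R" and x: "x \<in> carrier R"
 shows "set D <= carrier R ==> N <= carrier R ==> h \<in> lspan L D N
  ==> h \<in> carrier R & x \<otimes> h \<in> lspan L (map ((\<otimes>) x) D) ((\<otimes>) x ` N)"
proof (induction D arbitrary: h)
 case Nil
 then show ?case by auto
next
 case (Cons d D)
 obtain c h' where h: "h = c \<otimes> d \<oplus> h'" "c \<in> L" "h' \<in> lspan L D N" using Cons.prems by auto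
 have ih: "h' \<in> carrier R" "x \<otimes> h' \<in> lspan L (map ((\<otimes>) x) D) ((\<otimes>) x ` N)" using Cons.IH[of h'] Cons.prems h(3) by auto
 have c: "c \<in> carrier R" "d \<in> carrier R" using h(2) L Cons.prems(1) by auto
 have "x \<otimes> h = c \<otimes> (x \<otimes> d) \<oplus> x \<otimes> h'" unfolding h(1) using c ih(1) x by algebra
 then show ?case using ih h c by auto
qed

lemma lspan_subspace:
 assumes L: "subring L R" and N: "lsubspace L N"
 shows "set D <= carrier R ==> lsubspace L (lspan L D N)"
proof (induction D)
 case Nil
 then show ?case using N by simp
next
 case (Cons d D)
 note l = subringE[OF L]
 have V: "lsubspace L (lspan L D N)" using Cons by simp
 have d: "d \<in> carrier R" using Cons.prems by simp
 show ?case
 proof (rule lsubspaceI)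
  show "lspan L (d # D) N <= carrier R" using lsubspaceD(1)[OF V] l(1) d by auto
  show "\<zero> \<in> lspan L (d # D) N" using l(2) lsubspaceD(2)[OF V] d by (auto intro!: exI[of _ \<zero>])
  fix x assume "x \<in> lspan L (d # D) N"
  then obtain c h where x: "x = c \<otimes> d \<oplus> h" "c \<in> L" "h \<in> lspan L D N" by auto
  have c: "c \<in> carrier R" "h \<in> carrier R" using x l(1) lsubspaceD(1)[OF V] by auto
  {
   fix y assume "y \<in> lspan L (d # D) N"
   then obtain c' h' where y: "y = c' \<otimes> d \<oplus> h'" "c' \<in> L" "h' \<in> lspan L D N" by auto
   have c': "c' \<in> carrier R" "h' \<in> carrier R" using y l(1) lsubspaceD(1)[OF V] by auto
   have "x \<oplus> y = (c \<oplus> c') \<otimes> d \<oplus> (h \<oplus> h')" unfolding x y using c c' d by algebra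
   moreover have "c \<oplus> c' \<in> L" "h \<oplus> h' \<in> lspan L D N" using l(7) lsubspaceD(3)[OF V] x y by auto
   ultimately show "x \<oplus> y \<in> lspan L (d # D) N" by auto
  }
  fix e assume e: "e \<in> L"
  then have ec: "e \<in> carrier R" using l(1) by blast
  have "e \<otimes> x = (e \<otimes> c) \<otimes> d \<oplus> e \<otimes> h" unfolding x using c ec d by algebra
  moreover have "e \<otimes> c \<in> L" "e \<otimes> h \<in> lspan L D N" using l(6) lsubspaceD(4)[OF V] x e by auto
  ultimately show "e \<otimes> x \<in> lspan L (d # D) N" by auto
 qed
qed

lemma lspan_upper:
 assumes L: "subring L R" and N: "lsubspace L N"
 shows "set D <= carrier R ==> N <= lspan L D N & set D <= lspan L D N"
proof (induction D)
 case Nil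
 then show ?case by simp
next
 case (Cons d D)
 note l = subringE[OF L]
 have V: "lsubspace L (lspan L D N)" by (rule lspan_subspace[OF L N]) (use Cons.prems in simp)
 have d: "d \<in> carrier R" using Cons.prems by simp
 have 1: "h \<in> lspan L (d # D) N" if "h \<in> lspan L D N" for h
 proof -
  have "h = \<zero> \<otimes> d \<oplus> h" using d that lsubspaceD(1)[OF V] by auto
  then show ?thesis using that l(2) by auto
 qed
 have "d = \<one> \<otimes> d \<oplus> \<zero>" using d by simp
 then have "d \<in> lspan L (d # D) N" using l(3) lsubspaceD(2)[OF V] by auto
 then show ?case using 1 Cons by auto
qed

lemma lspan_least:
 assumes "lsubspace L V" "N <= V"
 shows "set D <= V ==> lspan L D N <= V" using lsubspaceD[OF assms(1)] assms(2) by (induction D) auto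

lemma finsum_lsubspace:
 assumes "lsubspace L N" "finite I" "!!i. i \<in> I ==> f i \<in> N"
 shows "finsum R f I \<in> N" using assms(2,3)
proof (induction I rule: finite_induct)
 case empty
 then show ?case using lsubspaceD(2)[OF assms(1)] by simp
next
 case (insert i I)
 have "finsum R f (Set.insert i I) = f i \<oplus> finsum R f I" by (rule finsum_insert) (use insert lsubspaceD(1)[OF assms(1)] in auto)
 then show ?case using insert lsubspaceD(3)[OF assms(1)] by simp
qed

text \<open>Gaussian elimination: one vector with non-zero coefficient at \<open>d\<close> is used
  to clear \<open>d\<close> from all others, which then lie in the span of a shorter list.\<close>

lemma lspan_dependence:
 assumes L: "subfield L R" and N: "lsubspace L N"
 shows "set D <= carrier R ==> finite I ==> (!!i. i \<in> I ==> f i \<in> lspan L D N) ==> length D < card I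
  ==> EX c. (ALL i:I. c i \<in> L) & (EX i:I. c i ~= \<zero>) & (\<Oplus>i\<in>I. c i \<otimes> f i) \<in> N"
proof (induction D arbitrary: I f)
 case Nil
 have sL: "subring L R" using subfieldE(1)[OF L] .
 obtain i where i: "i \<in> I" using Nil.prems(4) by fastforce
 have "(\<Oplus>i\<in>I. \<one> \<otimes> f i) \<in> N"
  by (rule finsum_lsubspace[OF N Nil.prems(2)]) (use Nil.prems(3) subringE(3)[OF sL] lsubspaceD(4)[OF N] in simp)
 then show ?case using i subringE(3)[OF sL] by (intro exI[of _ "%_. \<one>"]) auto
next
 case (Cons d D)
 have sL: "subring L R" using subfieldE(1)[OF L] .
 note l = subringE[OF sL]
 have LL: "lsubspace L L" by (rule lsubspace_subring[OF sL order_refl])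
 have V: "lsubspace L (lspan L D N)" by (rule lspan_subspace[OF sL N]) (use Cons.prems(1) in simp)
 have dc: "d \<in> carrier R" using Cons.prems(1) by simp
 have "ALL i:I. EX c h. f i = c \<otimes> d \<oplus> h & c \<in> L & h \<in> lspan L D N" using Cons.prems(3) by auto
 then obtain c0 h where ch: "!!i. i \<in> I ==> f i = c0 i \<otimes> d \<oplus> h i & c0 i \<in> L & h i \<in> lspan L D N" by metis
 have hc: "c0 i \<in> carrier R" "h i \<in> carrier R" "f i \<in> carrier R" if "i \<in> I" for i
  using ch[OF that] l(1) lsubspaceD(1)[OF V] dc by auto
 show ?case
 proof (cases "ALL i:I. c0 i = \<zero>")
  case True
  then have "f i \<in> lspan L D N" if "i \<in> I" for i using ch[OF that] hc[OF that] that dc by simp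
  then show ?thesis using Cons.IH[of I f] Cons.prems by simp
 next
  case False
  then obtain j where j: "j \<in> I" "c0 j ~= \<zero>" by blast
  have jU: "c0 j \<in> Units R" using j hc Units_iff by blast
  have ij: "inv (c0 j) \<in> L" using subfield_m_inv(1)[OF L, of "c0 j"] ch[OF j(1)] j(2) by simp
  define I' where "I' = I - {j}"
  define e where "e = (%i. c0 i \<otimes> inv (c0 j))"
  define f' where "f' = (%i. f i \<oplus> (\<ominus> e i) \<otimes> f j)"
  have eL: "e i \<in> L" if "i \<in> I" for i unfolding e_def using l(6) ij ch[OF that] by blast
  have ec: "e i \<in> carrier R" if "i \<in> I" for i using eL[OF that] l(1) by blast
  have f': "f' i \<in> lspan L D N" if "i \<in> I'" for i
  proof -
   have i: "i \<in> I" using that I'_def by blast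
   have "e i \<otimes> c0 j = c0 i" unfolding e_def using hc(1)[OF i] jU hc(1)[OF j(1)] by (simp add: m_assoc)
   moreover have "f' i = (c0 i \<oplus> \<ominus> (e i \<otimes> c0 j)) \<otimes> d \<oplus> (h i \<oplus> (\<ominus> e i) \<otimes> h j)"
    unfolding f'_def conjunct1[OF ch[OF i]] conjunct1[OF ch[OF j(1)]] using hc[OF i] hc[OF j(1)] ec[OF i] dc by algebra
   ultimately have "f' i = h i \<oplus> (\<ominus> e i) \<otimes> h j" using hc[OF i] hc[OF j(1)] ec[OF i] dc by (simp add: r_neg)
   then show ?thesis using lsubspaceD(3,4)[OF V] ch[OF i] ch[OF j(1)] l(5)[OF eL[OF i]] by simp
  qed
  have "card I = Suc (card I')" unfolding I'_def using card_Suc_Diff1[OF Cons.prems(2) j(1)] by (rule sym)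
  then obtain c where c: "ALL i:I'. c i \<in> L" "EX i:I'. c i ~= \<zero>" "(\<Oplus>i\<in>I'. c i \<otimes> f' i) \<in> N"
   using Cons.IH[of I' f'] f' Cons.prems(1,2,4) I'_def by auto
  have fI': "finite I'" "j ~: I'" "I = Set.insert j I'" "I' <= I" using Cons.prems(2) j(1) unfolding I'_def by auto
  define a where "a = (\<Oplus>i\<in>I'. c i \<otimes> (\<ominus> e i))"
  define c' where "c' = c(j := a)"
  have cc: "c i \<in> carrier R" if "i \<in> I'" for i using c(1) l(1) that by blast
  have aL: "a \<in> L" unfolding a_def by (rule finsum_lsubspace[OF LL fI'(1)]) (use c(1) l(5,6) eL fI'(4) in blast)
  then have ac: "a \<in> carrier R" using l(1) by blast
  have fjc: "f j \<in> carrier R" by (rule hc(3)[OF j(1)])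
  have t1: "(%i. c i \<otimes> f i) \<in> I' \<rightarrow> carrier R" using cc hc(3) fI'(4) by blast
  have t2: "(%i. c i \<otimes> (\<ominus> e i)) \<in> I' \<rightarrow> carrier R" using cc ec fI'(4) by blast
  have t3: "(%i. c i \<otimes> (\<ominus> e i) \<otimes> f j) \<in> I' \<rightarrow> carrier R" using t2 fjc by (auto simp: Pi_iff)
  have "(\<Oplus>i\<in>I. c' i \<otimes> f i) = c' j \<otimes> f j \<oplus> (\<Oplus>i\<in>I'. c' i \<otimes> f i)"
   unfolding fI'(3) by (rule finsum_insert) (use fI' ac fjc cc hc(3) in \<open>auto simp: c'_def\<close>)
  also have "(\<Oplus>i\<in>I'. c' i \<otimes> f i) = (\<Oplus>i\<in>I'. c i \<otimes> f i)"
   by (rule finsum_cong') (use t1 fI'(2) in \<open>auto simp: c'_def\<close>)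
  also have "c' j \<otimes> f j = (\<Oplus>i\<in>I'. c i \<otimes> (\<ominus> e i) \<otimes> f j)"
   unfolding c'_def a_def using finsum_ldistr[OF fI'(1) fjc t2] by simp
  also have "(\<Oplus>i\<in>I'. c i \<otimes> (\<ominus> e i) \<otimes> f j) \<oplus> (\<Oplus>i\<in>I'. c i \<otimes> f i)
    = (\<Oplus>i\<in>I'. c i \<otimes> (\<ominus> e i) \<otimes> f j \<oplus> c i \<otimes> f i)" by (rule finsum_addf[symmetric, OF t3 t1])
  also have "\<dots> = (\<Oplus>i\<in>I'. c i \<otimes> f' i)"
  proof (rule finsum_cong'[OF refl])
   show "(%i. c i \<otimes> f' i) \<in> I' \<rightarrow> carrier R" using cc f' lsubspaceD(1)[OF V] by blast
   fix i assume i: "i \<in> I'"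
   then have "i \<in> I" using fI'(4) by blast
   then show "c i \<otimes> (\<ominus> e i) \<otimes> f j \<oplus> c i \<otimes> f i = c i \<otimes> f' i"
    unfolding f'_def using cc[OF i] ec hc(3) fjc by algebra
  qed
  finally have "(\<Oplus>i\<in>I. c' i \<otimes> f i) \<in> N" using c(3) by simp
  moreover have "ALL i:I. c' i \<in> L" using c(1) aL fI' unfolding c'_def by auto
  moreover have "EX i:I. c' i ~= \<zero>" using c(2) fI' unfolding c'_def by (metis fun_upd_other subsetD)
  ultimately show ?thesis by blast
 qed
qed

lemma lsum_finsum:
 assumes O: "valring \<O>"
 shows "distinct xs ==> (!!i. i \<in> set xs ==> g i \<in> carrier R) ==> lsum (map g xs) = finsum R g (set xs)"
proof (induction xs)
 case Nil
 then show ?case by (simp add: lsum_simps[OF O])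
next
 case (Cons x xs)
 have "finsum R g (set (x # xs)) = g x \<oplus> finsum R g (set xs)" unfolding list.set by (rule finsum_insert) (use Cons.prems in auto)
 then show ?case using Cons by (simp add: lsum_simps[OF O])
qed

lemma dominant_finsum:
 assumes O: "valring \<O>" and I: "finite I" "I ~= {}" and u: "!!i. i \<in> I ==> g i \<in> Units R"
  and ne: "!!i j. i \<in> I ==> j \<in> I ==> i ~= j ==> ~ veq \<O> (g i) (g j)"
 shows "EX i:I. veq \<O> (finsum R g I) (g i)"
proof -
 obtain xs where xs: "set xs = I" "distinct xs" using finite_distinct_list[OF I(1)] by blast
 have "sorted_wrt (%x y. ~ veq \<O> x y) (map g ys)" if "distinct ys" "set ys <= I" for ys using that
 proof (induction ys)
  case Nil
  then show ?case by simp
 next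
  case (Cons a ys)
  have "~ veq \<O> (g a) (g j)" if "j \<in> set ys" for j using ne[of a j] Cons.prems that by auto
  then show ?case using Cons by auto
 qed
 then have s: "sorted_wrt (%x y. ~ veq \<O> x y) (map g xs)" using xs by blast
 have "map g xs ~= []" "set (map g xs) <= Units R" using xs I(2) u by auto
 then obtain x where "x \<in> set (map g xs)" "veq \<O> (lsum (map g xs)) x" using dominant_term[OF O _ _ s] by blast
 moreover have "lsum (map g xs) = finsum R g I" using lsum_finsum[OF O xs(2)] u Units_closed xs(1) by simp
 ultimately show ?thesis using xs(1) by auto
qed

lemma eval_lspan:
 assumes L: "subring L R" and x: "x \<in> carrier R" and N: "lsubspace L N"
 shows "set q <= L ==> length q <= m ==> eval q x \<in> lspan L (map (%i. x [^] i) [0..<m]) N"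
proof (induction q)
 case Nil
 have c: "set (map (%i. x [^] i) [0..<m]) <= carrier R" using x by auto
 show ?case using lsubspaceD(2)[OF lspan_subspace[OF L N c]] by simp
next
 case (Cons a q)
 have c: "set (map (%i. x [^] i) [0..<m]) <= carrier R" using x by auto
 note V = lspan_subspace[OF L N c]
 have "x [^] length q \<in> set (map (%i. x [^] i) [0..<m])" using Cons.prems(2) by auto
 then have "x [^] length q \<in> lspan L (map (%i. x [^] i) [0..<m]) N" using lspan_upper[OF L N c] by blast
 then have "a \<otimes> x [^] length q \<in> lspan L (map (%i. x [^] i) [0..<m]) N" using lsubspaceD(4)[OF V] Cons.prems(1) by simp
 moreover have "eval q x \<in> lspan L (map (%i. x [^] i) [0..<m]) N" using Cons by simp
 ultimately show ?case using lsubspaceD(3)[OF V] by simp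
qed

text \<open>The first non-zero coefficient is invertible in \<open>L\<close>, so the top power is
  expressed through lower ones modulo \<open>J\<close>.\<close>

lemma monic_relation:
 assumes L: "subfield L R" and A: "subring A R" "L <= A" and x: "x \<in> A" and J: "lsubspace A J"
 shows "set q <= L ==> ~ set q <= {\<zero>} ==> eval q x \<in> J
  \<Longrightarrow> \<exists>m\<ge>1. x [^] m \<in> lspan L (map (\<lambda>i. x [^] i) [0..<m]) J"
proof (induction q)
 case Nil
 then show ?case by simp
next
 case (Cons a q)
 note s = subringE[OF A(1)]
 have sL: "subring L R" using subfieldE(1)[OF L] .
 have xc: "x \<in> carrier R" using x s(1) by blast
 have JL: "lsubspace L J" by (rule lsubspace_subset[OF J A(2)])
 have qc: "set q <= carrier R" using Cons.prems(1) A(2) s(1) by auto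
 show ?case
 proof (cases "a = \<zero>")
  case True
  then have "eval (a # q) x = eval q x" using xc eval_in_carrier[OF qc xc] by simp
  then show ?thesis using Cons True by auto
 next
  case False
  have aL: "a \<in> L" using Cons.prems(1) by simp
  have aU: "a \<in> Units R" using aL A(2) s(1) False Units_iff by blast
  have ia: "inv a \<in> L" using subfield_m_inv(1)[OF L, of a] aL False by simp
  define n where "n = length q"
  define V where "V = lspan L (map (%i. x [^] i) [0..<n]) J"
  have c: "set (map (%i. x [^] i) [0..<n]) <= carrier R" using xc by auto
  have sV: "lsubspace L V" unfolding V_def by (rule lspan_subspace[OF sL JL c])
  have qV: "eval q x \<in> V" unfolding V_def n_def by (rule eval_lspan[OF sL xc JL]) (use Cons.prems in auto)
  have "a \<otimes> x [^] n \<oplus> eval q x \<in> V" using lspan_upper[OF sL JL c] Cons.prems(3) unfolding V_def n_def by auto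
  moreover have "\<ominus> \<one> \<otimes> eval q x \<in> V" using lsubspaceD(4)[OF sV _ qV] subringE(3,5)[OF sL] by blast
  ultimately have "(a \<otimes> x [^] n \<oplus> eval q x) \<oplus> \<ominus> \<one> \<otimes> eval q x \<in> V" by (rule lsubspaceD(3)[OF sV])
  moreover have "(a \<otimes> x [^] n \<oplus> eval q x) \<oplus> \<ominus> \<one> \<otimes> eval q x = a \<otimes> x [^] n"
  proof -
   have "x [^] n \<in> carrier R" "eval q x \<in> carrier R" "a \<in> carrier R" using xc aU lsubspaceD(1)[OF sV] qV Units_closed by auto
   then show ?thesis by algebra
  qed
  ultimately have "inv a \<otimes> (a \<otimes> x [^] n) \<in> V" using lsubspaceD(4)[OF sV ia] by simp
  then have xn: "x [^] n \<in> V" using Units_cancel(2)[OF aU, of "x [^] n"] xc by simp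
  show ?thesis
  \<comment> \<open>A relation of degree zero says that \<open>J\<close> contains one, hence also
    \<open>x\<close>. The exponent is then taken to be one, as \<open>m\<close> has to be
    positive.\<close>
  proof (cases "n = 0")
   case True
   then have "\<one> \<in> J" using xn unfolding V_def by simp
   then have "x \<otimes> \<one> \<in> J" using lsubspaceD(4)[OF J x] by blast
   then have "x [^] (1::nat) \<in> J" using xc by simp
   moreover have "set (map (%i. x [^] i) [0..<1::nat]) <= carrier R" using xc by auto
   ultimately have "x [^] (1::nat) \<in> lspan L (map (%i. x [^] i) [0..<1]) J" using lspan_upper[OF sL JL] by blast
   then show ?thesis by blast
  next
   case False
   then show ?thesis using xn unfolding V_def by (intro exI[of _ n]) auto
  qed
 qed
qed

text \<open>The products of \<open>D\<close> with powers of \<open>x\<close> below \<open>m\<close>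
  span, modulo \<open>J\<close>, a space that contains \<open>B\<close> and is stable under
  multiplication by \<open>x\<close>; the monic relation enters only at the top power.\<close>

lemma lspan_adjoin:
 assumes L: "subfield L R" and A: "subring A R" "L <= A" and x: "x \<in> A" and J: "lsubspace A J"
  and D: "set D <= A" "B <= lspan L D J" and m: "m \<ge> 1" "x [^] m \<in> lspan L (map (%i. x [^] i) [0..<m]) J"
 shows "EX D'. set D' <= A & simple_extension B x <= lspan L D' J"
proof -
 note s = subringE[OF A(1)]
 have sL: "subring L R" using subfieldE(1)[OF L] .
 have Lc: "L <= carrier R" using A(2) s(1) by blast
 have xc: "x \<in> carrier R" using x s(1) by blast
 have JL: "lsubspace L J" by (rule lsubspace_subset[OF J A(2)])
 have xA: "x [^] i \<in> A" for i :: nat using s(3,6) x by (induction i) auto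
 define D' where "D' = concat (map (%d. map (%i. d \<otimes> x [^] i) [0..<m]) D)"
 have setD': "set D' = {d \<otimes> x [^] i | d i. d \<in> set D & i < m}" unfolding D'_def by (auto, blast)
 have D'A: "set D' <= A" unfolding setD' using D(1) xA s(6) by blast
 have D'c: "set D' <= carrier R" using D'A s(1) by blast
 define V where "V = lspan L D' J"
 have sV: "lsubspace L V" unfolding V_def by (rule lspan_subspace[OF sL JL D'c])
 have uV: "J <= V" "set D' <= V" using lspan_upper[OF sL JL D'c] unfolding V_def by auto
 have Vc: "V <= carrier R" by (rule lsubspaceD(1)[OF sV])
 have Jc: "J <= carrier R" by (rule lsubspaceD(1)[OF J])
 have sc: "lsubspace L {u \<in> carrier R. d \<otimes> u \<in> V}" if d: "d \<in> carrier R" for d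
 proof (rule lsubspaceI)
  show "\<zero> \<in> {u \<in> carrier R. d \<otimes> u \<in> V}" using lsubspaceD(2)[OF sV] d by simp
  show "u \<oplus> v \<in> {u \<in> carrier R. d \<otimes> u \<in> V}"
   if "u \<in> {u \<in> carrier R. d \<otimes> u \<in> V}" "v \<in> {u \<in> carrier R. d \<otimes> u \<in> V}" for u v
   using lsubspaceD(3)[OF sV] that d by (simp add: r_distr)
  show "c \<otimes> u \<in> {u \<in> carrier R. d \<otimes> u \<in> V}" if c: "c \<in> L" and u: "u \<in> {u \<in> carrier R. d \<otimes> u \<in> V}" for c u
  proof -
   have cu: "c \<in> carrier R" "u \<in> carrier R" using c u Lc by auto
   have "d \<otimes> (c \<otimes> u) = c \<otimes> (d \<otimes> u)" using cu d by algebra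
   then show ?thesis using lsubspaceD(4)[OF sV c] u cu by simp
  qed
 qed auto
 have dV: "d \<in> V" if "d \<in> set D" for d
 proof -
  have "d = d \<otimes> x [^] (0::nat)" using that D(1) s(1) by auto
  moreover have "0 < m" using m(1) by simp
  ultimately have "d \<in> set D'" unfolding setD' using that by blast
  then show ?thesis using uV(2) by blast
 qed
 then have BV: "B <= V" using D(2) lspan_least[OF sV uV(1), of D] by blast
 have xV: "x \<otimes> v \<in> V" if "v \<in> V" for v
 proof -
  have "lspan L D' J <= {u \<in> carrier R. x \<otimes> u \<in> V}"
  proof (rule lspan_least[OF sc[OF xc]])
   show "J <= {u \<in> carrier R. x \<otimes> u \<in> V}" using lsubspaceD(4)[OF J x] uV(1) Jc by blast
   show "set D' <= {u \<in> carrier R. x \<otimes> u \<in> V}"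
   proof
    fix w assume "w \<in> set D'"
    then obtain d i where w: "w = d \<otimes> x [^] i" "d \<in> set D" "i < m" unfolding setD' by blast
    have dA: "d \<in> A" and dc: "d \<in> carrier R" using w(2) D(1) s(1) by auto
    have e: "x \<otimes> w = d \<otimes> x [^] Suc i" unfolding w(1) using dc xc by (simp add: m_ac)
    have "x \<otimes> w \<in> V"
    proof (cases "Suc i < m")
     case True
     then have "x \<otimes> w \<in> set D'" unfolding e setD' using w(2) by blast
     then show ?thesis using uV(2) by blast
    next
     case False
     then have im: "Suc i = m" using w(3) by simp
     have "lspan L (map (%i. x [^] i) [0..<m]) J <= {u \<in> carrier R. d \<otimes> u \<in> V}"
     proof (rule lspan_least[OF sc[OF dc]])
      show "J <= {u \<in> carrier R. d \<otimes> u \<in> V}" using lsubspaceD(4)[OF J dA] uV(1) Jc by blast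
      show "set (map (%i. x [^] i) [0..<m]) <= {u \<in> carrier R. d \<otimes> u \<in> V}"
      proof
       fix v assume "v \<in> set (map (%i. x [^] i) [0..<m])"
       then obtain i where i: "v = x [^] i" "i < m" by auto
       then have "d \<otimes> v \<in> set D'" unfolding setD' using w(2) by blast
       then show "v \<in> {u \<in> carrier R. d \<otimes> u \<in> V}" using uV(2) i xc by auto
      qed
     qed
     then show ?thesis unfolding e im using m(2) by blast
    qed
    then show "w \<in> {u \<in> carrier R. x \<otimes> u \<in> V}" using w(1) dc xc by simp
   qed
  qed
  then show ?thesis using that V_def by blast
 qed
 have "simple_extension B x <= V"
 proof
  fix v assume "v \<in> simple_extension B x"
  then show "v \<in> V"
  proof induction
   case zero
   then show ?case by (rule lsubspaceD(2)[OF sV])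
  next
   case (lin k1 k2)
   have "k1 \<otimes> x = x \<otimes> k1" using m_comm lin.IH Vc xc by blast
   then show ?case using xV[OF lin.IH] lin.hyps(2) BV lsubspaceD(3)[OF sV] by auto
  qed
 qed
 then show ?thesis using D'A V_def by blast
qed

lemma generate_ring_insert:
 assumes H: "H <= carrier R" and x: "x \<in> carrier R"
 shows "generate_ring R (insert x H) <= simple_extension (generate_ring R H) x"
proof (rule generate_ring_min_subring1)
 have s: "subring (generate_ring R H) R" by (rule generate_ring_is_subring[OF H])
 show "insert x H <= carrier R" using H x by blast
 show "subring (simple_extension (generate_ring R H) x) R" by (rule simple_extension_is_subring[OF s x])
 have "H <= generate_ring R H" by (intro subsetI generate_ring.incl)
 then show "insert x H <= simple_extension (generate_ring R H) x"
  using simple_extension_mem[OF s x] simple_extension_incl[OF generate_ring_incl[OF H] x] by blast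
qed

lemma finitely_generated_span:
 assumes L: "subfield L R" and A: "subring A R" "L <= A" and J: "lsubspace A J"
 shows "finite F ==> F <= A ==> (!!x. x \<in> F ==> EX q. set q <= L & ~ set q <= {\<zero>} & eval q x \<in> J)
  ==> EX D. set D <= A & generate_ring R (L Un F) <= lspan L D J"
proof (induction F rule: finite_induct)
 case empty
 have sL: "subring L R" using subfieldE(1)[OF L] .
 have Lc: "L <= carrier R" using subringE(1)[OF sL] .
 have JL: "lsubspace L J" by (rule lsubspace_subset[OF J A(2)])
 have "generate_ring R L <= L" by (rule generate_ring_min_subring1[OF Lc sL order_refl])
 moreover have "L <= lspan L [\<one>] J"
 proof
  fix a assume a: "a \<in> L"
  then have "a = a \<otimes> \<one> \<oplus> \<zero>" using Lc by auto
  then show "a \<in> lspan L [\<one>] J" using a lsubspaceD(2)[OF J] by auto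
 qed
 moreover have "set [\<one>] <= A" using subringE(3)[OF A(1)] by simp
 ultimately show ?case by (intro exI[of _ "[\<one>]"]) auto
next
 case (insert x F)
 obtain D where D: "set D <= A" "generate_ring R (L Un F) <= lspan L D J" using insert.IH insert.prems by blast
 have xA: "x \<in> A" using insert.prems(1) by blast
 obtain q where q: "set q <= L" "~ set q <= {\<zero>}" "eval q x \<in> J" using insert.prems(2) by blast
 obtain m where m: "m \<ge> 1" "x [^] m \<in> lspan L (map (%i. x [^] i) [0..<m]) J" using monic_relation[OF L A xA J q] by blast
 obtain D' where D': "set D' <= A" "simple_extension (generate_ring R (L Un F)) x <= lspan L D' J"
  using lspan_adjoin[OF L A xA J D m] by blast
 have "L Un F <= carrier R" "x \<in> carrier R" using subringE(1)[OF A(1)] A(2) insert.prems(1) by auto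
 then have "generate_ring R (L Un Set.insert x F) <= simple_extension (generate_ring R (L Un F)) x"
  using generate_ring_insert[of "L Un F" x] by simp
 then show ?case using D' by blast
qed

lemma eval_rev:
 assumes x: "x \<in> Units R"
 shows "set q <= carrier R ==> eval (rev q) (inv x) \<otimes> x [^] length q = eval q x \<otimes> x"
proof (induction q)
 case Nil
 then show ?case using x Units_closed by simp
next
 case (Cons c q)
 have cx: "x \<in> carrier R" "inv x \<in> carrier R" "c \<in> carrier R" "set (rev q) <= carrier R" "set q <= carrier R"
  using x Units_closed Cons.prems by auto
 have e: "eval (rev q) (inv x) \<in> carrier R" "eval q x \<in> carrier R" "x [^] length q \<in> carrier R" using cx eval_in_carrier by auto
 have "eval (rev (c # q)) (inv x) = eval (rev q) (inv x) \<otimes> inv x \<oplus> c" using eval_snoc[OF cx(4,3,2)] by simp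
 then have "eval (rev (c # q)) (inv x) \<otimes> x [^] length (c # q)
   = (eval (rev q) (inv x) \<otimes> inv x \<oplus> c) \<otimes> (x [^] length q \<otimes> x)" by simp
 also have "\<dots> = (eval (rev q) (inv x) \<otimes> x [^] length q) \<otimes> (inv x \<otimes> x) \<oplus> c \<otimes> x [^] length q \<otimes> x"
  using e cx(1,2,3) by algebra
 also have "\<dots> = eval q x \<otimes> x \<oplus> c \<otimes> x [^] length q \<otimes> x" using Cons x e cx by simp
 also have "\<dots> = eval (c # q) x \<otimes> x" using e cx by (simp add: l_distr a_comm)
 finally show ?case .
qed

text \<open>Algebraicity modulo \<open>J\<close> passes from \<open>x\<close> to its inverse by
  reversing the coefficients. The ring used later is generated by elements and their
  inverses.\<close>

lemma reverse_relation:
 assumes A: "subring A R" and x: "x \<in> A" "x \<in> Units R" "inv x \<in> A" and J: "lsubspace A J"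
  and q: "set q <= A" "~ set q <= {\<zero>}" "eval q x \<in> J"
 shows "EX p. set p <= set q & ~ set p <= {\<zero>} & eval p (inv x) \<in> J"
proof -
 note s = subringE[OF A]
 define n where "n = length q"
 have qc: "set q <= carrier R" using q(1) s(1) by blast
 have c: "x \<in> carrier R" "eval q x \<in> carrier R" "eval (rev q) (inv x) \<in> carrier R"
  using x s(1) qc eval_in_carrier[of q x] eval_in_carrier[of "rev q" "inv x"] by auto
 have xn: "x [^] n \<in> Units R" using Units_pow[OF x(2)] .
 have ixn: "inv (x [^] n) \<in> A"
 proof -
  have "inv x [^] i \<in> A" for i :: nat using s(3,6) x(3) by (induction i) auto
  moreover have "inv (x [^] n) = inv x [^] n"
  proof (rule comm_inv_char)
   show "x [^] n \<otimes> inv x [^] n = \<one>" using x(2) c(1) by (simp add: pow_mult_distrib[symmetric] m_comm)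
  qed (use c x in auto)
  ultimately show ?thesis by simp
 qed
 have "eval (rev q) (inv x) = (eval (rev q) (inv x) \<otimes> x [^] n) \<otimes> inv (x [^] n)" using c xn Units_closed by (simp add: m_assoc)
 also have "\<dots> = (inv (x [^] n) \<otimes> x) \<otimes> eval q x"
  unfolding n_def eval_rev[OF x(2) qc] using c xn Units_closed n_def by (simp add: m_ac)
 finally have "eval (rev q) (inv x) \<in> J" using lsubspaceD(4)[OF J _ q(3)] s(6)[OF ixn x(1)] by simp
 then show ?thesis using q(2) by (intro exI[of _ "rev q"]) simp
qed

lemma veq_cancel:
 assumes O: "valring \<O>" and u: "e \<in> Units R" "x \<in> Units R" "w \<in> Units R" and v: "veq \<O> (e \<otimes> x) (e \<otimes> w)"
 shows "veq \<O> x w"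
proof -
 have "veq \<O> (inv e \<otimes> (e \<otimes> x)) (inv e \<otimes> (e \<otimes> w))" by (rule veq_mult[OF O veq_refl[OF O] v]) (use u in simp)
 then show ?thesis using Units_cancel(2)[OF u(1)] u Units_closed by simp
qed

lemma veq_mono: "veq \<O> x y ==> vunits \<O> <= vunits \<W> ==> veq \<W> x y" unfolding veq_def by blast

lemma veq_root:
 assumes O: "valring \<O>" and v: "veq \<O> (x [^] n) (y [^] (n::nat))" "n \<ge> 1" and u: "x \<in> Units R" "y \<in> Units R"
 shows "veq \<O> x y"
proof -
 have c: "x \<in> carrier R" "inv y \<in> carrier R" "y \<in> carrier R" using u Units_closed by auto
 have "inv (y [^] n) = inv y [^] n" by (rule comm_inv_char) (use c u in \<open>auto simp: pow_mult_distrib[symmetric] m_comm\<close>)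
 then have "(x \<otimes> inv y) [^] n = x [^] n \<otimes> inv (y [^] n)" using pow_mult_distrib[OF m_comm] c by simp
 then have "(x \<otimes> inv y) [^] n \<in> vunits \<O>" using v(1) unfolding veq_def by simp
 then show ?thesis using vunits_root[OF O _ v(2)] u unfolding veq_def by simp
qed

lemma veq_vmax_pow:
 assumes O: "valring \<O>" and y: "y \<in> vmax \<O>" "y ~= \<zero>" and e: "e \<in> Units R"
  and v: "veq \<O> (e \<otimes> y [^] i) (e \<otimes> y [^] (j::nat))"
 shows "i = j"
proof -
 have yU: "y \<in> Units R" using vmax_in(1)[OF O y(1)] y(2) Units_iff by blast
 have False if "i < j" "veq \<O> (e \<otimes> y [^] i) (e \<otimes> y [^] j)" for i j :: nat
 proof -
  have "veq \<O> (e \<otimes> inv e) (y [^] (j - i))" by (rule veq_pow_diff[OF O that(2,1) e e yU])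
  then have "veq \<O> (y [^] (j - i)) \<one>" using veq_sym[OF O] e by simp
  then have "y [^] (j - i) \<in> vunits \<O>" using veq_one[OF O] by blast
  moreover have "1 <= j - i" using that(1) by arith
  ultimately show False using vmax_pow[OF O y(1)] unfolding vmax_def by blast
 qed
 then show ?thesis using v veq_sym[OF O v] by (metis linorder_neqE_nat)
qed

text \<open>Multiplication by a power of \<open>y\<close> maps \<open>A\<close> modulo
  \<open>y\<close> onto each layer of the filtration by powers of \<open>y\<close>, so the dimension
  grows at most linearly in \<open>n\<close>.\<close>

lemma filtration_span:
 assumes L: "subfield L R" and A: "subring A R" "L <= A" and y: "y \<in> A"
  and D: "set D <= A" "A <= lspan L D ((\<otimes>) y ` A)"
 shows "EX D'. length D' = n * length D & set D' <= A & A <= lspan L D' ((\<otimes>) (y [^] n) ` A)"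
proof (induction n)
 case 0
 have "A <= (\<otimes>) (y [^] (0::nat)) ` A" using subringE(1)[OF A(1)] by (force simp: image_iff)
 then show ?case by (intro exI[of _ "[]"]) simp
next
 case (Suc n)
 note s = subringE[OF A(1)]
 then obtain D' where D': "length D' = n * length D" "set D' <= A" "A <= lspan L D' ((\<otimes>) (y [^] n) ` A)" using Suc by blast
 have yc: "y \<in> carrier R" using y s(1) by blast
 have yn: "y [^] n \<in> A" using s(3,6) y by (induction n) auto
 define E where "E = map ((\<otimes>) (y [^] n)) D"
 have Lc: "L <= carrier R" and Dc: "set D <= carrier R" using A(2) D(1) s(1) by auto
 have Nc: "(\<otimes>) y ` A <= carrier R" using s(1) yc by auto
 have "(\<otimes>) (y [^] n) ` A <= lspan L E ((\<otimes>) (y [^] Suc n) ` A)"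
 proof
  fix w assume "w \<in> (\<otimes>) (y [^] n) ` A"
  then obtain a where a: "a \<in> A" "w = y [^] n \<otimes> a" by blast
  then have "w \<in> lspan L E ((\<otimes>) (y [^] n) ` (\<otimes>) y ` A)"
   using lspan_mult[OF Lc _ Dc Nc, of "y [^] n" a] D(2) yc unfolding E_def by auto
  moreover have "(\<otimes>) (y [^] n) ` (\<otimes>) y ` A = (\<otimes>) (y [^] Suc n) ` A"
   unfolding image_image by (rule image_cong) (use s(1) yc in \<open>auto simp: m_assoc\<close>)
  ultimately show "w \<in> lspan L E ((\<otimes>) (y [^] Suc n) ` A)" by simp
 qed
 then have "A <= lspan L (D' @ E) ((\<otimes>) (y [^] Suc n) ` A)" unfolding lspan_append using D'(3) lspan_mono by blast
 moreover have "set (D' @ E) <= A" unfolding E_def using D'(2) D(1) yn s(6) by auto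
 moreover have "length (D' @ E) = Suc n * length D" using D'(1) unfolding E_def by simp
 ultimately show ?case by blast
qed

text \<open>Growth comparison. The products \<open>f (a, b)\<close> of powers of \<open>z\<close>,
  \<open>z'\<close> and \<open>y\<close> have pairwise different values for \<open>\<O>\<close>, and
  there are quadratically many of them. If \<open>A\<close> were finite-dimensional modulo
  \<open>y\<close>, a non-trivial combination would lie in \<open>y [^] n\<close> times
  \<open>A\<close>; but its value for \<open>\<W>\<close> is that of a single product and is too
  small.\<close>

lemma no_finite_reduction:
 assumes L: "subfield L R" and w: "\<W> \<in> vals L" and v: "\<O> \<in> vals L" "vunits \<O> <= vunits \<W>"
  and A: "subring A R" "L <= A" "A <= \<W>" and y: "y \<in> vmax \<W>" "y ~= \<zero>" "y \<in> A"
  and z: "z \<in> A" "z' \<in> A" "veq \<W> z z'" "~ veq \<O> z z'" and C: "y [^] (C::nat) \<otimes> inv z' \<in> \<W>"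
  and D: "set D <= A"
 shows "~ A <= lspan L D ((\<otimes>) y ` A)"
proof
 assume fin: "A <= lspan L D ((\<otimes>) y ` A)"
 note s = subringE[OF A(1)]
 have vW: "valring \<W>" and vO: "valring \<O>" using w v(1) unfolding vals_def by auto
 have sW: "subring \<W> R" using vW unfolding valring_def by blast
 note ws = subringE[OF sW]
 have yU: "y \<in> Units R" using vmax_in(1)[OF vW y(1)] y(2) Units_iff by blast
 have zU: "z \<in> Units R" "z' \<in> Units R" using z(3) unfolding veq_def by auto
 \<comment> \<open>The choice gives \<open>n * length D <= B * (B + 1)\<close>, which is less than
   the number of products. By hypothesis \<open>C\<close> the value of every product is at most
   \<open>C * B + B\<close> times that of \<open>y\<close>, so \<open>n\<close> exceeds this by
   one.\<close>
 define B where "B = length D * (C + 1)"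
 define n where "n = C * B + B + 1"
 obtain D' where D': "length D' = n * length D" "set D' <= A" "A <= lspan L D' ((\<otimes>) (y [^] n) ` A)"
  using filtration_span[OF L A(1,2) y(3) D fin] by blast
 have powA: "a [^] (i::nat) \<in> A" if "a \<in> A" for a i using s(3,6) that by (induction i) auto
 define I where "I = {..B} \<times> {..B}"
 define f where "f = (%(a, b). z [^] (a::nat) \<otimes> z' [^] (B - a) \<otimes> y [^] (b::nat))"
 have fA: "f i \<in> A" for i unfolding f_def using s(6) powA z(1,2) y(3) by (auto split: prod.split)
 have fU: "f i \<in> Units R" for i unfolding f_def using Units_pow zU yU by (auto split: prod.split)
 define N where "N = (\<otimes>) (y [^] n) ` A"
 have yn: "y [^] n \<in> carrier R" using yU Units_closed by auto
 have N: "lsubspace L N"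
 proof (rule lsubspaceI)
  show "N <= carrier R" unfolding N_def using s(1) yn by auto
  have "\<zero> = y [^] n \<otimes> \<zero>" using yn by simp
  then show "\<zero> \<in> N" unfolding N_def using s(2) by blast
  show "u \<oplus> u' \<in> N" if uu: "u \<in> N" "u' \<in> N" for u u'
  proof -
   obtain a a' where a: "a \<in> A" "u = y [^] n \<otimes> a" "a' \<in> A" "u' = y [^] n \<otimes> a'" using uu unfolding N_def by blast
   have "a \<in> carrier R" "a' \<in> carrier R" using a s(1) by auto
   then have "u \<oplus> u' = y [^] n \<otimes> (a \<oplus> a')" unfolding a using yn by (simp add: r_distr)
   then show ?thesis unfolding N_def using s(7) a by blast
  qed
  show "c \<otimes> u \<in> N" if cu: "c \<in> L" "u \<in> N" for c u
  proof -
   obtain a where a: "a \<in> A" "u = y [^] n \<otimes> a" using cu unfolding N_def by blast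
   have "a \<in> carrier R" "c \<in> carrier R" using a cu A(2) s(1) by auto
   then have "c \<otimes> u = y [^] n \<otimes> (c \<otimes> a)" unfolding a using yn by (simp add: m_lcomm)
   then show ?thesis unfolding N_def using s(6) a cu A(2) by blast
  qed
 qed
 have cI: "card I = (B + 1) * (B + 1)" unfolding I_def by (simp add: card_cartesian_product)
 have "n <= (C + 1) * (B + 1)" unfolding n_def by (simp add: algebra_simps)
 then have "n * length D <= (C + 1) * (B + 1) * length D" by (rule mult_le_mono1)
 also have "\<dots> = B * (B + 1)" unfolding B_def by (simp add: algebra_simps)
 also have "\<dots> < (B + 1) * (B + 1)" by simp
 finally have "length D' < card I" using D'(1) cI by simp
 moreover have "set D' <= carrier R" using D'(2) s(1) by blast
 moreover have fI: "finite I" unfolding I_def by simp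
 moreover have "f i \<in> lspan L D' N" for i using fA D'(3) unfolding N_def by blast
 ultimately obtain c where c: "ALL i:I. c i \<in> L" "EX i:I. c i ~= \<zero>" "(\<Oplus>i\<in>I. c i \<otimes> f i) \<in> N"
  using lspan_dependence[OF L N, of D' I f] by blast
 define I0 where "I0 = {i \<in> I. c i ~= \<zero>}"
 have I0: "finite I0" "I0 ~= {}" "I0 <= I" unfolding I0_def using fI c(2) by auto
 have cc: "c i \<in> carrier R" if "i \<in> I" for i using c(1) that A(2) s(1) by blast
 have cv: "veq \<O> (c i) \<one>" if "i \<in> I0" for i using subfield_vunits[OF L v(1), of "c i"] c(1) that veq_one[OF vO] unfolding I0_def by auto
 have fc: "f i \<in> carrier R" for i using fU Units_closed by blast
 have sum: "(\<Oplus>i\<in>I. c i \<otimes> f i) = (\<Oplus>i\<in>I0. c i \<otimes> f i)"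
  by (rule add.finprod_mono_neutral_cong_right) (use fI I0(3) cc fc in \<open>auto simp: I0_def\<close>)
 have g: "veq \<O> (c i \<otimes> f i) (f i)" if "i \<in> I0" for i using veq_mult[OF vO cv[OF that] veq_refl[OF vO fU]] fc by simp
 \<comment> \<open>For \<open>\<W>\<close> the elements \<open>z\<close> and \<open>z'\<close> are
   indistinguishable, so the value depends on \<open>b\<close> alone. Equal values for
   \<open>\<O>\<close> thus force equal \<open>b\<close>, and then \<open>\<O>\<close> separates the
   exponents \<open>a\<close>.\<close>
 have fW: "veq \<W> (f (a, b)) (z' [^] B \<otimes> y [^] b)" if "a <= B" for a b
 proof -
  have "veq \<W> (z [^] a \<otimes> z' [^] (B - a)) (z' [^] a \<otimes> z' [^] (B - a))"
   by (rule veq_mult[OF vW veq_pow[OF vW z(3)] veq_refl[OF vW]]) (use Units_pow zU in blast)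
  moreover have "z' [^] a \<otimes> z' [^] (B - a) = z' [^] B" using nat_pow_mult[of z' a "B - a"] zU Units_closed that by simp
  ultimately show ?thesis unfolding f_def using veq_mult[OF vW _ veq_refl[OF vW Units_pow[OF yU]]] by simp
 qed
 have lt: False if ab: "a < a'" "a' <= B" and e: "veq \<O> (f (a, b)) (f (a', b))" for a a' b
 proof -
  define d where "d = a' - a"
  define e where "e = z [^] a \<otimes> z' [^] (B - a') \<otimes> y [^] b"
  have eU: "e \<in> Units R" unfolding e_def using Units_pow zU yU by simp
  have c': "z \<in> carrier R" "z' \<in> carrier R" "y \<in> carrier R" using zU yU Units_closed by auto
  have "z' [^] (B - a) = z' [^] (B - a') \<otimes> z' [^] d" using nat_pow_mult[of z' "B - a'" d] c' ab unfolding d_def by simp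
  then have 1: "f (a, b) = e \<otimes> z' [^] d" unfolding f_def e_def using c' by (simp add: m_ac)
  have "z [^] a' = z [^] a \<otimes> z [^] d" using nat_pow_mult[of z a d] c' ab unfolding d_def by simp
  then have 2: "f (a', b) = e \<otimes> z [^] d" unfolding f_def e_def using c' by (simp add: m_ac)
  have "veq \<O> (z' [^] d) (z [^] d)" by (rule veq_cancel[OF vO eU]) (use that(3) 1 2 Units_pow zU in simp_all)
  moreover have "1 <= d" using ab d_def by arith
  ultimately have "veq \<O> z' z" using veq_root[OF vO] zU by blast
  then show False using veq_sym[OF vO] z(4) by blast
 qed
 have ne: "~ veq \<O> (c i \<otimes> f i) (c j \<otimes> f j)" if ij: "i \<in> I0" "j \<in> I0" "i ~= j" for i j
 proof
  assume "veq \<O> (c i \<otimes> f i) (c j \<otimes> f j)"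
  then have fij: "veq \<O> (f i) (f j)" using veq_trans[OF vO veq_trans[OF vO veq_sym[OF vO g[OF ij(1)]]] g[OF ij(2)]] by blast
  obtain a b a' b' where i: "i = (a, b)" "j = (a', b')" by fastforce
  have le: "a <= B" "a' <= B" using ij(1,2) I0(3) unfolding i I_def by auto
  have "veq \<W> (z' [^] B \<otimes> y [^] b) (z' [^] B \<otimes> y [^] b')"
   using veq_trans[OF vW veq_trans[OF vW veq_sym[OF vW fW[OF le(1)]]] fW[OF le(2)]] veq_mono[OF fij v(2)] unfolding i by blast
  then have b: "b = b'" using veq_vmax_pow[OF vW y(1,2) Units_pow[OF zU(2)]] by blast
  then have "a ~= a'" using ij(3) i by simp
  then show False using lt[OF _ le(2)] lt[OF _ le(1)] fij veq_sym[OF vO fij] unfolding i b by (metis linorder_neqE_nat)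
 qed
 have gU: "c i \<otimes> f i \<in> Units R" if "i \<in> I0" for i using g[OF that] unfolding veq_def by blast
 obtain i where i: "i \<in> I0" "veq \<O> (\<Oplus>i\<in>I0. c i \<otimes> f i) (c i \<otimes> f i)"
 proof -
  have "EX i:I0. veq \<O> (\<Oplus>i\<in>I0. c i \<otimes> f i) (c i \<otimes> f i)"
   by (rule dominant_finsum[OF vO I0(1,2)]) (erule gU, erule (2) ne)
  then show thesis using that by (elim bexE)
 qed
 obtain a b where ab: "i = (a, b)" by fastforce
 have le: "a <= B" "b <= B" using i(1) I0(3) unfolding ab I_def by auto
 obtain \<alpha> where \<alpha>: "\<alpha> \<in> A" "(\<Oplus>i\<in>I. c i \<otimes> f i) = y [^] n \<otimes> \<alpha>" using c(3) unfolding N_def by blast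
 have "veq \<O> (\<Oplus>i\<in>I0. c i \<otimes> f i) (f i)" by (rule veq_trans[OF vO i(2) g[OF i(1)]])
 then have "veq \<W> (y [^] n \<otimes> \<alpha>) (z' [^] B \<otimes> y [^] b)"
  using veq_trans[OF vW veq_mono[OF _ v(2)] fW[OF le(1), of b]] sum \<alpha>(2) ab by simp
 define p where "p = y [^] C \<otimes> inv z'"
 have pU: "p \<in> Units R" unfolding p_def using Units_pow yU zU by simp
 have c': "z' \<in> carrier R" "y \<in> carrier R" "p \<in> carrier R" "\<alpha> \<in> carrier R" using zU yU pU Units_closed \<alpha>(1) s(1) by auto
 have pz: "z' \<otimes> p = y [^] C" unfolding p_def using zU(2) c' Units_cancel(3) by simp
 have pzB: "z' [^] B \<otimes> p [^] B = y [^] (C * B)" using pow_mult_distrib[OF m_comm, of z' p B] c' pz nat_pow_pow[of y C B] by simp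
 have \<alpha>U: "\<alpha> \<in> Units R"
 proof -
  have "y [^] n \<otimes> \<alpha> \<in> Units R" using \<open>veq \<W> (y [^] n \<otimes> \<alpha>) _\<close> unfolding veq_def by blast
  then have "\<alpha> ~= \<zero>" using yn by (metis Units_iff r_null)
  then show ?thesis using c' Units_iff by blast
 qed
 \<comment> \<open>Cancelling \<open>y [^] (C * B + b)\<close> in the comparison of values makes
   \<open>q\<close> a unit of \<open>\<W>\<close>, yet it contains the positive power
   \<open>1 + B - b\<close> of \<open>y\<close>.\<close>
 define q where "q = y [^] (1 + B - b) \<otimes> (\<alpha> \<otimes> p [^] B)"
 have qU: "q \<in> Units R" unfolding q_def using Units_pow yU \<alpha>U pU by simp
 have "veq \<W> (y [^] n \<otimes> \<alpha> \<otimes> p [^] B) (z' [^] B \<otimes> y [^] b \<otimes> p [^] B)"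
  by (rule veq_mult[OF vW \<open>veq \<W> (y [^] n \<otimes> \<alpha>) _\<close> veq_refl[OF vW Units_pow[OF pU]]])
 moreover have "z' [^] B \<otimes> y [^] b \<otimes> p [^] B = y [^] (C * B + b) \<otimes> \<one>"
 proof -
  have "z' [^] B \<otimes> y [^] b \<otimes> p [^] B = (z' [^] B \<otimes> p [^] B) \<otimes> y [^] b" using c' by (simp add: m_ac)
  then show ?thesis using pzB nat_pow_mult[of y "C * B" b] c' by simp
 qed
 moreover have "y [^] n \<otimes> \<alpha> \<otimes> p [^] B = y [^] (C * B + b) \<otimes> q"
 proof -
  have "n = (C * B + b) + (1 + B - b)" unfolding n_def using le by simp
  then have "y [^] n = y [^] (C * B + b) \<otimes> y [^] (1 + B - b)" using nat_pow_mult[of y "C * B + b" "1 + B - b"] c' by simp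
  then show ?thesis unfolding q_def using c' by (simp add: m_assoc)
 qed
 ultimately have "veq \<W> (y [^] (C * B + b) \<otimes> q) (y [^] (C * B + b) \<otimes> \<one>)" by simp
 then have "veq \<W> q \<one>" by (rule veq_cancel[OF vW Units_pow[OF yU] qU Units_one_closed])
 then have "q \<in> vunits \<W>" using veq_one[OF vW] by blast
 moreover have "q \<in> vmax \<W>"
 proof -
  have "p [^] B \<in> \<W>" using C[folded p_def] ws(3,6) by (induction B) auto
  then have "\<alpha> \<otimes> p [^] B \<in> \<W>" using \<alpha>(1) A(3) ws(6) by blast
  moreover have "y [^] (1 + B - b) \<in> vmax \<W>" by (rule vmax_pow[OF vW y(1)]) (use le in simp)
  ultimately show ?thesis unfolding q_def by (rule vmax_mult[OF vW, rotated])
 qed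
 ultimately show False unfolding vmax_def by blast
qed

lemma inv_in_valring: "valring \<W> ==> x \<in> Units R ==> x [^] n \<in> \<W> ==> n \<ge> (1::nat) ==> x \<in> \<W>"
proof (rule ccontr)
 assume v: "valring \<W>" "x \<in> Units R" "x [^] n \<in> \<W>" "n \<ge> 1" and n: "x ~: \<W>"
 have i: "inv x \<in> \<W>" using v(1,2) n unfolding valring_def by blast
 have "inv x \<in> vmax \<W>" using i v(2) n unfolding vmax_def vunits_def by simp
 then have "inv x [^] n \<in> vmax \<W>" using vmax_pow[OF v(1)] v(4) by blast
 then have "inv x [^] n \<otimes> x [^] n \<in> vmax \<W>" using vmax_mult[OF v(1)] v(3) by blast
 moreover have "inv x [^] n \<otimes> x [^] n = \<one>" using v(2) Units_closed by (simp add: pow_mult_distrib[symmetric] m_comm)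
 ultimately show False using vunits_one[OF v(1)] unfolding vmax_def by simp
qed

text \<open>If every \<open>s\<close> were algebraic over \<open>L\<close> modulo \<open>y\<close>,
  the ring \<open>A\<close> would be finite-dimensional modulo \<open>y\<close>, contrary to
  \<open>no_finite_reduction\<close>. The inverses of \<open>S\<close> are included so that
  \<open>S\<close> consists of units in every valuation ring above \<open>A\<close>.\<close>

lemma transcendental_generator:
 assumes L: "subfield L R" and w: "\<W> \<in> vals L" and v: "\<O> \<in> vals L" "vunits \<O> <= vunits \<W>"
  and S: "finite S" "S <= vunits \<W>" and y: "y \<in> vmax \<W>" "y ~= \<zero>"
  and A: "A = generate_ring R (L Un insert y (S Un m_inv R ` S))"
  and z: "z \<in> A" "z' \<in> A" "veq \<W> z z'" "~ veq \<O> z z'" and C: "y [^] (C::nat) \<otimes> inv z' \<in> \<W>"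
 shows "EX s:S. ALL q. set q <= L & eval q s \<in> (\<otimes>) y ` A --> set q <= {\<zero>}"
proof (rule ccontr)
 assume n: "~ ?thesis"
 have vW: "valring \<W>" using w unfolding vals_def by auto
 have sW: "subring \<W> R" using vW unfolding valring_def by blast
 have SU: "s \<in> Units R" "s \<in> \<W>" "inv s \<in> \<W>" if "s \<in> S" for s using that S(2) unfolding vunits_def by auto
 define F where "F = insert y (S Un m_inv R ` S)"
 have FW: "L Un F <= \<W>" using w y SU vmax_in[OF vW] unfolding F_def vals_def by auto
 have Fc: "L Un F <= carrier R" using FW subringE(1)[OF sW] by blast
 have sA: "subring A R" unfolding A F_def[symmetric] by (rule generate_ring_is_subring[OF Fc])
 note s = subringE[OF sA]
 have up: "L Un F <= A" unfolding A F_def by (intro subsetI generate_ring.incl)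
 have AW: "A <= \<W>" unfolding A F_def[symmetric] by (rule generate_ring_min_subring1[OF Fc sW FW])
 have yA: "y \<in> A" and yc: "y \<in> carrier R" using up s(1) F_def by auto
 define J where "J = (\<otimes>) y ` A"
 have J: "lsubspace A J"
 proof (rule lsubspaceI)
  show "J <= carrier R" unfolding J_def using s(1) yc by auto
  have "\<zero> = y \<otimes> \<zero>" using yc by simp
  then show "\<zero> \<in> J" unfolding J_def using s(2) by blast
  show "u \<oplus> u' \<in> J" if uu: "u \<in> J" "u' \<in> J" for u u'
  proof -
   obtain a a' where a: "a \<in> A" "u = y \<otimes> a" "a' \<in> A" "u' = y \<otimes> a'" using uu unfolding J_def by blast
   have "a \<in> carrier R" "a' \<in> carrier R" using a s(1) by auto
   then have "u \<oplus> u' = y \<otimes> (a \<oplus> a')" unfolding a using yc by (simp add: r_distr)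
   then show ?thesis unfolding J_def using s(7) a by blast
  qed
  show "c \<otimes> u \<in> J" if cu: "c \<in> A" "u \<in> J" for c u
  proof -
   obtain a where a: "a \<in> A" "u = y \<otimes> a" using cu unfolding J_def by blast
   have "a \<in> carrier R" "c \<in> carrier R" using a cu s(1) by auto
   then have "c \<otimes> u = y \<otimes> (c \<otimes> a)" unfolding a using yc by (simp add: m_lcomm)
   then show ?thesis unfolding J_def using s(6) a cu by blast
  qed
 qed
 have LA: "L <= A" using up by blast
 have rel: "EX q. set q <= L & ~ set q <= {\<zero>} & eval q s \<in> J" if "s \<in> S" for s
  using n that unfolding J_def by blast
 have "EX q. set q <= L & ~ set q <= {\<zero>} & eval q x \<in> J" if x: "x \<in> F" for x
 proof -
  consider "x = y" | "x \<in> S" | s where "s \<in> S" "x = inv s" using x unfolding F_def by blast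
  then show ?thesis
  proof cases
   case 1
   have "eval [\<one>, \<zero>] y = y \<otimes> \<one>" using yc by simp
   then have "eval [\<one>, \<zero>] y \<in> J" unfolding J_def using s(3) by blast
   then show ?thesis unfolding 1 using subringE(2,3)[OF subfieldE(1)[OF L]] by (intro exI[of _ "[\<one>, \<zero>]"]) auto
  next
   case 2
   then show ?thesis by (rule rel)
  next
   case (3 t)
   obtain q where q: "set q <= L" "~ set q <= {\<zero>}" "eval q t \<in> J" using rel[OF 3(1)] by blast
   have t: "t \<in> A" "inv t \<in> A" using up 3(1) unfolding F_def by auto
   have "set q <= A" using q(1) LA by blast
   then show ?thesis using reverse_relation[OF sA t(1) SU(1)[OF 3(1)] t(2) J _ q(2,3)] q(1) unfolding 3(2) by blast
  qed
 qed
 moreover have "finite F" "F <= A" using S(1) up unfolding F_def by auto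
 ultimately obtain D where D: "set D <= A" "generate_ring R (L Un F) <= lspan L D J"
  using finitely_generated_span[OF L sA LA J, of F] by blast
 then have "A <= lspan L D ((\<otimes>) y ` A)" unfolding A F_def J_def by blast
 then show False using no_finite_reduction[OF L w v sA LA AW y yA z C D(1)] by blast
qed

text \<open>All non-zero polynomials in \<open>s\<close> over \<open>L\<close> are inverted. None of
  them is divisible by \<open>y\<close> in \<open>A\<close>, so \<open>y\<close> remains a non-unit
  and Chevalley's theorem applies.\<close>

lemma localised_valuation:
 assumes L: "subring L R" and A: "subring A R" "L <= A" and s: "s \<in> A" and y: "y \<in> A"
  and tr: "!!q. set q <= L ==> eval q s \<in> (\<otimes>) y ` A ==> set q <= {\<zero>}"
 shows "EX \<O>. valring \<O> & A <= \<O> & fracs (simple_extension L s) <= \<O> & y \<in> vmax \<O>"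
proof -
 note a = subringE[OF A(1)]
 define E where "E = simple_extension L s"
 have Lc: "L <= carrier R" using subringE(1)[OF L] .
 have sc: "s \<in> carrier R" and yc: "y \<in> carrier R" using s y a(1) by auto
 have sE: "subring E R" unfolding E_def by (rule simple_extension_is_subring[OF L sc])
 note e = subringE[OF sE]
 have EA: "E <= A" unfolding E_def
 proof
  fix x assume "x \<in> simple_extension L s"
  then show "x \<in> A"
  proof induction
   case zero
   show ?case by (rule a(2))
  next
   case (lin k1 k2)
   show ?case by (rule a(7)[OF a(6)[OF lin.IH s] subsetD[OF A(2) lin.hyps(2)]])
  qed
 qed
 define B where "B = {x \<in> carrier R. EX q:E. q ~= \<zero> & x \<otimes> q \<in> A}"
 have B: "subring B R"
 proof (rule subringI)
  show "B <= carrier R" unfolding B_def by blast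
  show "\<one> \<in> B" unfolding B_def using e(3) a(3) by (auto intro!: bexI[of _ \<one>])
  show "\<ominus> h \<in> B" if h: "h \<in> B" for h
  proof -
   obtain q where q: "h \<in> carrier R" "q \<in> E" "q ~= \<zero>" "h \<otimes> q \<in> A" using h unfolding B_def by blast
   have "q \<in> carrier R" using q e(1) by blast
   then have "\<ominus> h \<otimes> q = \<ominus> (h \<otimes> q)" using q by (simp add: l_minus)
   then show ?thesis unfolding B_def using q a(5) by auto
  qed
  fix h h' assume "h \<in> B" "h' \<in> B"
  then obtain q q' where q: "h \<in> carrier R" "q \<in> E" "q ~= \<zero>" "h \<otimes> q \<in> A"
   "h' \<in> carrier R" "q' \<in> E" "q' ~= \<zero>" "h' \<otimes> q' \<in> A" unfolding B_def by blast
  have c: "q \<in> carrier R" "q' \<in> carrier R" using q e(1) by auto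
  have qq: "q \<otimes> q' \<in> E" "q \<otimes> q' ~= \<zero>" using q e(6) c integral by blast+
  have qA: "q \<in> A" "q' \<in> A" using q EA by auto
  have "(h \<otimes> h') \<otimes> (q \<otimes> q') = (h \<otimes> q) \<otimes> (h' \<otimes> q')" using q c by (simp add: m_ac)
  then have "(h \<otimes> h') \<otimes> (q \<otimes> q') \<in> A" using a(6) q by simp
  then show "h \<otimes> h' \<in> B" unfolding B_def using q qq by auto
  have "(h \<oplus> h') \<otimes> (q \<otimes> q') = (h \<otimes> q) \<otimes> q' \<oplus> (h' \<otimes> q') \<otimes> q" using q(1,5) c by algebra
  then have "(h \<oplus> h') \<otimes> (q \<otimes> q') \<in> A" using a(6,7) q qA by simp
  then show "h \<oplus> h' \<in> B" unfolding B_def using q qq by auto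
 qed
 have AB: "A <= B"
 proof
  fix x assume x: "x \<in> A"
  then have "x \<in> carrier R" using a(1) by blast
  then show "x \<in> B" unfolding B_def using x e(3) by (auto intro!: bexI[of _ \<one>])
 qed
 have fB: "fracs E <= B"
 proof
  fix x assume "x \<in> fracs E"
  then show "x \<in> B" unfolding fracs_iff[OF sE] B_def using EA by blast
 qed
 have id: "x \<in> (\<otimes>) y ` B" if "x \<in> idl B {y}" for x using that
 proof induction
  case zero
  have "\<zero> = y \<otimes> \<zero>" using yc by simp
  then show ?case using subringE(2)[OF B] by blast
 next
  case (step b j u)
  then obtain b' where b': "u = y \<otimes> b'" "b' \<in> B" by blast
  have c: "b \<in> carrier R" "b' \<in> carrier R" using step b' subringE(1)[OF B] by auto
  have "b \<otimes> j \<oplus> u = y \<otimes> (b \<oplus> b')" using step b' c yc by (simp add: r_distr m_comm)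
  then show ?case using subringE(7)[OF B] step b' by blast
 qed
 have "\<one> ~: idl B {y}"
 proof
  assume "\<one> \<in> idl B {y}"
  then obtain b where b: "\<one> = y \<otimes> b" "b \<in> B" using id by blast
  obtain q where q: "q \<in> E" "q ~= \<zero>" "b \<otimes> q \<in> A" using b(2) unfolding B_def by blast
  have c: "b \<in> carrier R" "q \<in> carrier R" using b(2) q e(1) B_def by auto
  have "q = y \<otimes> (b \<otimes> q)" using b(1) c yc by (metis l_one m_assoc)
  then have qJ: "q \<in> (\<otimes>) y ` A" using q(3) by blast
  obtain p where p: "set p <= L" "eval p s = q" using q(1) simple_extension_eval[OF Lc sc] unfolding E_def by blast
  then have "set p <= {\<zero>}" using tr qJ by blast
  then show False using eval_zero_coeffs[OF _ sc] p(2) q(2) by blast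
 qed
 moreover have "{y} <= B" using y AB by blast
 ultimately obtain \<O> where "valring \<O>" "B <= \<O>" "{y} <= vmax \<O>" using chevalley[OF B] by blast
 then show ?thesis using AB fB unfolding E_def by blast
qed

text \<open>An Archimedean property. Non-zero polynomials in \<open>y\<close> over \<open>L\<close>
  have the value of a power of \<open>y\<close>, and \<open>z\<close> is algebraic over the field
  they generate, so a tie gives some power of \<open>z\<close> the value of a quotient of powers of
  \<open>y\<close>.\<close>

lemma power_of_parameter:
 assumes L: "subfield L R" and w: "\<W> \<in> vals L" and y: "y \<in> vmax \<W>" "y ~= \<zero>"
  and K: "subfield K R" "K <= fracs (simple_extension L y)"
  and z: "z \<in> Units R" "!!\<O>. \<O> \<in> vals K ==> z \<in> vunits \<O>"
 shows "EX C::nat. y [^] C \<otimes> inv z \<in> \<W>"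
proof -
 have vW: "valring \<W>" using w unfolding vals_def by auto
 have sW: "subring \<W> R" using vW unfolding valring_def by blast
 note ws = subringE[OF sW]
 have yc: "y \<in> carrier R" by (rule vmax_in(1)[OF vW y(1)])
 have yU: "y \<in> Units R" using yc y(2) Units_iff by blast
 have Lc: "L <= carrier R" by (rule subfieldE(3)[OF L])
 have sE: "subring (simple_extension L y) R" by (rule simple_extension_is_subring[OF subfieldE(1)[OF L] yc])
 have dom: "EX i::nat. veq \<W> a (y [^] i)" if a: "a \<in> simple_extension L y" "a ~= \<zero>" for a
 proof -
  obtain p where p: "set p <= L" "eval p y = a" using a(1) simple_extension_eval[OF Lc yc] by blast
  have nz: "~ set p <= {\<zero>}" using eval_zero_coeffs[OF _ yc] p(2) a(2) by blast
  have u: "veq \<W> c \<one>" if "c \<in> set p - {\<zero>}" for c using subfield_vunits[OF L w, of c] p(1) that veq_one[OF vW] by auto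
  have cy: "veq \<W> (c \<otimes> y [^] i) (y [^] i)" if "c \<in> set p - {\<zero>}" for c and i :: nat
   using veq_mult[OF vW u[OF that] veq_refl[OF vW Units_pow[OF yU]], of i] yc by simp
  have "EX c:set p - {\<zero>}. EX i<length p. veq \<W> (eval p y) (c \<otimes> y [^] i)"
  proof (rule poly_dominant_term[OF vW _ nz yU])
   show "set p <= carrier R" using p(1) Lc by blast
   fix c d i j assume cd: "c \<in> set p - {\<zero>}" "d \<in> set p - {\<zero>}" "j < i" "i < length p"
   show "~ veq \<W> (c \<otimes> y [^] i) (d \<otimes> y [^] (j::nat))"
   proof
    assume "veq \<W> (c \<otimes> y [^] i) (d \<otimes> y [^] j)"
    then have "veq \<W> (y [^] i) (y [^] j)" using veq_trans[OF vW veq_trans[OF vW veq_sym[OF vW cy[OF cd(1)]]] cy[OF cd(2)]] by blast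
    then have "veq \<W> (\<one> \<otimes> y [^] i) (\<one> \<otimes> y [^] j)" using yc by simp
    then have "i = j" by (rule veq_vmax_pow[OF vW y Units_one_closed])
    then show False using cd(3) by simp
   qed
  qed
  then obtain c and i :: nat where c: "c \<in> set p - {\<zero>}" "veq \<W> (eval p y) (c \<otimes> y [^] i)" by blast
  then show ?thesis using veq_trans[OF vW c(2) cy[OF c(1)]] p(2) by blast
 qed
 obtain p where p: "set p <= simple_extension L y" "~ set p <= {\<zero>}" "eval p z = \<zero>"
  using algebraic_over_fracs[OF sE K z] by blast
 have pc: "set p <= carrier R" using p(1) subringE(1)[OF sE] by blast
 obtain a b i j where t: "a \<in> set p - {\<zero>}" "b \<in> set p - {\<zero>}" "i < j" "veq \<W> (a \<otimes> z [^] i) (b \<otimes> z [^] (j::nat))"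
  using poly_tie[OF vW pc p(2) z(1) p(3)] by blast
 have ab: "a \<in> Units R" "b \<in> Units R" using t pc Units_iff by auto
 define e where "e = j - i"
 have e1: "e \<ge> 1" using t(3) e_def by arith
 have "veq \<W> (a \<otimes> inv b) (z [^] e)" unfolding e_def by (rule veq_pow_diff[OF vW t(4,3) ab z(1)])
 obtain m n :: nat where mn: "veq \<W> a (y [^] m)" "veq \<W> b (y [^] n)" using dom t p(1) by blast
 have yp: "y [^] (i::nat) \<in> Units R" for i using Units_pow[OF yU] .
 have 1: "veq \<W> (z [^] e) (y [^] m \<otimes> inv (y [^] n))"
  using veq_trans[OF vW veq_sym[OF vW \<open>veq \<W> (a \<otimes> inv b) (z [^] e)\<close>] veq_mult[OF vW mn(1) veq_inv[OF vW mn(2)]]] .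
 \<comment> \<open>Since \<open>z [^] e\<close> has the value of \<open>y [^] m\<close> over
   \<open>y [^] n\<close>, the power \<open>x [^] e\<close> has that of \<open>y\<close> to the
   exponent \<open>n + m * (e - 1)\<close>. It lies in \<open>\<W>\<close>, and so does its root
   \<open>x\<close>.\<close>
 define x where "x = y [^] m \<otimes> inv z"
 have xU: "x \<in> Units R" unfolding x_def using yp z(1) by simp
 have zc: "z \<in> carrier R" "inv z \<in> carrier R" "x \<in> carrier R" using z(1) xU Units_closed by auto
 have xz: "z \<otimes> x = y [^] m" unfolding x_def using Units_cancel(3)[OF z(1)] yc by simp
 have e2: "z [^] e \<otimes> x [^] e = y [^] (m * e)" using pow_mult_distrib[OF m_comm, of z x e] zc xz nat_pow_pow[of y m e] yc by simp
 have "veq \<W> (z [^] e \<otimes> x [^] e) (y [^] m \<otimes> inv (y [^] n) \<otimes> x [^] e)"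
  by (rule veq_mult[OF vW 1 veq_refl[OF vW Units_pow[OF xU]]])
 moreover have "m * e = m + m * (e - 1)" using e1 by (cases e) auto
 ultimately have "veq \<W> (y [^] m \<otimes> y [^] (m * (e - 1))) (y [^] m \<otimes> (inv (y [^] n) \<otimes> x [^] e))"
  unfolding e2 using nat_pow_mult[of y m "m * (e - 1)"] yc yp[of n] zc by (simp add: m_assoc)
 then have "veq \<W> (y [^] (m * (e - 1))) (inv (y [^] n) \<otimes> x [^] e)" by (rule veq_cancel[OF vW yp yp, rotated]) (use yp xU Units_pow in simp)
 then have "veq \<W> (y [^] n \<otimes> y [^] (m * (e - 1))) (y [^] n \<otimes> (inv (y [^] n) \<otimes> x [^] e))"
  by (rule veq_mult[OF vW veq_refl[OF vW yp]])
 then have "veq \<W> (y [^] n \<otimes> y [^] (m * (e - 1))) (x [^] e)" using Units_cancel(1)[OF yp, of "x [^] e" n] zc by simp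
 then have "x [^] e \<otimes> inv (y [^] n \<otimes> y [^] (m * (e - 1))) \<in> \<W>" using veq_sym[OF vW] unfolding veq_def vunits_def by blast
 moreover have yW: "y [^] (i::nat) \<in> \<W>" for i using ws(3,6) vmax_in(2)[OF vW y(1)] by (induction i) auto
 ultimately have "(y [^] n \<otimes> y [^] (m * (e - 1))) \<otimes> (x [^] e \<otimes> inv (y [^] n \<otimes> y [^] (m * (e - 1)))) \<in> \<W>"
  using ws(6) by blast
 then have "x [^] e \<in> \<W>" using Units_cancel(3)[of "y [^] n \<otimes> y [^] (m * (e - 1))" "x [^] e"] yp zc by simp
 then show ?thesis using inv_in_valring[OF vW xU _ e1] x_def by blast
qed

end

section \<open>A second valuation transverse to a given one\<close>

context mult_field
begin

lemma td_insert_acl: "T <= G ==> W <= G ==> T <= W ==> td W = Suc (td T) ==> y \<in> W ==> y ~: acl T ==> W <= acl (insert y T)"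
 using D.rk_eq_imp_cl[of "insert y T" W] D.rk_insert[of T y] by (simp add: subset_iff)

text \<open>The new valuation ring keeps \<open>y\<close> a non-unit and \<open>S\<close> units but
  is taken over \<open>s\<close> and \<open>T2\<close>. Because \<open>td T2 < td T1\<close>, some
  \<open>g\<close> in \<open>T1\<close> is a non-unit of a refinement \<open>\<V>\<close> of
  \<open>\<W>\<close>. As \<open>g\<close> is algebraic over \<open>T2\<close> and \<open>S\<close>,
  a tie carries this into the ring generated by \<open>S\<close>: it yields \<open>z\<close> and
  \<open>z'\<close> that \<open>\<W>\<close> does not separate but \<open>\<V>\<close> does, the
  input of the growth comparison.\<close>

lemma transverse_valuation:
 assumes W: "W <= G" and T: "T2 <= T1" "T1 <= W" and td: "td T2 < td T1" "td W = Suc (td T1)"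
  and w: "\<W> \<in> vals (kf T1)" and y: "y \<in> W" "y \<in> vmax \<W>"
  and S: "finite S" "S <= W" "S <= vunits \<W>" "W <= acl (T2 Un S)"
 shows "EX s:S. EX \<O>:vals (kf (insert s T2)). s ~: acl T2 & y \<in> vmax \<O> & S <= vunits \<O>"
proof -
 have T1G: "T1 <= G" and T2G: "T2 <= G" and SG: "S <= G" using W T S by auto
 have vW: "valring \<W>" by (rule vals_valring[OF w])
 have yU: "y \<in> Units R" and y0: "y ~= \<zero>" using G_Units[of y] y(1) W Units_iff by auto
 define L where "L = kf T2"
 have L: "subfield L R" unfolding L_def by (rule kf_subfield[OF T2G])
 have sL: "subring L R" using subfieldE(1)[OF L] .
 have wL: "\<W> \<in> vals L" unfolding L_def using w vals_mono[OF kf_mono[OF T(1) T1G]] by blast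
 have "~ T1 <= acl T2" using D.rk_mono_cl[of T1 T2] T2G td(1) by auto
 then obtain g where g: "g \<in> T1" "g ~: acl T2" by blast
 have gG: "g \<in> G" using g T1G by blast
 obtain \<U> where u: "\<U> \<in> vals (kf T2)" "g ~: vunits \<U>" using g(2) gG unfolding acl_def by blast
 obtain \<V> where v: "\<V> \<in> vals (kf T2)" "vunits \<V> <= vunits \<W>" "!!x. x \<in> T1 ==> x \<in> vunits \<V> \<longleftrightarrow> x \<in> vunits \<U>"
  using composite[OF T(1) T1G w u(1)] by blast
 have gv: "g ~: vunits \<V>" using v(3)[OF g(1)] u(2) by blast
 have gw: "g \<in> vunits \<W>" using kf_vunits[OF T1G w] g(1) by blast
 have gU: "g \<in> Units R" by (rule G_Units[OF gG])
 have vV: "valring \<V>" by (rule vals_valring[OF v(1)])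
 define F where "F = L Un (S Un m_inv R ` S)"
 define A' where "A' = generate_ring R F"
 define A where "A = generate_ring R (L Un insert y (S Un m_inv R ` S))"
 have SU: "s \<in> Units R" if "s \<in> S" for s using that SG G_Units by blast
 have Fc: "F <= carrier R" unfolding F_def using subfieldE(3)[OF L] SU Units_closed by auto
 have Fy: "L Un insert y (S Un m_inv R ` S) <= carrier R" using Fc yU Units_closed unfolding F_def by blast
 have sA': "subring A' R" unfolding A'_def by (rule generate_ring_is_subring[OF Fc])
 have sA: "subring A R" unfolding A_def by (rule generate_ring_is_subring[OF Fy])
 have A'A: "A' <= A" unfolding A_def A'_def by (rule mono_generate_ring[OF _ Fy]) (auto simp: F_def)
 have FA': "F <= A'" unfolding A'_def by (intro subsetI generate_ring.incl)
 have T2S: "T2 Un S <= G" using T2G SG by blast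
 have kL: "k <= L" "T2 <= L" unfolding L_def using kf_upper[OF T2G] by auto
 have kA': "kf (T2 Un S) <= fracs A'"
  by (rule kf_least[OF T2S fracs_subfield(1)[OF sA']]) (use fracs_subfield(2)[OF sA'] FA' kL F_def in blast)+
 have "g \<in> acl (T2 Un S)" using g(1) T(2) S(4) by blast
 then have "!!\<O>. \<O> \<in> vals (kf (T2 Un S)) ==> g \<in> vunits \<O>" unfolding acl_def by blast
 then obtain p where p: "set p <= A'" "~ set p <= {\<zero>}" "eval p g = \<zero>"
  using algebraic_over_fracs[OF sA' kf_subfield[OF T2S] kA' gU] by blast
 have pc: "set p <= carrier R" using p(1) subringE(1)[OF sA'] by blast
 obtain z z' i j where t: "z \<in> set p - {\<zero>}" "z' \<in> set p - {\<zero>}" "i < j" "veq \<V> (z \<otimes> g [^] i) (z' \<otimes> g [^] (j::nat))"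
  using poly_tie[OF vV pc p(2) gU p(3)] by blast
 have zU: "z \<in> Units R" "z' \<in> Units R" using t pc Units_iff by auto
 have zA: "z \<in> A" "z' \<in> A" "z' \<in> A'" using t p(1) A'A by auto
 define e where "e = j - i"
 have e1: "e \<ge> 1" using t(3) e_def by arith
 have zg: "veq \<V> (z \<otimes> inv z') (g [^] e)" unfolding e_def by (rule veq_pow_diff[OF vV t(4,3) zU gU])
 have "veq \<W> (z \<otimes> inv z') (g [^] e)" by (rule veq_mono[OF zg v(2)])
 moreover have "veq \<W> (g [^] e) \<one>" using veq_one[OF vW] vunits_pow[OF vW gw] by blast
 ultimately have "veq \<W> (z \<otimes> inv z') \<one>" by (rule veq_trans[OF vW])
 then have zw: "veq \<W> z z'" using veq_one[OF vW] zU unfolding veq_def by blast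
 have zv: "~ veq \<V> z z'"
 proof
  assume "veq \<V> z z'"
  then have "veq \<V> (z \<otimes> inv z') \<one>" using veq_one[OF vV] unfolding veq_def by blast
  then have "veq \<V> (g [^] e) \<one>" using veq_trans[OF vV veq_sym[OF vV zg]] by blast
  then have "g [^] e \<in> vunits \<V>" using veq_one[OF vV] by blast
  then show False using vunits_root[OF vV gU e1] gv by blast
 qed
 have y1: "y ~: acl T1" using y(2) w unfolding acl_def vmax_def by blast
 have yT1: "insert y T1 <= G" using y(1) W T1G by blast
 have Wy: "W <= acl (insert y T1)" by (rule td_insert_acl[OF T1G W T(2) td(2) y(1) y1])
 \<comment> \<open>\<open>z'\<close> lies in the field generated by elements algebraic over
   \<open>T1\<close> and \<open>y\<close>, because \<open>td W\<close> exceeds \<open>td T1\<close>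
   by one and \<open>y\<close> is not algebraic over \<open>T1\<close>.\<close>
 have "EX C::nat. y [^] C \<otimes> inv z' \<in> \<W>"
 proof (rule power_of_parameter[OF kf_subfield[OF T1G] w y(2) y0 kf_subfield[OF yT1] kf_insert[OF T1G] zU(2)])
  show "y \<in> G" using y(1) W by blast
  fix \<O> assume O: "\<O> \<in> vals (kf (insert y T1))"
  then have O': "\<O> \<in> vals (kf (acl (insert y T1)))" using vals_kf_acl[OF yT1] by blast
  have aG: "acl (insert y T1) <= G" by (rule acl_in)
  have "F <= kf (acl (insert y T1))"
  proof -
   have sK: "subfield (kf (acl (insert y T1))) R" by (rule kf_subfield[OF aG])
   have "T2 Un S <= acl (insert y T1)" using Wy T S(2) by blast
   then have L': "L <= kf (acl (insert y T1))" and S': "S <= kf (acl (insert y T1))"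
    unfolding L_def using kf_mono[OF _ aG] kf_upper(1)[OF aG] by blast+
   have "inv s \<in> kf (acl (insert y T1))" if "s \<in> S" for s using subfield_m_inv(1)[OF sK, of s] S' that SU[OF that] Units_iff by blast
   then show ?thesis unfolding F_def using L' S' by blast
  qed
  then have "A' <= kf (acl (insert y T1))" unfolding A'_def by (rule generate_ring_min_subring1[OF Fc subfieldE(1)[OF kf_subfield[OF aG]]])
  then have "z' \<in> kf (acl (insert y T1)) - {\<zero>}" using zA(3) t(2) by blast
  then show "z' \<in> vunits \<O>" by (rule kf_vunits_nonzero[OF aG O'])
 qed
 then obtain C :: nat where C: "y [^] C \<otimes> inv z' \<in> \<W>" by blast
 obtain s where s: "s \<in> S" "ALL q. set q <= L & eval q s \<in> (\<otimes>) y ` A --> set q <= {\<zero>}"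
  using transcendental_generator[OF L wL v(1)[folded L_def] v(2) S(1,3) y(2) y0 A_def zA(1,2) zw zv C] by blast
 have up: "L Un insert y (S Un m_inv R ` S) <= A" unfolding A_def by (intro subsetI generate_ring.incl)
 have "L <= A" "s \<in> A" "y \<in> A" using up s(1) by auto
 then obtain \<O> where O: "valring \<O>" "A <= \<O>" "fracs (simple_extension L s) <= \<O>" "y \<in> vmax \<O>"
  using localised_valuation[OF sL sA, of s y] s(2) by blast
 have sG: "s \<in> G" using s(1) SG by blast
 have sc: "s \<in> carrier R" using SU[OF s(1)] Units_closed by blast
 have "kf (insert s T2) <= fracs (simple_extension L s)" unfolding L_def by (rule kf_insert[OF T2G sG])
 then have OK: "\<O> \<in> vals (kf (insert s T2))" using O(1,3) unfolding vals_def by blast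
 have SO: "S <= vunits \<O>"
 proof
  fix x assume "x \<in> S"
  then show "x \<in> vunits \<O>" using SU up O(2) unfolding vunits_def by blast
 qed
 have "s ~: acl T2"
 proof
  assume "s \<in> acl T2"
  then have "!!\<O>. \<O> \<in> vals L ==> s \<in> vunits \<O>" unfolding acl_def L_def by blast
  then obtain q where q: "set q <= L" "~ set q <= {\<zero>}" "eval q s = \<zero>"
   using valg_algebraic[OF L SU[OF s(1)]] by blast
  have "eval q s = y \<otimes> \<zero>" using yU Units_closed q(3) by simp
  then have "eval q s \<in> (\<otimes>) y ` A" using subringE(2)[OF sA] by (rule image_eqI)
  then show False using s(2) q by blast
 qed
 then show ?thesis using s(1) OK O(4) SO by blast
qed

end

section \<open>Semisimplicity\<close>

context mult_field
begin

definition zflat :: "'a set => 'a set => 'a set" where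
 "zflat T W = ic (T Un \<Union>(Z T W))"

lemma zflat_props:
 assumes T: "flat T" and W: "flat W" and TW: "T <= W"
 shows "flat (zflat T W)" "T <= zflat T W" "zflat T W <= W" "!!S. S \<in> Z T W ==> S <= zflat T W"
  "rk W + td (zflat T W) = td W + rk (zflat T W)"
proof -
 have UW: "T Un \<Union>(Z T W) <= W" using Z_props(3)[OF T W TW] TW by blast
 have UM: "T Un \<Union>(Z T W) <= carrier M" using order_trans[OF UW flatD(1)[OF W]] by simp
 show "flat (zflat T W)" unfolding zflat_def by (rule M.flat_cl[OF UM])
 have up: "T Un \<Union>(Z T W) <= zflat T W" unfolding zflat_def by (rule M.cl_increasing[OF UM])
 then show "T <= zflat T W" by blast
 show "S <= zflat T W" if "S \<in> Z T W" for S using up that by blast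
 show "zflat T W <= W" unfolding zflat_def by (rule M.cl_flat_min[OF UW W])
 show "rk W + td (zflat T W) = td W + rk (zflat T W)" by (rule td_eq_rk_above_Z[OF T W TW zflat_def])
qed

end

text \<open>The two closure conditions are the points where the lattice, otherwise governed by
  rational rank alone, is tied to the field.\<close>

locale val_lattice = mult_field R k G + Lat: flat_lattice "carrier (mult_grp R G)" "icl (mult_grp R G)" LL
 for R :: "('a, 'm) ring_scheme" (structure) and k G :: "'a set" and LL +
 assumes LL_acl: "!!W Q. W \<in> LL ==> Q \<in> LL ==> W Int acl Q \<in> LL"
  and LL_Z: "!!T W. T \<in> LL ==> W \<in> LL ==> T <= W ==> Z T W <= LL"
begin

abbreviation line where "line \<equiv> Lat.line"
abbreviation ss where "ss \<equiv> Lat.semisimple"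

lemmas fl = Lat.LL_flat

lemma zflat_LL: "T \<in> LL ==> W \<in> LL ==> T <= W ==> zflat T W \<in> LL"
 unfolding zflat_def by (rule Lat.LL_Union_finite[OF finite_Z LL_Z]) (use fl in blast)+

lemma full_LL: "T \<in> LL ==> W \<in> LL ==> T <= W ==> full T W \<O> ==> W Int vunits \<O> \<in> Z T W & W Int vunits \<O> \<in> LL"
 using LL_Z unfolding Z_def by blast

definition good :: "'a set => 'a set => bool" where
 "good T W \<longleftrightarrow> T \<in> LL & W \<in> LL & T <= W & W Int acl T = T"

text \<open>The induction hypothesis of \<open>semisimple_zflat\<close>, named so that the existence
  of a line can be proved separately from it.\<close>

definition smaller :: "'a set => 'a set => bool" where
 "smaller T W \<longleftrightarrow> (ALL T' W'. good T' W' & rk W' - rk T' < rk W - rk T --> ss T' (zflat T' W'))"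

lemma goodD:
 assumes "good T W"
 shows "T \<in> LL" "W \<in> LL" "T <= W" "W Int acl T = T" "flat T" "flat W" "T <= G" "W <= G"
 using assms flatD(1) fl unfolding good_def by auto

lemma good_sub: "good T W ==> V \<in> LL ==> T <= V ==> V <= W ==> good T V"
 unfolding good_def using acl_increasing[of T] flatD(1)[OF fl, of T] by blast

lemma good_acl:
 assumes g: "good T W" and Q: "Q \<in> LL" "T <= Q" "Q <= W"
 shows "good T (W Int acl Q)" "good (W Int acl Q) W"
proof -
 note w = goodD[OF g]
 have QG: "Q <= G" using Q w by blast
 have L: "W Int acl Q \<in> LL" by (rule LL_acl[OF w(2) Q(1)])
 show "good T (W Int acl Q)" by (rule good_sub[OF g L]) (use acl_increasing[OF QG] Q w(3) in blast)+
 have "acl (W Int acl Q) <= acl (acl Q)" by (rule acl_mono[OF _ acl_in]) blast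
 then have "acl (W Int acl Q) <= acl Q" using acl_idem[OF QG] by simp
 moreover have "W Int acl Q <= acl (W Int acl Q)" by (rule acl_increasing) (use acl_in in blast)
 ultimately show "good (W Int acl Q) W" unfolding good_def using L w(2) by blast
qed

lemma rk_lt: "T \<in> LL ==> W \<in> LL ==> T <= W ==> T ~= W ==> rk T < rk W"
 using M.flat_psubset_rk fl by blast

text \<open>If rank and degree of \<open>V\<close> over \<open>T\<close> differ,
  \<open>zflat T V\<close> is larger than \<open>T\<close>. By the hypothesis on smaller pairs it is
  semisimple and therefore contains a line.\<close>

lemma line_from_smaller:
 assumes IH: "smaller T W" and g: "good T W" and V: "V \<in> LL" "T <= V" "V <= W" "V ~= W"
  and r: "rk V + td T ~= td V + rk T"
 shows "EX L. line T L & L <= W"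
proof -
 note w = goodD[OF g]
 have gV: "good T V" by (rule good_sub[OF g V(1,2,3)])
 note v = goodD[OF gV]
 have "rk V < rk W" by (rule rk_lt[OF V(1) w(2) V(3,4)])
 moreover have "rk T <= rk V" by (rule M.flat_rk_mono[OF V(2) v(6)])
 ultimately have "ss T (zflat T V)" using IH gV unfolding smaller_def by (meson diff_less_mono)
 moreover have "zflat T V ~= T" using zflat_props(5)[OF v(5,6,3)] r by auto
 ultimately obtain L where "line T L" "L <= zflat T V" using Lat.semisimple_has_line w(1) by blast
 then show ?thesis using zflat_props(3)[OF v(5,6,3)] V(3) by blast
qed

text \<open>If \<open>N\<close> is not algebraically closed in \<open>W\<close>, its closure has
  larger rank at the same degree, and \<open>line_from_smaller\<close> applies. Otherwise the
  hypothesis for the pair \<open>N\<close>, \<open>W\<close> gives a semisimple \<open>Sw\<close>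
  over \<open>N\<close>, and a composite valuation without units in \<open>N\<close> beyond
  \<open>T\<close> supplies a complement \<open>S\<close> of \<open>N\<close> in \<open>Sw\<close>,
  which inherits semisimplicity over \<open>T\<close>.\<close>

lemma line_from_complement:
 assumes IH: "smaller T W" and g: "good T W" and N: "N \<in> LL" "T <= N" "N <= W" "N ~= T"
  and rN: "rk N + td T = td N + rk T" and nW: "~ W <= acl N" and rW: "td W + rk T < rk W + td T"
 shows "EX L. line T L & L <= W"
proof -
 note w = goodD[OF g]
 define T1 where "T1 = W Int acl N"
 have fN: "flat N" by (rule fl[OF N(1)])
 have NG: "N <= G" using N w by blast
 have g1: "good T T1" "good T1 W" unfolding T1_def using good_acl[OF g N(1,2,3)] by auto
 have NT1: "N <= T1" unfolding T1_def using acl_increasing[OF NG] N(3) by blast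
 have T1W: "T1 <= W" "T1 ~= W" unfolding T1_def using nW by auto
 have tdT1: "td T1 = td N" unfolding T1_def by (rule td_Int_acl[OF N(3) w(8)])
 show ?thesis
 proof (cases "T1 = N")
  case False
  have "rk N < rk T1" by (rule rk_lt[OF N(1) _ NT1]) (use False goodD(2)[OF g1(1)] in auto)
  then have "rk T1 + td T ~= td T1 + rk T" using rN tdT1 by simp
  then show ?thesis by (rule line_from_smaller[OF IH g goodD(2)[OF g1(1)] goodD(3)[OF g1(1)] T1W])
 next
  case True
  have gN: "good N W" using g1(2) True by simp
  have rTN: "rk T < rk N" by (rule rk_lt[OF w(1) N(1,2)]) (use N(4) in blast)
  have rNW: "rk N < rk W" by (rule rk_lt[OF N(1) w(2) N(3)]) (use T1W True in blast)
  have "ss N (zflat N W)" using IH gN rTN rNW unfolding smaller_def by (meson diff_less_mono2 order_less_trans)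
  obtain \<W> where wv: "full N W \<W>" using full_exists[OF fN w(6) N(3)] by blast
  define Sw where "Sw = W Int vunits \<W>"
  have Sw: "Sw \<in> Z N W" "Sw \<in> LL" unfolding Sw_def using full_LL[OF N(1) w(2) N(3) wv] by auto
  have NSw: "N <= Sw" by (rule Z_props(2)[OF fN w(6) N(3) Sw(1)])
  have ssw: "ss N Sw" by (rule Lat.semisimple_sub[OF \<open>ss N (zflat N W)\<close> N(1) zflat_LL[OF N(1) w(2) N(3)] Sw(2) NSw
      zflat_props(4)[OF fN w(6) N(3) Sw(1)]])
  obtain \<U> where u: "full T N \<U>" using full_exists[OF w(5) fN N(2)] by blast
  obtain \<O> where O: "full T W \<O>" "T <= N" "N Int vunits \<O> = N Int vunits \<U>"
   "ic ((W Int vunits \<O>) Un N) <= Sw" "rk (W Int vunits \<O>) + rk N = rk Sw + rk (N Int vunits \<U>)"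
   using composite_full[OF w(5) fN w(6) N(2,3) wv u] N(2) unfolding Sw_def by metis
  define S where "S = W Int vunits \<O>"
  have S: "S \<in> Z T W" "S \<in> LL" unfolding S_def using full_LL[OF w(1,2,3) O(1)] by auto
  note sp = Z_props[OF w(5,6,3) S(1)]
  have U: "N Int vunits \<U> \<in> Z T N" using u unfolding Z_def by blast
  \<comment> \<open>Rank and degree of \<open>N\<close> over \<open>T\<close> agree, so equality in
    Abhyankar's inequality leaves no units in \<open>N\<close> beyond \<open>T\<close>.\<close>
  have rU: "rk (N Int vunits \<U>) = rk T" using Z_props(4)[OF w(5) fN N(2) U] rN by simp
  then have eU: "N Int vunits \<U> = T" using M.flat_eqI[OF Z_props(2)[OF w(5) fN N(2) U] w(5) Z_props(1)[OF w(5) fN N(2) U]] by simp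
  have SN: "S Int N = T" unfolding S_def using O(3) eU N(3) by blast
  have fSw: "flat Sw" by (rule fl[OF Sw(2)])
  have "rk (ic (S Un N)) = rk Sw" using M.rk_modular[OF sp(1) fN] SN O(5) rU unfolding S_def by simp
  then have j: "ic (S Un N) = Sw" using M.flat_eqI[OF _ M.flat_join[OF sp(1) fN] fSw] O(4) unfolding S_def by simp
  have "ss T S" by (rule Lat.semisimple_complement[OF ssw w(1) N(1) Sw(2) S(2) sp(2) N(2) _ j]) (use SN in blast)
  moreover have "S ~= T" using sp(4) rW by auto
  ultimately show ?thesis using Lat.semisimple_has_line[of T S] w(1) sp(3) by blast
 qed
qed

text \<open>With \<open>d = td W - td T\<close>, the two preceding lemmas settle the case unless
  \<open>S\<close> has rank \<open>d\<close> over \<open>T\<close> and \<open>W\<close> is algebraic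
  over \<open>S\<close>. For \<open>d = 1\<close> this \<open>S\<close> is itself a line. For
  \<open>d > 1\<close> a second member \<open>S'\<close> of \<open>Z T W\<close> is constructed such
  that \<open>S Int S'\<close> lies strictly between \<open>T\<close> and \<open>S\<close>; then
  \<open>W\<close> is not algebraic over it and \<open>line_from_complement\<close> applies.\<close>

lemma line_exists:
 assumes IH: "smaller T W" and g: "good T W" and rW: "td W + rk T < rk W + td T" and ne: "T ~= W"
 shows "EX L. line T L & L <= W"
proof -
 note w = goodD[OF g]
 have WM: "W <= carrier M" using w(8) by simp
 have "~ W <= acl T" using w(4) ne by blast
 obtain C where C: "finite C" "C <= W" "W <= acl (T Un C)" "td W = td T + card C"
  and rC: "ALL D<=C. td (T Un D) = td T + card D" using D.relative_basis[OF w(3,8)] by blast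
 have "C ~= {}" using C(3) \<open>~ W <= acl T\<close> by auto
 then obtain c where c: "c \<in> C" by blast
 define d where "d = card C"
 define C1 where "C1 = C - {c}"
 have d1: "d \<ge> 1" using C(1) c d_def by (metis One_nat_def Suc_leI card_gt_0_iff empty_iff)
 have cC1: "card C1 = d - 1" unfolding C1_def d_def using C(1) c by simp
 have TC: "T Un D <= W" "T Un D <= G" if "D <= C" for D using that C(2) w(3,8) by auto
 define T1 where "T1 = W Int acl (T Un C1)"
 have C1C: "C1 <= C" unfolding C1_def by blast
 have tdT1: "td T1 = td T + (d - 1)" unfolding T1_def using td_Int_acl[OF TC(1)[OF C1C] w(8)] rC C1C cC1 by simp
 have fT1: "flat T1" unfolding T1_def by (rule M.flat_Int[OF w(6) acl_flat])
 have TT1: "T <= T1" unfolding T1_def using acl_increasing[OF TC(2)[OF C1C]] w(3) by blast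
 have T1W: "T1 <= W" unfolding T1_def by blast
 have tdW: "td W = Suc (td T1)" using tdT1 C(4) d1 d_def by simp
 obtain \<W> where wv: "full T1 W \<W>" using full_exists[OF fT1 w(6) T1W] by blast
 obtain \<U> where u: "full T T1 \<U>" using full_exists[OF w(5) fT1 TT1] by blast
 \<comment> \<open>The detour through \<open>T1\<close> keeps \<open>S\<close> among the units of
   \<open>\<W>\<close>, whose units have corank one in \<open>W\<close>. The transverse valuation
   below requires this.\<close>
 obtain \<O> where O: "full T W \<O>" "vunits \<O> <= vunits \<W>" by (rule composite_full[OF w(5) fT1 w(6) TT1 T1W wv u]) (rule that)
 define S where "S = W Int vunits \<O>"
 have S: "S \<in> Z T W" "S \<in> LL" unfolding S_def using full_LL[OF w(1,2,3) O(1)] by auto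
 note sp = Z_props[OF w(5,6,3) S(1)]
 have SG: "S <= G" using sp(3) w(8) by blast
 have rS: "rk W = rk S + d" using sp(4) C(4) d_def by simp
 have SW: "S ~= W" using rS d1 by auto
 show ?thesis
 proof (cases "rk S + td T = td S + rk T")
  case False
  then show ?thesis by (rule line_from_smaller[OF IH g S(2) sp(2,3) SW])
 next
  case eq: True
  have ST: "S ~= T" using rS rW C(4) d_def by auto
  show ?thesis
  proof (cases "W <= acl S")
   case False
   then show ?thesis by (rule line_from_complement[OF IH g S(2) sp(2,3) ST eq _ rW])
  next
   case WS: True
   have tdS: "td S = td W" using D.rk_mono_cl[OF WS SG] D.rk_mono[OF sp(3) w(8)] by simp
   have rST: "rk S = rk T + d" using eq tdS C(4) d_def by simp
   show ?thesis
   proof (cases "d = 1")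
    case True
    then have "line T S" unfolding Lat.line_def using S(2) sp(2) rST by simp
    then show ?thesis using sp(3) by blast
   next
    case False
    then have d2: "d \<ge> 2" using d1 by simp
    then have "C1 ~= {}" using cC1 by auto
    then obtain c2 where c2: "c2 \<in> C1" by blast
    define C2 where "C2 = C1 - {c2}"
    have C2C: "C2 <= C" "C2 <= C1" unfolding C2_def using C1C by auto
    have "finite C1" using C(1) C1C finite_subset by blast
    then have cC2: "card C2 = d - 2" unfolding C2_def using c2 cC1 by simp
    define T2 where "T2 = W Int acl (T Un C2)"
    have tdT2: "td T2 = td T + (d - 2)" unfolding T2_def using td_Int_acl[OF TC(1)[OF C2C(1)] w(8)] rC C2C(1) cC2 by simp
    have fT2: "flat T2" unfolding T2_def by (rule M.flat_Int[OF w(6) acl_flat])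
    have TT2: "T <= T2" unfolding T2_def using acl_increasing[OF TC(2)[OF C2C(1)]] w(3) by blast
    have T21: "T2 <= T1" unfolding T2_def T1_def using acl_mono[OF _ TC(2)[OF C1C], of "T Un C2"] C2C(2) by blast
    have T2W: "T2 <= W" and T2G: "T2 <= G" unfolding T2_def using acl_in by auto
    have wv': "\<W> \<in> vals (kf T1)" and rw: "rk W + td T1 = rk (W Int vunits \<W>) + td W" using wv unfolding full_def by auto
    have vW: "valring \<W>" by (rule vals_valring[OF wv'])
    have "W Int vunits \<W> ~= W" using rw tdW by auto
    then obtain y0 where y0: "y0 \<in> W" "y0 ~: vunits \<W>" by blast
    have "y0 \<in> Units R" using y0(1) w(8) G_Units by blast
    then have "y0 \<in> vmax \<W> | inv y0 \<in> vmax \<W>" using vunits_trichotomy[OF vW] y0(2) by blast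
    then obtain y where y: "y \<in> W" "y \<in> vmax \<W>" using y0(1) flatD(4)[OF w(6)] by blast
    obtain P where P: "finite P" "P <= S" "S <= ic (T Un P)" using M.relative_basis[OF sp(2)] SG by auto
    have PW: "P <= W" "P <= vunits \<W>" using P(2) O(2) unfolding S_def by auto
    have PG: "P <= G" using PW w(8) by blast
    have WP: "W <= acl (T2 Un P)"
    proof -
     have t: "T2 Un P <= G" using T2G PG by blast
     have tp: "T Un P <= G" using w(7) PG by blast
     have "S <= acl (T Un P)" using P(3) ic_acl[OF tp] by blast
     also have "\<dots> <= acl (T2 Un P)" by (rule acl_mono[OF _ t]) (use TT2 in blast)
     finally have "acl S <= acl (acl (T2 Un P))" by (rule acl_mono[OF _ acl_in])
     then show ?thesis using WS acl_idem[OF t] by blast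
    qed
    have "td T2 < td T1" using tdT1 tdT2 d2 by simp
    then obtain s \<V> where s: "s \<in> P" "\<V> \<in> vals (kf (insert s T2))" "s ~: acl T2" "y \<in> vmax \<V>" "P <= vunits \<V>"
     using transverse_valuation[OF w(8) T21 T1W _ tdW wv' y P(1) PW WP] by blast
    have sW: "s \<in> W" and sG: "s \<in> G" using s(1) PW PG by auto
    have sT2: "insert s T2 <= W" "insert s T2 <= G" using sW T2W w(8) by auto
    define T3 where "T3 = W Int acl (insert s T2)"
    have fT3: "flat T3" unfolding T3_def by (rule M.flat_Int[OF w(6) acl_flat])
    have T3W: "T3 <= W" unfolding T3_def by blast
    have sT3: "insert s T2 <= T3" unfolding T3_def using acl_increasing[OF sT2(2)] sT2(1) by blast
    have TT3: "T <= T3" using TT2 sT3 by blast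
    have tdT3: "td T3 = Suc (td T2)" unfolding T3_def using td_Int_acl[OF sT2(1) w(8)] D.rk_insert[OF T2G sG s(3)] by simp
    have T3acl: "T3 <= acl (insert s T2)" unfolding T3_def by blast
    have "\<V> \<in> vals (kf (acl (insert s T2)))" using vals_kf_acl[OF sT2(2)] s(2) by simp
    then have V3: "\<V> \<in> vals (kf T3)" using vals_mono[OF kf_mono[OF T3acl acl_in]] by blast
    have vV: "valring \<V>" by (rule vals_valring[OF V3])
    define Sv where "Sv = W Int vunits \<V>"
    have fSv: "flat Sv" unfolding Sv_def by (rule flat_vunits[OF vV w(6)])
    have "y ~: vunits \<V>" using s(4) unfolding vmax_def by blast
    then have SvW: "Sv \<subset> W" unfolding Sv_def using y(1) by blast
    have rSv: "rk Sv < rk W" by (rule M.flat_psubset_rk[OF SvW fSv w(6)])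
    \<comment> \<open>The degree of \<open>W\<close> over \<open>T3\<close> is one, and the non-unit
      \<open>y\<close> accounts for a loss of at least one in rank.\<close>
    have fullV: "full T3 W \<V>" by (rule fullI[OF fT3 w(6) T3W V3]) (use rSv tdT3 tdT2 d2 C(4) d_def Sv_def in simp)
    have SSv: "S <= Sv"
    proof -
     have "T3 <= Sv" unfolding Sv_def using kf_vunits[OF _ V3] T3W w(8) by blast
     then have "T Un P <= Sv" using TT3 s(5) PW(1) unfolding Sv_def by blast
     then show ?thesis using P(3) M.cl_flat_min[OF _ fSv] by blast
    qed
    have "s ~: acl T" using s(3) acl_mono[OF TT2 T2G] by blast
    \<comment> \<open>Making \<open>s\<close> a non-unit separates \<open>S'\<close> from
      \<open>S\<close>, because \<open>s\<close> belongs to \<open>P\<close> and hence to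
      \<open>S\<close>.\<close>
    then obtain \<U>' where u': "full T T3 \<U>'" "s ~: vunits \<U>'" using full_exists_avoiding[OF w(5) fT3 TT3] sT3 by blast
    obtain \<O>' where O': "full T W \<O>'" "vunits \<O>' <= vunits \<V>" "T3 Int vunits \<O>' = T3 Int vunits \<U>'"
     by (rule composite_full[OF w(5) fT3 w(6) TT3 T3W fullV u'(1)]) (rule that)
    define S' where "S' = W Int vunits \<O>'"
    have S': "S' \<in> Z T W" "S' \<in> LL" unfolding S'_def using full_LL[OF w(1,2,3) O'(1)] by auto
    note sp' = Z_props[OF w(5,6,3) S'(1)]
    define N where "N = S Int S'"
    have N: "N \<in> LL" unfolding N_def by (rule Lat.LL_Int[OF S(2) S'(2)])
    have TN: "T <= N" unfolding N_def using sp(2) sp'(2) by blast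
    have "s ~: S'" unfolding S'_def using O'(3) u'(2) sT3 by blast
    then have NS: "N <= S" "N ~= S" unfolding N_def using s(1) P(2) by auto
    have rNS: "rk N < rk S" by (rule rk_lt[OF N S(2) NS])
    have S'v: "S' <= Sv" unfolding S'_def Sv_def using O'(2) by blast
    \<comment> \<open>Both \<open>S\<close> and \<open>S'\<close> lie in the proper subgroup
      \<open>Sv\<close> of \<open>W\<close>. Since \<open>S\<close> has rank \<open>d\<close> over
      \<open>T\<close> and \<open>S'\<close> has corank \<open>d\<close> in \<open>W\<close>, the
      intersection must be larger than \<open>T\<close>.\<close>
    have "rk (ic (S Un S')) <= rk Sv" by (rule M.flat_rk_mono[OF M.join_least[OF SSv S'v fSv] fSv])
    moreover have "rk W = rk S' + d" using sp'(4) C(4) d_def by simp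
    ultimately have rN: "rk T < rk N" using M.rk_modular[OF sp(1) sp'(1)] rSv rST unfolding N_def by simp
    then have NT: "N ~= T" by auto
    have NG: "N <= G" and NW: "N <= W" using NS(1) SG sp(3) by auto
    have a1: "td S + rk N <= td N + rk S" by (rule td_le_rk[OF NS(1) SG])
    have a2: "td N + rk T <= td T + rk N" by (rule td_le_rk[OF TN NG])
    have eqN: "rk N + td T = td N + rk T" using a1 a2 eq by simp
    have "~ W <= acl N"
    proof
     assume "W <= acl N"
     then have "td W <= td N" by (rule D.rk_mono_cl[OF _ NG])
     then show False using eqN rNS rST C(4) d_def by simp
    qed
    then show ?thesis by (rule line_from_complement[OF IH g N TN NW NT eqN _ rW])
   qed
  qed
 qed
qed

text \<open>The closure of a line has degree at most one over \<open>T\<close>, so the units of full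
  valuations have corank at most one. They are the hyperplanes required by
  \<open>semisimple_hyperplanes\<close>.\<close>

lemma semisimple_acl_line:
 assumes g: "good T W" and L: "line T L" "L <= W"
 shows "ss T (W Int acl L)"
proof -
 note w = goodD[OF g]
 have LL: "L \<in> LL" "T <= L" "rk L = Suc (rk T)" using L(1) unfolding Lat.line_def by auto
 define T' where "T' = W Int acl L"
 have g': "good T T'" unfolding T'_def by (rule good_acl(1)[OF g LL(1,2) L(2)])
 note t = goodD[OF g']
 have LG: "L <= G" using L w by blast
 have "td T' = td L" unfolding T'_def by (rule td_Int_acl[OF L(2) w(8)])
 moreover have "td L + rk T <= td T + rk L" by (rule td_le_rk[OF LL(2) LG])
 ultimately have tdT': "td T' <= Suc (td T)" using LL(3) by simp
 show ?thesis unfolding T'_def[symmetric]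
 proof (rule Lat.semisimple_hyperplanes[OF t(1,2,3)])
  fix h assume h: "h \<in> T' - T"
  have "h ~: acl T" using h t(4) by blast
  then obtain \<O> where O: "full T T' \<O>" "h ~: vunits \<O>" using full_exists_avoiding[OF t(5,6,3)] h by blast
  have S: "T' Int vunits \<O> \<in> Z T T'" "T' Int vunits \<O> \<in> LL" using full_LL[OF t(1,2,3) O(1)] by auto
  note sp = Z_props[OF t(5,6,3) S(1)]
  have "rk T' <= Suc (rk (T' Int vunits \<O>))" using sp(4) tdT' by simp
  then show "EX U:LL. T <= U & U <= T' & h ~: U & rk T' <= Suc (rk U)" using S(2) sp(2) O(2) by blast
 qed
qed

text \<open>Take \<open>C\<close> of least rank with join \<open>S\<close>. Were some
  \<open>h\<close> outside \<open>T\<close> in \<open>C Int T'\<close>, a composite full valuation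
  with \<open>h\<close> as non-unit would have units of corank at most one in \<open>S\<close>.
  Cutting \<open>C\<close> by them loses at most one in the rank of \<open>C\<close> and at least
  one in that of \<open>C Int T'\<close>, so the join would still be \<open>S\<close>.\<close>

lemma complement_in_Z:
 assumes g: "good T W" and T': "T' \<in> LL" "T <= T'" "T' <= W" "td T' <= Suc (td T)" "T' Int acl T = T"
  and S: "S \<in> Z T' W" "S \<in> LL"
 shows "EX C:LL. T <= C & C <= S & C Int T' <= T & ic (C Un T') = S"
proof -
 note w = goodD[OF g]
 have fT': "flat T'" and fS: "flat S" using fl T'(1) S(2) by auto
 have TS: "T' <= S" by (rule Z_props(2)[OF fT' w(6) T'(3) S(1)])
 obtain \<W> where wv: "full T' W \<W>" "S = W Int vunits \<W>" using S(1) unfolding Z_def by blast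
 define P where "P = (%C. C \<in> LL & T <= C & C <= S & ic (C Un T') = S)"
 have "ic (S Un T') = S"
 proof -
  have "S Un T' = S" using TS by blast
  then show ?thesis using fS unfolding M.flat_def by simp
 qed
 then have "P S" unfolding P_def using S(2) TS T'(2) by blast
 then obtain C where C: "P C" and min: "!!C'. P C' ==> rk C <= rk C'"
  using exists_least_iff[of "%n. EX C. P C & rk C = n"] by (metis linorder_not_le)
 have c: "C \<in> LL" "T <= C" "C <= S" "ic (C Un T') = S" using C unfolding P_def by auto
 have fC: "flat C" by (rule fl[OF c(1)])
 have "C Int T' <= T"
 proof
  fix h assume h: "h \<in> C Int T'"
  show "h \<in> T"
  proof (rule ccontr)
   assume "h ~: T"
   then have "h ~: acl T" using T'(5) h by blast
   then obtain \<U> where u: "full T T' \<U>" "h ~: vunits \<U>" using full_exists_avoiding[OF w(5) fT' T'(2)] h by blast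
   have U: "T' Int vunits \<U> \<in> Z T T'" using u(1) unfolding Z_def by blast
   have rU: "rk T' <= Suc (rk (T' Int vunits \<U>))" using Z_props(4)[OF w(5) fT' T'(2) U] T'(4) by simp
   obtain \<O> where O: "full T W \<O>" "vunits \<O> <= vunits \<W>" "T' Int vunits \<O> = T' Int vunits \<U>"
    "rk (W Int vunits \<O>) + rk T' = rk (W Int vunits \<W>) + rk (T' Int vunits \<U>)"
    by (rule composite_full[OF w(5) fT' w(6) T'(2,3) wv(1) u(1)]) (rule that)
   define V where "V = W Int vunits \<O>"
   have V: "V \<in> Z T W" "V \<in> LL" unfolding V_def using full_LL[OF w(1,2,3) O(1)] by auto
   note vp = Z_props[OF w(5,6,3) V(1)]
   have rV: "rk S <= Suc (rk V)" using O(4) rU wv(2) V_def by simp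
   have VS: "V <= S" unfolding V_def wv(2) using O(2) by blast
   have hV: "h ~: V" unfolding V_def using O(3) u(2) h by blast
   define C' where "C' = C Int V"
   have C': "C' \<in> LL" unfolding C'_def by (rule Lat.LL_Int[OF c(1) V(2)])
   have fC': "flat C'" by (rule fl[OF C'])
   have "rk (ic (C Un V)) <= rk S" by (rule M.flat_rk_mono[OF M.join_least[OF c(3) VS fS] fS])
   then have r1: "rk C <= Suc (rk C')" using M.rk_modular[OF fC vp(1)] rV unfolding C'_def by simp
   have "C' Int T' \<subset> C Int T'" unfolding C'_def using h hV by blast
   then have r2: "rk (C' Int T') < rk (C Int T')" by (rule M.flat_psubset_rk[OF _ M.flat_Int[OF fC' fT'] M.flat_Int[OF fC fT']])
   have "rk S <= rk (ic (C' Un T'))" using M.rk_modular[OF fC fT'] M.rk_modular[OF fC' fT'] r1 r2 c(4) by simp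
   moreover have "ic (C' Un T') <= S" by (rule M.join_least[OF _ TS fS]) (use c(3) C'_def in blast)
   ultimately have "ic (C' Un T') = S" using M.flat_eqI[OF _ M.flat_join[OF fC' fT'] fS] by blast
   then have "P C'" unfolding P_def using C' c(2,3) vp(2) C'_def by blast
   then have "rk C <= rk C'" by (rule min)
   moreover have "C' \<subset> C" unfolding C'_def using h hV by blast
   then have "rk C' < rk C" by (rule M.flat_psubset_rk[OF _ fC' fC])
   ultimately show False by simp
  qed
 qed
 then show ?thesis using c by blast
qed

text \<open>Let \<open>T'\<close> be the closure in \<open>W\<close> of a line. Semisimplicity
  descends from \<open>T'\<close> to \<open>T\<close>: every \<open>S\<close> in
  \<open>Z T' W\<close> is the join of \<open>T'\<close> with a complement that is semisimple over
  \<open>T\<close>. Hence \<open>zflat T' W\<close> is semisimple over \<open>T\<close>, and it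
  contains \<open>zflat T W\<close> by \<open>Z_subset\<close>.\<close>

theorem semisimple_zflat: "good T W ==> ss T (zflat T W)"
proof (induction "rk W - rk T" arbitrary: T W rule: less_induct)
 case less
 note g = less.prems
 note w = goodD[OF g]
 note z = zflat_props[OF w(5,6,3)]
 have IH: "smaller T W" unfolding smaller_def using less.hyps by blast
 show ?case
 proof (cases "zflat T W = T")
  case True
  then show ?thesis using Lat.semisimpleI[OF w(5) order_refl] Lat.socle_upper(1)[of T T] w(7) by simp
 next
  case False
  have ne: "T ~= W" using z(2,3) False by blast
  have "td W + rk T <= td T + rk W" by (rule td_le_rk[OF w(3,8)])
  moreover have "td W + rk T ~= td T + rk W"
  proof
   assume e: "td W + rk T = td T + rk W"
   have "S = T" if "S \<in> Z T W" for S using M.flat_eqI[OF Z_props(2)[OF w(5,6,3) that] w(5) Z_props(1)[OF w(5,6,3) that]]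
     Z_props(4)[OF w(5,6,3) that] e by simp
   then have "T Un \<Union>(Z T W) = T" by blast
   then show False using False w(5) unfolding zflat_def M.flat_def by simp
  qed
  ultimately have rW: "td W + rk T < rk W + td T" by simp
  obtain L where L: "line T L" "L <= W" using line_exists[OF IH g rW ne] by blast
  have L': "L \<in> LL" "T <= L" "rk L = Suc (rk T)" using L(1) unfolding Lat.line_def by auto
  have LG: "L <= G" using L w by blast
  define T' where "T' = W Int acl L"
  have gT: "good T T'" "good T' W" unfolding T'_def using good_acl[OF g L'(1,2) L(2)] by auto
  note t = goodD[OF gT(1)] and t' = goodD[OF gT(2)]
  have sT': "ss T T'" unfolding T'_def by (rule semisimple_acl_line[OF g L])
  have LT': "L <= T'" unfolding T'_def using acl_increasing[OF LG] L(2) by blast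
  have "rk L <= rk T'" by (rule M.flat_rk_mono[OF LT' t(6)])
  then have rT: "rk T < rk T'" using L'(3) by simp
  have "td T' = td L" unfolding T'_def by (rule td_Int_acl[OF L(2) w(8)])
  then have tdT': "td T' <= Suc (td T)" using td_le_rk[OF L'(2) LG] L'(3) by simp
  have "rk T' <= rk W" by (rule M.flat_rk_mono[OF t'(3) w(6)])
  show ?thesis
  proof (cases "T' = W")
   case True
   then show ?thesis using Lat.semisimple_sub[OF _ w(1,2) zflat_LL[OF w(1,2,3)] z(2,3)] sT' by simp
  next
   case False
   have "rk T' < rk W" by (rule rk_lt[OF t'(1) w(2) t'(3) False])
   then have s': "ss T' (zflat T' W)" using less.hyps[OF _ gT(2)] rT by simp
   note z' = zflat_props[OF t'(5,6,3)]
   define Q where "Q = zflat T' W"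
   have Q: "Q \<in> LL" unfolding Q_def by (rule zflat_LL[OF t'(1,2,3)])
   have sS: "ss T S" if S: "S \<in> Z T' W" for S
   proof -
    have SL: "S \<in> LL" using LL_Z[OF t'(1,2,3)] S by blast
    have TS: "T' <= S" by (rule Z_props(2)[OF t'(5,6,3) S])
    have "ss T' S" by (rule Lat.semisimple_sub[OF s' t'(1) Q[unfolded Q_def] SL TS z'(4)[OF S]])
    obtain C where C: "C \<in> LL" "T <= C" "C <= S" "C Int T' <= T" "ic (C Un T') = S"
     using complement_in_Z[OF g t(2,3) t'(3) tdT' t(4) S SL] by blast
    have sC: "ss T C" by (rule Lat.semisimple_complement[OF \<open>ss T' S\<close> w(1) t'(1) SL C(1,2) t(3) C(4,5)])
    have "C <= G" using flatD(1)[OF fl[OF C(1)]] .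
    then have "ss T (ic (T Un \<Union>{C, T'}))" using Lat.semisimple_Union[OF w(1), of "{C, T'}"] sC sT' t(8) by auto
    moreover have "T Un \<Union>{C, T'} = C Un T'" using C(2) by blast
    ultimately show ?thesis using C(5) by simp
   qed
   have "ss T (ic (T Un \<Union>(Set.insert T' (Z T' W))))"
   proof (rule Lat.semisimple_Union[OF w(1)])
    fix V assume V: "V \<in> Set.insert T' (Z T' W)"
    have "V <= W" using V t'(3) Z_props(3)[OF t'(5,6,3)] by blast
    then show "ss T V & V <= carrier M" using V sT' sS w(8) by auto
   qed
   moreover have "T Un \<Union>(Set.insert T' (Z T' W)) = T' Un \<Union>(Z T' W)" using t(3) by blast
   ultimately have sQ: "ss T Q" unfolding Q_def zflat_def by simp
   have TQ: "T <= Q" "Q <= W" unfolding Q_def using t(3) z'(2,3) by auto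
   have eq: "rk W + td Q <= td W + rk Q" unfolding Q_def using z'(5) by simp
   have fQ: "flat Q" by (rule fl[OF Q])
   have "S <= Q" if "S \<in> Z T W" for S by (rule Z_subset[OF w(5) fQ w(6) TQ eq that])
   then have "T Un \<Union>(Z T W) <= Q" using TQ(1) by blast
   then have zQ: "zflat T W <= Q" unfolding zflat_def by (rule M.cl_flat_min[OF _ fQ])
   show ?thesis by (rule Lat.semisimple_sub[OF sQ w(1) Q zflat_LL[OF w(1,2,3)] z(2) zQ])
  qed
 qed
qed

end

section \<open>Automorphisms\<close>

context mult_field
begin

text \<open>Values outside \<open>carrier R\<close> are left open. This is harmless, because images
  are taken only of subsets of the carrier.\<close>

definition auts :: "('a => 'a) set" where
 "auts = {\<rho> \<in> ring_hom R R. bij_betw \<rho> (carrier R) (carrier R) & (ALL a:k. \<rho> a = a) & \<rho> ` G = G}"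

context
 fixes \<rho> assumes \<rho>: "\<rho> \<in> auts"
begin

lemma aut_hom: "\<rho> \<in> ring_hom R R" and aut_inj: "inj_on \<rho> (carrier R)" and aut_surj: "\<rho> ` carrier R = carrier R"
 and aut_k: "a \<in> k ==> \<rho> a = a" and aut_G: "\<rho> ` G = G" using \<rho> unfolding auts_def bij_betw_def by auto

lemma aut_closed: "x \<in> carrier R ==> \<rho> x \<in> carrier R" using ring_hom_closed[OF aut_hom] .

lemma aut_one: "\<rho> \<one> = \<one>" by (rule ring_hom_one[OF aut_hom])

lemma aut_mult: "x \<in> carrier R ==> y \<in> carrier R ==> \<rho> (x \<otimes> y) = \<rho> x \<otimes> \<rho> y"
 by (rule ring_hom_mult[OF aut_hom])

lemma aut_ring_hom_ring: "ring_hom_ring R R \<rho>" by (rule ring_hom_ringI2[OF ring_axioms ring_axioms aut_hom])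

lemma aut_Units_inv:
 assumes "x \<in> Units R"
 shows "\<rho> x \<in> Units R" "\<rho> (inv x) = inv (\<rho> x)"
proof -
 have c: "x \<in> carrier R" "inv x \<in> carrier R" using assms Units_closed by auto
 have 1: "\<rho> x \<otimes> \<rho> (inv x) = \<one>" using aut_mult[OF c] assms aut_one by simp
 then have "\<rho> x ~= \<zero>" using aut_closed[OF c(2)] by auto
 then show "\<rho> x \<in> Units R" using aut_closed[OF c(1)] Units_iff by blast
 show "\<rho> (inv x) = inv (\<rho> x)" using comm_inv_char[OF aut_closed[OF c(1)] aut_closed[OF c(2)] 1] by simp
qed

lemma aut_pow: "x \<in> carrier R ==> \<rho> (x [^] (n::nat)) = \<rho> x [^] n" by (induction n) (simp_all add: aut_one aut_mult)

lemma aut_flat: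
 assumes H: "flat H"
 shows "flat (\<rho> ` H)"
proof (rule flatI)
 note h = flatD[OF H]
 have Hc: "H <= carrier R" using h(1) G_carrier by blast
 show "\<rho> ` H <= G" using h(1) aut_G by blast
 show "\<one> \<in> \<rho> ` H" using h(2) aut_one by (metis image_eqI)
 show "x \<otimes> y \<in> \<rho> ` H" if xy: "x \<in> \<rho> ` H" "y \<in> \<rho> ` H" for x y
 proof -
  obtain x' y' where "x' \<in> H" "x = \<rho> x'" "y' \<in> H" "y = \<rho> y'" using xy by blast
  then show ?thesis using aut_mult[of x' y'] h(3) Hc by (metis image_eqI subsetD)
 qed
 show "inv x \<in> \<rho> ` H" if x: "x \<in> \<rho> ` H" for x
 proof -
  obtain x' where x': "x' \<in> H" "x = \<rho> x'" using x by blast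
  have "x' \<in> Units R" using x'(1) h(1) G_Units by blast
  then have "inv x = \<rho> (inv x')" using aut_Units_inv(2) x'(2) by simp
  then show ?thesis using h(4)[OF x'(1)] by blast
 qed
 show "g \<in> \<rho> ` H" if g: "g \<in> G" "n \<ge> 1" "g [^] n \<in> \<rho> ` H" for g and n :: nat
 proof -
  obtain g' where g': "g' \<in> G" "g = \<rho> g'" using g(1) aut_G by blast
  obtain h' where h': "h' \<in> H" "g [^] n = \<rho> h'" using g(3) by blast
  have gc: "g' \<in> carrier R" using g'(1) G_carrier by blast
  have "\<rho> (g' [^] n) = \<rho> h'" using aut_pow[OF gc] g'(2) h'(2) by simp
  then have "g' [^] n = h'" using inj_onD[OF aut_inj] gc h'(1) Hc by blast
  then have "g' \<in> H" using h(5)[OF g'(1) g(2)] h'(1) by simp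
  then show ?thesis using g'(2) by blast
 qed
qed

lemma aut_vunits_aux:
 assumes O: "valring \<O>"
 shows "valring (\<rho> ` \<O>)" "vunits (\<rho> ` \<O>) = \<rho> ` vunits \<O>"
proof -
 have sO: "subring \<O> R" using O unfolding valring_def by blast
 have Oc: "\<O> <= carrier R" using subringE(1)[OF sO] .
 have U: "EX x':Units R. x = \<rho> x'" if x: "x \<in> Units R" for x
 proof -
  obtain x' where x': "x' \<in> carrier R" "x = \<rho> x'" using aut_surj x Units_closed by blast
  have "\<rho> \<zero> = \<zero>" using ring_hom_zero[OF aut_hom ring_axioms ring_axioms] .
  then have "x' ~= \<zero>" using x'(2) x Units_iff by blast
  then show ?thesis using x' Units_iff by blast
 qed
 have m: "x \<in> \<O>" if "\<rho> x \<in> \<rho> ` \<O>" "x \<in> carrier R" for x using that inj_onD[OF aut_inj, of x] Oc by blast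
 have "subring (\<rho> ` \<O>) R" by (rule ring_hom_ring.img_is_subring[OF aut_ring_hom_ring sO])
 moreover have "x \<in> \<rho> ` \<O> | inv x \<in> \<rho> ` \<O>" if x: "x \<in> Units R" for x
 proof -
  obtain x' where x': "x' \<in> Units R" "x = \<rho> x'" using U[OF x] by blast
  have "x' \<in> \<O> | inv x' \<in> \<O>" using O x'(1) unfolding valring_def by blast
  then show ?thesis using x'(2) aut_Units_inv(2)[OF x'(1)] by (metis image_eqI)
 qed
 ultimately show "valring (\<rho> ` \<O>)" unfolding valring_def by blast
 show "vunits (\<rho> ` \<O>) = \<rho> ` vunits \<O>"
 proof
  show "vunits (\<rho> ` \<O>) <= \<rho> ` vunits \<O>"
  proof
   fix x assume x: "x \<in> vunits (\<rho> ` \<O>)"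
   then obtain x' where x': "x' \<in> Units R" "x = \<rho> x'" using U vunits_def by blast
   have c: "x' \<in> carrier R" "inv x' \<in> carrier R" using x'(1) Units_closed by auto
   have "\<rho> x' \<in> \<rho> ` \<O>" "\<rho> (inv x') \<in> \<rho> ` \<O>" using x x'(2) aut_Units_inv(2)[OF x'(1)] unfolding vunits_def by auto
   then have "x' \<in> vunits \<O>" unfolding vunits_def using m c x'(1) by blast
   then show "x \<in> \<rho> ` vunits \<O>" using x'(2) by blast
  qed
  show "\<rho> ` vunits \<O> <= vunits (\<rho> ` \<O>)"
  proof
   fix x assume "x \<in> \<rho> ` vunits \<O>"
   then obtain x' where x': "x' \<in> Units R" "x' \<in> \<O>" "inv x' \<in> \<O>" "x = \<rho> x'" unfolding vunits_def by blast
   then have "inv x \<in> \<rho> ` \<O>" using aut_Units_inv(2)[OF x'(1)] by (metis image_eqI)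
   then show "x \<in> vunits (\<rho> ` \<O>)" unfolding vunits_def using x' aut_Units_inv(1) by blast
  qed
 qed
qed

lemma aut_kf_sub:
 assumes A: "A <= G"
 shows "kf (\<rho> ` A) <= \<rho> ` kf A"
proof (rule kf_least)
 show "\<rho> ` A <= G" using A aut_G by blast
 show "subfield (\<rho> ` kf A) R" by (rule ring_hom_ring.img_is_subfield(2)[OF aut_ring_hom_ring kf_subfield[OF A]]) simp
 show "k <= \<rho> ` kf A" using aut_k kf_upper(2)[OF A] by (metis image_eqI subsetD subsetI)
 show "\<rho> ` A <= \<rho> ` kf A" using kf_upper(1)[OF A] by blast
qed

lemma aut_inverse:
 obtains \<tau> where "\<tau> \<in> auts" "!!x. x \<in> carrier R ==> \<tau> (\<rho> x) = x" "!!x. x \<in> carrier R ==> \<rho> (\<tau> x) = x"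
proof -
 define \<tau> where "\<tau> = inv_into (carrier R) \<rho>"
 have ts: "\<tau> (\<rho> x) = x" if "x \<in> carrier R" for x unfolding \<tau>_def using inv_into_f_f[OF aut_inj that] .
 have st: "\<rho> (\<tau> x) = x" if "x \<in> carrier R" for x unfolding \<tau>_def using f_inv_into_f[of x \<rho> "carrier R"] aut_surj that by blast
 have tc: "\<tau> x \<in> carrier R" if "x \<in> carrier R" for x
  unfolding \<tau>_def using inv_into_into[of x \<rho> "carrier R"] aut_surj that by blast
 have "\<tau> \<in> ring_hom R R"
 proof (rule ring_hom_memI)
  fix x y assume xy: "x \<in> carrier R" "y \<in> carrier R"
  have "\<rho> (\<tau> x \<otimes> \<tau> y) = x \<otimes> y" using aut_mult[OF tc tc] st xy by simp
  then show "\<tau> (x \<otimes> y) = \<tau> x \<otimes> \<tau> y" using ts[of "\<tau> x \<otimes> \<tau> y"] tc xy by simp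
  have "\<rho> (\<tau> x \<oplus> \<tau> y) = x \<oplus> y" using ring_hom_add[OF aut_hom tc tc] st xy by simp
  then show "\<tau> (x \<oplus> y) = \<tau> x \<oplus> \<tau> y" using ts[of "\<tau> x \<oplus> \<tau> y"] tc xy by simp
 next
  show "\<tau> \<one> = \<one>" using ts[of \<one>] aut_one by simp
 qed (rule tc)
 moreover have "bij_betw \<tau> (carrier R) (carrier R)"
  unfolding \<tau>_def using bij_betw_inv_into[of \<rho> "carrier R" "carrier R"] aut_inj aut_surj bij_betw_def by blast
 moreover have "\<tau> a = a" if "a \<in> k" for a using ts[of a] aut_k[OF that] subfieldE(3)[OF k] that by auto
 moreover have "\<tau> ` G = G"
 proof -
  have "(%x. \<tau> (\<rho> x)) ` G = (%x. x) ` G" by (rule image_cong[OF refl]) (rule ts, erule subsetD[OF G_carrier])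
  then have "\<tau> ` \<rho> ` G = G" by (simp add: image_image)
  then show ?thesis using aut_G by simp
 qed
 ultimately have "\<tau> \<in> auts" unfolding auts_def by blast
 then show ?thesis using that ts st by blast
qed

end

text \<open>An inclusion that holds for every automorphism becomes an equality when it is also
  applied to the inverse automorphism.\<close>

lemma auts_image_eqI:
 assumes \<rho>: "\<rho> \<in> auts" and F: "!!A. A <= G ==> F A <= carrier R"
  and sub: "!!\<rho> A. \<rho> \<in> auts ==> A <= G ==> F (\<rho> ` A) <= \<rho> ` F A" and A: "A <= G"
 shows "F (\<rho> ` A) = \<rho> ` F A"
proof
 show "F (\<rho> ` A) <= \<rho> ` F A" by (rule sub[OF \<rho> A])
 obtain \<tau> where t: "\<tau> \<in> auts" "!!x. x \<in> carrier R ==> \<tau> (\<rho> x) = x" "!!x. x \<in> carrier R ==> \<rho> (\<tau> x) = x"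
  by (rule aut_inverse[OF \<rho>]) (rule that)
 have sA: "\<rho> ` A <= G" using A aut_G[OF \<rho>] by blast
 have "(%x. \<tau> (\<rho> x)) ` A = (%x. x) ` A"
  by (rule image_cong[OF refl]) (rule t(2), rule subsetD[OF G_carrier], erule subsetD[OF A])
 then have "\<tau> ` \<rho> ` A = A" by (simp add: image_image)
 then have FA: "F A <= \<tau> ` F (\<rho> ` A)" using sub[OF t(1) sA] by simp
 show "\<rho> ` F A <= F (\<rho> ` A)"
 proof
  fix y assume "y \<in> \<rho> ` F A"
  then obtain z where z: "z \<in> F (\<rho> ` A)" "y = \<rho> (\<tau> z)" using FA by blast
  then show "y \<in> F (\<rho> ` A)" using t(3)[of z] F[OF sA] by auto
 qed
qed

lemma aut_kf: "\<rho> \<in> auts ==> A <= G ==> kf (\<rho> ` A) = \<rho> ` kf A"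
 by (rule auts_image_eqI) (use kf_subfield subfieldE(3) aut_kf_sub in blast)+

lemma aut_ic:
 assumes "\<rho> \<in> auts" "A <= G"
 shows "ic (\<rho> ` A) = \<rho> ` ic A"
proof (rule auts_image_eqI[OF assms(1) _ _ assms(2)])
 fix A assume A: "A <= G"
 then have AM: "A <= carrier M" by simp
 show "ic A <= carrier R" using flatD(1)[OF M.flat_cl[OF AM]] G_carrier by blast
 fix \<rho> assume s: "\<rho> \<in> auts"
 show "ic (\<rho> ` A) <= \<rho> ` ic A" by (rule M.cl_flat_min[OF image_mono[OF M.cl_increasing[OF AM]] aut_flat[OF s M.flat_cl[OF AM]]])
qed

lemma aut_vals:
 assumes "\<rho> \<in> auts" "A <= G" "\<O> \<in> vals (kf A)"
 shows "\<rho> ` \<O> \<in> vals (kf (\<rho> ` A))" "vunits (\<rho> ` \<O>) = \<rho> ` vunits \<O>"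
 using aut_vunits_aux[OF assms(1) vals_valring[OF assms(3)]] aut_kf[OF assms(1,2)] assms(3) unfolding vals_def by auto

lemma aut_acl:
 assumes "\<rho> \<in> auts" "A <= G"
 shows "acl (\<rho> ` A) = \<rho> ` acl A"
proof (rule auts_image_eqI[OF assms(1) _ _ assms(2)])
 show "acl A <= carrier R" for A using acl_in G_carrier by blast
 fix \<rho> A assume s: "\<rho> \<in> auts" and A: "A <= G"
 show "acl (\<rho> ` A) <= \<rho> ` acl A"
 proof
  fix g assume g: "g \<in> acl (\<rho> ` A)"
  then have "g \<in> G" using acl_in by blast
  then obtain g' where g': "g' \<in> G" "g = \<rho> g'" using aut_G[OF s] by blast
  have gc: "g' \<in> carrier R" using g'(1) G_carrier by blast
  have "g' \<in> vunits \<O>" if O: "\<O> \<in> vals (kf A)" for \<O>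
  proof -
   have "\<rho> g' \<in> \<rho> ` vunits \<O>" using g aut_vals[OF s A O] g'(2) unfolding acl_def by blast
   moreover have "vunits \<O> <= carrier R" unfolding vunits_def using Units_closed by blast
   ultimately show ?thesis using inj_onD[OF aut_inj[OF s]] gc by blast
  qed
  then show "g \<in> \<rho> ` acl A" unfolding acl_def using g' by blast
 qed
qed

lemma aut_bij_G: "\<rho> \<in> auts ==> bij_betw \<rho> G G"
 unfolding bij_betw_def using aut_G inj_on_subset[OF aut_inj G_carrier] by blast

lemma aut_rk: "\<rho> \<in> auts ==> A <= G ==> rk (\<rho> ` A) = rk A"
 using M.rk_image[of \<rho> A] aut_bij_G aut_ic by simp

lemma aut_td: "\<rho> \<in> auts ==> A <= G ==> td (\<rho> ` A) = td A"
 using D.rk_image[of \<rho> A] aut_bij_G aut_acl by simp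

lemma aut_Int:
 assumes "\<rho> \<in> auts" "A <= carrier R" "B <= carrier R"
 shows "\<rho> ` (A Int B) = \<rho> ` A Int \<rho> ` B" by (rule inj_on_image_Int[OF aut_inj[OF assms(1)] assms(2,3)])

lemma aut_Z:
 assumes s: "\<rho> \<in> auts" and T: "flat T" and W: "flat W" and S: "S \<in> Z T W"
 shows "\<rho> ` S \<in> Z (\<rho> ` T) (\<rho> ` W)"
proof -
 have TG: "T <= G" and WG: "W <= G" using flatD(1) T W by auto
 obtain \<O> where O: "\<O> \<in> vals (kf T)" "rk W + td T = rk (W Int vunits \<O>) + td W" "S = W Int vunits \<O>"
  using S unfolding Z_def full_def by blast
 note v = aut_vals[OF s TG O(1)]
 have "vunits \<O> <= carrier R" unfolding vunits_def using Units_closed by blast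
 then have e: "\<rho> ` S = \<rho> ` W Int vunits (\<rho> ` \<O>)" unfolding O(3) v(2) by (rule aut_Int[OF s order_trans[OF WG G_carrier]])
 have "rk (\<rho> ` S) = rk S" by (rule aut_rk[OF s]) (use O(3) WG in blast)
 then have "full (\<rho> ` T) (\<rho> ` W) (\<rho> ` \<O>)"
  unfolding full_def using v(1) O(2,3) e aut_rk[OF s WG] aut_td[OF s WG] aut_td[OF s TG] by simp
 then show ?thesis unfolding Z_def using e by blast
qed

definition orb :: "'a set => 'a set set" where
 "orb V = (%\<rho>. \<rho> ` V) ` auts"

text \<open>Orbits are taken under all of \<open>auts\<close>, so one choice of subgroups serves
  every group of automorphisms in the theorem.\<close>

definition fin_orb_flats :: "'a set set" where
 "fin_orb_flats = {V. flat V & finite (orb V)}"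

lemma orb_binary:
 assumes "finite (orb V)" "finite (orb W)" "!!\<rho>. \<rho> \<in> auts ==> \<rho> ` f V W = f (\<rho> ` V) (\<rho> ` W)"
 shows "finite (orb (f V W))"
proof -
 have "orb (f V W) <= (%(a, b). f a b) ` (orb V \<times> orb W)" unfolding orb_def using assms(3) by fastforce
 then show ?thesis using assms(1,2) by (meson finite_SigmaI finite_imageI finite_subset)
qed

text \<open>Each operation commutes with automorphisms, so orbits of results are controlled by
  orbits of arguments. For \<open>Z V W\<close> the orbit of a member lies in a union of sets
  \<open>Z a b\<close> over the finitely many translates \<open>a\<close> and \<open>b\<close>, each
  of which is finite.\<close>

lemma val_lattice_fin_orb: "val_lattice R k G fin_orb_flats"
proof (intro val_lattice.intro val_lattice_axioms.intro flat_lattice.intro flat_lattice_axioms.intro)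
 show "mult_field R k G" by (rule mult_field_axioms)
 show "modular_pregeometry (carrier M) (icl M)" by (rule M.modular_pregeometry_axioms)
 show "flat V" if "V \<in> fin_orb_flats" for V using that fin_orb_flats_def by blast
 have c: "V <= carrier R" "V <= G" if "flat V" for V using flatD(1)[OF that] G_carrier by auto
 fix V W assume VW: "V \<in> fin_orb_flats" "W \<in> fin_orb_flats"
 then have f: "flat V" "flat W" and o: "finite (orb V)" "finite (orb W)" unfolding fin_orb_flats_def by auto
 show "V Int W \<in> fin_orb_flats"
  unfolding fin_orb_flats_def using M.flat_Int[OF f] orb_binary[OF o, of "(Int)"] aut_Int[OF _ c(1)[OF f(1)] c(1)[OF f(2)]] by blast
 have u: "\<rho> ` ic (V Un W) = ic (\<rho> ` V Un \<rho> ` W)" if "\<rho> \<in> auts" for \<rho>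
  using aut_ic[OF that, of "V Un W"] c(2)[OF f(1)] c(2)[OF f(2)] image_Un[of \<rho> V W] by simp
 show "ic (V Un W) \<in> fin_orb_flats"
  unfolding fin_orb_flats_def using M.flat_join[OF f] orb_binary[OF o, of "%V W. ic (V Un W)"] u by blast
 have a: "\<rho> ` (V Int acl W) = \<rho> ` V Int acl (\<rho> ` W)" if "\<rho> \<in> auts" for \<rho>
  using aut_Int[OF that c(1)[OF f(1)], of "acl W"] acl_in[of W] G_carrier aut_acl[OF that c(2)[OF f(2)]] by auto
 show "V Int acl W \<in> fin_orb_flats"
  unfolding fin_orb_flats_def using M.flat_Int[OF f(1) acl_flat] orb_binary[OF o, of "%V W. V Int acl W"] a by blast
 assume sub: "V <= W"
 show "Z V W <= fin_orb_flats"
 proof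
  fix S assume S: "S \<in> Z V W"
  have "orb S <= \<Union>((%(a, b). Z a b) ` ({(a, b) \<in> orb V \<times> orb W. a <= b}))"
  proof
   fix X' assume "X' \<in> orb S"
   then obtain \<rho> where s: "\<rho> \<in> auts" "X' = \<rho> ` S" unfolding orb_def by blast
   have "X' \<in> Z (\<rho> ` V) (\<rho> ` W)" unfolding s(2) by (rule aut_Z[OF s(1) f S])
   moreover have "\<rho> ` V \<in> orb V" "\<rho> ` W \<in> orb W" "\<rho> ` V <= \<rho> ` W" using s(1) sub unfolding orb_def by auto
   ultimately show "X' \<in> \<Union>((%(a, b). Z a b) ` ({(a, b) \<in> orb V \<times> orb W. a <= b}))" by blast
  qed
  moreover have "finite (Z a b)" if "a \<in> orb V" "b \<in> orb W" "a <= b" for a b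
   using finite_Z[OF _ _ that(3)] that(1,2) aut_flat f unfolding orb_def by blast
  moreover have "finite {(a, b) \<in> orb V \<times> orb W. a <= b}" by (rule finite_subset[of _ "orb V \<times> orb W"]) (use o in auto)
  ultimately have "finite (orb S)" by (elim finite_subset) auto
  then show "S \<in> fin_orb_flats" unfolding fin_orb_flats_def using Z_props(1)[OF f sub S] by blast
 qed
qed

theorem finite_stable_lines:
 assumes triv: "acl {} = {\<one>}"
 shows "EX Ys. finite Ys & (ALL Y:Ys. flat Y & rk Y = 1 & finite (orb Y)) & ic (\<Union>Ys) = zflat {\<one>} G"
proof -
 interpret V: val_lattice R k G fin_orb_flats by (rule val_lattice_fin_orb)
 have f1: "flat {\<one>}" using acl_flat[of "{}"] triv by simp
 have "orb {\<one>} <= {{\<one>}}" unfolding orb_def using aut_one by auto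
 then have T: "{\<one>} \<in> fin_orb_flats" unfolding fin_orb_flats_def using f1 finite_subset by blast
 have "orb G <= {G}" unfolding orb_def using aut_G by auto
 then have GL: "G \<in> fin_orb_flats" unfolding fin_orb_flats_def using flat_G finite_subset by blast
 have "acl {\<one>} = {\<one>}" using acl_idem[of "{}"] triv by simp
 then have g: "V.good {\<one>} G" unfolding V.good_def using T GL G_one by auto
 define W where "W = zflat {\<one>} G"
 have s: "V.ss {\<one>} W" unfolding W_def by (rule V.semisimple_zflat[OF g])
 define \<L> where "\<L> = {L. V.line {\<one>} L & L <= W}"
 have WG: "W <= G" and fW: "flat W" unfolding W_def using zflat_props[OF f1 flat_G] G_one by auto
 have W: "W = ic ({\<one>} Un \<Union>\<L>)" using s unfolding V.Lat.semisimple_def V.Lat.socle_def \<L>_def by simp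
 have LM: "\<Union>\<L> <= carrier M" using WG unfolding \<L>_def by auto
 have nM: "{} <= carrier M" by simp
 have ic0: "ic {} = {\<one>}" using M.cl_flat_min[OF _ f1, of "{}"] flatD(2)[OF M.flat_cl[OF nM]] by blast
 have W': "W = ic (\<Union>\<L>)"
 proof
  have "{\<one>} Un \<Union>\<L> <= ic (\<Union>\<L>)" using flatD(2)[OF M.flat_cl[OF LM]] M.cl_increasing[OF LM] by blast
  then show "W <= ic (\<Union>\<L>)" unfolding W by (rule M.cl_flat_min[OF _ M.flat_cl[OF LM]])
  show "ic (\<Union>\<L>) <= W" by (rule M.cl_flat_min[OF _ fW]) (use \<L>_def in blast)
 qed
 \<comment> \<open>A basis taken from the union of the lines selects finitely many of them that
   still generate \<open>W\<close>.\<close>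
 obtain I where I: "M.indep I" "I <= \<Union>\<L>" "\<Union>\<L> <= ic I" by (rule M.basis_exists[OF LM]) (rule that)
 have fI: "finite I" by (rule M.indep_finite[OF I(1)])
 have "ALL i:I. EX L:\<L>. i \<in> L" using I(2) by blast
 then obtain h where h: "!!i. i \<in> I ==> h i \<in> \<L> & i \<in> h i" by metis
 have hL: "\<Union>(h ` I) <= \<Union>\<L>" using h by blast
 then have hM: "\<Union>(h ` I) <= carrier M" using LM by blast
 have Ih: "I <= ic (\<Union>(h ` I))" using h M.cl_increasing[OF hM] by blast
 then have "ic I <= ic (\<Union>(h ` I))" by (rule M.cl_flat_min[OF _ M.flat_cl[OF hM]])
 then have "\<Union>\<L> <= ic (\<Union>(h ` I))" using I(3) by blast
 then have "ic (\<Union>\<L>) <= ic (\<Union>(h ` I))" by (rule M.cl_flat_min[OF _ M.flat_cl[OF hM]])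
 moreover have "ic (\<Union>(h ` I)) <= ic (\<Union>\<L>)" by (rule M.cl_mono[OF hL LM])
 ultimately have e: "ic (\<Union>(h ` I)) = W" using W' by simp
 have "rk {\<one>} <= rk {}" using M.rk_mono_cl[of "{\<one>}" "{}"] ic0 by simp
 moreover have "rk {} = 0" using M.rk_eq_card[OF M.indep_empty, of "{}"] by simp
 ultimately have "rk {\<one>} = 0" by simp
 then have "flat Y & rk Y = 1 & finite (orb Y)" if Y: "Y \<in> h ` I" for Y
 proof -
  obtain i where i: "i \<in> I" "Y = h i" using Y by blast
  have "V.line {\<one>} Y" using h[OF i(1)] i(2) unfolding \<L>_def by blast
  then have "Y \<in> fin_orb_flats" "rk Y = Suc (rk {\<one>})" unfolding V.Lat.line_def by auto
  then show ?thesis using \<open>rk {\<one>} = 0\<close> unfolding fin_orb_flats_def by simp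
 qed
 then show ?thesis using fI e unfolding W_def by (intro exI[of _ "h ` I"]) blast
qed

end

section \<open>Rank via the tensor product\<close>

context comm_group
begin

lemma isolated_Union_chain:
 assumes "C ~= {}" "!!H. H \<in> C ==> isolated G H" "!!H V. H \<in> C ==> V \<in> C ==> H <= V | V <= H"
 shows "isolated G (\<Union>C)"
proof -
 have s: "subgroup H G" if "H \<in> C" for H using assms(2)[OF that] isolated_def by blast
 have "subgroup (\<Union>C) G"
 proof (rule subgroupI)
  show "\<Union>C <= carrier G" using subgroup.subset[OF s] by blast
  show "\<Union>C ~= {}" using assms(1) subgroup.one_closed[OF s] by blast
  show "inv a \<in> \<Union>C" if "a \<in> \<Union>C" for a using that subgroup.m_inv_closed[OF s] by blast
  show "a \<otimes> b \<in> \<Union>C" if ab: "a \<in> \<Union>C" "b \<in> \<Union>C" for a b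
  proof -
   obtain H V where HV: "H \<in> C" "a \<in> H" "V \<in> C" "b \<in> V" using ab by blast
   then consider "H <= V" | "V <= H" using assms(3) by blast
   then show ?thesis
   proof cases
    case 1
    then show ?thesis using HV subgroup.m_closed[OF s[OF HV(3)], of a b] by blast
   next
    case 2
    then show ?thesis using HV subgroup.m_closed[OF s[OF HV(1)], of a b] by blast
   qed
  qed
 qed
 then show ?thesis unfolding isolated_def using isolatedD[OF assms(2)] by blast
qed

lemma maximal_isolated_avoiding:
 assumes D: "isolated G D" and g: "g ~: D"
 obtains P where "isolated G P" "D <= P" "g ~: P" "!!H. isolated G H ==> P <= H ==> g ~: H ==> H = P"
proof -
 define A where "A = {H. isolated G H & D <= H & g ~: H}"
 have "EX P:A. ALL H:A. P <= H --> H = P"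
 proof (rule subset_Zorn_nonempty)
  show "A ~= {}" using D g A_def by blast
  fix C assume C: "C ~= {}" "subset.chain A C"
  have "H <= V | V <= H" if "H \<in> C" "V \<in> C" for H V using C(2) that unfolding subset.chain_def by blast
  moreover have CA: "C <= A" using C(2) unfolding subset.chain_def by blast
  moreover have "isolated G H" if "H \<in> C" for H using CA that A_def by blast
  ultimately have "isolated G (\<Union>C)" by (intro isolated_Union_chain[OF C(1)]) blast+
  then show "\<Union>C \<in> A" using CA C(1) unfolding A_def by blast
 qed
 then obtain P where P: "P \<in> A" "ALL H:A. P <= H --> H = P" by blast
 show ?thesis by (rule that[of P]) (use P in \<open>auto simp: A_def\<close>)
qed

text \<open>Modulo a maximal isolated subgroup \<open>P\<close> avoiding \<open>g\<close> the group
  has rank one: by maximality every element satisfies a multiplicative relation with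
  \<open>g\<close> modulo \<open>P\<close>, and the character reads off its slope.\<close>

lemma rational_character:
 assumes D: "isolated G D" and g: "g \<in> carrier G" "g ~: D"
 obtains \<psi> :: "'a => rat" where "!!x y. x \<in> carrier G ==> y \<in> carrier G ==> \<psi> (x \<otimes> y) = \<psi> x + \<psi> y"
  "!!d. d \<in> D ==> \<psi> d = 0" "\<psi> g = 1"
proof -
 obtain P where P: "isolated G P" "D <= P" "g ~: P" "!!H. isolated G H ==> P <= H ==> g ~: H ==> H = P"
  by (rule maximal_isolated_avoiding[OF D g(2)]) (rule that)
 have sP: "subgroup P G" using P(1) isolated_def by blast
 have PG: "P <= carrier G" by (rule subgroup.subset[OF sP])
 note mP = subgroup.m_closed[OF sP] and oP = subgroup.one_closed[OF sP]
 \<comment> \<open>If \<open>\<psi> g = 1\<close> and \<open>\<psi>\<close> vanishes on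
   \<open>P\<close>, membership of the product in \<open>P\<close> forces this value of
   \<open>q\<close> on \<open>h\<close>.\<close>
 define rel where "rel = (%h (q::rat). EX i n. i ~= 0 & h [^] (i::int) \<otimes> g [^] (n::int) \<in> P & q = - of_int n / of_int i)"
 have pow_rel: "(h [^] (i::int) \<otimes> g [^] (n::int)) [^] (j::int) = h [^] (i * j) \<otimes> g [^] (n * j)" if "h \<in> carrier G" for h i n j
  using that g(1) by (simp add: int_pow_distrib int_pow_pow)
 have ex: "EX q. rel h q" if h: "h \<in> carrier G" for h
 proof (cases "h \<in> P")
  case True
  then have "h [^] (1::int) \<otimes> g [^] (0::int) \<in> P" using h g(1) by simp
  then show ?thesis unfolding rel_def by (intro exI[of _ 0] exI[of _ 1] exI[of _ 0]) simp
 next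
  case False
  have hP: "insert h P <= carrier G" using h PG by blast
  have "g \<in> icl G (insert h P)" using P(4)[OF isolated_icl[OF hP]] icl_upper[of "insert h P"] False by blast
  then obtain n d i where n: "n \<ge> (1::nat)" "d \<in> P" "g [^] n = d \<otimes> h [^] (i::int)" using icl_insert_elem[OF P(1) h] by blast
  have dc: "d \<in> carrier G" using n(2) PG by blast
  have "i ~= 0"
  proof
   assume "i = 0"
   then have "g [^] n \<in> P" using n(2,3) dc by simp
   then show False using isolatedD[OF P(1) g(1) n(1)] P(3) by blast
  qed
  have "g [^] (int n) = d \<otimes> h [^] i" using n(3) by (simp add: int_pow_int)
  then have "h [^] i \<otimes> g [^] (- int n) = inv d" using h g(1) dc by (simp add: int_pow_neg inv_mult m_ac)
  then have "h [^] i \<otimes> g [^] (- int n) \<in> P" using subgroup.m_inv_closed[OF sP n(2)] by simp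
  then show ?thesis unfolding rel_def using \<open>i ~= 0\<close> by blast
 qed
 have uniq: "q = q'" if h: "h \<in> carrier G" and r: "rel h q" "rel h q'" for h q q'
 proof -
  obtain i n where 1: "i ~= 0" "h [^] (i::int) \<otimes> g [^] (n::int) \<in> P" "q = - of_int n / of_int i" using r(1) rel_def by blast
  obtain i' n' where 2: "i' ~= 0" "h [^] (i'::int) \<otimes> g [^] (n'::int) \<in> P" "q' = - of_int n' / of_int i'" using r(2) rel_def by blast
  have "(h [^] i \<otimes> g [^] n) [^] i' \<otimes> inv ((h [^] i' \<otimes> g [^] n') [^] i) \<in> P"
   using mP subgroup.m_inv_closed[OF sP] subgroup_int_pow[OF sP] 1(2) 2(2) by blast
  moreover have "(h [^] i \<otimes> g [^] n) [^] i' \<otimes> inv ((h [^] i' \<otimes> g [^] n') [^] i) = g [^] (n * i' - n' * i)"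
  proof -
   have "(h [^] i \<otimes> g [^] n) [^] i' \<otimes> inv ((h [^] i' \<otimes> g [^] n') [^] i)
    = (h [^] (i * i') \<otimes> g [^] (n * i')) \<otimes> (h [^] (- (i' * i)) \<otimes> g [^] (- (n' * i)))"
    using pow_rel[OF h] h g(1) by (simp add: inv_mult int_pow_neg)
   also have "\<dots> = (h [^] (i * i') \<otimes> h [^] (- (i' * i))) \<otimes> (g [^] (n * i') \<otimes> g [^] (- (n' * i)))"
    using h g(1) by (simp add: m_ac)
   also have "\<dots> = g [^] (n * i' - n' * i)" using h g(1) by (simp add: int_pow_mult[symmetric] mult.commute)
   finally show ?thesis .
  qed
  ultimately have "g [^] (n * i' - n' * i) \<in> P" by simp
  then have "n * i' - n' * i = 0" using isolatedD_int[OF P(1) g(1)] P(3) by blast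
  then have "n * i' = n' * i" by simp
  then have "(of_int n :: rat) * of_int i' = of_int n' * of_int i" by (metis of_int_mult)
  then show ?thesis unfolding 1(3) 2(3) using 1(1) 2(1) by (simp add: field_simps)
 qed
 define \<psi> where "\<psi> = (%h. THE q. rel h q)"
 have \<psi>: "\<psi> h = q" if "h \<in> carrier G" "rel h q" for h q unfolding \<psi>_def using that uniq by (intro the_equality) blast+
 have \<psi>': "rel h (\<psi> h)" if "h \<in> carrier G" for h using ex[OF that] \<psi>[OF that] by metis
 show ?thesis
 proof (rule that[of \<psi>])
  fix x y assume xy: "x \<in> carrier G" "y \<in> carrier G"
  obtain i n where 1: "i ~= 0" "x [^] (i::int) \<otimes> g [^] (n::int) \<in> P" "\<psi> x = - of_int n / of_int i"
   using \<psi>'[OF xy(1)] rel_def by blast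
  obtain j m where 2: "j ~= 0" "y [^] (j::int) \<otimes> g [^] (m::int) \<in> P" "\<psi> y = - of_int m / of_int j"
   using \<psi>'[OF xy(2)] rel_def by blast
  have "(x [^] i \<otimes> g [^] n) [^] j \<otimes> (y [^] j \<otimes> g [^] m) [^] i \<in> P" using mP subgroup_int_pow[OF sP] 1(2) 2(2) by blast
  moreover have "(x [^] i \<otimes> g [^] n) [^] j \<otimes> (y [^] j \<otimes> g [^] m) [^] i = (x \<otimes> y) [^] (i * j) \<otimes> g [^] (n * j + m * i)"
  proof -
   have "(x [^] i \<otimes> g [^] n) [^] j \<otimes> (y [^] j \<otimes> g [^] m) [^] i
    = (x [^] (i * j) \<otimes> y [^] (j * i)) \<otimes> (g [^] (n * j) \<otimes> g [^] (m * i))"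
    unfolding pow_rel[OF xy(1)] pow_rel[OF xy(2)] using xy g(1) by (simp add: m_ac)
   then show ?thesis using xy g(1) by (simp add: int_pow_distrib int_pow_mult mult.commute)
  qed
  ultimately have "rel (x \<otimes> y) (- of_int (n * j + m * i) / of_int (i * j))"
   unfolding rel_def using 1(1) 2(1) by (intro exI[of _ "i * j"] exI[of _ "n * j + m * i"]) simp
  then have "\<psi> (x \<otimes> y) = - of_int (n * j + m * i) / of_int (i * j)" using \<psi> xy by simp
  then show "\<psi> (x \<otimes> y) = \<psi> x + \<psi> y" unfolding 1(3) 2(3) using 1(1) 2(1) by (simp add: field_simps)
 next
  fix d assume d: "d \<in> D"
  then have dc: "d \<in> carrier G" "d \<in> P" using P(2) PG by auto
  then have "d [^] (1::int) \<otimes> g [^] (0::int) \<in> P" using g(1) by simp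
  then have "rel d 0" unfolding rel_def by (intro exI[of _ 1] exI[of _ 0]) simp
  then show "\<psi> d = 0" using \<psi> dc(1) by blast
 next
  have "g [^] (1::int) \<otimes> g [^] (-1::int) \<in> P" using g(1) oP by (simp add: int_pow_neg)
  then have "rel g 1" unfolding rel_def by (intro exI[of _ 1] exI[of _ "-1"]) simp
  then show "\<psi> g = 1" using \<psi> g(1) by blast
 qed
qed

section \<open>The tensor product as a quotient of a free abelian group\<close>

definition ind :: "('a \<times> rat) set" where "ind = carrier G \<times> UNIV"
definition tF where "tF = free_Abelian_group ind"
definition tN where "tN = generate tF (tensor_relations G)"
definition cls where "cls x = tN #>\<^bsub>tF\<^esub> x"

lemma tF_simps [simp]: "x \<in> carrier tF \<longleftrightarrow> Poly_Mapping.keys x <= ind" "x \<otimes>\<^bsub>tF\<^esub> y = x + y" "\<one>\<^bsub>tF\<^esub> = 0"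
 unfolding tF_def by auto

lemma tF_comm_group: "comm_group tF" unfolding tF_def by (rule abelian_free_Abelian_group)

lemma keys_closed:
 assumes "Poly_Mapping.keys x <= ind" "Poly_Mapping.keys y <= ind"
 shows "Poly_Mapping.keys (x + y) <= ind" "Poly_Mapping.keys (x - y) <= ind"
 using assms keys_add[of x y] keys_diff[of x y] by blast+

lemma keys_frag: "g \<in> carrier G ==> Poly_Mapping.keys (frag_of (g, q)) <= ind" unfolding ind_def by simp

lemma tensor_relations_in: "tensor_relations G <= carrier tF"
proof
 fix x assume "x \<in> tensor_relations G"
 then consider g h q where "x = frag_of (g \<otimes> h, q) - frag_of (g, q) - frag_of (h, q)" "g \<in> carrier G" "h \<in> carrier G"
  | g q r where "x = frag_of (g, q + r) - frag_of (g, q) - frag_of (g, r)" "g \<in> carrier G" unfolding tensor_relations_def by blast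
 then have "Poly_Mapping.keys x <= ind"
 proof cases
  case 1
  then show ?thesis using keys_closed(2)[OF keys_closed(2)[OF keys_frag keys_frag] keys_frag] m_closed by simp
 next
  case 2
  then show ?thesis using keys_closed(2)[OF keys_closed(2)[OF keys_frag keys_frag] keys_frag] by simp
 qed
 then show "x \<in> carrier tF" using tF_simps(1) by blast
qed

lemma tN_subgroup: "subgroup tN tF"
 unfolding tN_def by (rule group.generate_is_subgroup[OF comm_group.axioms(2)[OF tF_comm_group] tensor_relations_in])

lemma tN_in: "n \<in> tN ==> Poly_Mapping.keys n <= ind"
 using subsetD[OF subgroup.subset[OF tN_subgroup], of n] tF_simps(1)[of n] by blast

lemma tN_0: "0 \<in> tN" and tN_add: "x \<in> tN ==> y \<in> tN ==> x + y \<in> tN"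
 using subgroup.one_closed[OF tN_subgroup] subgroup.m_closed[OF tN_subgroup, of x y] by auto

lemma tN_uminus: "x \<in> tN ==> - x \<in> tN" using subgroup.m_inv_closed[OF tN_subgroup, of x] tN_in[of x] unfolding tF_def by simp

lemma tN_diff: "x \<in> tN ==> y \<in> tN ==> x - y \<in> tN" using tN_add[OF _ tN_uminus, of x y] by simp

lemma tN_rel: "x \<in> tensor_relations G ==> x \<in> tN" unfolding tN_def by (rule generate.incl)

lemma tN_induct [consumes 1, case_names rel zero diff]:
 assumes "x \<in> tN" "!!x. x \<in> tensor_relations G ==> P x" "P 0" "!!x y. x \<in> tN ==> y \<in> tN ==> P x ==> P y ==> P (x - y)"
 shows "P x"
proof -
 have "x \<in> tN & P x" using assms(1) unfolding tN_def
 proof (induction rule: generate.induct)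
  case one
  then show ?case using assms(3) tN_0 tN_def by simp
 next
  case (incl h)
  then show ?case using assms(2) generate.incl by metis
 next
  case (inv h)
  have "h \<in> tN" using inv tN_rel by blast
  then have "P (0 - h)" using assms(4)[OF tN_0, of h] assms(2)[OF inv] assms(3) by blast
  moreover have "inv\<^bsub>tF\<^esub> h = 0 - h" using tN_in[OF \<open>h \<in> tN\<close>] unfolding tF_def by simp
  ultimately show ?case using tN_uminus[OF \<open>h \<in> tN\<close>] tN_def by simp
 next
  case (eng h1 h2)
  then have h: "h1 \<in> tN" "h2 \<in> tN" "P h1" "P h2" unfolding tN_def by auto
  have "P (- h2)" using assms(4)[OF tN_0 h(2) assms(3) h(4)] by simp
  then have "P (h1 - (- h2))" by (rule assms(4)[OF h(1) tN_uminus[OF h(2)] h(3)])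
  then show ?case using tN_add[OF h(1,2)] tN_def by simp
 qed
 then show ?thesis by blast
qed

lemma cls_mem: "y \<in> cls x \<longleftrightarrow> y - x \<in> tN"
proof -
 have "cls x = (%n. n + x) ` tN" unfolding cls_def r_coset_def by (auto simp: image_def)
 then show ?thesis by (metis (no_types, lifting) add_diff_cancel_right' diff_add_cancel image_iff)
qed

lemma cls_eq: "cls x = cls y \<longleftrightarrow> x - y \<in> tN"
proof
 assume "cls x = cls y"
 moreover have "x \<in> cls x" unfolding cls_mem using tN_0 by simp
 ultimately show "x - y \<in> tN" using cls_mem by blast
next
 assume a: "x - y \<in> tN"
 have "z - x \<in> tN \<longleftrightarrow> z - y \<in> tN" for z using tN_add[OF _ a, of "z - x"] tN_diff[OF _ a, of "z - y"] by auto
 then show "cls x = cls y" using cls_mem by blast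
qed

definition ts :: "rat => (('a \<times> rat) \<Rightarrow>\<^sub>0 int) => (('a \<times> rat) \<Rightarrow>\<^sub>0 int)" where "ts = tensor_scale"

lemma ts_frag [simp]: "ts r (frag_of (g, q)) = frag_of (g, r * q)" unfolding ts_def tensor_scale_def by simp

lemma ts_add: "ts r (x + y) = ts r x + ts r y" and ts_diff: "ts r (x - y) = ts r x - ts r y" and ts_0: "ts r 0 = 0"
 unfolding ts_def tensor_scale_def by (simp_all add: frag_extend_add frag_extend_diff)

lemma tF_induct [consumes 1, case_names zero frag diff]:
 assumes "Poly_Mapping.keys x <= ind" "P 0" "!!g q. g \<in> carrier G ==> P (frag_of (g, q))"
  "!!x y. Poly_Mapping.keys x <= ind ==> Poly_Mapping.keys y <= ind ==> P x ==> P y ==> P (x - y)"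
 shows "P x" by (rule free_Abelian_group_induct[OF assms(1)]) (use assms(2-4) in \<open>auto simp: ind_def\<close>)

lemma ts_in: "Poly_Mapping.keys x <= ind ==> Poly_Mapping.keys (ts r x) <= ind"
proof (induction x rule: tF_induct)
 case (diff x y)
 then show ?case using keys_closed(2) ts_diff by metis
qed (auto simp: ts_0 ind_def)

lemma ts_tN: "x \<in> tN ==> ts r x \<in> tN"
proof (induction x rule: tN_induct)
 case (rel x)
 then consider g h q where "x = frag_of (g \<otimes> h, q) - frag_of (g, q) - frag_of (h, q)" "g \<in> carrier G" "h \<in> carrier G"
  | g q s where "x = frag_of (g, q + s) - frag_of (g, q) - frag_of (g, s)" "g \<in> carrier G" unfolding tensor_relations_def by blast
 then have "ts r x \<in> tensor_relations G"
 proof cases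
  case 1
  then show ?thesis unfolding tensor_relations_def by (auto simp: ts_diff)
 next
  case 2
  then have "ts r x = frag_of (g, r * q + r * s) - frag_of (g, r * q) - frag_of (g, r * s)" by (simp add: ts_diff distrib_left)
  then show ?thesis using 2 unfolding tensor_relations_def by blast
 qed
 then show ?case by (rule tN_rel)
next
 case (diff x y)
 then show ?case using tN_diff ts_diff by metis
qed (simp add: ts_0 tN_0)

lemma rat_tensor_eq: "rat_tensor G = \<lparr> carrier = carrier (tF Mod tN), monoid.mult = (%_ _. tN), one = tN,
  ring.zero = \<one>\<^bsub>tF Mod tN\<^esub>, ring.add = (\<otimes>\<^bsub>tF Mod tN\<^esub>), module.smult = (%r C. tN <#>\<^bsub>tF\<^esub> (tensor_scale r ` C)) \<rparr>"
 unfolding rat_tensor_def tN_def tF_def ind_def Let_def ..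

lemma tensor_carrier: "carrier (rat_tensor G) = cls ` {x. Poly_Mapping.keys x <= ind}"
 unfolding rat_tensor_eq FactGroup_def RCOSETS_def cls_def by auto

lemma tensor_add: "cls x \<oplus>\<^bsub>rat_tensor G\<^esub> cls y = cls (x + y)"
proof -
 have "cls x <#>\<^bsub>tF\<^esub> cls y = cls (x + y)"
 proof
  show "cls x <#>\<^bsub>tF\<^esub> cls y <= cls (x + y)"
  proof
   fix z assume "z \<in> cls x <#>\<^bsub>tF\<^esub> cls y"
   then obtain a b where ab: "a - x \<in> tN" "b - y \<in> tN" "z = a + b" unfolding set_mult_def cls_mem[symmetric] by auto
   have "(a - x) + (b - y) \<in> tN" by (rule tN_add[OF ab(1,2)])
   then show "z \<in> cls (x + y)" unfolding cls_mem ab(3) by (simp add: algebra_simps)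
  qed
  show "cls (x + y) <= cls x <#>\<^bsub>tF\<^esub> cls y"
  proof
   fix z assume "z \<in> cls (x + y)"
   then have "(z - y) - x \<in> tN" unfolding cls_mem by (simp add: algebra_simps)
   then have "z - y \<in> cls x" unfolding cls_mem .
   moreover have "y \<in> cls y" unfolding cls_mem using tN_0 by simp
   moreover have "z = (z - y) \<otimes>\<^bsub>tF\<^esub> y" by simp
   ultimately show "z \<in> cls x <#>\<^bsub>tF\<^esub> cls y" unfolding set_mult_def by blast
  qed
 qed
 then show ?thesis unfolding rat_tensor_eq FactGroup_def by simp
qed

lemma tensor_zero: "\<zero>\<^bsub>rat_tensor G\<^esub> = cls 0"
proof -
 have "tN = cls 0" using cls_mem[of _ 0] by auto
 then show ?thesis unfolding rat_tensor_eq FactGroup_def by simp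
qed

lemma tensor_smult: "r \<odot>\<^bsub>rat_tensor G\<^esub> cls x = cls (ts r x)"
proof -
 have "tN <#>\<^bsub>tF\<^esub> (ts r ` cls x) = cls (ts r x)"
 proof
  show "tN <#>\<^bsub>tF\<^esub> (ts r ` cls x) <= cls (ts r x)"
  proof
   fix z assume "z \<in> tN <#>\<^bsub>tF\<^esub> (ts r ` cls x)"
   then obtain n a where na: "n \<in> tN" "a - x \<in> tN" "z = n + ts r a" unfolding set_mult_def cls_mem[symmetric] by auto
   have "n + ts r (a - x) \<in> tN" by (rule tN_add[OF na(1) ts_tN[OF na(2)]])
   then show "z \<in> cls (ts r x)" unfolding cls_mem na(3) by (simp add: ts_diff algebra_simps)
  qed
  show "cls (ts r x) <= tN <#>\<^bsub>tF\<^esub> (ts r ` cls x)"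
  proof
   fix z assume "z \<in> cls (ts r x)"
   then have "z - ts r x \<in> tN" unfolding cls_mem .
   moreover have "x \<in> cls x" unfolding cls_mem using tN_0 by simp
   moreover have "z = (z - ts r x) \<otimes>\<^bsub>tF\<^esub> ts r x" by simp
   ultimately show "z \<in> tN <#>\<^bsub>tF\<^esub> (ts r ` cls x)" unfolding set_mult_def by blast
  qed
 qed
 then show ?thesis unfolding rat_tensor_eq ts_def by simp
qed

lemma ts_scalar_add: "Poly_Mapping.keys x <= ind ==> ts (r + s) x - (ts r x + ts s x) \<in> tN"
proof (induction x rule: tF_induct)
 case zero
 then show ?case using tN_0 by (simp add: ts_0)
next
 case (frag g q)
 have "frag_of (g, r * q + s * q) - frag_of (g, r * q) - frag_of (g, s * q) \<in> tN"
  by (rule tN_rel) (use frag in \<open>auto simp: tensor_relations_def\<close>)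
 then show ?case by (simp add: distrib_right algebra_simps)
next
 case (diff x y)
 have "(ts (r + s) x - (ts r x + ts s x)) - (ts (r + s) y - (ts r y + ts s y)) \<in> tN" by (rule tN_diff[OF diff.IH])
 then show ?case by (simp add: ts_diff algebra_simps)
qed

lemma ts_scalar_mult: "Poly_Mapping.keys x <= ind ==> ts (r * s) x = ts r (ts s x)"
 by (induction x rule: tF_induct) (simp_all add: ts_0 ts_diff mult.assoc)

lemma ts_one: "Poly_Mapping.keys x <= ind ==> ts 1 x = x" by (induction x rule: tF_induct) (simp_all add: ts_0 ts_diff)

lemma rat_field: "field rat_field"
proof -
 have ag: "abelian_group rat_field"
 proof (rule abelian_groupI)
  fix x assume "x \<in> carrier rat_field"
  show "EX y:carrier rat_field. y \<oplus>\<^bsub>rat_field\<^esub> x = \<zero>\<^bsub>rat_field\<^esub>"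
   by (rule bexI[of _ "- x"]) (auto simp: rat_field_def)
 qed (auto simp: rat_field_def)
 have "cring rat_field" by (rule cringI[OF ag], rule comm_monoidI) (auto simp: rat_field_def distrib_right)
 then show ?thesis
 proof (rule cring.cring_fieldI2)
  show "\<zero>\<^bsub>rat_field\<^esub> ~= \<one>\<^bsub>rat_field\<^esub>" by (simp add: rat_field_def)
  fix a assume "a \<in> carrier rat_field" "a ~= \<zero>\<^bsub>rat_field\<^esub>"
  then show "EX b:carrier rat_field. a \<otimes>\<^bsub>rat_field\<^esub> b = \<one>\<^bsub>rat_field\<^esub>"
   by (intro bexI[of _ "inverse a"]) (auto simp: rat_field_def)
 qed
qed

lemma rat_field_simps: "carrier rat_field = UNIV" "x \<oplus>\<^bsub>rat_field\<^esub> y = x + y" "x \<otimes>\<^bsub>rat_field\<^esub> y = x * y"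
 "\<zero>\<^bsub>rat_field\<^esub> = 0" "\<one>\<^bsub>rat_field\<^esub> = 1" by (simp_all add: rat_field_def)

lemma tensor_vectorspace: "vectorspace rat_field (rat_tensor G)"
proof -
 have ag: "abelian_group (rat_tensor G)"
 proof (rule abelian_groupI)
  show "\<zero>\<^bsub>rat_tensor G\<^esub> \<in> carrier (rat_tensor G)" unfolding tensor_carrier tensor_zero by auto
  show "x \<oplus>\<^bsub>rat_tensor G\<^esub> y \<in> carrier (rat_tensor G)"
   if xy: "x \<in> carrier (rat_tensor G)" "y \<in> carrier (rat_tensor G)" for x y
  proof -
   obtain a b where a: "x = cls a" "Poly_Mapping.keys a <= ind" "y = cls b" "Poly_Mapping.keys b <= ind"
    using xy unfolding tensor_carrier by blast
   then show ?thesis unfolding tensor_carrier using keys_closed(1)[OF a(2,4)] by (simp add: tensor_add)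
  qed
  show "EX y:carrier (rat_tensor G). y \<oplus>\<^bsub>rat_tensor G\<^esub> x = \<zero>\<^bsub>rat_tensor G\<^esub>"
   if x: "x \<in> carrier (rat_tensor G)" for x
  proof -
   obtain a where a: "x = cls a" "Poly_Mapping.keys a <= ind" using x unfolding tensor_carrier by blast
   then show ?thesis unfolding tensor_carrier tensor_zero by (intro bexI[of _ "cls (- a)"]) (auto simp: tensor_add)
  qed
 qed (auto simp: tensor_carrier tensor_zero tensor_add algebra_simps)
 have "module rat_field (rat_tensor G)"
 proof (rule moduleI[OF _ ag])
  show "cring rat_field" by (rule domain.axioms(1)[OF field.axioms(1)[OF rat_field]])
  show "a \<odot>\<^bsub>rat_tensor G\<^esub> x \<in> carrier (rat_tensor G)" if "x \<in> carrier (rat_tensor G)" for a x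
   using that ts_in unfolding tensor_carrier by (auto simp: tensor_smult)
  show "(a \<oplus>\<^bsub>rat_field\<^esub> b) \<odot>\<^bsub>rat_tensor G\<^esub> x = a \<odot>\<^bsub>rat_tensor G\<^esub> x \<oplus>\<^bsub>rat_tensor G\<^esub> b \<odot>\<^bsub>rat_tensor G\<^esub> x"
   if x: "x \<in> carrier (rat_tensor G)" for a b x
  proof -
   obtain u where u: "x = cls u" "Poly_Mapping.keys u <= ind" using x unfolding tensor_carrier by blast
   have "cls (ts (a + b) u) = cls (ts a u + ts b u)" unfolding cls_eq by (rule ts_scalar_add[OF u(2)])
   then show ?thesis unfolding u(1) tensor_smult tensor_add rat_field_simps .
  qed
 qed (auto simp: tensor_carrier tensor_smult tensor_add rat_field_simps ts_add ts_scalar_mult ts_one)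
 then show ?thesis using rat_field by (rule vectorspace.intro)
qed

text \<open>The functional induced by \<open>\<psi>\<close>, sending a generator
  \<open>(g, q)\<close> to \<open>q * \<psi> g\<close>. It is defined on the free group;
  \<open>phi_tN\<close> lets it descend to the tensor product when \<open>\<psi>\<close> is
  additive.\<close>

definition phi :: "('a => rat) => (('a \<times> rat) \<Rightarrow>\<^sub>0 int) => rat" where
 "phi \<psi> c = (\<Sum>p\<in>Poly_Mapping.keys c. of_int (Poly_Mapping.lookup c p) * (snd p * \<psi> (fst p)))"

lemma phi_superset:
 assumes "finite S" "Poly_Mapping.keys c <= S"
 shows "phi \<psi> c = (\<Sum>p\<in>S. of_int (Poly_Mapping.lookup c p) * (snd p * \<psi> (fst p)))"
 unfolding phi_def by (rule sum.mono_neutral_left[OF assms]) (auto simp: in_keys_iff)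

lemma phi_diff: "phi \<psi> (x - y) = phi \<psi> x - phi \<psi> y"
proof -
 let ?S = "Poly_Mapping.keys x Un Poly_Mapping.keys y"
 have "finite ?S" by simp
 note p = phi_superset[OF this]
 have "phi \<psi> (x - y) = (\<Sum>p\<in>?S. of_int (Poly_Mapping.lookup (x - y) p) * (snd p * \<psi> (fst p)))" by (rule p[OF keys_diff])
 also have "\<dots> = phi \<psi> x - phi \<psi> y" using p[of x] p[of y] by (simp add: lookup_minus left_diff_distrib sum_subtractf)
 finally show ?thesis .
qed

lemma phi_0: "phi \<psi> 0 = 0" and phi_frag: "phi \<psi> (frag_of (g, q)) = q * \<psi> g" unfolding phi_def by simp_all

lemma phi_ts: "Poly_Mapping.keys x <= ind ==> phi \<psi> (ts r x) = r * phi \<psi> x"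
 by (induction x rule: tF_induct) (simp_all add: ts_0 phi_0 phi_frag ts_diff phi_diff right_diff_distrib)

lemma phi_tN:
 assumes "!!x y. x \<in> carrier G ==> y \<in> carrier G ==> \<psi> (x \<otimes> y) = \<psi> x + \<psi> y"
 shows "x \<in> tN ==> phi \<psi> x = 0"
proof (induction x rule: tN_induct)
 case (rel x)
 then consider g h q where "x = frag_of (g \<otimes> h, q) - frag_of (g, q) - frag_of (h, q)" "g \<in> carrier G" "h \<in> carrier G"
  | g q s where "x = frag_of (g, q + s) - frag_of (g, q) - frag_of (g, s)" "g \<in> carrier G" unfolding tensor_relations_def by blast
 then show ?case
 proof cases
  case 1
  then show ?thesis using assms[OF 1(2,3)] by (simp add: phi_diff phi_frag distrib_left)
 next
  case 2
  then show ?thesis by (simp add: phi_diff phi_frag distrib_right)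
 qed
qed (simp_all add: phi_0 phi_diff)

text \<open>\<open>B\<close> collects the first components in representatives of a finite generating
  set. A \<open>g\<close> outside \<open>icl G B\<close> would admit a character that vanishes on
  \<open>B\<close> but not at \<open>g\<close>; its functional would vanish on the generators and
  hence everywhere.\<close>

lemma finite_rank_imp_finite_icl:
 assumes "finite_rank G"
 shows "EX B. finite B & B <= carrier G & carrier G <= icl G B"
proof -
 interpret V: vectorspace rat_field "rat_tensor G" by (rule tensor_vectorspace)
 obtain A where A: "finite A" "A <= carrier (rat_tensor G)" "V.gen_set A" using assms unfolding finite_rank_def V.fin_dim_def by blast
 have "ALL a:A. EX x. a = cls x & Poly_Mapping.keys x <= ind" using A(2) unfolding tensor_carrier by blast
 then obtain h where h: "!!a. a \<in> A ==> a = cls (h a) & Poly_Mapping.keys (h a) <= ind" by metis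
 define B where "B = (\<Union>a\<in>A. fst ` Poly_Mapping.keys (h a))"
 have fB: "finite B" unfolding B_def using A(1) by simp
 have BG: "B <= carrier G" unfolding B_def using h unfolding ind_def by fastforce
 have "carrier G <= icl G B"
 proof (rule ccontr)
  assume "~ carrier G <= icl G B"
  then obtain g where g: "g \<in> carrier G" "g ~: icl G B" by blast
  obtain \<psi> :: "'a => rat" where p: "!!x y. x \<in> carrier G ==> y \<in> carrier G ==> \<psi> (x \<otimes> y) = \<psi> x + \<psi> y"
   "!!d. d \<in> icl G B ==> \<psi> d = 0" "\<psi> g = 1" by (rule rational_character[OF isolated_icl[OF BG] g]) (rule that)
  define K where "K = {C \<in> carrier (rat_tensor G). ALL x:C. phi \<psi> x = 0}"
  have K: "cls x \<in> K \<longleftrightarrow> phi \<psi> x = 0" if "Poly_Mapping.keys x <= ind" for x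
  proof -
   have 1: "phi \<psi> y = phi \<psi> x" if "y \<in> cls x" for y using phi_tN[OF p(1), of "y - x"] that unfolding cls_mem phi_diff by simp
   have 2: "x \<in> cls x" unfolding cls_mem using tN_0 by simp
   have 3: "cls x \<in> carrier (rat_tensor G)" unfolding tensor_carrier using that by blast
   show ?thesis
   proof
    show "phi \<psi> x = 0" if "cls x \<in> K" using that 2 unfolding K_def by blast
    show "cls x \<in> K" if x: "phi \<psi> x = 0"
    proof -
     have "ALL y:cls x. phi \<psi> y = 0" using 1 x by simp
     then show ?thesis using 3 unfolding K_def by blast
    qed
   qed
  qed
  have phi_add: "phi \<psi> (x + y) = phi \<psi> x + phi \<psi> y" for x y using phi_diff[of \<psi> "x + y" y] by simp
  have Kc: "C \<in> K ==> EX x. C = cls x & Poly_Mapping.keys x <= ind & phi \<psi> x = 0" for C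
   using K unfolding K_def tensor_carrier by blast
  have K0: "\<zero>\<^bsub>rat_tensor G\<^esub> \<in> K" unfolding tensor_zero using K[of 0] phi_0 by simp
  have Kadd: "C \<oplus>\<^bsub>rat_tensor G\<^esub> C' \<in> K" if C: "C \<in> K" "C' \<in> K" for C C'
  proof -
   obtain x y where "C = cls x" "Poly_Mapping.keys x <= ind" "phi \<psi> x = 0" "C' = cls y" "Poly_Mapping.keys y <= ind" "phi \<psi> y = 0"
    using Kc C by metis
   then show ?thesis using K[OF keys_closed(1)] by (simp add: tensor_add phi_add)
  qed
  have Ksm: "r \<odot>\<^bsub>rat_tensor G\<^esub> C \<in> K" if C: "C \<in> K" for r C
  proof -
   obtain x where "C = cls x" "Poly_Mapping.keys x <= ind" "phi \<psi> x = 0" using Kc[OF C] by blast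
   then show ?thesis using K[OF ts_in] phi_ts by (simp add: tensor_smult)
  qed
  have AK: "A <= K"
  proof
   fix a assume a: "a \<in> A"
   have "\<psi> (fst p) = 0" if "p \<in> Poly_Mapping.keys (h a)" for p using p(2) icl_upper[of B] a that unfolding B_def by blast
   then have "phi \<psi> (h a) = 0" unfolding phi_def by simp
   then show "a \<in> K" using K[of "h a"] h[OF a] by metis
  qed
  have fs: "finsum (rat_tensor G) f S \<in> K" if "finite S" "!!i. i \<in> S ==> f i \<in> K" for f S using that
  proof (induction S rule: finite_induct)
   case empty
   then show ?case using K0 by simp
  next
   case (insert i S)
   have "finsum (rat_tensor G) f (Set.insert i S) = f i \<oplus>\<^bsub>rat_tensor G\<^esub> finsum (rat_tensor G) f S"
    by (rule V.M.finsum_insert) (use insert K_def in auto)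
   then show ?case using Kadd insert by simp
  qed
  have "V.lincomb c S \<in> K" if "finite S" "S <= A" for c S
   unfolding V.lincomb_def by (rule fs[OF that(1)]) (rule Ksm, rule subsetD[OF AK], rule subsetD[OF that(2)])
  then have "V.span A <= K" unfolding V.span_def by blast
  moreover have "cls (frag_of (g, 1)) \<in> carrier (rat_tensor G)" unfolding tensor_carrier using keys_frag[OF g(1)] by blast
  ultimately have "cls (frag_of (g, 1)) \<in> K" using A(3) by blast
  then show False using K[OF keys_frag[OF g(1)]] p(3) by (simp add: phi_frag)
 qed
 then show ?thesis using fB BG by blast
qed

text \<open>\<open>y\<close> tensor one spans, because exponents can be moved into the rational
  factor. It is independent by the functional of a character with value one at
  \<open>y\<close>.\<close>

lemma rank_one_if_icl_singleton:
 assumes y: "y \<in> carrier G" "carrier G <= icl G {y}" and tf: "isolated G {\<one>}" "y ~= \<one>"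
 shows "rank_one G"
proof -
 interpret V: vectorspace rat_field "rat_tensor G" by (rule tensor_vectorspace)
 define C0 where "C0 = cls (frag_of (y, 1))"
 have C0: "C0 \<in> carrier (rat_tensor G)" unfolding C0_def tensor_carrier using keys_frag[OF y(1)] by blast
 obtain \<psi> :: "'a => rat" where p: "!!x y. x \<in> carrier G ==> y \<in> carrier G ==> \<psi> (x \<otimes> y) = \<psi> x + \<psi> y"
   "!!d. d \<in> {\<one>} ==> \<psi> d = 0" "\<psi> y = 1" by (rule rational_character[OF tf(1) y(1)]) (use tf(2) that in auto)
 have bil: "frag_of (g \<otimes> h, q) - (frag_of (g, q) + frag_of (h, q)) \<in> tN" if "g \<in> carrier G" "h \<in> carrier G" for g h q
  using tN_rel[of "frag_of (g \<otimes> h, q) - frag_of (g, q) - frag_of (h, q)"] that unfolding tensor_relations_def by (auto simp: algebra_simps)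
 have bil2: "frag_of (g, q + s) - (frag_of (g, q) + frag_of (g, s)) \<in> tN" if "g \<in> carrier G" for g q s
  using tN_rel[of "frag_of (g, q + s) - frag_of (g, q) - frag_of (g, s)"] that unfolding tensor_relations_def by (auto simp: algebra_simps)
 have pow: "frag_of (g [^] n, q) - frag_of (g, of_nat n * q) \<in> tN" if g: "g \<in> carrier G" for g q and n :: nat
 proof (induction n)
  case 0
  have "frag_of (\<one>, q) - (frag_of (\<one>, q) + frag_of (\<one>, q)) \<in> tN" using bil[of \<one> \<one> q] by simp
  then have 1: "- frag_of (\<one>, q) \<in> tN" by simp
  have "frag_of (g, 0) - (frag_of (g, 0) + frag_of (g, 0)) \<in> tN" using bil2[OF g, of 0 0] by simp
  then have "- frag_of (g, 0) \<in> tN" by simp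
  then have "- frag_of (g, 0) - (- frag_of (\<one>, q)) \<in> tN" using 1 tN_diff by blast
  then show ?case by simp
 next
  case (Suc n)
  have a: "frag_of (g [^] n \<otimes> g, q) - (frag_of (g [^] n, q) + frag_of (g, q)) \<in> tN" using bil g by simp
  have b: "frag_of (g, of_nat n * q + q) - (frag_of (g, of_nat n * q) + frag_of (g, q)) \<in> tN" using bil2 g by simp
  have "(frag_of (g [^] n \<otimes> g, q) - (frag_of (g [^] n, q) + frag_of (g, q)))
    + (frag_of (g [^] n, q) - frag_of (g, of_nat n * q))
    - (frag_of (g, of_nat n * q + q) - (frag_of (g, of_nat n * q) + frag_of (g, q))) \<in> tN" by (rule tN_diff[OF tN_add[OF a Suc] b])
  then show ?case by (simp add: algebra_simps)
 qed
 have pinv: "frag_of (inv g, q) - frag_of (g, - q) \<in> tN" if g: "g \<in> carrier G" for g q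
 proof -
  have a: "frag_of (inv g \<otimes> g, q) - (frag_of (inv g, q) + frag_of (g, q)) \<in> tN" by (rule bil) (use g in auto)
  have b: "frag_of (g, - q + q) - (frag_of (g, - q) + frag_of (g, q)) \<in> tN" by (rule bil2[OF g])
  have c: "frag_of (\<one>, q) - frag_of (g, 0) \<in> tN" using pow[OF g, of 0 q] by simp
  have "(frag_of (inv g \<otimes> g, q) - (frag_of (inv g, q) + frag_of (g, q)))
    - (frag_of (g, - q + q) - (frag_of (g, - q) + frag_of (g, q))) - (frag_of (\<one>, q) - frag_of (g, 0)) \<in> tN"
   by (rule tN_diff[OF tN_diff[OF a b] c])
  then have "- (frag_of (inv g, q) - frag_of (g, - q)) \<in> tN" using g by (simp add: algebra_simps)
  then show ?thesis using tN_uminus by fastforce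
 qed
 have ipow: "frag_of (g [^] i, q) - frag_of (g, of_int i * q) \<in> tN" if g: "g \<in> carrier G" for g q and i :: int
 proof (cases i)
  case (nonneg n)
  then show ?thesis using pow[OF g, of n q] by (simp add: int_pow_int)
 next
  case (neg n)
  have e: "g [^] i = inv (g [^] Suc n)" unfolding neg using g by (simp only: int_pow_neg int_pow_int)
  have "frag_of (inv (g [^] Suc n), q) - frag_of (g [^] Suc n, - q) \<in> tN" using pinv g by simp
  moreover have "frag_of (g [^] Suc n, - q) - frag_of (g, of_nat (Suc n) * (- q)) \<in> tN" by (rule pow[OF g])
  ultimately have "(frag_of (inv (g [^] Suc n), q) - frag_of (g [^] Suc n, - q)) + (frag_of (g [^] Suc n, - q) - frag_of (g, of_nat (Suc n) * (- q))) \<in> tN"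
   by (rule tN_add)
  moreover have "(of_int i :: rat) * q = of_nat (Suc n) * (- q)" unfolding neg by (simp add: algebra_simps)
  ultimately show ?thesis unfolding e by simp
 qed
 have yG: "subgroup {\<one>} G" using tf(1) isolated_def by blast
 have el: "EX r. frag_of (g, q) - frag_of (y, r) \<in> tN" if g: "g \<in> carrier G" for g q
 proof -
  have "g \<in> icl G (insert y {\<one>})" using y(2) g icl_least[OF isolated_icl, of "insert y {\<one>}" "{y}"] icl_upper[of "insert y {\<one>}"] y(1) by blast
  then obtain n d i where n: "n \<ge> (1::nat)" "d \<in> {\<one>}" "g [^] n = d \<otimes> y [^] (i::int)"
   using icl_insert_elem[OF tf(1) y(1)] by blast
  have gy: "g [^] n = y [^] i" using n y(1) by simp
  have n0: "of_nat n * (q / of_nat n) = q" using n(1) by simp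
  \<comment> \<open>Division takes place in the rational factor: \<open>g\<close> tensor
    \<open>q\<close> equals \<open>g [^] n\<close> tensor \<open>q / n\<close>.\<close>
  have a: "frag_of (g [^] n, q / of_nat n) - frag_of (g, q) \<in> tN" using pow[OF g, of n "q / of_nat n"] n0 by simp
  have b: "frag_of (y [^] i, q / of_nat n) - frag_of (y, of_int i * (q / of_nat n)) \<in> tN" by (rule ipow[OF y(1)])
  have "frag_of (g, q) - frag_of (y, of_int i * (q / of_nat n)) \<in> tN" using tN_diff[OF b a] unfolding gy by simp
  then show ?thesis by blast
 qed
 have all: "Poly_Mapping.keys x <= ind ==> EX r. x - frag_of (y, r) \<in> tN" for x
 proof (induction x rule: tF_induct)
  case zero
  have "frag_of (y, 0) - (frag_of (y, 0) + frag_of (y, 0)) \<in> tN" using bil2[OF y(1), of 0 0] by simp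
  then have "0 - frag_of (y, 0) \<in> tN" by simp
  then show ?case by blast
 next
  case (frag g q)
  then show ?case using el by blast
 next
  case (diff x x')
  then obtain r r' where r: "x - frag_of (y, r) \<in> tN" "x' - frag_of (y, r') \<in> tN" by blast
  have "frag_of (y, (r - r') + r') - (frag_of (y, r - r') + frag_of (y, r')) \<in> tN" by (rule bil2[OF y(1)])
  then have "(x - frag_of (y, r)) - (x' - frag_of (y, r')) + (frag_of (y, (r - r') + r') - (frag_of (y, r - r') + frag_of (y, r'))) \<in> tN"
   by (rule tN_add[OF tN_diff[OF r]])
  then have "(x - x') - frag_of (y, r - r') \<in> tN" by (simp add: algebra_simps)
  then show ?case by blast
 qed
 have gen: "V.gen_set {C0}"
 proof
  show "V.span {C0} <= carrier (rat_tensor G)" by (rule V.span_is_subset2) (use C0 in blast)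
  show "carrier (rat_tensor G) <= V.span {C0}"
  proof
   fix C assume "C \<in> carrier (rat_tensor G)"
   then obtain x where x: "C = cls x" "Poly_Mapping.keys x <= ind" unfolding tensor_carrier by blast
   obtain r where r: "x - frag_of (y, r) \<in> tN" using all[OF x(2)] by blast
   have "C = r \<odot>\<^bsub>rat_tensor G\<^esub> C0" unfolding x(1) C0_def tensor_smult cls_eq using r by simp
   also have "\<dots> = V.lincomb (%_. r) {C0}" unfolding V.lincomb_def using C0 by (simp add: rat_field_simps)
   finally show "C \<in> V.span {C0}" unfolding V.span_def by (auto simp: rat_field_simps)
  qed
 qed
 have li: "V.lin_indpt {C0}"
 proof
  assume "V.lin_dep {C0}"
  then obtain A a v where v: "A <= {C0}" "V.lincomb a A = \<zero>\<^bsub>rat_tensor G\<^esub>" "v \<in> A" "a v ~= \<zero>\<^bsub>rat_field\<^esub>"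
   unfolding V.lin_dep_def by blast
  have A: "A = {C0}" "v = C0" using v(1,3) by auto
  have "V.lincomb a A = a C0 \<odot>\<^bsub>rat_tensor G\<^esub> C0" unfolding V.lincomb_def A using C0 by (simp add: rat_field_simps)
  then have "cls (frag_of (y, a C0)) = cls 0" using v(2) unfolding C0_def tensor_zero by (simp add: tensor_smult)
  then have "phi \<psi> (frag_of (y, a C0)) = 0" using phi_tN[OF p(1)] unfolding cls_eq by simp
  then show False using v(4) p(3) A(2) by (simp add: phi_frag rat_field_simps)
 qed
 have b: "V.basis {C0}" unfolding V.basis_def using li gen C0 by simp
 then have "V.dim = 1" using V.dim_basis[of "{C0}"] by simp
 moreover have "V.fin_dim" unfolding V.fin_dim_def by (intro exI[of _ "{C0}"] conjI gen) (use C0 in simp_all)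
 ultimately show ?thesis unfolding rank_one_def finite_rank_def group_rank_def by simp
qed

end

section \<open>The controller\<close>

context mult_field
begin

definition supp :: "('a => 'a) => 'a set" where "supp f = {x. f x ~= \<zero>}"

definition gr :: "('a => 'a) set" where
 "gr = {f. f \<in> G \<rightarrow> k & (ALL x. x ~: G --> f x = \<zero>) & finite (supp f)}"

definition fib :: "('a => 'a) => ('a => 'a) => 'a => ('a \<times> 'a) set" where
 "fib f h x = {(y, z). f y ~= \<zero> & h z ~= \<zero> & y \<otimes> z = x}"

definition gmul :: "('a => 'a) => ('a => 'a) => 'a => 'a" where
 "gmul f h = (%x. \<Oplus>p\<in>fib f h x. f (fst p) \<otimes> h (snd p))"

definition gadd :: "('a => 'a) => ('a => 'a) => 'a => 'a" where
 "gadd f h = (%x. f x \<oplus> h x)"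

definition pr :: "('a => 'a) => 'a" where "pr f = (\<Oplus>x\<in>supp f. f x \<otimes> x)"

definition ker :: "('a => 'a) set" where "ker = {f \<in> gr. pr f = \<zero>}"

definition hsub :: "'a set => ('a => 'a) set" where "hsub H = {f \<in> gr. supp f <= H}"

definition rs :: "'a set => ('a => 'a) => 'a => 'a" where "rs A f = (%x. if x \<in> A then f x else \<zero>)"

definition single :: "'a => 'a => 'a => 'a" where "single g a = (%x. if x = g then a else \<zero>)"

definition cs :: "'a set => 'a => 'a set" where "cs H g = (%h. h \<otimes> g) ` H"

lemma k_props: "subring k R" "k <= carrier R" "\<zero> \<in> k" "\<one> \<in> k"
 "!!a b. a \<in> k ==> b \<in> k ==> a \<oplus> b \<in> k" "!!a b. a \<in> k ==> b \<in> k ==> a \<otimes> b \<in> k" "!!a. a \<in> k ==> \<ominus> a \<in> k"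
 using subringE[OF subfieldE(1)[OF k]] subfieldE(1)[OF k] by auto

lemma grD:
 assumes "f \<in> gr"
 shows "f x \<in> k" "f x \<in> carrier R" "supp f <= G" "finite (supp f)" "x ~: G ==> f x = \<zero>"
proof -
 show k: "f x \<in> k" using assms k_props(3) unfolding gr_def by (cases "x \<in> G") auto
 show "f x \<in> carrier R" using k k_props(2) by blast
 show "supp f <= G" "finite (supp f)" "x ~: G ==> f x = \<zero>" using assms unfolding gr_def supp_def by auto
qed

lemma grI:
 assumes "!!x. f x \<in> k" "supp f <= S" "finite S" "S <= G"
 shows "f \<in> gr"
proof -
 have "f x = \<zero>" if "x ~: G" for x using that assms(2,4) unfolding supp_def by blast
 moreover have "finite (supp f)" using assms(2,3) finite_subset by blast
 ultimately show ?thesis unfolding gr_def using assms(1) by blast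
qed

lemma Gc: "x \<in> G ==> x \<in> carrier R" using G_carrier by blast

lemma pr_superset:
 assumes f: "f \<in> gr" and S: "finite S" "supp f <= S" "S <= G"
 shows "pr f = (\<Oplus>x\<in>S. f x \<otimes> x)" unfolding pr_def
proof (rule add.finprod_mono_neutral_cong_left[OF S(1,2)])
 show "f i \<otimes> i = \<zero>" if "i \<in> S - supp f" for i using that S(3) Gc unfolding supp_def by auto
 show "(%x. f x \<otimes> x) \<in> S \<rightarrow> carrier R" using grD(2)[OF f] S(3) Gc by blast
qed (rule refl)

lemma pr_closed: "f \<in> gr ==> pr f \<in> carrier R" unfolding pr_def using grD(2,3) Gc by (intro finsum_closed) blast

lemma rs_gr: "f \<in> gr ==> rs A f \<in> gr"
 by (rule grI[of _ "supp f"]) (use grD k_props(3) in \<open>auto simp: rs_def supp_def\<close>)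

lemma supp_rs: "supp (rs A f) = supp f Int A" unfolding supp_def rs_def by auto

lemma gadd_gr:
 assumes "f \<in> gr" "h \<in> gr"
 shows "gadd f h \<in> gr" "supp (gadd f h) <= supp f Un supp h"
proof -
 show s: "supp (gadd f h) <= supp f Un supp h" unfolding supp_def gadd_def by auto
 show "gadd f h \<in> gr" by (rule grI[OF _ s]) (use grD[OF assms(1)] grD[OF assms(2)] k_props(5) in \<open>auto simp: gadd_def\<close>)
qed

lemma pr_gadd:
 assumes f: "f \<in> gr" and h: "h \<in> gr"
 shows "pr (gadd f h) = pr f \<oplus> pr h"
proof -
 define S where "S = supp f Un supp h"
 have S: "finite S" "S <= G" "supp f <= S" "supp h <= S" unfolding S_def using grD[OF f] grD[OF h] by auto
 have c: "(%x. f x \<otimes> x) \<in> S \<rightarrow> carrier R" "(%x. h x \<otimes> x) \<in> S \<rightarrow> carrier R"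
  using grD(2)[OF f] grD(2)[OF h] S(2) Gc by blast+
 have "pr (gadd f h) = (\<Oplus>x\<in>S. gadd f h x \<otimes> x)"
  by (rule pr_superset[OF gadd_gr(1)[OF f h] S(1) _ S(2)]) (use gadd_gr(2)[OF f h] S_def in blast)
 also have "\<dots> = (\<Oplus>x\<in>S. f x \<otimes> x \<oplus> h x \<otimes> x)"
 proof (rule finsum_cong'[OF refl])
  show "(%x. f x \<otimes> x \<oplus> h x \<otimes> x) \<in> S \<rightarrow> carrier R" using c by blast
  show "gadd f h x \<otimes> x = f x \<otimes> x \<oplus> h x \<otimes> x" if "x \<in> S" for x
   unfolding gadd_def using grD(2)[OF f] grD(2)[OF h] that S(2) Gc by (simp add: l_distr subsetD)
 qed
 also have "\<dots> = pr f \<oplus> pr h" using finsum_addf[OF c] pr_superset[OF f S(1,3,2)] pr_superset[OF h S(1,4,2)] by simp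
 finally show ?thesis .
qed

lemma supp_single: "a ~= \<zero> ==> supp (single g a) = {g}" "supp (single g a) <= {g}"
 unfolding supp_def single_def by auto

lemma single_gr: "g \<in> G ==> a \<in> k ==> single g a \<in> gr"
 by (rule grI[of _ "{g}"]) (use k_props(3) supp_single(2) in \<open>auto simp: single_def\<close>)

lemma pr_single:
 assumes "g \<in> G" "a \<in> k"
 shows "pr (single g a) = a \<otimes> g"
proof -
 have c: "a \<in> carrier R" "g \<in> carrier R" using assms k_props(2) Gc by auto
 have "pr (single g a) = (\<Oplus>x\<in>{g}. single g a x \<otimes> x)"
  by (rule pr_superset[OF single_gr[OF assms]]) (use supp_single(2) assms in auto)
 also have "\<dots> = a \<otimes> g" using c by (simp add: single_def finsum_insert)
 finally show ?thesis .
qed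

lemma gmul_fib: "gmul f h x = (\<Oplus>p\<in>fib f h x. f (fst p) \<otimes> h (snd p))" unfolding gmul_def ..

lemma fib_sub: "fib f h x <= supp f \<times> supp h" unfolding fib_def supp_def by auto

lemma gmul_gr:
 assumes f: "f \<in> gr" and h: "h \<in> gr"
 shows "gmul f h \<in> gr" "supp (gmul f h) <= (%(y, z). y \<otimes> z) ` (supp f \<times> supp h)"
proof -
 have kk: "lsubspace k k" by (rule lsubspace_subring[OF k_props(1) order_refl])
 have ff: "finite (fib f h x)" for x by (rule finite_subset[OF fib_sub]) (use grD(4)[OF f] grD(4)[OF h] in simp)
 have v: "gmul f h x \<in> k" for x unfolding gmul_fib by (rule finsum_lsubspace[OF kk ff]) (use grD(1)[OF f] grD(1)[OF h] k_props(6) in blast)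
 show s: "supp (gmul f h) <= (%(y, z). y \<otimes> z) ` (supp f \<times> supp h)"
 proof
  fix x assume "x \<in> supp (gmul f h)"
  then have "fib f h x ~= {}" unfolding supp_def gmul_fib by auto
  then show "x \<in> (%(y, z). y \<otimes> z) ` (supp f \<times> supp h)" unfolding fib_def supp_def by force
 qed
 show "gmul f h \<in> gr" by (rule grI[OF v s]) (use grD(3,4)[OF f] grD(3,4)[OF h] G_mult in \<open>auto simp: subset_iff\<close>)
qed

lemma pr_gmul:
 assumes f: "f \<in> gr" and h: "h \<in> gr"
 shows "pr (gmul f h) = pr f \<otimes> pr h"
proof -
 define S where "S = supp f \<times> supp h"
 define Y where "Y = (%(y, z). y \<otimes> z) ` S"
 define t where "t = (%p. (f (fst p) \<otimes> h (snd p)) \<otimes> (fst p \<otimes> snd p))"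
 note fD = grD[OF f] and hD = grD[OF h]
 have fS: "finite S" unfolding S_def using fD(4) hD(4) by simp
 have fY: "finite Y" unfolding Y_def using fS by simp
 have SG: "fst p \<in> G" "snd p \<in> G" if "p \<in> S" for p using that fD(3) hD(3) unfolding S_def by auto
 have YG: "Y <= G" unfolding Y_def using SG G_mult by (auto simp: case_prod_unfold)
 have sc: "fst p \<in> carrier R" "snd p \<in> carrier R" if "p \<in> S" for p using SG[OF that] Gc by auto
 have tc: "t p \<in> carrier R" if "p \<in> S" for p unfolding t_def using sc[OF that] fD(2) hD(2) by simp
 have fibS: "fib f h x <= S" for x unfolding S_def by (rule fib_sub)
 have un: "S = (\<Union>x\<in>Y. fib f h x)" unfolding Y_def S_def fib_def supp_def by auto
 have "(\<Oplus>p\<in>S. t p) = (\<Oplus>x\<in>Y. \<Oplus>p\<in>fib f h x. t p)" unfolding un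
 proof (rule add.finprod_UN_disjoint[OF fY])
  show "finite (fib f h i)" for i by (rule finite_subset[OF fibS fS])
  show "pairwise (%i j. disjnt (fib f h i) (fib f h j)) Y" unfolding pairwise_def disjnt_def fib_def by auto
  show "t x \<in> carrier R" if "x \<in> fib f h i" for i x using tc fibS that by blast
 qed
 also have "\<dots> = (\<Oplus>x\<in>Y. gmul f h x \<otimes> x)"
 proof (rule finsum_cong'[OF refl])
  show "(%x. gmul f h x \<otimes> x) \<in> Y \<rightarrow> carrier R" using grD(2)[OF gmul_gr(1)[OF f h]] YG Gc by blast
  fix x assume x: "x \<in> Y"
  have xc: "x \<in> carrier R" using x YG Gc by blast
  have fin: "finite (fib f h x)" by (rule finite_subset[OF fibS fS])
  have "(\<Oplus>p\<in>fib f h x. t p) = (\<Oplus>p\<in>fib f h x. (f (fst p) \<otimes> h (snd p)) \<otimes> x)"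
   by (rule finsum_cong'[OF refl]) (use fD(2) hD(2) xc in \<open>auto simp: t_def fib_def\<close>)
  also have "\<dots> = gmul f h x \<otimes> x" unfolding gmul_fib by (rule finsum_ldistr[OF fin xc, symmetric]) (use fD(2) hD(2) in auto)
  finally show "(\<Oplus>p\<in>fib f h x. t p) = gmul f h x \<otimes> x" .
 qed
 also have "\<dots> = pr (gmul f h)" by (rule pr_superset[OF gmul_gr(1)[OF f h] fY _ YG, symmetric]) (use gmul_gr(2)[OF f h] Y_def S_def in blast)
 finally have 1: "(\<Oplus>p\<in>S. t p) = pr (gmul f h)" .
 have un2: "S = (\<Union>y\<in>supp f. Pair y ` supp h)" unfolding S_def by auto
 have prc: "pr h \<in> carrier R" by (rule pr_closed[OF h])
 have "(\<Oplus>p\<in>S. t p) = (\<Oplus>y\<in>supp f. \<Oplus>p\<in>Pair y ` supp h. t p)" unfolding un2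
 proof (rule add.finprod_UN_disjoint[OF fD(4)])
  show "finite (Pair i ` supp h)" for i using hD(4) by simp
  show "pairwise (%i j. disjnt (Pair i ` supp h) (Pair j ` supp h)) (supp f)" unfolding pairwise_def disjnt_def by auto
  show "t x \<in> carrier R" if "i \<in> supp f" "x \<in> Pair i ` supp h" for i x using tc un2 that by blast
 qed
 also have "\<dots> = (\<Oplus>y\<in>supp f. (f y \<otimes> y) \<otimes> pr h)"
 proof (rule finsum_cong'[OF refl])
  show "(%y. (f y \<otimes> y) \<otimes> pr h) \<in> supp f \<rightarrow> carrier R" using fD(2,3) prc Gc by blast
  fix y assume y: "y \<in> supp f"
  have yc: "y \<in> carrier R" "f y \<in> carrier R" using y fD(2,3) Gc by auto
  have tt: "t (y, z) = (f y \<otimes> y) \<otimes> (h z \<otimes> z)" if "z \<in> supp h" for z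
  proof -
   have "z \<in> carrier R" "h z \<in> carrier R" using that hD(2,3) Gc by auto
   then show ?thesis unfolding t_def using yc by (simp add: m_ac)
  qed
  have hz: "(%z. h z \<otimes> z) \<in> supp h \<rightarrow> carrier R" using hD(2,3) Gc by blast
  have "(\<Oplus>p\<in>Pair y ` supp h. t p) = (\<Oplus>z\<in>supp h. t (y, z))"
   by (rule finsum_reindex) (use tc y in \<open>auto simp: S_def inj_on_def\<close>)
  also have "\<dots> = (\<Oplus>z\<in>supp h. (f y \<otimes> y) \<otimes> (h z \<otimes> z))" by (rule finsum_cong'[OF refl]) (use tt hz yc in auto)
  also have "\<dots> = (f y \<otimes> y) \<otimes> pr h" unfolding pr_def by (rule finsum_rdistr[OF hD(4) _ hz, symmetric]) (use yc in simp)
  finally show "(\<Oplus>p\<in>Pair y ` supp h. t p) = (f y \<otimes> y) \<otimes> pr h" .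
 qed
 also have "\<dots> = pr f \<otimes> pr h" unfolding pr_def[of f] by (rule finsum_ldistr[OF fD(4) prc, symmetric]) (use fD(2,3) Gc in blast)
 finally show ?thesis using 1 by simp
qed

lemma ker_gadd: "f \<in> ker ==> h \<in> ker ==> gadd f h \<in> ker" unfolding ker_def using gadd_gr(1) pr_gadd by simp

lemma ker_gmul: "f \<in> ker ==> h \<in> gr ==> gmul f h \<in> ker"
 unfolding ker_def using gmul_gr(1) pr_gmul pr_closed by simp

abbreviation "kk \<equiv> R\<lparr>carrier := k\<rparr>"
abbreviation "GR \<equiv> group_ring kk M"

lemma finsum_kk:
 assumes "finite A" "f \<in> A \<rightarrow> k"
 shows "finsum kk f A = finsum R f A"
proof -
 interpret K: field kk using subfield_iff(2)[OF k] .
 show ?thesis using assms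
 proof (induction A rule: finite_induct)
  case (insert a A)
  have "finsum kk f (Set.insert a A) = f a \<oplus>\<^bsub>kk\<^esub> finsum kk f A" by (rule K.finsum_insert) (use insert in auto)
  moreover have "finsum R f (Set.insert a A) = f a \<oplus> finsum R f A" by (rule finsum_insert) (use insert k_props(2) in auto)
  ultimately show ?case using insert by auto
 qed simp
qed

lemma GR_carrier: "carrier GR = gr" unfolding group_ring_def gr_def supp_def by simp

lemma GR_sub_carrier: "H <= G ==> carrier (group_ring kk (M\<lparr>carrier := H\<rparr>)) = hsub H"
 unfolding group_ring_def hsub_def gr_def supp_def using k_props(3) by (auto simp: Pi_iff)

lemma GR_add: "f \<oplus>\<^bsub>GR\<^esub> h = gadd f h" unfolding group_ring_def gadd_def by simp

lemma GR_mult: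
 assumes f: "f \<in> gr" and h: "h \<in> gr"
 shows "f \<otimes>\<^bsub>GR\<^esub> h = gmul f h"
proof
 fix x
 have "f \<otimes>\<^bsub>GR\<^esub> h = (%x. finsum kk (%p. f (fst p) \<otimes> h (snd p)) (fib f h x))"
  unfolding group_ring_def fib_def by (simp add: case_prod_unfold)
 moreover have "finite (fib f h x)" by (rule finite_subset[OF fib_sub]) (use grD(4)[OF f] grD(4)[OF h] in simp)
 ultimately show "(f \<otimes>\<^bsub>GR\<^esub> h) x = gmul f h x"
  using finsum_kk[of "fib f h x" "%p. f (fst p) \<otimes> h (snd p)"] grD(1)[OF f] grD(1)[OF h] k_props(6) unfolding gmul_fib by auto
qed

section \<open>Control of the kernel and restriction to cosets\<close>

definition ctrl :: "'a set => bool" where "ctrl H = controls kk M ker H"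

lemma ctrl_iff: "ctrl H \<longleftrightarrow> subgroup H M & ker = ideal_prod GR (hsub H Int ker) gr"
proof (cases "subgroup H M")
 case True
 then have "H <= G" using subgroup_M_iff[of H] by simp
 then show ?thesis unfolding ctrl_def controls_def GR_carrier GR_sub_carrier[OF \<open>H <= G\<close>] by simp
qed (simp add: ctrl_def controls_def)

lemma hsub_gr: "hsub H <= gr" unfolding hsub_def by blast

lemma prod_in_ker: "f \<in> ideal_prod GR (hsub H Int ker) gr ==> f \<in> ker"
proof (induction rule: ideal_prod.induct)
 case (prod i j)
 then have "i \<in> gr" "i \<in> ker" "j \<in> gr" using hsub_gr by auto
 then show ?case using GR_mult[of i j] ker_gmul[of i j] by simp
next
 case (sum s1 s2)
 then show ?case using GR_add ker_gadd by simp
qed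

lemma cs_mem:
 assumes "subgroup H M" "g \<in> G" "x \<in> carrier R"
 shows "x \<in> cs H g \<longleftrightarrow> x \<otimes> inv g \<in> H"
proof -
 have HG: "H <= carrier R" using assms(1) subgroup_M_iff[of H] by (meson G_carrier order_trans)
 have gU: "g \<in> Units R" by (rule G_Units[OF assms(2)])
 have gc: "g \<in> carrier R" "inv g \<in> carrier R" using gU by auto
 show ?thesis
 proof
  assume "x \<in> cs H g"
  then obtain h where h: "h \<in> H" "x = h \<otimes> g" unfolding cs_def by blast
  then have "x \<otimes> inv g = h" using HG gU gc by (simp add: m_assoc subsetD)
  then show "x \<otimes> inv g \<in> H" using h by simp
 next
  assume a: "x \<otimes> inv g \<in> H"
  have "x = (x \<otimes> inv g) \<otimes> g" using assms(3) gU gc by (simp add: m_assoc)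
  then show "x \<in> cs H g" unfolding cs_def using a by blast
 qed
qed

lemma cs_mult:
 assumes H: "subgroup H M" and g: "g \<in> G" and y: "y \<in> H" and z: "z \<in> carrier R"
 shows "y \<otimes> z \<in> cs H g \<longleftrightarrow> z \<in> cs H g"
proof -
 note h = H[unfolded subgroup_M_iff]
 have yU: "y \<in> Units R" using h y G_Units by blast
 have c: "y \<in> carrier R" "inv y \<in> carrier R" "inv g \<in> carrier R" using yU G_Units[OF g] by auto
 have e: "y \<otimes> z \<otimes> inv g = y \<otimes> (z \<otimes> inv g)" using c z by (simp add: m_assoc)
 have e2: "z \<otimes> inv g = inv y \<otimes> (y \<otimes> (z \<otimes> inv g))" using Units_cancel(2)[OF yU] c z by simp
 have yz: "y \<otimes> z \<in> carrier R" using c z by simp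
 show ?thesis unfolding cs_mem[OF H g yz] cs_mem[OF H g z] e using e2 h y by metis
qed

text \<open>A left factor supported in \<open>H\<close> preserves the cosets of \<open>H\<close>, so
  restricting a product to a coset amounts to restricting its right factor. With
  \<open>ctrlI\<close>, control by \<open>H\<close> is the same as closure of the kernel under
  restriction to cosets of \<open>H\<close>.\<close>

lemma ctrl_restrict:
 assumes H: "ctrl H" and f: "f \<in> ker" and g: "g \<in> G"
 shows "rs (cs H g) f \<in> ker"
proof -
 have sH: "subgroup H M" and e: "ker = ideal_prod GR (hsub H Int ker) gr" using H ctrl_iff by auto
 have "f \<in> ideal_prod GR (hsub H Int ker) gr" using f e by simp
 then show ?thesis
 proof (induction rule: ideal_prod.induct)
  case (prod i j)
  then have i: "i \<in> gr" "supp i <= H" "i \<in> ker" and j: "j \<in> gr" unfolding hsub_def by auto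
  define j' where "j' = rs (cs H g) j"
  have j': "j' \<in> gr" unfolding j'_def by (rule rs_gr[OF j])
  have "rs (cs H g) (gmul i j) = gmul i j'"
  proof
   fix x
   have key: "fib i j' x = (if x \<in> cs H g then fib i j x else {})"
   proof -
    have "(y, z) \<in> fib i j' x \<longleftrightarrow> x \<in> cs H g & (y, z) \<in> fib i j x" for y z
    proof -
     have "z \<in> cs H g \<longleftrightarrow> x \<in> cs H g" if "i y ~= \<zero>" "j z ~= \<zero>" "y \<otimes> z = x"
     proof -
      have "y \<in> H" using that(1) i(2) unfolding supp_def by blast
      moreover have "z \<in> carrier R" using that(2) grD(3)[OF j] Gc unfolding supp_def by blast
      ultimately show ?thesis using cs_mult[OF sH g] that(3) by blast
     qed
     then show ?thesis unfolding fib_def j'_def rs_def by auto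
    qed
    then show ?thesis by auto
   qed
   show "rs (cs H g) (gmul i j) x = gmul i j' x"
   proof (cases "x \<in> cs H g")
    case True
    have "gmul i j' x = (\<Oplus>p\<in>fib i j x. i (fst p) \<otimes> j' (snd p))" unfolding gmul_fib key using True by simp
    also have "\<dots> = gmul i j x" unfolding gmul_fib
    proof (rule finsum_cong'[OF refl])
     show "(%p. i (fst p) \<otimes> j (snd p)) \<in> fib i j x \<rightarrow> carrier R" using grD(2)[OF i(1)] grD(2)[OF j] by blast
     fix p assume "p \<in> fib i j x"
     then have "p \<in> fib i j' x" using key True by simp
     then have "j' (snd p) ~= \<zero>" unfolding fib_def by auto
     then show "i (fst p) \<otimes> j' (snd p) = i (fst p) \<otimes> j (snd p)" unfolding j'_def rs_def by (auto split: if_splits)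
    qed
    finally show ?thesis using True by (simp add: rs_def)
   next
    case False
    then show ?thesis unfolding gmul_fib[of i j'] key by (simp add: rs_def)
   qed
  qed
  then show ?case using GR_mult[OF i(1) j] ker_gmul[OF i(3) j'] by simp
 next
  case (sum s1 s2)
  have s: "s1 \<in> ker" "s2 \<in> ker" using sum.hyps prod_in_ker by auto
  have "rs (cs H g) (gadd s1 s2) = gadd (rs (cs H g) s1) (rs (cs H g) s2)" unfolding rs_def gadd_def by auto
  then show ?case using GR_add ker_gadd sum.IH by simp
 qed
qed

lemma zero_fun: "(%_. \<zero>) \<in> ker" "(%_. \<zero>) \<in> hsub H" "gmul (%_. \<zero>) (%_. \<zero>) = (%_. \<zero>)"
proof -
 have s: "supp (%_. \<zero>) = {}" unfolding supp_def by simp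
 have g: "(%_. \<zero>) \<in> gr" by (rule grI[of _ "{}"]) (use k_props(3) s in auto)
 show "(%_. \<zero>) \<in> ker" unfolding ker_def pr_def using g by (simp add: s)
 show "(%_. \<zero>) \<in> hsub H" unfolding hsub_def using g s by simp
 show "gmul (%_. \<zero>) (%_. \<zero>) = (%_. \<zero>)" unfolding gmul_def fib_def by simp
qed

text \<open>One coset is split off at a time. The part on a coset is a translate of an element
  supported in \<open>H\<close>, which again lies in the kernel because the translating group
  element is invertible.\<close>

lemma ctrlI:
 assumes H: "subgroup H M" and r: "!!f g. f \<in> ker ==> g \<in> G ==> rs (cs H g) f \<in> ker"
 shows "ctrl H"
proof -
 have "f \<in> ker ==> f \<in> ideal_prod GR (hsub H Int ker) gr" for f
 proof (induction "card (supp f)" arbitrary: f rule: less_induct)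
  case less
  have fg: "f \<in> gr" using less.prems ker_def by blast
  note fD = grD[OF fg]
  show ?case
  proof (cases "supp f = {}")
   case True
   then have "f = (%_. \<zero>)" unfolding supp_def by auto
   moreover have "(%_. \<zero>) \<in> gr" using zero_fun(1) ker_def by blast
   ultimately have "f = (%_. \<zero>) \<otimes>\<^bsub>GR\<^esub> (%_. \<zero>)" using GR_mult zero_fun(3) by simp
   then show ?thesis using ideal_prod.prod[of "%_. \<zero>" "hsub H Int ker" "%_. \<zero>" gr GR] zero_fun \<open>(%_. \<zero>) \<in> gr\<close> by simp
  next
   case False
   then obtain g where g: "g \<in> supp f" by blast
   have gG: "g \<in> G" using g fD(3) by blast
   have gU: "g \<in> Units R" and gc: "g \<in> carrier R" using G_Units[OF gG] Units_closed by auto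
   define A where "A = cs H g"
   define f1 where "f1 = rs A f"
   define f2 where "f2 = rs (- A) f"
   have f1: "f1 \<in> ker" unfolding f1_def A_def by (rule r[OF less.prems gG])
   have f1g: "f1 \<in> gr" using f1 ker_def by blast
   have f2g: "f2 \<in> gr" unfolding f2_def by (rule rs_gr[OF fg])
   have "f x = gadd f1 f2 x" for x unfolding gadd_def f1_def f2_def rs_def using fD(2) by simp
   then have fe: "f = gadd f1 f2" by blast
   have "pr f1 \<oplus> pr f2 = \<zero>" using pr_gadd[OF f1g f2g] fe less.prems ker_def by simp
   then have f2: "f2 \<in> ker" using f1 f2g pr_closed[OF f2g] unfolding ker_def by simp
   have "\<one> \<in> H" using H subgroup_M_iff by blast
   then have "g \<in> A" unfolding A_def cs_def using gc by force
   then have "supp f2 \<subset> supp f" unfolding f2_def supp_rs using g by blast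
   then have "card (supp f2) < card (supp f)" by (rule psubset_card_mono[OF fD(4)])
   then have p2: "f2 \<in> ideal_prod GR (hsub H Int ker) gr" using less.hyps f2 by blast
   \<comment> \<open>The part of \<open>f\<close> on the coset of \<open>g\<close>, moved back into
     \<open>H\<close>; multiplication by the group element \<open>g\<close> undoes the
     shift.\<close>
   define sh where "sh = (%y. if y \<in> G then f1 (y \<otimes> g) else \<zero>)"
   have shs: "supp sh <= (%x. x \<otimes> inv g) ` supp f1"
   proof
    fix y assume "y \<in> supp sh"
    then have y: "y \<in> G" "y \<otimes> g \<in> supp f1" unfolding supp_def sh_def by (auto split: if_splits)
    have "y = (y \<otimes> g) \<otimes> inv g" using y(1) Gc gU gc by (simp add: m_assoc)
    then show "y \<in> (%x. x \<otimes> inv g) ` supp f1" using y(2) by blast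
   qed
   have shg: "sh \<in> gr" by (rule grI[OF _ shs]) (use grD[OF f1g] k_props(3) G_mult G_inv gG in \<open>auto simp: sh_def subset_iff\<close>)
   have "supp sh <= H"
   proof
    fix y assume "y \<in> supp sh"
    then have y: "y \<in> G" "y \<otimes> g \<in> supp f1" unfolding supp_def sh_def by (auto split: if_splits)
    then have "y \<otimes> g \<in> A" unfolding f1_def supp_rs by blast
    moreover have "y \<otimes> g \<otimes> inv g = y" using y(1) Gc gU gc by (simp add: m_assoc)
    ultimately show "y \<in> H" unfolding A_def using cs_mem[OF H gG, of "y \<otimes> g"] y(1) Gc gc by simp
   qed
   then have shH: "sh \<in> hsub H" unfolding hsub_def using shg by blast
   define d where "d = single g \<one>"
   have dg: "d \<in> gr" unfolding d_def by (rule single_gr[OF gG k_props(4)])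
   have m: "gmul sh d = f1"
   proof
    fix x
    show "gmul sh d x = f1 x"
    proof (cases "f1 x = \<zero>")
     case True
     have "fib sh d x = {}"
     proof (rule ccontr)
      assume "fib sh d x ~= {}"
      then obtain y z where "sh y ~= \<zero>" "d z ~= \<zero>" "y \<otimes> z = x" unfolding fib_def by blast
      then have "z = g" "f1 (y \<otimes> z) ~= \<zero>" unfolding d_def single_def sh_def by (auto split: if_splits)
      then show False using True \<open>y \<otimes> z = x\<close> by simp
     qed
     then show ?thesis unfolding gmul_fib using True by simp
    next
     case False
     then have xG: "x \<in> G" using grD(5)[OF f1g] by blast
     have xc: "x \<in> carrier R" using xG Gc by blast
     have xg: "x \<otimes> inv g \<in> G" using G_mult[OF xG G_inv[OF gG]] .
     have e: "x \<otimes> inv g \<otimes> g = x" using xc gU gc by (simp add: m_assoc)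
     have shx: "sh (x \<otimes> inv g) = f1 x" unfolding sh_def using xg e by simp
     have "fib sh d x = {(x \<otimes> inv g, g)}"
     proof
      show "{(x \<otimes> inv g, g)} <= fib sh d x" unfolding fib_def d_def single_def using shx False e by simp
      show "fib sh d x <= {(x \<otimes> inv g, g)}"
      proof
       fix p assume "p \<in> fib sh d x"
       then obtain y z where p: "p = (y, z)" "sh y ~= \<zero>" "d z ~= \<zero>" "y \<otimes> z = x" unfolding fib_def by blast
       have z: "z = g" using p(3) unfolding d_def single_def by (auto split: if_splits)
       have "y \<in> carrier R" using p(2) Gc unfolding sh_def by (auto split: if_splits)
       then have "y = x \<otimes> inv g" using p(4) z gU gc by (auto simp: m_assoc)
       then show "p \<in> {(x \<otimes> inv g, g)}" using p(1) z by simp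
      qed
     qed
     then show ?thesis unfolding gmul_fib using shx grD(2)[OF f1g] by (simp add: d_def single_def finsum_insert)
    qed
   qed
   have prd: "pr d = g" unfolding d_def using pr_single[OF gG k_props(4)] gc by simp
   have "pr sh \<otimes> g = \<zero>" using pr_gmul[OF shg dg] m f1 prd unfolding ker_def by simp
   then have "pr sh = \<zero>" using integral_iff[OF pr_closed[OF shg] gc] gU Units_iff by blast
   then have "sh \<in> hsub H Int ker" using shH shg ker_def by blast
   then have "sh \<otimes>\<^bsub>GR\<^esub> d \<in> ideal_prod GR (hsub H Int ker) gr" using dg by (rule ideal_prod.prod)
   then have "f1 \<in> ideal_prod GR (hsub H Int ker) gr" using GR_mult[OF shg dg] m by simp
   then have "f1 \<oplus>\<^bsub>GR\<^esub> f2 \<in> ideal_prod GR (hsub H Int ker) gr" using p2 by (rule ideal_prod.sum)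
   then show ?thesis using GR_add fe by simp
  qed
 qed
 then show ?thesis using ctrl_iff H prod_in_ker by blast
qed

lemma ctrl_mono:
 assumes "ctrl H" "subgroup V M" "H <= V"
 shows "ctrl V"
proof -
 have e: "ker = ideal_prod GR (hsub H Int ker) gr" using assms(1) ctrl_iff by blast
 have "hsub H Int ker <= hsub V Int ker" using assms(3) unfolding hsub_def by blast
 note sub = this
 have "f \<in> ideal_prod GR (hsub V Int ker) gr" if "f \<in> ideal_prod GR (hsub H Int ker) gr" for f using that
 proof (induction rule: ideal_prod.induct)
  case (prod i j)
  show ?case by (rule ideal_prod.prod[OF subsetD[OF sub prod(1)] prod(2)])
 next
  case (sum s1 s2)
  show ?case by (rule ideal_prod.sum[OF sum.IH])
 qed
 then show ?thesis using ctrl_iff assms(2) e prod_in_ker by blast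
qed

lemma subgroup_G: "subgroup G M" unfolding subgroup_M_iff using G_one G_mult G_inv by blast

lemma ctrl_G: "ctrl G"
proof (rule ctrlI[OF subgroup_G])
 fix f g assume f: "f \<in> ker" and g: "g \<in> G"
 have fg: "f \<in> gr" using f ker_def by blast
 have key: "x \<in> cs G g" if "f x ~= \<zero>" for x
 proof -
  have x: "x \<in> G" using that grD(5)[OF fg] by blast
  then show ?thesis using cs_mem[OF subgroup_G g, of x] G_mult[OF x G_inv[OF g]] Gc by blast
 qed
 have "rs (cs G g) f = f"
 proof
  show "rs (cs G g) f x = f x" for x using key[of x] unfolding rs_def by (cases "f x = \<zero>") simp_all
 qed
 then show "rs (cs G g) f \<in> ker" using f by simp
qed

definition ctr :: "'a set" where "ctr = \<Inter>{H. ctrl H}"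

text \<open>A support is finite, so finitely many controlling subgroups separate its points outside
  a coset of \<open>ctr\<close> from that coset. Restricting successively to their cosets has the
  same effect as restricting to the coset of \<open>ctr\<close>.\<close>

lemma ctrl_ctr: "ctrl ctr"
proof (rule ctrlI)
 have s: "subgroup H M" if "ctrl H" for H using that ctrl_iff by blast
 show sC: "subgroup ctr M" unfolding ctr_def by (rule M.subgroups_Inter) (use s ctrl_G in auto)
 fix f g assume f: "f \<in> ker" and g: "g \<in> G"
 have fg: "f \<in> gr" using f ker_def by blast
 have "EX A. cs ctr g <= A & A Int E = {} & rs A f \<in> ker" if "finite E" "E <= supp f - cs ctr g" for E
  using that
 proof (induction E rule: finite_induct)
  case empty
  have "rs UNIV f = f" unfolding rs_def by simp
  then show ?case using f by (intro exI[of _ UNIV]) simp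
 next
  case (insert e E)
  then obtain A where A: "cs ctr g <= A" "A Int E = {}" "rs A f \<in> ker" by auto
  have eG: "e \<in> G" using insert.prems grD(3)[OF fg] by blast
  have "e \<otimes> inv g ~: ctr" using cs_mem[OF sC g Gc[OF eG]] insert.prems by blast
  then obtain H where H: "ctrl H" "e \<otimes> inv g ~: H" unfolding ctr_def by blast
  have e: "e ~: cs H g" using cs_mem[OF s[OF H(1)] g Gc[OF eG]] H(2) by blast
  have "rs (A Int cs H g) f = rs (cs H g) (rs A f)" unfolding rs_def by auto
  then have "rs (A Int cs H g) f \<in> ker" using ctrl_restrict[OF H(1) A(3) g] by simp
  moreover have "cs ctr g <= cs H g" unfolding cs_def using H(1) ctr_def by blast
  ultimately show ?case using A e by (intro exI[of _ "A Int cs H g"]) blast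
 qed
 moreover have "finite (supp f - cs ctr g)" using grD(4)[OF fg] by simp
 ultimately obtain A where A: "cs ctr g <= A" "A Int (supp f - cs ctr g) = {}" "rs A f \<in> ker" by blast
 have "rs A f = rs (cs ctr g) f"  by (rule ext) (use A(1,2) in \<open>auto simp: rs_def supp_def\<close>)
 then show "rs (cs ctr g) f \<in> ker" using A(3) by simp
qed

text \<open>\<open>ctr\<close> controls the kernel and lies in every controlling subgroup, so the
  definite description has a unique solution.\<close>

lemma controller_eq: "controller kk M ker = ctr" unfolding controller_def
proof (rule the_equality)
 have c: "controls kk M ker H \<longleftrightarrow> ctrl H" for H by (simp add: ctrl_def)
 have min: "ctr <= H" if "ctrl H" for H unfolding ctr_def using that by blast
 show "controls kk M ker ctr & (ALL H'. controls kk M ker H' & H' <= ctr --> H' = ctr)"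
  unfolding c using ctrl_ctr min by blast
 show "H = ctr" if "controls kk M ker H & (ALL H'. controls kk M ker H' & H' <= H --> H' = H)" for H
  using that unfolding c using ctrl_ctr min by blast
qed

text \<open>Rank and degree agree above \<open>W = zflat {\<one>} G\<close>, so a full valuation
  over \<open>kf W\<close> has exactly \<open>W\<close> as its units in \<open>G\<close>. The sum of
  an element over one coset is a \<open>kf W\<close>-multiple of a representative, and different
  cosets have different values. If the total vanishes, every coset sum must vanish.\<close>

lemma ctrl_zflat:
 assumes f1: "flat {\<one>}"
 shows "ctrl (zflat {\<one>} G)"
proof -
 define W where "W = zflat {\<one>} G"
 have o1: "{\<one>} <= G" using G_one by blast
 note z = zflat_props[OF f1 flat_G o1, folded W_def]
 have WG: "W <= G" by (rule z(3))
 note wD = flatD[OF z(1)]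
 have sW: "subgroup W M" unfolding subgroup_M_iff using wD by blast
 obtain \<O> where O: "\<O> \<in> vals (kf W)" "rk G + td W = rk (G Int vunits \<O>) + td G"
  using full_exists[OF z(1) flat_G WG] unfolding full_def by blast
 have vO: "valring \<O>" by (rule vals_valring[OF O(1)])
 have fO: "flat (G Int vunits \<O>)" by (rule flat_vunits[OF vO flat_G])
 have "W <= G Int vunits \<O>" using kf_vunits[OF WG O(1)] WG by blast
 moreover have "rk (G Int vunits \<O>) <= rk W" using O(2) z(5) by simp
 ultimately have "W = G Int vunits \<O>" using M.flat_eqI[OF _ z(1) fO] by metis
 then have GO: "G Int vunits \<O> = W" by (rule sym)
 show ?thesis unfolding W_def[symmetric]
 proof (rule ctrlI[OF sW])
  fix f g assume f: "f \<in> ker" and g: "g \<in> G"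
  have fg: "f \<in> gr" using f ker_def by blast
  note fD = grD[OF fg]
  define Y where "Y = supp f"
  have Y: "finite Y" "Y <= G" unfolding Y_def using fD by auto
  define P where "P = (%x. Y Int cs W x) ` Y"
  have fP: "finite P" unfolding P_def using Y(1) by simp
  have cseq: "cs W x = cs W y" if x: "x \<in> G" and y: "y \<in> G" and xy: "x \<in> cs W y" for x y
  proof -
   have xU: "x \<in> Units R" "y \<in> Units R" using x y G_Units by auto
   have c: "x \<in> carrier R" "y \<in> carrier R" "inv x \<in> carrier R" "inv y \<in> carrier R" using xU by auto
   have w: "x \<otimes> inv y \<in> W" using xy cs_mem[OF sW y c(1)] by blast
   have "u \<in> cs W x \<longleftrightarrow> u \<in> cs W y" if u: "u \<in> carrier R" for u
   proof -
    have e1: "u \<otimes> inv y = (u \<otimes> inv x) \<otimes> (x \<otimes> inv y)"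
     using Units_cancel(2)[OF xU(1), of "inv y"] c u by (simp add: m_assoc)
    have e2: "u \<otimes> inv x = (u \<otimes> inv y) \<otimes> inv (x \<otimes> inv y)"
    proof -
     have "inv (x \<otimes> inv y) = inv x \<otimes> y" using Units_inv_mult[OF xU(1), of "inv y"] xU by simp
     then show ?thesis using Units_cancel(4)[OF xU(2), of "inv x"] c u by (simp add: m_assoc)
    qed
    show ?thesis unfolding cs_mem[OF sW x u] cs_mem[OF sW y u] using e1 e2 wD(3,4) w by metis
   qed
   moreover have "cs W x <= carrier R" "cs W y <= carrier R" unfolding cs_def using WG Gc c by auto
   ultimately show ?thesis by blast
  qed
  have self: "x \<in> cs W x" if "x \<in> G" for x using cs_mem[OF sW that Gc[OF that]] G_Units[OF that] wD(2) by simp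
  have Pun: "Y = \<Union>P" unfolding P_def using self Y(2) by auto
  have disj: "pairwise (%i j. disjnt i j) P"
  proof (rule pairwiseI)
   fix i j assume "i \<in> P" "j \<in> P" "i ~= j"
   then obtain x y where xy: "x \<in> Y" "i = Y Int cs W x" "y \<in> Y" "j = Y Int cs W y" unfolding P_def by blast
   show "disjnt i j"
   proof (rule ccontr)
    assume "~ disjnt i j"
    then obtain u where u: "u \<in> Y" "u \<in> cs W x" "u \<in> cs W y" unfolding disjnt_def xy by blast
    have "x \<in> G" "y \<in> G" "u \<in> G" using xy u Y(2) by auto
    then have "cs W u = cs W x" "cs W u = cs W y" using cseq u by blast+
    then show False using xy \<open>i ~= j\<close> by simp
   qed
  qed
  define t where "t = (%x. f x \<otimes> x)"
  have tc: "t x \<in> carrier R" if "x \<in> Y" for x unfolding t_def using fD(2) that Y(2) Gc by blast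
  define s where "s = (%c. \<Oplus>x\<in>c. t x)"
  have PY: "c <= Y" if "c \<in> P" for c using that P_def by blast
  have sc: "s c \<in> carrier R" if "c \<in> P" for c unfolding s_def by (rule finsum_closed) (use tc PY that in blast)
  have "finsum R t (\<Union>((%c. c) ` P)) = (\<Oplus>c\<in>P. finsum R t c)"
  proof (rule add.finprod_UN_disjoint[OF fP])
   show "finite c" if "c \<in> P" for c by (rule finite_subset[OF PY[OF that] Y(1)])
   show "pairwise (%i j. disjnt i j) P" by (rule disj)
   show "t x \<in> carrier R" if "c \<in> P" "x \<in> c" for c x by (rule tc[OF subsetD[OF PY[OF that(1)] that(2)]])
  qed
  then have "(\<Oplus>x\<in>Y. t x) = (\<Oplus>c\<in>P. s c)" unfolding s_def Pun by simp
  moreover have "(\<Oplus>x\<in>Y. t x) = \<zero>" using f unfolding ker_def pr_def Y_def t_def by simp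
  ultimately have sum0: "(\<Oplus>c\<in>P. s c) = \<zero>" by simp
  have "ALL c:P. EX x. x \<in> Y & c = Y Int cs W x" unfolding P_def by blast
  from bchoice[OF this] obtain r where r: "!!c. c \<in> P ==> r c \<in> Y & c = Y Int cs W (r c)" by auto
  have rG: "r c \<in> G" if "c \<in> P" for c using r[OF that] Y(2) by blast
  have veq: "veq \<O> (s c) (r c)" if c: "c \<in> P" "s c ~= \<zero>" for c
  proof -
   have rU: "r c \<in> Units R" by (rule G_Units[OF rG[OF c(1)]])
   have rc: "r c \<in> carrier R" "inv (r c) \<in> carrier R" using rU by auto
   have fc: "finite c" using PY[OF c(1)] Y(1) finite_subset by blast
   have skf: "subfield (kf W) R" by (rule kf_subfield[OF WG])
   have ls: "lsubspace (kf W) (kf W)" by (rule lsubspace_subring[OF subfieldE(1)[OF skf] order_refl])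
   have tI: "t x \<otimes> inv (r c) \<in> kf W" if x: "x \<in> c" for x
   proof -
    have xY: "x \<in> Y" using PY[OF c(1)] x by blast
    have xc: "x \<in> carrier R" using xY Y(2) Gc by blast
    have "x \<in> cs W (r c)" using r[OF c(1)] x by blast
    then have "x \<otimes> inv (r c) \<in> W" using cs_mem[OF sW rG[OF c(1)] xc] by blast
    then have "x \<otimes> inv (r c) \<in> kf W" using kf_upper(1)[OF WG] by blast
    moreover have "f x \<in> kf W" using fD(1) kf_upper(2)[OF WG] by blast
    ultimately have "f x \<otimes> (x \<otimes> inv (r c)) \<in> kf W" using subringE(6)[OF subfieldE(1)[OF skf]] by blast
    then show ?thesis unfolding t_def using fD(2) xc rc by (simp add: m_assoc)
   qed
   have "s c \<otimes> inv (r c) = (\<Oplus>x\<in>c. t x \<otimes> inv (r c))"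
    unfolding s_def by (rule finsum_ldistr[OF fc rc(2)]) (use tc PY[OF c(1)] in blast)
   also have "\<dots> \<in> kf W" by (rule finsum_lsubspace[OF ls fc tI])
   finally have "s c \<otimes> inv (r c) \<in> kf W" .
   moreover have "s c \<otimes> inv (r c) ~= \<zero>" using integral_iff[OF sc[OF c(1)] rc(2)] c(2) Units_inv_Units[OF rU] Units_iff by blast
   ultimately have "s c \<otimes> inv (r c) \<in> vunits \<O>" using kf_vunits_nonzero[OF WG O(1)] by blast
   then show ?thesis unfolding veq_def using rU sc[OF c(1)] c(2) Units_iff by blast
  qed
  have s0: "s c = \<zero>" if "c \<in> P" for c
  proof (rule ccontr)
   assume ne: "s c ~= \<zero>"
   define P0 where "P0 = {c \<in> P. s c ~= \<zero>}"
   have P0: "finite P0" "P0 ~= {}" "P0 <= P" unfolding P0_def using fP that ne by auto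
   have "(\<Oplus>c\<in>P. s c) = (\<Oplus>c\<in>P0. s c)"
    by (rule add.finprod_mono_neutral_cong_right) (use fP P0(3) sc in \<open>auto simp: P0_def\<close>)
   then have z0: "(\<Oplus>c\<in>P0. s c) = \<zero>" using sum0 by simp
   have "EX c:P0. veq \<O> (\<Oplus>c\<in>P0. s c) (s c)"
   proof (rule dominant_finsum[OF vO P0(1,2)])
    show "s i \<in> Units R" if "i \<in> P0" for i using that sc Units_iff unfolding P0_def by blast
    show "~ veq \<O> (s i) (s j)" if ij: "i \<in> P0" "j \<in> P0" "i ~= j" for i j
    proof
     assume a: "veq \<O> (s i) (s j)"
     have p: "i \<in> P" "s i ~= \<zero>" "j \<in> P" "s j ~= \<zero>" using ij unfolding P0_def by auto
     have "veq \<O> (r i) (r j)" by (rule veq_trans[OF vO veq_trans[OF vO veq_sym[OF vO veq[OF p(1,2)]] a] veq[OF p(3,4)]])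
     then have "r i \<otimes> inv (r j) \<in> W" unfolding veq_def GO[symmetric] using G_mult[OF rG[OF p(1)] G_inv[OF rG[OF p(3)]]] by blast
     then have "r i \<in> cs W (r j)" using cs_mem[OF sW rG[OF p(3)] Gc[OF rG[OF p(1)]]] by blast
     then have "cs W (r i) = cs W (r j)" by (rule cseq[OF rG[OF p(1)] rG[OF p(3)]])
     then show False using r[OF p(1)] r[OF p(3)] ij(3) by metis
    qed
   qed
   then show False unfolding z0 veq_def Units_iff by blast
  qed
  have "pr (rs (cs W g) f) = (\<Oplus>x\<in>Y Int cs W g. t x)" unfolding pr_def supp_rs Y_def
   by (rule finsum_cong'[OF refl]) (use tc in \<open>auto simp: t_def rs_def Y_def\<close>)
  also have "\<dots> = \<zero>"
  proof (cases "Y Int cs W g = {}")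
   case True
   then show ?thesis by simp
  next
   case False
   then obtain x where x: "x \<in> Y" "x \<in> cs W g" by blast
   then have "cs W x = cs W g" using cseq g Y(2) by blast
   then have "Y Int cs W g \<in> P" unfolding P_def using x(1) by blast
   then show ?thesis using s0 unfolding s_def by blast
  qed
  finally show "rs (cs W g) f \<in> ker" unfolding ker_def using rs_gr[OF fg] by blast
 qed
qed

text \<open>A polynomial relation for \<open>x\<close> over the ring generated by \<open>k\<close>
  and \<open>V\<close> lifts to an element of the kernel whose monomials live on the distinct cosets
  of the powers of \<open>x\<close>. Control splits it into these parts, so every coefficient
  vanishes.\<close>

lemma ctrl_flat_acl:
 assumes V: "flat V" and c: "ctrl V" and x: "x \<in> G" "x ~: V"
 shows "x ~: acl V"
proof
 assume xa: "x \<in> acl V"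
 have VG: "V <= G" by (rule flatD(1)[OF V])
 note vD = flatD[OF V]
 have sV: "subgroup V M" unfolding subgroup_M_iff using vD by blast
 have xU: "x \<in> Units R" by (rule G_Units[OF x(1)])
 have xc: "x \<in> carrier R" using xU by auto
 have xp: "x [^] (n::nat) \<in> G" for n by (rule flat_pow[OF flat_G x(1)])
 have xnV: "x [^] (n::nat) \<in> V ==> n = 0" for n using vD(5)[OF x(1), of n] x(2) by (cases n) auto
 define A where "A = pr ` hsub V"
 have hg: "f \<in> gr" if "f \<in> hsub V" for f using that hsub_gr by blast
 have sA: "subring A R"
 proof (rule subringI)
  show "A <= carrier R" unfolding A_def using pr_closed hg by blast
  have s1: "single v a \<in> hsub V" if "v \<in> V" "a \<in> k" for v a unfolding hsub_def using single_gr that VG supp_single(2)[of v a] by blast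
  have "\<one> = pr (single \<one> \<one>)" using pr_single[OF G_one k_props(4)] by simp
  then show "\<one> \<in> A" unfolding A_def using s1[OF vD(2) k_props(4)] by blast
  have mult: "u \<otimes> v \<in> A" if uv: "u \<in> A" "v \<in> A" for u v
  proof -
   obtain f h where f: "f \<in> hsub V" "u = pr f" "h \<in> hsub V" "v = pr h" using uv unfolding A_def by blast
   have "supp (gmul f h) <= V"
   proof
    fix u' assume "u' \<in> supp (gmul f h)"
    then have "u' \<in> (%(y, z). y \<otimes> z) ` (supp f \<times> supp h)" by (rule subsetD[OF gmul_gr(2)[OF hg[OF f(1)] hg[OF f(3)]]])
    then obtain y z where yz: "y \<in> supp f" "z \<in> supp h" "u' = y \<otimes> z" by auto
    have "y \<in> V" "z \<in> V" using f(1,3) yz unfolding hsub_def by auto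
    then show "u' \<in> V" using vD(3) yz(3) by simp
   qed
   then have "gmul f h \<in> hsub V" unfolding hsub_def using gmul_gr(1)[OF hg[OF f(1)] hg[OF f(3)]] by blast
   moreover have "u \<otimes> v = pr (gmul f h)" unfolding f(2,4) using pr_gmul[OF hg[OF f(1)] hg[OF f(3)]] by simp
   ultimately show ?thesis unfolding A_def by blast
  qed
  then show "h1 \<otimes> h2 \<in> A" if "h1 \<in> A" "h2 \<in> A" for h1 h2 using that by blast
  show "u \<oplus> v \<in> A" if uv: "u \<in> A" "v \<in> A" for u v
  proof -
   obtain f h where f: "f \<in> hsub V" "u = pr f" "h \<in> hsub V" "v = pr h" using uv unfolding A_def by blast
   have "gadd f h \<in> hsub V" unfolding hsub_def using gadd_gr[OF hg[OF f(1)] hg[OF f(3)]] f(1,3) unfolding hsub_def by blast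
   moreover have "u \<oplus> v = pr (gadd f h)" unfolding f(2,4) using pr_gadd[OF hg[OF f(1)] hg[OF f(3)]] by simp
   ultimately show ?thesis unfolding A_def by blast
  qed
  have "\<ominus> \<one> = pr (single \<one> (\<ominus> \<one>))" using pr_single[OF G_one k_props(7)[OF k_props(4)]] by simp
  then have m1: "\<ominus> \<one> \<in> A" unfolding A_def using s1[OF vD(2) k_props(7)[OF k_props(4)]] by blast
  show "\<ominus> u \<in> A" if u: "u \<in> A" for u
  proof -
   have "u \<in> carrier R" using u pr_closed hg unfolding A_def by blast
   then have "\<ominus> u = \<ominus> \<one> \<otimes> u" by (simp add: l_minus)
   then show ?thesis using mult[OF m1 u] by simp
  qed
 qed
 have up: "k Un V <= A"
 proof
  fix a assume "a \<in> k Un V"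
  then consider "a \<in> k" | "a \<in> V" by blast
  then show "a \<in> A"
  proof cases
   case 1
   have "a \<in> carrier R" using 1 k_props(2) by blast
   then have "a = pr (single \<one> a)" using pr_single[OF G_one 1] by simp
   moreover have "single \<one> a \<in> hsub V" unfolding hsub_def using single_gr[OF G_one 1] supp_single(2)[of \<one> a] vD(2) by blast
   ultimately show ?thesis unfolding A_def by blast
  next
   case 2
   have aG: "a \<in> G" using 2 VG by blast
   then have "a = pr (single a \<one>)" using pr_single[OF aG k_props(4)] Gc by simp
   moreover have "single a \<one> \<in> hsub V" unfolding hsub_def using single_gr[OF aG k_props(4)] supp_single(2)[of a \<one>] 2 by blast
   ultimately show ?thesis unfolding A_def by blast
  qed
 qed
 have kA: "kf V <= fracs A" by (rule kf_least[OF VG fracs_subfield(1)[OF sA]]) (use up fracs_subfield(2)[OF sA] in blast)+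
 have "!!\<O>. \<O> \<in> vals (kf V) ==> x \<in> vunits \<O>" using xa unfolding acl_def by blast
 then obtain p where p: "set p <= A" "~ set p <= {\<zero>}" "eval p x = \<zero>"
  using algebraic_over_fracs[OF sA kf_subfield[OF VG] kA xU] by blast
 have Ac: "A <= carrier R" using subringE(1)[OF sA] .
 have mono: "EX f:gr. supp f <= cs V (x [^] n) & pr f = a \<otimes> x [^] n" if a: "a \<in> A" for a and n :: nat
 proof -
  obtain h where h: "h \<in> hsub V" "a = pr h" using a unfolding A_def by blast
  define d where "d = single (x [^] n) \<one>"
  have d: "d \<in> gr" "pr d = x [^] n" unfolding d_def using single_gr[OF xp k_props(4)] pr_single[OF xp k_props(4)] xc by auto
  have "supp (gmul h d) <= (%(y, z). y \<otimes> z) ` (supp h \<times> supp d)" by (rule gmul_gr(2)[OF hg[OF h(1)] d(1)])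
  also have "\<dots> <= cs V (x [^] n)" using h(1) supp_single(2)[of "x [^] n" \<one>] unfolding hsub_def cs_def d_def by auto
  finally show ?thesis using gmul_gr(1)[OF hg[OF h(1)] d(1)] pr_gmul[OF hg[OF h(1)] d(1)] d(2) h(2) by metis
 qed
 have ex: "set q <= A ==> EX f:gr. supp f <= (\<Union>i<length q. cs V (x [^] i)) & pr f = eval q x" for q
 proof (induction q)
  case Nil
  have "(%_. \<zero>) \<in> gr" "pr (%_. \<zero>) = \<zero>" "supp (%_. \<zero>) = {}" using zero_fun(1) unfolding ker_def supp_def by auto
  then show ?case by (intro bexI[of _ "%_. \<zero>"]) auto
 next
  case (Cons a q)
  obtain f where f: "f \<in> gr" "supp f <= (\<Union>i<length q. cs V (x [^] i))" "pr f = eval q x" using Cons by auto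
  obtain f' where f': "f' \<in> gr" "supp f' <= cs V (x [^] length q)" "pr f' = a \<otimes> x [^] length q"
   using mono[of a "length q"] Cons.prems by auto
  have "supp (gadd f' f) <= (\<Union>i<length (a # q). cs V (x [^] i))"
   using gadd_gr(2)[OF f'(1) f(1)] f(2) f'(2) by (fastforce simp: less_Suc_eq)
  moreover have "pr (gadd f' f) = eval (a # q) x" using pr_gadd[OF f'(1) f(1)] f(3) f'(3) by simp
  ultimately show ?case using gadd_gr(1)[OF f'(1) f(1)] by blast
 qed
 have "set q <= A ==> eval q x = \<zero> ==> set q <= {\<zero>}" for q
 proof (induction q)
  case Nil
  then show ?case by simp
 next
  case (Cons a q)
  define n where "n = length q"
  have qA: "set q <= A" and aA: "a \<in> A" using Cons.prems by auto
  have ac: "a \<in> carrier R" and qc: "set q <= carrier R" using aA qA Ac by auto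
  obtain f where f: "f \<in> gr" "supp f <= (\<Union>i<n. cs V (x [^] i))" "pr f = eval q x" using ex[OF qA] unfolding n_def by blast
  obtain f' where f': "f' \<in> gr" "supp f' <= cs V (x [^] n)" "pr f' = a \<otimes> x [^] n" using mono[OF aA] by blast
  have "pr (gadd f' f) = \<zero>" using pr_gadd[OF f'(1) f(1)] f(3) f'(3) Cons.prems(2) unfolding n_def by simp
  then have "gadd f' f \<in> ker" unfolding ker_def using gadd_gr(1)[OF f'(1) f(1)] by blast
  then have "rs (cs V (x [^] n)) (gadd f' f) \<in> ker" by (rule ctrl_restrict[OF c _ xp])
  moreover have "rs (cs V (x [^] n)) (gadd f' f) = f'"
  proof
   fix y
   have d: "y ~: cs V (x [^] i)" if y: "y \<in> cs V (x [^] n)" and i: "i < n" for i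
   proof
    assume yi: "y \<in> cs V (x [^] i)"
    obtain v v' where v: "v \<in> V" "y = v \<otimes> x [^] n" "v' \<in> V" "y = v' \<otimes> x [^] i" using y yi unfolding cs_def by blast
    have vU: "v \<in> Units R" "v' \<in> Units R" "x [^] i \<in> Units R" using v VG G_Units xp by blast+
    have vc: "v \<in> carrier R" "v' \<in> carrier R" "x [^] i \<in> carrier R" "x [^] (n - i) \<in> carrier R" using vU xc by auto
    have "x [^] n = x [^] (n - i) \<otimes> x [^] i" using nat_pow_mult[of x "n - i" i] xc i by simp
    then have "(v \<otimes> x [^] (n - i)) \<otimes> x [^] i = v' \<otimes> x [^] i" using v vc by (simp add: m_assoc)
    then have "v \<otimes> x [^] (n - i) = v'" using m_rcancel[of "x [^] i"] vU(3) vc Units_iff by simp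
    then have "x [^] (n - i) = inv v \<otimes> v'" using Units_cancel(2)[OF vU(1), of "x [^] (n - i)"] vc by simp
    then have "x [^] (n - i) \<in> V" using vD(3,4) v by simp
    then show False using xnV i by force
   qed
   show "rs (cs V (x [^] n)) (gadd f' f) y = f' y"
   proof (cases "y \<in> cs V (x [^] n)")
    case True
    then have "f y = \<zero>" using f(2) d unfolding supp_def by blast
    then show ?thesis using True grD(2)[OF f'(1)] by (simp add: rs_def gadd_def)
   next
    case False
    then have "f' y = \<zero>" using f'(2) unfolding supp_def by blast
    then show ?thesis using False by (simp add: rs_def)
   qed
  qed
  ultimately have "a \<otimes> x [^] n = \<zero>" using f'(3) unfolding ker_def by simp
  then have a0: "a = \<zero>" using integral_iff[OF ac, of "x [^] n"] Units_pow[OF xU, of n] xc Units_iff by blast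
  have "eval q x = \<zero>" using Cons.prems(2) a0 xc eval_in_carrier[OF qc xc] by simp
  then show ?case using Cons.IH[OF qA] a0 by simp
 qed
 then show False using p by blast
qed

text \<open>Every flat above the isolator \<open>Q\<close> of the controller controls the kernel and
  is therefore algebraically closed in \<open>G\<close>. Hence multiplicative independence over
  \<open>Q\<close> implies algebraic independence, rank and degree agree above \<open>Q\<close>, and
  \<open>Z_subset\<close> gives \<open>zflat {\<one>} G <= Q\<close>. The other inclusion is
  \<open>ctrl_zflat\<close>.\<close>

theorem isolator_controller:
 assumes triv: "acl {} = {\<one>}"
 shows "isolator M (controller kk M ker) = zflat {\<one>} G"
proof -
 have f1: "flat {\<one>}" using acl_flat[of "{}"] triv by simp
 have o1: "{\<one>} <= G" using G_one by blast
 define W where "W = zflat {\<one>} G"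
 note z = zflat_props[OF f1 flat_G o1, folded W_def]
 have sC: "subgroup ctr M" using ctrl_ctr ctrl_iff by blast
 define Q where "Q = isolator M ctr"
 have Q: "isolated M Q" "ctr <= Q" unfolding Q_def using M.isolated_isolator[OF sC] M.isolator_upper[OF sC] by auto
 have fQ: "flat Q" using Q(1) M.flat_iff_isolated by blast
 have QG: "Q <= G" by (rule flatD(1)[OF fQ])
 have "ctr <= W" unfolding ctr_def W_def using ctrl_zflat[OF f1] by blast
 moreover have "isolated M W" using z(1) M.flat_iff_isolated by blast
 ultimately have QW: "Q <= W" unfolding Q_def using M.isolator_least by blast
 have QM: "Q <= carrier M" and GM: "G <= carrier M" using QG by auto
 obtain E where E: "finite E" "E <= G" "G <= ic (Q Un E)" "rk G = rk Q + card E"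
  and oE: "ALL D<=E. ALL c:E - D. c ~: ic (Q Un D)" using M.relative_basis[OF QG GM] by blast
 have "td (Q Un E) = td Q + card E"
 proof (rule D.rk_Un_indep[OF QG E(1,2)])
  fix D c assume D: "D <= E" "c \<in> E" "c ~: D"
  define V where "V = ic (Q Un D)"
  have QD: "Q Un D <= carrier M" using QG D(1) E(2) by auto
  have fV: "flat V" unfolding V_def by (rule M.flat_cl[OF QD])
  have up: "Q Un D <= V" unfolding V_def by (rule M.cl_increasing[OF QD])
  have sV: "subgroup V M" unfolding subgroup_M_iff using flatD[OF fV] by blast
  have "ctrl V" by (rule ctrl_mono[OF ctrl_ctr sV]) (use Q(2) up in blast)
  moreover have "c ~: V" unfolding V_def using oE D by blast
  moreover have "c \<in> G" using D(2) E(2) by blast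
  ultimately have "c ~: acl V" using ctrl_flat_acl[OF fV] by blast
  then show "c ~: acl (Q Un D)" using acl_mono[OF up flatD(1)[OF fV]] by blast
 qed
 moreover have "td (Q Un E) <= td G" by (rule D.rk_mono[OF _ order_refl]) (use QG E(2) in blast)
 ultimately have eq: "rk G + td Q <= td G + rk Q" using E(4) by simp
 have o1Q: "{\<one>} <= Q" using flatD(2)[OF fQ] by blast
 have "S <= Q" if "S \<in> Z {\<one>} G" for S by (rule Z_subset[OF f1 fQ flat_G o1Q QG eq that])
 then have "{\<one>} Un \<Union>(Z {\<one>} G) <= Q" using o1Q by blast
 then have "W <= Q" unfolding W_def zflat_def by (rule M.cl_flat_min[OF _ fQ])
 then show ?thesis using QW controller_eq unfolding Q_def W_def by simp
qed

end

section \<open>The theorem\<close>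

context field
begin

lemma mult_grp_comm_group:
 assumes E: "subgroup E (Multiplicative_Group.mult_of R)"
 shows "comm_group (mult_grp R E)"
proof -
 have c: "comm_group (Multiplicative_Group.mult_of R)" unfolding mult_of_is_Units by (rule units_comm_group)
 show ?thesis
 proof (rule group.group_comm_groupI[OF subgroup.subgroup_is_group[OF E comm_group.axioms(2)[OF c]]])
  fix x y assume "x \<in> carrier (mult_grp R E)" "y \<in> carrier (mult_grp R E)"
  then have "x \<in> carrier R" "y \<in> carrier R" using subgroup.subset[OF E] by auto
  then show "x \<otimes>\<^bsub>mult_grp R E\<^esub> y = y \<otimes>\<^bsub>mult_grp R E\<^esub> x" by (simp add: m_comm)
 qed
qed

lemma finsum_subfield:
 assumes "subfield L R" "finite A" "f \<in> A \<rightarrow> L"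
 shows "finsum (R\<lparr>carrier := L\<rparr>) f A = finsum R f A"
proof -
 interpret K: field "R\<lparr>carrier := L\<rparr>" using subfield_iff(2)[OF assms(1)] .
 show ?thesis using assms(2,3)
 proof (induction A rule: finite_induct)
  case (insert a A)
  have "finsum (R\<lparr>carrier := L\<rparr>) f (Set.insert a A) = f a \<oplus>\<^bsub>R\<lparr>carrier := L\<rparr>\<^esub> finsum (R\<lparr>carrier := L\<rparr>) f A"
   by (rule K.finsum_insert) (use insert in auto)
  moreover have "finsum R f (Set.insert a A) = f a \<oplus> finsum R f A" by (rule finsum_insert) (use insert subfieldE(3)[OF assms(1)] in auto)
  ultimately show ?case using insert by auto
 qed simp
qed

text \<open>Elements of \<open>univ_poly\<close> have non-zero leading coefficient, so leading zeros
  are stripped from the list first.\<close>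

lemma algebraic_if_root:
 assumes L: "subfield L R" and x: "x \<in> carrier R"
 shows "set p <= L ==> ~ set p <= {\<zero>} ==> eval p x = \<zero> ==> (algebraic over L) x"
proof (induction p)
 case Nil
 then show ?case by simp
next
 case (Cons a p)
 have pc: "set p <= carrier R" using Cons.prems(1) subfieldE(3)[OF L] by auto
 show ?case
 proof (cases "a = \<zero>")
  case True
  then have "eval p x = \<zero>" using Cons.prems(3) x eval_in_carrier[OF pc x] by simp
  then show ?thesis using Cons True by auto
 next
  case False
  show ?thesis
  proof (rule algebraicI[OF _ _ Cons.prems(3)])
   show "a # p \<in> carrier (L [X])" using Cons.prems(1) False unfolding univ_poly_def polynomial_def by auto
  qed simp
 qed
qed

end

context mult_field
begin

lemma acl_empty:
 assumes "!!g. g \<in> G ==> (algebraic over k) g ==> g = \<one>"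
 shows "acl {} = {\<one>}"
proof
 show "{\<one>} <= acl {}" using flatD(2)[OF acl_flat] by blast
 show "acl {} <= {\<one>}"
 proof
  fix g assume g: "g \<in> acl {}"
  then have gG: "g \<in> G" and v: "!!\<O>. \<O> \<in> vals (kf {}) ==> g \<in> vunits \<O>" unfolding acl_def by auto
  obtain p where p: "set p <= kf {}" "~ set p <= {\<zero>}" "eval p g = \<zero>"
   using valg_algebraic[OF kf_subfield[OF empty_subsetI] G_Units[OF gG]] v by metis
  have "kf {} <= k" by (rule kf_least) (use k in auto)
  then have "set p <= k" using p(1) by blast
  then have "(algebraic over k) g" using algebraic_if_root[OF k _ _ p(2,3)] G_carrier gG by blast
  then show "g \<in> {\<one>}" using assms gG by blast
 qed
qed

lemma rank_one_flat:
 assumes f1: "flat {\<one>}" and Y: "flat Y" "rk Y = 1"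
 shows "rank_one (mult_grp R Y)"
proof -
 define N where "N = mult_grp R Y"
 have YG: "Y <= G" by (rule flatD(1)[OF Y(1)])
 have sY: "subgroup Y M" unfolding subgroup_M_iff using flatD[OF Y(1)] by blast
 have sY': "subgroup Y (Multiplicative_Group.mult_of R)" by (rule group.incl_subgroup[OF comm_group.axioms(2)[OF group_mult_of] G sY])
 interpret N: comm_group N unfolding N_def by (rule mult_grp_comm_group[OF sY'])
 have NM: "N = M\<lparr>carrier := Y\<rparr>" unfolding N_def by simp
 have cN: "carrier N = Y" unfolding N_def by simp
 have pw: "x [^]\<^bsub>N\<^esub> (n::nat) = x [^] n" for x n unfolding N_def by (induction n) (simp_all add: nat_pow_def)
 have YM: "Y <= carrier M" using YG by simp
 obtain J where J: "M.indep J" "J <= Y" "Y <= ic J" "rk Y = card J"  by (rule M.basis_exists[OF YM]) (rule that)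
 obtain y where y: "J = {y}" using J(4) Y(2) card_1_singletonE by metis
 have yY: "y \<in> Y" using J(2) y by blast
 have tr: "isolated M H" if H: "isolated N H" for H
 proof -
  have sH: "subgroup H M" using H group.incl_subgroup[OF M.is_group sY] unfolding isolated_def NM by blast
  have "g \<in> H" if g: "g \<in> G" "n \<ge> 1" "g [^] n \<in> H" for g and n :: nat
  proof -
   have "H <= Y" using H subgroup.subset[of H N] cN unfolding isolated_def by blast
   then have "g \<in> Y" using flatD(5)[OF Y(1) g(1,2)] g(3) by blast
   then show ?thesis using H g(2,3) pw cN unfolding isolated_def by auto
  qed
  then show ?thesis using sH unfolding isolated_def M_nat_pow by auto
 qed
 have yN: "{y} <= carrier N" using yY cN by blast
 have "rank_one N"
 proof (rule N.rank_one_if_icl_singleton)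
  show "y \<in> carrier N" using yN by blast
  have "icl M {y} <= icl N {y}" by (rule M.icl_least[OF tr[OF N.isolated_icl[OF yN]] N.icl_upper])
  then show "carrier N <= icl N {y}" using J(3) y cN by blast
  have s1: "subgroup {\<one>} M" using f1 unfolding M.flat_iff_isolated isolated_def by blast
  have "subgroup {\<one>} N" unfolding NM by (rule group.subgroup_incl[OF M.is_group s1 sY]) (use flatD(2)[OF Y(1)] in blast)
  moreover have o: "\<one>\<^bsub>N\<^esub> = \<one>" unfolding N_def by simp
  moreover have "g \<in> {\<one>}" if "g \<in> Y" "n \<ge> 1" "g [^] n \<in> {\<one>}" for g and n :: nat
   using flatD(5)[OF f1 _ that(2,3)] that(1) YG by blast
  ultimately show "isolated N {\<one>\<^bsub>N\<^esub>}" unfolding isolated_def cN pw by auto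
  show "y ~= \<one>\<^bsub>N\<^esub>"
  proof
   assume "y = \<one>\<^bsub>N\<^esub>"
   then have "y \<in> icl M {}" using flatD(2)[OF M.flat_cl[of "{}"]] o by simp
   then show False using J(1) y unfolding M.indep_def by auto
  qed
 qed
 then show ?thesis unfolding N_def .
qed

lemma dense_generate:
 assumes B: "flat B" "B = ic (\<Union>Ys)" and Ys: "!!Y. Y \<in> Ys ==> Y <= B"
 shows "dense_subgroup (generate (mult_grp R B) (\<Union>Ys)) (mult_grp R B)"
proof -
 define N where "N = mult_grp R B"
 have BG: "B <= G" by (rule flatD(1)[OF B(1)])
 have sB: "subgroup B M" unfolding subgroup_M_iff using flatD[OF B(1)] by blast
 have sB': "subgroup B (Multiplicative_Group.mult_of R)" by (rule group.incl_subgroup[OF comm_group.axioms(2)[OF group_mult_of] G sB])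
 interpret N: comm_group N unfolding N_def by (rule mult_grp_comm_group[OF sB'])
 have NM: "N = M\<lparr>carrier := B\<rparr>" unfolding N_def by simp
 have cN: "carrier N = B" unfolding N_def by simp
 have pw: "x [^]\<^bsub>N\<^esub> (n::nat) = x [^]\<^bsub>M\<^esub> n" for x n unfolding N_def by (induction n) (simp_all add: nat_pow_def)
 have UB: "\<Union>Ys <= B" using Ys by blast
 then have UM: "\<Union>Ys <= carrier M" using BG by auto
 define H where "H = generate N (\<Union>Ys)"
 have HM: "H = generate M (\<Union>Ys)" unfolding H_def NM by (rule M.generate_consistent[OF UB sB])
 have sH: "subgroup H N" unfolding H_def by (rule N.generate_is_subgroup) (use UB cN in simp)
 have nH: "H \<lhd> N" by (rule N.subgroup_imp_normal[OF sH])
 interpret Q: normal H N by (rule nH)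
 have gQ: "group (N Mod H)" by (rule Q.factorgroup_is_group)
 have gh: "group_hom N (N Mod H) (%a. H #>\<^bsub>N\<^esub> a)"
  by (rule group_hom.intro[OF N.is_group gQ]) (rule group_hom_axioms.intro[OF Q.r_coset_hom_Mod])
 have "torsion_group (N Mod H)" unfolding torsion_group_def
 proof
  fix c assume "c \<in> carrier (N Mod H)"
  then obtain b where b: "b \<in> B" "c = H #>\<^bsub>N\<^esub> b" unfolding FactGroup_def RCOSETS_def using cN by auto
  have "b \<in> isolator M (generate M (\<Union>Ys))" using b(1) B(2) M.icl_eq_isolator[OF UM] by simp
  then obtain m where m: "m \<ge> (1::nat)" "b [^]\<^bsub>M\<^esub> m \<in> H" unfolding isolator_def HM by blast
  have bN: "b \<in> carrier N" using b(1) cN by simp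
  have "c [^]\<^bsub>N Mod H\<^esub> m = H #>\<^bsub>N\<^esub> (b [^]\<^bsub>N\<^esub> m)"
   unfolding b(2) using group_hom.hom_nat_pow[OF gh bN, of m] by simp
  also have "\<dots> = H" using N.coset_join2[OF _ sH] m(2) pw bN by simp
  finally show "EX m::nat. m \<ge> 1 & c [^]\<^bsub>N Mod H\<^esub> m = \<one>\<^bsub>N Mod H\<^esub>"
   using m(1) unfolding FactGroup_def by auto
 qed
 then show ?thesis unfolding dense_subgroup_def using sH unfolding H_def N_def by blast
qed

end

lemma finite_image_factor:
 assumes "finite (f ` A)" "!!x y. x \<in> A ==> y \<in> A ==> f x = f y ==> g x = g y"
 shows "finite (g ` A)"
proof -
 have "g ` A <= (%u. g (SOME x. x \<in> A & f x = u)) ` (f ` A)"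
 proof
  fix z assume "z \<in> g ` A"
  then obtain x where x: "x \<in> A" "z = g x" by blast
  define y where "y = (SOME y. y \<in> A & f y = f x)"
  have "y \<in> A & f y = f x" unfolding y_def by (rule someI[of _ x]) (use x in blast)
  then have "z = g y" using assms(2) x by metis
  then show "z \<in> (%u. g (SOME x. x \<in> A & f x = u)) ` (f ` A)" unfolding y_def using x(1) by blast
 qed
 then show ?thesis using assms(1) finite_subset by blast
qed

context field
begin

lemma subgroup_rel_auto:
 assumes k: "k <= carrier R"
 shows "subgroup (rel_auto k R) (BijGroup (carrier R))"
proof -
 have B: "f \<in> Bij (carrier R)" "f \<in> ring_hom R R" "!!a. a \<in> k ==> f a = a" if "f \<in> rel_auto k R" for f
  using that unfolding rel_auto_def by auto
 have m: "f \<otimes>\<^bsub>BijGroup (carrier R)\<^esub> h = compose (carrier R) f h" if "f \<in> rel_auto k R" "h \<in> rel_auto k R" for f h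
  using B(1) that unfolding BijGroup_def by simp
 show ?thesis
 proof (rule subgroup.intro)
  show "rel_auto k R <= carrier (BijGroup (carrier R))" using B(1) unfolding BijGroup_def by auto
  show "\<one>\<^bsub>BijGroup (carrier R)\<^esub> \<in> rel_auto k R"
   unfolding rel_auto_def BijGroup_def using id_Bij k by (auto intro!: ring_hom_memI)
  fix f assume f: "f \<in> rel_auto k R"
  note bf = B[OF f]
  have fc: "f x \<in> carrier R" if "x \<in> carrier R" for x using Bij_imp_funcset[OF bf(1)] that by blast
  {
   fix h assume h: "h \<in> rel_auto k R"
   note bh = B[OF h]
   have hc: "h x \<in> carrier R" if "x \<in> carrier R" for x using Bij_imp_funcset[OF bh(1)] that by blast
   have "compose (carrier R) f h \<in> ring_hom R R" by (rule ring_hom_memI)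
     (use fc hc ring_hom_mult[OF bf(2)] ring_hom_mult[OF bh(2)] ring_hom_add[OF bf(2)] ring_hom_add[OF bh(2)]
      ring_hom_one[OF bf(2)] ring_hom_one[OF bh(2)] in \<open>auto simp: compose_def\<close>)
   moreover have "compose (carrier R) f h \<in> Bij (carrier R)" by (rule compose_Bij[OF bf(1) bh(1)])
   moreover have "compose (carrier R) f h a = a" if "a \<in> k" for a using that k bf(3) bh(3) by (auto simp: compose_def)
   ultimately show "f \<otimes>\<^bsub>BijGroup (carrier R)\<^esub> h \<in> rel_auto k R" unfolding m[OF f h] unfolding rel_auto_def by blast
  }
  have bij: "bij_betw f (carrier R) (carrier R)" using bf(1) unfolding Bij_def by blast
  define i where "i = inv_into (carrier R) f"
  have fi: "f (i x) = x" "i x \<in> carrier R" if "x \<in> carrier R" for x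
   unfolding i_def using bij that f_inv_into_f[of x f "carrier R"] inv_into_into[of x f "carrier R"] unfolding bij_betw_def by auto
  have if': "i (f x) = x" if "x \<in> carrier R" for x unfolding i_def using bij that inv_into_f_f unfolding bij_betw_def by fastforce
  have "(\<lambda>x\<in>carrier R. i x) \<in> ring_hom R R"
  proof (rule ring_hom_memI)
   fix x y assume xy: "x \<in> carrier R" "y \<in> carrier R"
   show "(\<lambda>x\<in>carrier R. i x) x \<in> carrier R" using fi(2) xy by simp
   have "i (f (i x \<otimes> i y)) = i x \<otimes> i y" using if' fi(2) xy by simp
   then show "(\<lambda>x\<in>carrier R. i x) (x \<otimes> y) = (\<lambda>x\<in>carrier R. i x) x \<otimes> (\<lambda>x\<in>carrier R. i x) y"
    using ring_hom_mult[OF bf(2) fi(2)[OF xy(1)] fi(2)[OF xy(2)]] fi(1) xy by simp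
   have "i (f (i x \<oplus> i y)) = i x \<oplus> i y" using if' fi(2) xy by simp
   then show "(\<lambda>x\<in>carrier R. i x) (x \<oplus> y) = (\<lambda>x\<in>carrier R. i x) x \<oplus> (\<lambda>x\<in>carrier R. i x) y"
    using ring_hom_add[OF bf(2) fi(2)[OF xy(1)] fi(2)[OF xy(2)]] fi(1) xy by simp
  next
   show "(\<lambda>x\<in>carrier R. i x) \<one> = \<one>" using if'[of \<one>] ring_hom_one[OF bf(2)] by simp
  qed
  moreover have "(\<lambda>x\<in>carrier R. i x) \<in> Bij (carrier R)" unfolding i_def by (rule restrict_inv_into_Bij[OF bf(1)])
  moreover have "(\<lambda>x\<in>carrier R. i x) a = a" if "a \<in> k" for a using if'[of a] bf(3)[OF that] that k by auto
  ultimately show "inv\<^bsub>BijGroup (carrier R)\<^esub> f \<in> rel_auto k R"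
   unfolding inv_BijGroup[OF bf(1)] i_def[symmetric] rel_auto_def by blast
 qed
qed

end

section \<open>Stabilisers of finite index\<close>

context mult_field
begin

text \<open>A right coset of the stabiliser is determined by the images of the members of
  \<open>Ys\<close> under the inverse of a representative, and finiteness of the orbits leaves
  finitely many possibilities.\<close>

lemma finite_index_stabiliser:
 assumes Ys: "finite Ys" "!!Y. Y \<in> Ys ==> Y <= G & finite (orb Y)"
  and \<Gamma>: "subgroup \<Gamma> (RelAutoGroup k R)" "stabilises \<Gamma> G"
 shows "finite_index {\<rho> \<in> \<Gamma>. ALL Y:Ys. \<rho> ` Y = Y} ((RelAutoGroup k R)\<lparr>carrier := \<Gamma>\<rparr>)"
proof -
 define U where "U = BijGroup (carrier R)"
 define P where "P = (RelAutoGroup k R)\<lparr>carrier := \<Gamma>\<rparr>"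
 define \<Delta> where "\<Delta> = {\<rho> \<in> \<Gamma>. ALL Y:Ys. \<rho> ` Y = Y}"
 have gU: "group U" unfolding U_def by (rule group_BijGroup)
 have sA: "subgroup (rel_auto k R) U" unfolding U_def by (rule subgroup_rel_auto[OF k_props(2)])
 have sG: "subgroup \<Gamma> U" by (rule group.incl_subgroup[OF gU sA]) (use \<Gamma>(1) in \<open>simp add: RelAutoGroup_def U_def\<close>)
 have P: "P = U\<lparr>carrier := \<Gamma>\<rparr>" unfolding P_def RelAutoGroup_def U_def by simp
 interpret P: group P unfolding P by (rule subgroup.subgroup_is_group[OF sG gU])
 have cP: "carrier P = \<Gamma>" unfolding P by simp
 have GA: "\<Gamma> <= rel_auto k R" using subgroup.subset[OF \<Gamma>(1)] unfolding RelAutoGroup_def by simp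
 have Bj: "\<rho> \<in> Bij (carrier R)" if "\<rho> \<in> \<Gamma>" for \<rho> using GA that unfolding rel_auto_def by blast
 have au: "\<rho> \<in> auts" if "\<rho> \<in> \<Gamma>" for \<rho>
  using GA that \<Gamma>(2) unfolding rel_auto_def auts_def Bij_def stabilises_def by auto
 have mi: "(\<rho> \<otimes>\<^bsub>P\<^esub> \<tau>) ` Y = \<rho> ` \<tau> ` Y" if "\<rho> \<in> \<Gamma>" "\<tau> \<in> \<Gamma>" "Y <= G" for \<rho> \<tau> Y
 proof -
  have "\<rho> \<otimes>\<^bsub>P\<^esub> \<tau> = compose (carrier R) \<rho> \<tau>" unfolding P U_def BijGroup_def using Bj that by simp
  moreover have "compose (carrier R) \<rho> \<tau> y = \<rho> (\<tau> y)" if "y \<in> Y" for y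
   using that \<open>Y <= G\<close> G_carrier by (simp add: compose_def subset_iff)
  ultimately show ?thesis by (simp add: image_image cong: image_cong)
 qed
 have oi: "\<one>\<^bsub>P\<^esub> ` Y = Y" if "Y <= G" for Y
 proof -
  have "\<one>\<^bsub>P\<^esub> y = y" if "y \<in> Y" for y
   unfolding P U_def BijGroup_def using that \<open>Y <= G\<close> G_carrier by (simp add: subset_iff)
  then show ?thesis by (simp cong: image_cong)
 qed
 have inI: "inv\<^bsub>P\<^esub> \<rho> \<in> \<Gamma>" if "\<rho> \<in> \<Gamma>" for \<rho> using P.inv_closed that cP by simp
 have imG: "\<rho> ` Y <= G" if "\<rho> \<in> \<Gamma>" "Y <= G" for \<rho> Y using aut_G[OF au[OF that(1)]] that(2) by blast
 have sD: "subgroup \<Delta> P"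
 proof (rule P.subgroupI)
  show "\<Delta> <= carrier P" unfolding \<Delta>_def cP by blast
  have "\<one>\<^bsub>P\<^esub> \<in> \<Delta>" unfolding \<Delta>_def using P.one_closed cP oi Ys(2) by auto
  then show "\<Delta> ~= {}" by blast
  fix \<rho> assume r: "\<rho> \<in> \<Delta>"
  then have rG: "\<rho> \<in> \<Gamma>" unfolding \<Delta>_def by blast
  have "(inv\<^bsub>P\<^esub> \<rho>) ` Y = Y" if "Y \<in> Ys" for Y
  proof -
   have YG: "Y <= G" using Ys(2) that by blast
   have "(inv\<^bsub>P\<^esub> \<rho>) ` Y = (inv\<^bsub>P\<^esub> \<rho>) ` \<rho> ` Y" using r that unfolding \<Delta>_def by simp
   also have "\<dots> = (inv\<^bsub>P\<^esub> \<rho> \<otimes>\<^bsub>P\<^esub> \<rho>) ` Y" using mi[OF inI[OF rG] rG YG] by simp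
   also have "\<dots> = Y" using P.l_inv[of \<rho>] rG cP oi[OF YG] by simp
   finally show ?thesis .
  qed
  then show "inv\<^bsub>P\<^esub> \<rho> \<in> \<Delta>" unfolding \<Delta>_def using inI[OF rG] by blast
  fix \<tau> assume t: "\<tau> \<in> \<Delta>"
  then have tG: "\<tau> \<in> \<Gamma>" unfolding \<Delta>_def by blast
  have "(\<rho> \<otimes>\<^bsub>P\<^esub> \<tau>) ` Y = Y" if "Y \<in> Ys" for Y
   using mi[OF rG tG, of Y] Ys(2)[OF that] r t that unfolding \<Delta>_def by simp
  then show "\<rho> \<otimes>\<^bsub>P\<^esub> \<tau> \<in> \<Delta>" unfolding \<Delta>_def using P.m_closed[of \<rho> \<tau>] rG tG cP by simp
 qed
 have "finite ((%\<rho>. \<Delta> #>\<^bsub>P\<^esub> \<rho>) ` \<Gamma>)"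
 proof (rule finite_image_factor)
  \<comment> \<open>Inverses appear because right cosets are counted: two representatives give the
    same coset once their inverses act equally on \<open>Ys\<close>.\<close>
  define \<Phi> where "\<Phi> = (%\<rho>. \<lambda>Y\<in>Ys. (inv\<^bsub>P\<^esub> \<rho>) ` Y)"
  have "\<Phi> ` \<Gamma> <= PiE Ys orb" unfolding \<Phi>_def orb_def using inI au by auto
  moreover have "finite (PiE Ys orb)" by (rule finite_PiE[OF Ys(1)]) (use Ys(2) in blast)
  ultimately show "finite (\<Phi> ` \<Gamma>)" using finite_subset by blast
  fix \<rho> \<tau> assume rt: "\<rho> \<in> \<Gamma>" "\<tau> \<in> \<Gamma>" and e: "\<Phi> \<rho> = \<Phi> \<tau>"
  have "(\<rho> \<otimes>\<^bsub>P\<^esub> inv\<^bsub>P\<^esub> \<tau>) ` Y = Y" if Y: "Y \<in> Ys" for Y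
  proof -
   have YG: "Y <= G" using Ys(2) Y by blast
   have "(inv\<^bsub>P\<^esub> \<rho>) ` Y = (inv\<^bsub>P\<^esub> \<tau>) ` Y" using fun_cong[OF e, of Y] Y unfolding \<Phi>_def by simp
   then have "(\<rho> \<otimes>\<^bsub>P\<^esub> inv\<^bsub>P\<^esub> \<tau>) ` Y = \<rho> ` (inv\<^bsub>P\<^esub> \<rho>) ` Y" using mi[OF rt(1) inI[OF rt(2)] YG] by simp
   also have "\<dots> = (\<rho> \<otimes>\<^bsub>P\<^esub> inv\<^bsub>P\<^esub> \<rho>) ` Y" using mi[OF rt(1) inI[OF rt(1)] YG] by simp
   also have "\<dots> = Y" using P.r_inv[of \<rho>] rt(1) cP oi[OF YG] by simp
   finally show ?thesis .
  qed
  then have d: "\<rho> \<otimes>\<^bsub>P\<^esub> inv\<^bsub>P\<^esub> \<tau> \<in> \<Delta>" unfolding \<Delta>_def using P.m_closed[of \<rho> "inv\<^bsub>P\<^esub> \<tau>"] rt inI cP by simp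
  have "\<rho> = (\<rho> \<otimes>\<^bsub>P\<^esub> inv\<^bsub>P\<^esub> \<tau>) \<otimes>\<^bsub>P\<^esub> \<tau>"
   using P.m_assoc[of \<rho> "inv\<^bsub>P\<^esub> \<tau>" \<tau>] P.l_inv[of \<tau>] P.r_one[of \<rho>] inI[OF rt(2)] rt cP by simp
  then have "\<rho> \<in> \<Delta> #>\<^bsub>P\<^esub> \<tau>" unfolding r_coset_def using d by blast
  then show "\<Delta> #>\<^bsub>P\<^esub> \<rho> = \<Delta> #>\<^bsub>P\<^esub> \<tau>" using P.repr_independence[OF _ _ sD] rt(2) cP by simp
 qed
 moreover have "rcosets\<^bsub>P\<^esub> \<Delta> = (%\<rho>. \<Delta> #>\<^bsub>P\<^esub> \<rho>) ` \<Gamma>" unfolding RCOSETS_def cP by blast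
 ultimately show ?thesis unfolding finite_index_def using sD unfolding P_def \<Delta>_def by simp
qed

lemma stable_rank_one_subgroups:
 assumes triv: "acl {} = {\<one>}" and B: "B = isolator M (controller kk M ker)"
 shows "EX Ys. finite Ys & (ALL Y:Ys. subgroup Y (mult_grp R B) & rank_one (mult_grp R Y)) &
  dense_subgroup (generate (mult_grp R B) (\<Union>Ys)) (mult_grp R B) &
  (ALL \<Gamma>. subgroup \<Gamma> (RelAutoGroup k R) & stabilises \<Gamma> G -->
    (EX \<Delta>. finite_index \<Delta> ((RelAutoGroup k R)\<lparr>carrier := \<Gamma>\<rparr>) & (ALL Y:Ys. stabilises \<Delta> Y)))"
proof -
 have f1: "flat {\<one>}" using acl_flat[of "{}"] triv by simp
 have o1: "{\<one>} <= G" using G_one by blast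
 have B': "B = zflat {\<one>} G" unfolding B by (rule isolator_controller[OF triv])
 have fB: "flat B" unfolding B' by (rule zflat_props(1)[OF f1 flat_G o1])
 have sB: "subgroup B M" unfolding subgroup_M_iff using flatD[OF fB] by blast
 obtain Ys where Ys: "finite Ys" "!!Y. Y \<in> Ys ==> flat Y & rk Y = 1 & finite (orb Y)" "ic (\<Union>Ys) = B"
  using finite_stable_lines[OF triv] unfolding B' by metis
 have YG: "Y <= G" if "Y \<in> Ys" for Y using flatD(1) Ys(2)[OF that] by blast
 then have "\<Union>Ys <= carrier M" by auto
 then have YB: "Y <= B" if "Y \<in> Ys" for Y using M.cl_increasing[of "\<Union>Ys"] Ys(3) that by blast
 have "subgroup Y (mult_grp R B)" if Y: "Y \<in> Ys" for Y
 proof -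
  have "subgroup Y M" unfolding subgroup_M_iff using flatD Ys(2)[OF Y] by blast
  then have "subgroup Y (M\<lparr>carrier := B\<rparr>)" by (rule group.subgroup_incl[OF M.is_group _ sB YB[OF Y]])
  then show ?thesis by simp
 qed
 moreover have "rank_one (mult_grp R Y)" if "Y \<in> Ys" for Y using rank_one_flat[OF f1] Ys(2)[OF that] by blast
 moreover have "dense_subgroup (generate (mult_grp R B) (\<Union>Ys)) (mult_grp R B)" by (rule dense_generate[OF fB Ys(3)[symmetric] YB])
 moreover have "EX \<Delta>. finite_index \<Delta> ((RelAutoGroup k R)\<lparr>carrier := \<Gamma>\<rparr>) & (ALL Y:Ys. stabilises \<Delta> Y)"
  if "subgroup \<Gamma> (RelAutoGroup k R) & stabilises \<Gamma> G" for \<Gamma>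
 proof (intro exI conjI)
  show "finite_index {\<rho> \<in> \<Gamma>. ALL Y:Ys. \<rho> ` Y = Y} ((RelAutoGroup k R)\<lparr>carrier := \<Gamma>\<rparr>)"
   by (rule finite_index_stabiliser[OF Ys(1)]) (use YG Ys(2) that in auto)
  show "ALL Y:Ys. stabilises {\<rho> \<in> \<Gamma>. ALL Y:Ys. \<rho> ` Y = Y} Y" unfolding stabilises_def by blast
 qed
 ultimately show ?thesis using Ys(1) by blast
qed

end

theorem theorem1:
  fixes K :: "('a, 'm) ring_scheme" and k G B :: "'a set" and I :: "('a \<Rightarrow> 'a) set"
  assumes "field K" and "subfield k K"
    and "subgroup G (Multiplicative_Group.mult_of K)"
    and "torsion_free_group (mult_grp K G)" and "finite_rank (mult_grp K G)"
    and "\<forall>g \<in> G. (ring.algebraic K over k) g \<longrightarrow> g = \<one>\<^bsub>K\<^esub>"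
    and "I = a_kernel (group_ring (K\<lparr>carrier := k\<rparr>) (mult_grp K G)) (algebra_gen K k G)
               (group_ring_proj K)"
    and "B = isolator (mult_grp K G) (controller (K\<lparr>carrier := k\<rparr>) (mult_grp K G) I)"
  shows "\<exists>Ys. finite Ys \<and>
           (\<forall>Y \<in> Ys. subgroup Y (mult_grp K B) \<and> rank_one (mult_grp K Y)) \<and>
           dense_subgroup (generate (mult_grp K B) (\<Union>Ys)) (mult_grp K B) \<and>
           (\<forall>\<Gamma>. subgroup \<Gamma> (RelAutoGroup k (field_gen K k G)) \<and> stabilises \<Gamma> G \<longrightarrow>
              (\<exists>\<Delta>. finite_index \<Delta> ((RelAutoGroup k (field_gen K k G))\<lparr>carrier := \<Gamma>\<rparr>) \<and>
                   (\<forall>Y \<in> Ys. stabilises \<Delta> Y)))"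
proof -
 interpret K: field K by (rule assms(1))
 \<comment> \<open>The development is applied to the field generated by \<open>k\<close> and
   \<open>G\<close>, on which the automorphisms act. The group, its finite rank and algebraicity
   over \<open>k\<close> are transferred there from \<open>K\<close>.\<close>
 define L where "L = generate_field K (k Un G)"
 define F where "F = K\<lparr>carrier := L\<rparr>"
 have Gc: "G <= carrier K - {\<zero>\<^bsub>K\<^esub>}" using subgroup.subset[OF assms(3)] by simp
 have kG: "k Un G <= carrier K" using Gc subfieldE(3)[OF assms(2)] by blast
 have L: "subfield L K" unfolding L_def by (rule K.generate_field_is_subfield[OF kG])
 have up: "k Un G <= L" using K.generate_fieldE(2)[OF kG refl] unfolding L_def .
 interpret F: field F unfolding F_def by (rule K.subfield_iff(2)[OF L])
 have mo: "Multiplicative_Group.mult_of F = (Multiplicative_Group.mult_of K)\<lparr>carrier := L - {\<zero>\<^bsub>K\<^esub>}\<rparr>"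
  unfolding F_def Multiplicative_Group.mult_of_def by simp
 have mg: "mult_grp F E = mult_grp K E" for E unfolding mo by simp
 have "subgroup (L - {\<zero>\<^bsub>K\<^esub>}) (Multiplicative_Group.mult_of K)" by (rule K.subgroup_mult_of[OF L])
 then have GF: "subgroup G (Multiplicative_Group.mult_of F)"
  unfolding mo by (rule group.subgroup_incl[OF K.field_mult_group assms(3)]) (use Gc up in blast)
 have kF: "subfield k F"
 proof (rule F.subfield_iff(1))
  show "field (F\<lparr>carrier := k\<rparr>)" using K.subfield_iff(2)[OF assms(2)] unfolding F_def by simp
  show "k <= carrier F" using up unfolding F_def by simp
 qed
 have "EX B. finite B & B <= G & G <= icl (mult_grp F G) B"
  using comm_group.finite_rank_imp_finite_icl[OF K.mult_grp_comm_group[OF assms(3)] assms(5)] mg by simp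
 then interpret mult_field F k G by (intro mult_field.intro mult_field_axioms.intro F.field_axioms kF GF)
 have "acl {} = {\<one>\<^bsub>F\<^esub>}"
 proof (rule acl_empty)
  fix g assume g: "g \<in> G" "(F.algebraic over k) g"
  have "K.algebraic = F.algebraic" unfolding F_def by (rule K.algebraic_consistent[OF subfieldE(1)[OF L]])
  then have "(K.algebraic over k) g" using g(2) unfolding over_def by metis
  then show "g = \<one>\<^bsub>F\<^esub>" using assms(6) g(1) unfolding F_def by simp
 qed
 \<comment> \<open>The projection is computed in \<open>K\<close>, the map \<open>pr\<close> in the
   subfield \<open>L\<close>; the sums agree because all terms lie in \<open>L\<close>.\<close>
 moreover have "I = ker"
 proof -
  have "group_ring_proj K f = pr f" if f: "f \<in> gr" for f
  proof -
   have "(%g. f g \<otimes>\<^bsub>K\<^esub> g) \<in> supp f \<rightarrow> L"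
    using grD(1,3)[OF f] up subringE(6)[OF subfieldE(1)[OF L]] by blast
   then have "finsum (K\<lparr>carrier := L\<rparr>) (%g. f g \<otimes>\<^bsub>K\<^esub> g) (supp f) = finsum K (%g. f g \<otimes>\<^bsub>K\<^esub> g) (supp f)"
    by (rule K.finsum_subfield[OF L grD(4)[OF f]])
   moreover have "pr f = finsum (K\<lparr>carrier := L\<rparr>) (%g. f g \<otimes>\<^bsub>K\<^esub> g) (supp f)"
    unfolding pr_def unfolding F_def by simp
   moreover have "supp f = {g. f g ~= \<zero>\<^bsub>K\<^esub>}" unfolding supp_def unfolding F_def by simp
   ultimately show ?thesis unfolding group_ring_proj_def by simp
  qed
  moreover have "F\<lparr>carrier := k\<rparr> = K\<lparr>carrier := k\<rparr>" "\<zero>\<^bsub>F\<^esub> = \<zero>\<^bsub>K\<^esub>" unfolding F_def by simp_all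
  ultimately show ?thesis unfolding assms(7) a_kernel_def' ker_def using GR_carrier unfolding mg by auto
 qed
 moreover have "F\<lparr>carrier := k\<rparr> = K\<lparr>carrier := k\<rparr>" unfolding F_def by simp
 ultimately show ?thesis
  using stable_rank_one_subgroups[of B] assms(8) unfolding mg by (simp add: F_def L_def)
qed

end
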